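(* (i) A function $f$ belongs to $\mathcal S$ if and only if it has an expansion $$f(x_0,p,\underline\omega)=\sum_{j\in\mathbb Z,\,k\in\mathbb N_0}(x_0+\underline\omega p)^j\,\underline\omega^k\,P_{k,j}(\underline\omega)$$ for some $k$-homogeneous monogenic polynomials $P_{k,j}:\mathbb R^n\to\mathbb R_n$ such that for each $m\in\mathbb N_0$ and each $a>0$ there is $C>0$ with $\|P_{k,j}\|\le C\,a^{|j|}(k+1)^{-m}$ for all $k\in\mathbb N_0$, $j\in\mathbb Z$ (here $\|\cdot\|$ is $\|\cdot\|_{L_2}$ or $\|\cdot\|_\infty$ on $S^{n-1}$); this expansion is unique. (ii) Moreover, $f$ belongs to $\mathcal S_0$ (resp. $\mathcal S_\infty$) if and only if its expansion as in (i) has $P_{k,j}=0$ unless $j\ge0$ (resp. unless $j<0$). In particular $\mathcal S=\mathcal S_0\oplus\mathcal S_\infty$ and $\mathcal S_\infty=I_2(\mathcal S_0)$.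
   Context: $\mathbb R_n$ is the real Clifford algebra generated by $e_1,\dots,e_n$ with $e_ie_j+e_je_i=-2\delta_{ij}$; $|\cdot|$ its Euclidean norm; $S^{n-1}=\{\underline\omega=\sum\omega_je_j:\sum\omega_j^2=1\}$. A smooth $f:U\times S^{n-1}\to\mathbb R_n$ ($U\subseteq\mathbb R^2$ open, variables $(x_0,p,\underline\omega)$) is slice monogenic if $\frac12(\partial_{x_0}+\underline\omega\partial_p)f=0$ for every $\underline\omega$; even if $f(x_0,-p,-\underline\omega)=f(x_0,p,\underline\omega)$. $\mathcal S$: right $\mathbb R_n$-module of even slice monogenic functions on $(\mathbb R^2\setminus\{0\})\times S^{n-1}$; $\mathcal S_0$: those extending analytically to $\mathbb R^2\times S^{n-1}$; $\mathcal S_\infty$: those extending analytically at $\infty$ (regular at infinity and tending to $0$ as $x_0^2+p^2\to\infty$). $I_2f(x_0,p,\underline\omega)=\frac{x_0-\underline\omega p}{x_0^2+p^2}f\big(\frac{x_0}{x_0^2+p^2},\frac{-p}{x_0^2+p^2},\underline\omega\big)$. A $k$-homogeneous monogenic polynomial is a homogeneous polynomial $P:\mathbb R^n\to\mathbb R_n$ of degree $k$ with $\sum_je_j\partial_{x_j}P=0$. $\|g\|_{L_2}^2=\frac1{A_n}\int_{S^{n-1}}|g|^2d\underline\omega$, $\|g\|_\infty=\sup_{S^{n-1}}|g|$. *)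

theory Defs
  imports "HOL-Analysis.Analysis"
begin

text \<open>The generators are indexed by a finite linearly ordered type 'n (so n = CARD('n)).
  An element of R_n is represented by its coordinates with respect to the basis of
  blades e_A (A a subset of the generators), i.e. as a vector in real^('n set).
  The Euclidean norm of this vector is the Euclidean norm of R_n.\<close>

type_synonym 'n clif = "real ^ ('n set)"

definition blade_sign :: "'n::{finite,linorder} set \<Rightarrow> 'n set \<Rightarrow> real" where
  "blade_sign A B = (-1) ^ (card {(a, b). a \<in> A \<and> b \<in> B \<and> b < a} + card (A \<inter> B))"

definition cl_mult :: "'n::{finite,linorder} clif \<Rightarrow> 'n clif \<Rightarrow> 'n clif" (infixl "\<star>" 70) where
  "x \<star> y = (\<chi> C. \<Sum>A\<in>UNIV. \<Sum>B\<in>UNIV.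
       if (A - B) \<union> (B - A) = C then blade_sign A B * (x $ A) * (y $ B) else 0)"

definition cl_one :: "'n::{finite,linorder} clif" where
  "cl_one = (\<chi> A. if A = {} then 1 else 0)"

definition cl_e :: "'n::{finite,linorder} \<Rightarrow> 'n clif" where
  "cl_e i = (\<chi> A. if A = {i} then 1 else 0)"

definition cl_vec :: "(real ^ ('n::{finite,linorder})) \<Rightarrow> 'n clif" where
  "cl_vec w = (\<Sum>i\<in>UNIV. (w $ i) *\<^sub>R cl_e i)"

primrec cl_pow :: "'n::{finite,linorder} clif \<Rightarrow> nat \<Rightarrow> 'n clif" where
  "cl_pow x 0 = cl_one"
| "cl_pow x (Suc k) = x \<star> cl_pow x k"

definition cl_inv :: "'n::{finite,linorder} clif \<Rightarrow> 'n clif" where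
  "cl_inv x = (THE y. x \<star> y = cl_one \<and> y \<star> x = cl_one)"

definition cl_zpow :: "'n::{finite,linorder} clif \<Rightarrow> int \<Rightarrow> 'n clif" where
  "cl_zpow x j = (if 0 \<le> j then cl_pow x (nat j) else cl_pow (cl_inv x) (nat (- j)))"

definition para :: "real \<Rightarrow> real \<Rightarrow> (real ^ ('n::{finite,linorder})) \<Rightarrow> 'n clif" where
  "para x0 p w = x0 *\<^sub>R cl_one + p *\<^sub>R cl_vec w"

fun smooth_k :: "nat \<Rightarrow> 'a::euclidean_space set \<Rightarrow> ('a \<Rightarrow> 'b::euclidean_space) \<Rightarrow> bool" where
  "smooth_k 0 S f = continuous_on S f"
| "smooth_k (Suc k) S f = (f differentiable_on S \<and>
      (\<forall>v\<in>Basis. smooth_k k S (\<lambda>x. frechet_derivative f (at x) v)))"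

definition smooth_on :: "'a::euclidean_space set \<Rightarrow> ('a \<Rightarrow> 'b::euclidean_space) \<Rightarrow> bool" where
  "smooth_on S f = (\<forall>k. smooth_k k S f)"

definition sdom :: "(real \<times> real) set \<Rightarrow> (real \<times> real \<times> (real ^ 'n)) set" where
  "sdom U = {(x0, p, w). (x0, p) \<in> U \<and> w \<in> sphere 0 1}"

definition smooth_on_sdom ::
  "(real \<times> real) set \<Rightarrow> (real \<times> real \<times> (real ^ ('n::{finite,linorder})) \<Rightarrow> 'n clif) \<Rightarrow> bool" where
  "smooth_on_sdom U f = (\<exists>W F. open W \<and> sdom U \<subseteq> W \<and> smooth_on W F \<and> (\<forall>z\<in>sdom U. F z = f z))"

definition slice_monogenic ::
  "(real \<times> real) set \<Rightarrow> (real \<times> real \<times> (real ^ ('n::{finite,linorder})) \<Rightarrow> 'n clif) \<Rightarrow> bool" where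
  "slice_monogenic U f = (open U \<and> smooth_on_sdom U f \<and>
     (\<forall>x0 p w. (x0, p) \<in> U \<and> w \<in> sphere 0 1 \<longrightarrow>
        (\<exists>D0 Dp. ((\<lambda>t. f (t, p, w)) has_vector_derivative D0) (at x0) \<and>
                 ((\<lambda>t. f (x0, t, w)) has_vector_derivative Dp) (at p) \<and>
                 (1/2) *\<^sub>R (D0 + cl_vec w \<star> Dp) = 0)))"

abbreviation punct :: "(real \<times> real) set" where
  "punct \<equiv> UNIV - {(0, 0)}"

definition in_S :: "(real \<times> real \<times> (real ^ ('n::{finite,linorder})) \<Rightarrow> 'n clif) \<Rightarrow> bool" where
  "in_S f = (slice_monogenic punct f \<and>
     (\<forall>x0 p w. (x0, p) \<noteq> (0, 0) \<and> w \<in> sphere 0 1 \<longrightarrow> f (x0, -p, -w) = f (x0, p, w)))"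

definition in_S0 :: "(real \<times> real \<times> (real ^ ('n::{finite,linorder})) \<Rightarrow> 'n clif) \<Rightarrow> bool" where
  "in_S0 f = (in_S f \<and> (\<exists>g. slice_monogenic UNIV g \<and>
     (\<forall>x0 p w. (x0, p) \<noteq> (0, 0) \<and> w \<in> sphere 0 1 \<longrightarrow> g (x0, p, w) = f (x0, p, w))))"

definition in_Sinf :: "(real \<times> real \<times> (real ^ ('n::{finite,linorder})) \<Rightarrow> 'n clif) \<Rightarrow> bool" where
  "in_Sinf f = (in_S f \<and>
     (\<exists>g. slice_monogenic UNIV g \<and>
        (\<forall>x0 p w. (x0, p) \<noteq> (0, 0) \<and> w \<in> sphere 0 1 \<longrightarrow>
           g (x0, p, w) = f (x0 / (x0\<^sup>2 + p\<^sup>2), - p / (x0\<^sup>2 + p\<^sup>2), w))) \<and>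
     (\<forall>\<epsilon>>0. \<exists>R. \<forall>x0 p w. x0\<^sup>2 + p\<^sup>2 \<ge> R \<and> w \<in> sphere 0 1 \<longrightarrow> norm (f (x0, p, w)) < \<epsilon>))"

definition I2 :: "(real \<times> real \<times> (real ^ ('n::{finite,linorder})) \<Rightarrow> 'n clif) \<Rightarrow> (real \<times> real \<times> (real, 'n) vec \<Rightarrow> 'n clif)" where
  "I2 f = (\<lambda>(x0, p, w). ((1 / (x0\<^sup>2 + p\<^sup>2)) *\<^sub>R (x0 *\<^sub>R cl_one - p *\<^sub>R cl_vec w))
             \<star> f (x0 / (x0\<^sup>2 + p\<^sup>2), - p / (x0\<^sup>2 + p\<^sup>2), w))"

definition hom_poly :: "nat \<Rightarrow> ((real ^ ('n::{finite,linorder})) \<Rightarrow> 'n clif) \<Rightarrow> bool" where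
  "hom_poly k P = (\<exists>c :: ('n \<Rightarrow> nat) \<Rightarrow> 'n clif. \<forall>x.
      P x = (\<Sum>\<alpha>\<in>{\<alpha>. sum \<alpha> UNIV = k}. (\<Prod>i\<in>UNIV. (x $ i) ^ \<alpha> i) *\<^sub>R c \<alpha>))"

definition monogenic_hom :: "nat \<Rightarrow> ((real ^ ('n::{finite,linorder})) \<Rightarrow> 'n clif) \<Rightarrow> bool" where
  "monogenic_hom k P = (hom_poly k P \<and>
      (\<forall>x. (\<Sum>i\<in>UNIV. cl_e i \<star> frechet_derivative P (at x) (axis i 1)) = 0))"

definition sup_norm_S :: "((real ^ ('n::{finite,linorder})) \<Rightarrow> 'n clif) \<Rightarrow> real" where
  "sup_norm_S g = Sup ((\<lambda>w. norm (g w)) ` sphere 0 1)"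

text \<open>Normalised L2 norm on S^{n-1}: (1/A_n) int_{S^{n-1}} |g|^2 equals the average over the
  unit ball of |g(x/|x|)|^2 (cone construction of the surface measure).\<close>
definition L2_norm_S :: "((real ^ ('n::{finite,linorder})) \<Rightarrow> 'n clif) \<Rightarrow> real" where
  "L2_norm_S g = sqrt ((integral\<^sup>L lborel (\<lambda>x. indicator (ball 0 1) x * (norm (g ((1 / norm x) *\<^sub>R x)))\<^sup>2))
                      / measure lborel (ball (0 :: (real, 'n) vec) 1))"

definition exp_term :: "(nat \<Rightarrow> int \<Rightarrow> (real ^ ('n::{finite,linorder})) \<Rightarrow> 'n clif)
     \<Rightarrow> real \<Rightarrow> real \<Rightarrow> (real, 'n) vec \<Rightarrow> int \<times> nat \<Rightarrow> 'n clif" where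
  "exp_term P x0 p w = (\<lambda>(j, k). cl_zpow (para x0 p w) j \<star> (cl_pow (cl_vec w) k \<star> P k j w))"

definition is_expansion ::
  "(((real ^ ('n::{finite,linorder})) \<Rightarrow> 'n clif) \<Rightarrow> real)
   \<Rightarrow> (real \<times> real \<times> (real, 'n) vec \<Rightarrow> 'n clif) \<Rightarrow> (nat \<Rightarrow> int \<Rightarrow> (real, 'n) vec \<Rightarrow> 'n clif) \<Rightarrow> bool" where
  "is_expansion N f P = ((\<forall>k j. monogenic_hom k (P k j)) \<and>
     (\<forall>m::nat. \<forall>a>0. \<exists>C>0. \<forall>k j. N (P k j) \<le> C * a ^ nat \<bar>j\<bar> / (real k + 1) ^ m) \<and>
     (\<forall>x0 p w. (x0, p) \<noteq> (0, 0) \<and> w \<in> sphere 0 1 \<longrightarrow>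
        (exp_term P x0 p w has_sum f (x0, p, w)) UNIV))"

end

theory Submission
  imports Defs "HOL-Complex_Analysis.Cauchy_Integral_Formula"
begin

text \<open>On a fixed sphere direction $\underline\omega$, left multiplication by $\underline\omega$ is a complex
  structure on the Clifford algebra, so the slice equation is a Cauchy--Riemann equation and $f$ has a Laurent series
  $\sum_j (x_0+\underline\omega p)^j a_j(\underline\omega)$, with $a_j$ given by Fourier integrals over any circle.
  The functions $\underline\omega^k P_k(\underline\omega)$ with $P_k$ monogenic, together with the even parity of
  $a_j$, are handled through the spherical Dirac operator: it is symmetric, the spherical monogenics $P_k$ and
  $\underline\omega P_k$ are its eigenfunctions, and they are complete by the Fischer decomposition and the
  Stone--Weierstrass theorem. Symmetry gives orthogonality, and integrating by parts $m$ times gives the decay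
  $(k+1)^{-m}$ of the components of $a_j$; evenness of $f$ leaves only $\underline\omega^k P_k$.
  Conversely, a Markov inequality for homogeneous polynomials bounds the derivatives of each term polynomially in $k$,
  so rapidly decreasing expansions may be differentiated termwise.
  Membership at $0$ and at $\infty$ is read off from the scaling $r^j$ of the Laurent coefficients.\<close>


section \<open>The Clifford algebra\<close>

text \<open>Two features of omega^k P_k shape the argument. Up to sign it is the restriction of a
  polynomial of even degree (P_k for even k, x P_k for odd k), and these restrictions have pairwise
  distinct eigenvalues -k and n + k - 1 under the spherical Dirac operator. Distinctness gives
  orthogonality, the growth of the eigenvalues gives decay, and the even degree matches the parity
  of f. Stokes' theorem does not enter: the sphere carries the image of the uniform measure on the
  ball, and symmetry of the operator comes from differentiating the invariance under plane
  rotations. The two norms differ by a factor polynomial in k, which rapid decay absorbs, so all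
  estimates can be made in the supremum norm. In the converse direction f must extend smoothly to a
  neighbourhood of the sphere in R^n, where a polynomial of degree k behaves like |y|^k; dividing by
  a power of |y| keeps the size under control, and the class of such terms is closed under partial
  derivatives, so one convergence estimate settles all orders at once.\<close>

lemma blade_sign_eq_prod:
  "blade_sign A B = (\<Prod>a\<in>A. \<Prod>b\<in>B. if b \<le> a then -1 else 1)"
proof -
  have "(\<Prod>a\<in>A. \<Prod>b\<in>B. if b \<le> a then -1 else 1::real)
      = (\<Prod>x\<in>A \<times> B. if snd x \<le> fst x then -1 else 1)"
    by (simp add: prod.cartesian_product split_def)
  also have "\<dots> = (-1) ^ card ((A \<times> B) \<inter> {x. snd x \<le> fst x})"
    by (subst prod.If_cases) auto
  also have "(A \<times> B) \<inter> {x. snd x \<le> fst x}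
      = {(a, b). a \<in> A \<and> b \<in> B \<and> b < a} \<union> (\<lambda>x. (x, x)) ` (A \<inter> B)"
    by auto
  also have "card \<dots> = card {(a, b). a \<in> A \<and> b \<in> B \<and> b < a} + card ((\<lambda>x. (x, x)) ` (A \<inter> B))"
    by (rule card_Un_disjoint) auto
  also have "card ((\<lambda>x. (x, x)) ` (A \<inter> B)) = card (A \<inter> B)"
    by (rule card_image) (auto simp: inj_on_def)
  finally show ?thesis by (simp add: blade_sign_def)
qed

lemma prod_sym_diff:
  fixes g :: "'a::finite \<Rightarrow> real"
  assumes "\<And>a. g a * g a = 1"
  shows "prod g (sym_diff A B) = prod g A * prod g B"
proof -
  have "prod g A * prod g B = (prod g (A - B) * prod g (A \<inter> B)) * (prod g (B - A) * prod g (A \<inter> B))"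
    using prod.Int_Diff[of A g B] prod.Int_Diff[of B g A] by (simp add: Int_commute mult.commute)
  also have "\<dots> = prod g (A - B) * prod g (B - A) * prod (\<lambda>a. g a * g a) (A \<inter> B)"
    by (simp add: prod.distrib)
  also have "\<dots> = prod g (sym_diff A B)"
    by (subst prod.union_disjoint) (auto simp: assms)
  finally show ?thesis by simp
qed

text \<open>Counting the pairs with \<open>b \<le> a\<close> merges the two exponents of the
  definition into one product over pairs, and generators occurring twice cancel. So the sign is a
  bicharacter on subsets under symmetric difference, which is the cocycle identity behind
  associativity.\<close>

lemma blade_sign_sym_diff_left: "blade_sign (sym_diff A B) C = blade_sign A C * blade_sign B C"
  unfolding blade_sign_eq_prod
  by (rule prod_sym_diff) (auto simp: prod.distrib[symmetric] intro!: prod.neutral)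

lemma blade_sign_sym_diff_right: "blade_sign A (sym_diff B C) = blade_sign A B * blade_sign A C"
proof -
  have "blade_sign A (sym_diff B C)
      = (\<Prod>a\<in>A. (\<Prod>b\<in>B. if b \<le> a then -1 else 1) * (\<Prod>b\<in>C. if b \<le> a then -1 else 1))"
    unfolding blade_sign_eq_prod by (intro prod.cong refl prod_sym_diff) auto
  then show ?thesis by (simp add: blade_sign_eq_prod prod.distrib)
qed

lemma blade_sign_square: "blade_sign A B * blade_sign A B = 1"
  by (simp add: blade_sign_def flip: power_mult_distrib)

lemma sym_diff_cancel: "sym_diff A (sym_diff A B) = B"
  by auto

lemma bij_sym_diff: "bij (sym_diff A)"
  by (rule o_bij[of "sym_diff A"]) (auto simp: fun_eq_iff)

text \<open>Only \<open>B = sym_diff A C\<close> contributes to the blade \<open>C\<close>: the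
  algebra is a twisted group algebra of subsets, and its product a twisted convolution with a single
  sum.\<close>

lemma cl_mult_nth:
  "(x \<star> y) $ C = (\<Sum>A\<in>UNIV. blade_sign A (sym_diff A C) * x $ A * y $ sym_diff A C)"
proof -
  have "(\<Sum>B\<in>UNIV. if sym_diff A B = C then blade_sign A B * x $ A * y $ B else 0)
      = blade_sign A (sym_diff A C) * x $ A * y $ sym_diff A C" for A
  proof -
    have eq: "(sym_diff A B = C) = (B = sym_diff A C)" for B by auto
    show ?thesis unfolding eq by simp
  qed
  then show ?thesis by (simp add: cl_mult_def)
qed

lemma cl_mult_assoc: "(x \<star> y) \<star> z = x \<star> (y \<star> z)"
proof (rule vec_eq_iff[THEN iffD2], rule allI)
  fix D
  have regroup: "a * (b * x * y) * z = c * x * (d * y * z)" if "a * b = c * d" for a b c d x y z :: real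
  proof -
    have "a * (b * x * y) * z = (a * b) * (x * y * z)" by simp
    then show ?thesis unfolding that by simp
  qed
  have "((x \<star> y) \<star> z) $ D = (\<Sum>E\<in>UNIV. \<Sum>A\<in>UNIV. blade_sign E (sym_diff E D)
      * (blade_sign A (sym_diff A E) * x $ A * y $ sym_diff A E) * z $ sym_diff E D)"
    by (simp add: cl_mult_nth sum_distrib_left sum_distrib_right mult_ac)
  also have "\<dots> = (\<Sum>A\<in>UNIV. \<Sum>E\<in>UNIV. blade_sign E (sym_diff E D)
      * (blade_sign A (sym_diff A E) * x $ A * y $ sym_diff A E) * z $ sym_diff E D)"
    by (rule sum.swap)
  \<comment> \<open>Substituting \<open>E = sym_diff A B\<close> indexes both triple products by the
    blades of \<open>x\<close> and \<open>y\<close>; the blade of \<open>z\<close> then agrees, and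
    only the signs remain to be compared.\<close>
  also have "\<dots> = (\<Sum>A\<in>UNIV. \<Sum>B\<in>UNIV. blade_sign (sym_diff A B) (sym_diff (sym_diff A B) D)
      * (blade_sign A (sym_diff A (sym_diff A B)) * x $ A * y $ sym_diff A (sym_diff A B))
      * z $ sym_diff (sym_diff A B) D)"
    by (intro sum.cong refl sum.reindex_bij_betw[symmetric] bij_sym_diff)
  also have "\<dots> = (\<Sum>A\<in>UNIV. \<Sum>B\<in>UNIV. blade_sign A (sym_diff A D) * x $ A
      * (blade_sign B (sym_diff B (sym_diff A D)) * y $ B * z $ sym_diff B (sym_diff A D)))"
  proof (intro sum.cong refl)
    fix A B
    have 1: "sym_diff (sym_diff A B) D = sym_diff B (sym_diff A D)" by auto
    have 2: "blade_sign A (sym_diff A D) = blade_sign A B * blade_sign A (sym_diff B (sym_diff A D))"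
      using blade_sign_sym_diff_right[of A B "sym_diff B (sym_diff A D)"] unfolding sym_diff_cancel .
    have "blade_sign (sym_diff A B) (sym_diff B (sym_diff A D)) * blade_sign A B
       = blade_sign A (sym_diff A D) * blade_sign B (sym_diff B (sym_diff A D))"
      unfolding 2 blade_sign_sym_diff_left by (simp only: mult_ac)
    then show "blade_sign (sym_diff A B) (sym_diff (sym_diff A B) D)
      * (blade_sign A (sym_diff A (sym_diff A B)) * x $ A * y $ sym_diff A (sym_diff A B))
      * z $ sym_diff (sym_diff A B) D = blade_sign A (sym_diff A D) * x $ A
      * (blade_sign B (sym_diff B (sym_diff A D)) * y $ B * z $ sym_diff B (sym_diff A D))"
      unfolding 1 sym_diff_cancel by (rule regroup)
  qed
  also have "\<dots> = (x \<star> (y \<star> z)) $ D"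
    by (simp add: cl_mult_nth sum_distrib_left)
  finally show "((x \<star> y) \<star> z) $ D = (x \<star> (y \<star> z)) $ D" .
qed

interpretation cl_mult: bounded_bilinear "(\<star>) :: 'n::{finite,linorder} clif \<Rightarrow> 'n clif \<Rightarrow> 'n clif"
proof -
  have "bilinear ((\<star>) :: 'n clif \<Rightarrow> 'n clif \<Rightarrow> 'n clif)"
    by (auto simp: bilinear_def linear_iff vec_eq_iff cl_mult_nth algebra_simps sum.distrib sum_distrib_left)
  then show "bounded_bilinear ((\<star>) :: 'n clif \<Rightarrow> 'n clif \<Rightarrow> 'n clif)"
    by (simp add: bilinear_conv_bounded_bilinear)
qed

lemma blade_sign_empty [simp]: "blade_sign {} A = 1" "blade_sign A {} = 1"
  by (simp_all add: blade_sign_eq_prod)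

lemma cl_one_mult [simp]: "cl_one \<star> x = x"
  by (simp add: vec_eq_iff cl_mult_nth cl_one_def if_distrib if_distribR cong: if_cong)

lemma cl_mult_one [simp]: "x \<star> cl_one = x"
proof -
  have eq: "(sym_diff A C = {}) = (A = C)" for A C :: "'a set" by auto
  show ?thesis
    unfolding vec_eq_iff cl_mult_nth cl_one_def vec_lambda_beta eq
    by (simp add: if_distrib cong: if_cong)
qed

lemma cl_e_mult_nth: "(cl_e i \<star> x) $ C = blade_sign {i} (sym_diff {i} C) * x $ sym_diff {i} C"
  by (simp add: cl_mult_nth cl_e_def if_distrib if_distribR cong: if_cong)

lemma blade_sign_singletons: "blade_sign {i} {j} = (if j \<le> i then -1 else 1)"
  by (simp add: blade_sign_eq_prod)

text \<open>Stated with a factor \<open>x\<close> on the right because the generators act below as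
  left multiplication operators.\<close>

lemma cl_e_anticommute:
  "cl_e i \<star> (cl_e j \<star> x) + cl_e j \<star> (cl_e i \<star> x) = (if i = j then -2 else 0) *\<^sub>R x"
proof (rule vec_eq_iff[THEN iffD2], rule allI)
  fix C
  have 1: "sym_diff {j} (sym_diff {i} C) = sym_diff {i} (sym_diff {j} C)"
    "sym_diff {i} (sym_diff {i} C) = C" by auto
  show "(cl_e i \<star> (cl_e j \<star> x) + cl_e j \<star> (cl_e i \<star> x)) $ C = ((if i = j then -2 else 0) *\<^sub>R x) $ C"
    by (auto simp: cl_e_mult_nth 1 blade_sign_sym_diff_right blade_sign_singletons blade_sign_square)
qed

text \<open>Left multiplication by a generator permutes the blades up to sign, and undoing the
  permutation changes the sign because the generator squares to -1. This skew-adjointness is behind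
  both the isometry of unit vectors and the symmetry of the spherical Dirac operator.\<close>

lemma inner_cl_e_mult: "inner (cl_e i \<star> x) y = - inner x (cl_e i \<star> y)"
proof -
  have s: "blade_sign {i} (sym_diff {i} C) = - blade_sign {i} C" for C
    by (simp add: blade_sign_sym_diff_right blade_sign_singletons)
  have "inner (cl_e i \<star> x) y
      = (\<Sum>C\<in>UNIV. blade_sign {i} (sym_diff {i} C) * x $ sym_diff {i} C * y $ C)"
    by (simp add: inner_vec_def cl_e_mult_nth)
  also have "\<dots> = (\<Sum>C\<in>UNIV. blade_sign {i} (sym_diff {i} (sym_diff {i} C))
      * x $ sym_diff {i} (sym_diff {i} C) * y $ sym_diff {i} C)"
    by (rule sum.reindex_bij_betw[symmetric, OF bij_sym_diff])
  also have "\<dots> = - inner x (cl_e i \<star> y)"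
    unfolding sym_diff_cancel by (simp add: inner_vec_def cl_e_mult_nth s sum_negf mult_ac)
  finally show ?thesis .
qed

section \<open>Vectors as left multiplication operators\<close>

lemma bounded_linear_cl_vec: "bounded_linear cl_vec"
  unfolding cl_vec_def
  by (intro bounded_linear_sum bounded_linear_compose[OF bounded_linear_scaleR_left bounded_linear_vec_nth])

lemma cl_vec_linear_simps:
  "cl_vec (x + y) = cl_vec x + cl_vec y" "cl_vec (- x) = - cl_vec x" "cl_vec (x - y) = cl_vec x - cl_vec y"
  "cl_vec (c *\<^sub>R x) = c *\<^sub>R cl_vec x"
  by (simp_all add: cl_vec_def scaleR_left_distrib scaleR_left_diff_distrib sum.distrib sum_subtractf
      sum_negf scaleR_sum_right)

lemma cl_vec_axis: "cl_vec (axis i 1) = cl_e i"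
  by (simp add: cl_vec_def axis_def if_distrib if_distribR cong: if_cong)

lemma cl_vec_mult: "cl_vec w \<star> x = (\<Sum>i\<in>UNIV. (w $ i) *\<^sub>R (cl_e i \<star> x))"
  by (simp add: cl_vec_def cl_mult.sum_left cl_mult.scaleR_left)

lemma inner_cl_vec_mult: "inner (cl_vec w \<star> x) y = - inner x (cl_vec w \<star> y)"
  by (simp add: cl_vec_mult inner_sum_left inner_sum_right inner_cl_e_mult sum_negf)

lemma cl_vec_anticommute:
  "cl_vec v \<star> (cl_vec w \<star> x) + cl_vec w \<star> (cl_vec v \<star> x) = (-2 * inner v w) *\<^sub>R x"
proof -
  have "cl_vec v \<star> (cl_vec w \<star> x) = (\<Sum>i\<in>UNIV. \<Sum>j\<in>UNIV. (v $ i * w $ j) *\<^sub>R (cl_e i \<star> (cl_e j \<star> x)))"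
    by (subst cl_vec_mult[of v], subst cl_vec_mult[of w])
      (simp add: cl_mult.sum_right cl_mult.scaleR_right scaleR_sum_right)
  moreover have "cl_vec w \<star> (cl_vec v \<star> x)
      = (\<Sum>j\<in>UNIV. \<Sum>i\<in>UNIV. (v $ i * w $ j) *\<^sub>R (cl_e j \<star> (cl_e i \<star> x)))"
    by (subst cl_vec_mult[of w], subst cl_vec_mult[of v])
      (simp add: cl_mult.sum_right cl_mult.scaleR_right scaleR_sum_right mult_ac)
  moreover have "\<dots> = (\<Sum>i\<in>UNIV. \<Sum>j\<in>UNIV. (v $ i * w $ j) *\<^sub>R (cl_e j \<star> (cl_e i \<star> x)))"
    by (rule sum.swap)
  ultimately have "cl_vec v \<star> (cl_vec w \<star> x) + cl_vec w \<star> (cl_vec v \<star> x)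
      = (\<Sum>i\<in>UNIV. \<Sum>j\<in>UNIV. (v $ i * w $ j) *\<^sub>R (cl_e i \<star> (cl_e j \<star> x) + cl_e j \<star> (cl_e i \<star> x)))"
    by (simp add: sum.distrib scaleR_add_right)
  also have "\<dots> = (\<Sum>i\<in>UNIV. \<Sum>j\<in>UNIV. if i = j then (-2 * v $ i * w $ i) *\<^sub>R x else 0)"
    by (intro sum.cong refl) (simp add: cl_e_anticommute)
  also have "\<dots> = (-2 * inner v w) *\<^sub>R x"
    by (simp add: inner_vec_def scaleR_left.sum[symmetric] sum_negf sum_distrib_left mult_ac)
  finally show ?thesis .
qed

lemma cl_vec_square: "cl_vec w \<star> (cl_vec w \<star> x) = - ((norm w)\<^sup>2 *\<^sub>R x)"
proof -
  have "2 *\<^sub>R (cl_vec w \<star> (cl_vec w \<star> x)) = 2 *\<^sub>R (- ((norm w)\<^sup>2 *\<^sub>R x))"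
    using cl_vec_anticommute[of w w x] by (simp add: power2_norm_eq_inner flip: scaleR_2)
  then show ?thesis by (simp only: scaleR_cancel_left) simp
qed

lemma norm_cl_vec_mult: "norm (cl_vec w \<star> x) = norm w * norm x"
proof -
  have "(norm (cl_vec w \<star> x))\<^sup>2 = (norm w * norm x)\<^sup>2"
    unfolding power2_norm_eq_inner[of "cl_vec w \<star> x"] inner_cl_vec_mult cl_vec_square
    by (simp add: power_mult_distrib power2_norm_eq_inner)
  then show ?thesis by (simp add: power2_eq_iff_nonneg)
qed

text \<open>The complex number \<open>z\<close> acts with \<open>w\<close> in the role of the
  imaginary unit. For a unit vector this is multiplicative in \<open>z\<close> and scales norms by
  the modulus, so powers, exponentials and holomorphic factors are treated as complex numbers and
  applied to a Clifford value only at the end.\<close>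

definition cact :: "real ^ 'n::{finite,linorder} \<Rightarrow> complex \<Rightarrow> 'n clif \<Rightarrow> 'n clif" where
  "cact w z x = Re z *\<^sub>R x + Im z *\<^sub>R (cl_vec w \<star> x)"

lemma cact_simps:
  "cact w (z1 + z2) x = cact w z1 x + cact w z2 x" "cact w (- z) x = - cact w z x"
  "cact w (z1 - z2) x = cact w z1 x - cact w z2 x"
  "cact w z (x + y) = cact w z x + cact w z y" "cact w z (- x) = - cact w z x"
  "cact w z (x - y) = cact w z x - cact w z y"
  "cact w 0 x = 0" "cact w z 0 = 0" "cact w 1 x = x" "cact w (of_real c) x = c *\<^sub>R x"
  "cact w (c *\<^sub>R z) x = c *\<^sub>R cact w z x" "cact w z (c *\<^sub>R x) = c *\<^sub>R cact w z x"
  "cact w \<i> x = cl_vec w \<star> x"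
  by (simp_all add: cact_def cl_mult.add_right cl_mult.diff_right cl_mult.minus_right
      cl_mult.zero_right cl_mult.scaleR_right algebra_simps)

lemma cact_mult:
  assumes "norm w = 1"
  shows "cact w (z1 * z2) x = cact w z1 (cact w z2 x)"
  by (simp add: cact_def cl_mult.add_right cl_mult.scaleR_right cl_vec_square assms algebra_simps)

lemma norm_cact:
  assumes "norm w = 1"
  shows "norm (cact w z x) = norm z * norm x"
proof -
  have "inner x (cl_vec w \<star> x) = 0"
    using inner_cl_vec_mult[of w x x] by (simp add: inner_commute)
  then have "(norm (cact w z x))\<^sup>2 = (Re z)\<^sup>2 * (norm x)\<^sup>2 + (Im z)\<^sup>2 * (norm (cl_vec w \<star> x))\<^sup>2"
    unfolding power2_norm_eq_inner by (simp add: cact_def inner_add_left inner_add_right inner_commute power2_eq_square)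
  also have "\<dots> = (norm z * norm x)\<^sup>2"
    by (simp add: norm_cl_vec_mult assms cmod_power2 power_mult_distrib algebra_simps)
  finally show ?thesis by (simp add: power2_eq_iff_nonneg)
qed

lemma bounded_bilinear_cact: "bounded_bilinear (cact w)"
  unfolding bilinear_conv_bounded_bilinear[symmetric] bilinear_def linear_iff
  by (auto simp: cact_simps)

lemma para_mult: "para x0 p w \<star> x = cact w (Complex x0 p) x"
  by (simp add: para_def cact_def cl_mult.add_left cl_mult.scaleR_left)

lemma cl_pow_para_mult:
  assumes "norm w = 1"
  shows "cl_pow (para x0 p w) m \<star> x = cact w (Complex x0 p ^ m) x"
  by (induction m) (simp_all add: cact_simps(9) cl_mult_assoc cact_mult assms flip: para_mult)

lemma cl_pow_cl_vec_mult:
  assumes "norm w = 1"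
  shows "cl_pow (cl_vec w) k \<star> x = cact w (\<i> ^ k) x"
  using cl_pow_para_mult[OF assms, of 0 1] by (simp add: para_def imaginary_unit.code)

text \<open>The inverse, defined by description, is located in the copy of the complex plane
  generated by \<open>w\<close>; associativity makes a two-sided inverse unique.\<close>

lemma cl_inv_para:
  assumes "norm w = 1" "Complex x0 p \<noteq> 0"
  shows "cl_inv (para x0 p w) = para (Re (inverse (Complex x0 p))) (Im (inverse (Complex x0 p))) w"
proof -
  have m: "para a b w \<star> para c d w = para (Re (Complex a b * Complex c d)) (Im (Complex a b * Complex c d)) w"
    for a b c d
    using cact_mult[OF assms(1), of "Complex a b" "Complex c d" cl_one]
    by (simp add: cact_def para_def cl_mult.add_left cl_mult.scaleR_left)
  have 1: "para (Re 1) (Im 1) w = cl_one" by (simp add: para_def)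
  show ?thesis
    unfolding cl_inv_def
  proof (rule the_equality)
    show "para x0 p w \<star> para (Re (inverse (Complex x0 p))) (Im (inverse (Complex x0 p))) w = cl_one \<and>
      para (Re (inverse (Complex x0 p))) (Im (inverse (Complex x0 p))) w \<star> para x0 p w = cl_one"
      using assms(2) by (simp only: m complex_surj right_inverse left_inverse 1 simp_thms not_False_eq_True)
    then show "y = para (Re (inverse (Complex x0 p))) (Im (inverse (Complex x0 p))) w"
      if "para x0 p w \<star> y = cl_one \<and> y \<star> para x0 p w = cl_one" for y
      using that by (metis cl_mult_assoc cl_mult_one cl_one_mult)
  qed
qed

lemma cl_zpow_para_mult:
  assumes "norm w = 1" "Complex x0 p \<noteq> 0"
  shows "cl_zpow (para x0 p w) j \<star> x = cact w (Complex x0 p powi j) x"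
  unfolding cl_zpow_def power_int_def cl_inv_para[OF assms]
  by (simp only: if_distribR if_distrib[of "\<lambda>y. y \<star> x"] if_distrib[of "\<lambda>z. cact w z x"]
      cl_pow_para_mult[OF assms(1)] complex_surj)

text \<open>Bridge from the Clifford powers of the statement to \<open>cact\<close>: from here on a
  term is the complex number z^j i^k acting on the value of a polynomial.\<close>

lemma exp_term_eq:
  assumes "norm w = 1" "(x0, p) \<noteq> (0, 0)"
  shows "exp_term P x0 p w (j, k) = cact w (Complex x0 p powi j * \<i> ^ k) (P k j w)"
proof -
  have "Complex x0 p \<noteq> 0" using assms(2) by (simp add: complex_eq_iff)
  then show ?thesis
    by (simp add: exp_term_def cl_zpow_para_mult[OF assms(1)] cl_pow_cl_vec_mult[OF assms(1)]
        cact_mult[OF assms(1)])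
qed

section \<open>Homogeneous polynomials and the Fischer decomposition\<close>

lemma finite_multi_index: "finite {\<alpha> :: 'n::finite \<Rightarrow> nat. sum \<alpha> UNIV = k}"
proof (rule finite_subset)
  show "{\<alpha> :: 'n \<Rightarrow> nat. sum \<alpha> UNIV = k} \<subseteq> Pi\<^sub>E UNIV (\<lambda>_. {..k})"
    by (auto simp: PiE_def intro: member_le_sum)
  show "finite (Pi\<^sub>E (UNIV :: 'n set) (\<lambda>_. {..k}))"
    by (rule finite_PiE) auto
qed

lemma hom_poly_monomial:
  fixes \<alpha> :: "'n::{finite,linorder} \<Rightarrow> nat"
  shows "hom_poly (sum \<alpha> UNIV) (\<lambda>x. (\<Prod>i\<in>UNIV. (x $ i) ^ \<alpha> i) *\<^sub>R c)"
  unfolding hom_poly_def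
proof (intro exI[of _ "\<lambda>\<beta>. if \<beta> = \<alpha> then c else 0"] allI)
  fix x :: "(real, 'n) vec"
  show "(\<Prod>i\<in>UNIV. (x $ i) ^ \<alpha> i) *\<^sub>R c = (\<Sum>\<beta> | sum \<beta> UNIV = sum \<alpha> UNIV.
      (\<Prod>i\<in>UNIV. (x $ i) ^ \<beta> i) *\<^sub>R (if \<beta> = \<alpha> then c else 0))"
    using finite_multi_index[where 'n='n, of "sum \<alpha> UNIV"]
    by (simp add: if_distrib[of "\<lambda>y. _ *\<^sub>R y"] sum.delta' cong: if_cong)
qed

lemma hom_poly_zero: "hom_poly k (\<lambda>x. 0)"
  unfolding hom_poly_def by (rule exI[of _ "\<lambda>_. 0"]) simp

lemma hom_poly_add: "hom_poly k P \<Longrightarrow> hom_poly k Q \<Longrightarrow> hom_poly k (\<lambda>x. P x + Q x)"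
  unfolding hom_poly_def
  by (elim exE, rule_tac x="\<lambda>\<alpha>. c \<alpha> + ca \<alpha>" in exI) (simp add: sum.distrib scaleR_add_right)

lemma hom_poly_sum: "(\<And>i. i \<in> A \<Longrightarrow> hom_poly k (P i)) \<Longrightarrow> hom_poly k (\<lambda>x. \<Sum>i\<in>A. P i x)"
  by (induction A rule: infinite_finite_induct) (auto intro: hom_poly_zero hom_poly_add)

lemma hom_poly_linear:
  assumes "linear L" "hom_poly k P"
  shows "hom_poly k (\<lambda>x. L (P x))"
proof -
  obtain c where c: "\<And>x. P x = (\<Sum>\<alpha> | sum \<alpha> UNIV = k. (\<Prod>i\<in>UNIV. (x $ i) ^ \<alpha> i) *\<^sub>R c \<alpha>)"
    using assms(2) by (auto simp: hom_poly_def)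
  show ?thesis
    unfolding hom_poly_def
    by (rule exI[of _ "\<lambda>\<alpha>. L (c \<alpha>)"]) (simp add: c linear_sum[OF assms(1)] linear_scale[OF assms(1)])
qed

lemma hom_poly_scaleR: "hom_poly k P \<Longrightarrow> hom_poly k (\<lambda>x. c *\<^sub>R P x)"
  by (rule hom_poly_linear[of "\<lambda>y. c *\<^sub>R y"]) (auto intro: linear_scaleR)

lemma hom_poly_minus: "hom_poly k P \<Longrightarrow> hom_poly k (\<lambda>x. - P x)"
  using hom_poly_scaleR[of k P "-1"] by simp

lemma hom_poly_diff: "hom_poly k P \<Longrightarrow> hom_poly k Q \<Longrightarrow> hom_poly k (\<lambda>x. P x - Q x)"
  using hom_poly_add[of k P "\<lambda>x. - Q x"] hom_poly_minus[of k Q] by simp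

lemma hom_poly_cl_mult: "hom_poly k P \<Longrightarrow> hom_poly k (\<lambda>x. a \<star> P x)"
  by (rule hom_poly_linear[of "\<lambda>y. a \<star> y"])
    (auto intro: bounded_linear.linear cl_mult.bounded_linear_right)

lemma hom_poly_const: "hom_poly 0 (\<lambda>x. c)"
  using hom_poly_monomial[of "\<lambda>_. 0" c] by simp

lemma hom_poly_eq_sum_monomials:
  assumes "hom_poly k P"
  obtains c where "P = (\<lambda>x. \<Sum>\<alpha> | sum \<alpha> UNIV = k. (\<Prod>i\<in>UNIV. (x $ i) ^ \<alpha> i) *\<^sub>R c \<alpha>)"
  using assms by (auto simp: hom_poly_def)

lemma monomial_coord_mult:
  fixes x :: "real ^ 'n::finite"
  shows "x $ i * (\<Prod>l\<in>UNIV. (x $ l) ^ \<alpha> l) = (\<Prod>l\<in>UNIV. (x $ l) ^ (\<alpha>(i := Suc (\<alpha> i))) l)"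
proof -
  have "(\<Prod>l\<in>UNIV. (x $ l) ^ \<alpha> l) = (x $ i) ^ \<alpha> i * (\<Prod>l\<in>UNIV - {i}. (x $ l) ^ \<alpha> l)"
    by (simp add: prod.remove)
  moreover have "(\<Prod>l\<in>UNIV. (x $ l) ^ (\<alpha>(i := Suc (\<alpha> i))) l)
      = (x $ i) ^ Suc (\<alpha> i) * (\<Prod>l\<in>UNIV - {i}. (x $ l) ^ (\<alpha>(i := Suc (\<alpha> i))) l)"
    by (subst prod.remove[of _ i]) simp_all
  moreover have "(\<Prod>l\<in>UNIV - {i}. (x $ l) ^ (\<alpha>(i := Suc (\<alpha> i))) l) = (\<Prod>l\<in>UNIV - {i}. (x $ l) ^ \<alpha> l)"
    by (intro prod.cong) auto
  ultimately show ?thesis by simp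
qed

lemma sum_fun_upd_Suc: "sum (\<alpha>(i := Suc (\<alpha> i))) UNIV = Suc (sum \<alpha> (UNIV :: 'n::finite set))"
proof -
  have "sum (\<alpha>(i := Suc (\<alpha> i))) UNIV = Suc (\<alpha> i) + sum (\<alpha>(i := Suc (\<alpha> i))) (UNIV - {i})"
    by (subst sum.remove[of _ i]) simp_all
  also have "sum (\<alpha>(i := Suc (\<alpha> i))) (UNIV - {i}) = sum \<alpha> (UNIV - {i})"
    by (intro sum.cong) auto
  finally show ?thesis by (simp add: sum.remove[of UNIV i])
qed

lemma hom_poly_coord:
  assumes "hom_poly k P"
  shows "hom_poly (Suc k) (\<lambda>x. x $ i *\<^sub>R P x)"
proof -
  obtain c where c: "P = (\<lambda>x. \<Sum>\<alpha> | sum \<alpha> UNIV = k. (\<Prod>i\<in>UNIV. (x $ i) ^ \<alpha> i) *\<^sub>R c \<alpha>)"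
    using hom_poly_eq_sum_monomials[OF assms] .
  have "hom_poly (Suc k) (\<lambda>x. \<Sum>\<alpha> | sum \<alpha> UNIV = k.
      (\<Prod>l\<in>UNIV. (x $ l) ^ (\<alpha>(i := Suc (\<alpha> i))) l) *\<^sub>R c \<alpha>)"
    by (intro hom_poly_sum) (metis (mono_tags) hom_poly_monomial sum_fun_upd_Suc mem_Collect_eq)
  then show ?thesis
    unfolding monomial_coord_mult[symmetric] by (simp add: c scaleR_sum_right)
qed

text \<open>Constants, sums and multiplication by a coordinate generate all homogeneous polynomials.
  Since the degree is an argument of the predicate, facts on derivatives, scaling and trigonometric
  degree follow without handling multi-indices.\<close>

lemma hom_poly_induct [consumes 1, case_names const add coord]:
  fixes P :: "real ^ 'n::{finite,linorder} \<Rightarrow> 'n clif"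
  assumes "hom_poly k P"
    and const: "\<And>c. \<Phi> 0 (\<lambda>x. c)"
    and add: "\<And>k P Q. hom_poly k P \<Longrightarrow> \<Phi> k P \<Longrightarrow> hom_poly k Q \<Longrightarrow> \<Phi> k Q \<Longrightarrow> \<Phi> k (\<lambda>x. P x + Q x)"
    and coord: "\<And>k i P. hom_poly k P \<Longrightarrow> \<Phi> k P \<Longrightarrow> \<Phi> (Suc k) (\<lambda>x. x $ i *\<^sub>R P x)"
  shows "\<Phi> k P"
proof -
  \<comment> \<open>The zero polynomial is needed in every degree, as the empty sum of monomials; it
    arises from the constant 0 by multiplying with coordinates.\<close>
  have zero: "\<Phi> k (\<lambda>x. 0)" for k
  proof (induction k)
    case 0
    show ?case by (rule const)
  next
    case (Suc k)
    then show ?case using coord[OF hom_poly_zero Suc, of undefined] by simp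
  qed
  have mono: "\<Phi> (sum \<alpha> UNIV) (\<lambda>x. (\<Prod>i\<in>UNIV. (x $ i) ^ \<alpha> i) *\<^sub>R c)" for \<alpha> :: "'n \<Rightarrow> nat" and c
  proof (induction "sum \<alpha> UNIV" arbitrary: \<alpha>)
    case 0
    then have "\<alpha> = (\<lambda>_. 0)" by (simp add: fun_eq_iff)
    then show ?case using const[of c] by simp
  next
    case (Suc k)
    then obtain i where i: "\<alpha> i \<noteq> 0" by (metis sum.neutral UNIV_I nat.distinct(1))
    define \<beta> where "\<beta> = \<alpha>(i := \<alpha> i - 1)"
    have \<alpha>: "\<alpha> = \<beta>(i := Suc (\<beta> i))" using i by (auto simp: \<beta>_def fun_eq_iff)
    have "k = sum \<beta> UNIV" using Suc(2) \<alpha> sum_fun_upd_Suc[of \<beta> i] by simp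
    from coord[OF hom_poly_monomial Suc(1)[OF this], of i]
    have "\<Phi> (Suc (sum \<beta> UNIV)) (\<lambda>x. (x $ i * (\<Prod>i\<in>UNIV. (x $ i) ^ \<beta> i)) *\<^sub>R c)"
      using \<open>k = sum \<beta> UNIV\<close> by simp
    then show ?case
      unfolding monomial_coord_mult sum_fun_upd_Suc[of \<beta> i, symmetric] \<alpha>[symmetric] .
  qed
  obtain c where c: "P = (\<lambda>x. \<Sum>\<alpha> | sum \<alpha> UNIV = k. (\<Prod>i\<in>UNIV. (x $ i) ^ \<alpha> i) *\<^sub>R c \<alpha>)"
    using hom_poly_eq_sum_monomials[OF assms(1)] .
  have "hom_poly k (\<lambda>x. \<Sum>\<alpha>\<in>A. (\<Prod>i\<in>UNIV. (x $ i) ^ \<alpha> i) *\<^sub>R c \<alpha>) \<and>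
      \<Phi> k (\<lambda>x. \<Sum>\<alpha>\<in>A. (\<Prod>i\<in>UNIV. (x $ i) ^ \<alpha> i) *\<^sub>R c \<alpha>)"
    if "A \<subseteq> {\<alpha>. sum \<alpha> UNIV = k}" for A
    using finite_subset[OF that finite_multi_index] that
  proof (induction A rule: finite_induct)
    case empty
    show ?case using zero hom_poly_zero by simp
  next
    case (insert \<alpha> A)
    then have k: "k = sum \<alpha> UNIV" by simp
    from insert show ?case
      using hom_poly_monomial[of \<alpha> "c \<alpha>"] mono[of \<alpha> "c \<alpha>"] by (auto simp: k intro!: hom_poly_add add)
  qed
  then show ?thesis by (simp add: c)
qed

section \<open>Partial derivatives of homogeneous polynomials\<close>

definition pdiff :: "(real ^ 'n::finite \<Rightarrow> 'b::real_normed_vector) \<Rightarrow> 'n \<Rightarrow> (real, 'n) vec \<Rightarrow> 'b" where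
  "pdiff F i x = frechet_derivative F (at x) (axis i 1)"

lemma pdiff_eq: "(F has_derivative F') (at x) \<Longrightarrow> pdiff F i x = F' (axis i 1)"
  unfolding pdiff_def by (simp add: frechet_derivative_at[symmetric])

lemma pdiff_const [simp]: "pdiff (\<lambda>x. c) i x = 0"
  by (subst pdiff_eq[OF has_derivative_const]) simp

lemma pdiff_add:
  assumes "F differentiable at x" "G differentiable at x"
  shows "pdiff (\<lambda>x. F x + G x) i x = pdiff F i x + pdiff G i x"
  using pdiff_eq[OF has_derivative_add[OF frechet_derivative_works[THEN iffD1] frechet_derivative_works[THEN iffD1]], OF assms]
  by (simp add: pdiff_def)

lemma pdiff_diff:
  assumes "F differentiable at x" "G differentiable at x"
  shows "pdiff (\<lambda>x. F x - G x) i x = pdiff F i x - pdiff G i x"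
  using pdiff_eq[OF has_derivative_diff[OF frechet_derivative_works[THEN iffD1] frechet_derivative_works[THEN iffD1]], OF assms]
  by (simp add: pdiff_def)

lemma pdiff_sum:
  assumes "\<And>j. j \<in> A \<Longrightarrow> F j differentiable at x"
  shows "pdiff (\<lambda>x. \<Sum>j\<in>A. F j x) i x = (\<Sum>j\<in>A. pdiff (F j) i x)"
  using pdiff_eq[OF has_derivative_sum[OF frechet_derivative_works[THEN iffD1]], OF assms, of A]
  by (simp add: pdiff_def)

lemma pdiff_linear:
  assumes "bounded_linear L" "F differentiable at x"
  shows "pdiff (\<lambda>x. L (F x)) i x = L (pdiff F i x)"
  using pdiff_eq[OF bounded_linear.has_derivative[OF assms(1) frechet_derivative_works[THEN iffD1, OF assms(2)]]]
  by (simp add: pdiff_def)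

lemma has_derivative_coord_scaleR:
  fixes F :: "real ^ 'n::finite \<Rightarrow> 'b::real_normed_vector"
  assumes "(F has_derivative F') (at x)"
  shows "((\<lambda>x. x $ j *\<^sub>R F x) has_derivative (\<lambda>v. x $ j *\<^sub>R F' v + v $ j *\<^sub>R F x)) (at x)"
  using assms by (auto intro!: derivative_eq_intros bounded_linear.has_derivative[OF bounded_linear_vec_nth])

lemma pdiff_coord_scaleR:
  assumes "F differentiable at x"
  shows "pdiff (\<lambda>x. x $ j *\<^sub>R F x) i x = x $ j *\<^sub>R pdiff F i x + (if i = j then F x else 0)"
  using pdiff_eq[OF has_derivative_coord_scaleR[OF frechet_derivative_works[THEN iffD1, OF assms]]]
  by (simp add: pdiff_def axis_def)

text \<open>Differentiability and the degree of the partial derivatives are proved together, since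
  the product rule in the coordinate step uses both. Degree 0 is separate because
  \<open>k - 1\<close> truncates there.\<close>

lemma hom_poly_differentiable_pdiff:
  assumes "hom_poly k P"
  shows "(\<forall>x. P differentiable at x) \<and> (\<forall>i. if k = 0 then pdiff P i = (\<lambda>x. 0) else hom_poly (k - 1) (pdiff P i))"
  using assms
proof (induction rule: hom_poly_induct)
  case (const c)
  show ?case by (simp add: fun_eq_iff)
next
  case (add k P Q)
  then have "pdiff (\<lambda>x. P x + Q x) i = (\<lambda>x. pdiff P i x + pdiff Q i x)" for i
    by (auto simp: fun_eq_iff pdiff_add)
  with add show ?case by (auto intro: hom_poly_add)
next
  case (coord k j P)
  then have eq: "pdiff (\<lambda>x. x $ j *\<^sub>R P x) i = (\<lambda>x. x $ j *\<^sub>R pdiff P i x + (if i = j then P x else 0))" for i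
    by (auto simp: fun_eq_iff pdiff_coord_scaleR)
  have d: "(\<lambda>x. x $ j *\<^sub>R P x) differentiable at x" for x
    using coord has_derivative_coord_scaleR unfolding differentiable_def by blast
  have h: "hom_poly k (\<lambda>x. x $ j *\<^sub>R pdiff P i x)" for i
    using coord hom_poly_coord[of "k - 1" "pdiff P i" j] by (cases k) (auto intro: hom_poly_zero)
  show ?case
  proof (intro conjI allI)
    show "if Suc k = 0 then pdiff (\<lambda>x. x $ j *\<^sub>R P x) i = (\<lambda>x. 0)
      else hom_poly (Suc k - 1) (pdiff (\<lambda>x. x $ j *\<^sub>R P x) i)" for i
      using h hom_poly_add[OF h coord(1)] by (cases "i = j") (auto simp: eq)
  qed (rule d)
qed

lemma hom_poly_differentiable: "hom_poly k P \<Longrightarrow> P differentiable at x"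
  using hom_poly_differentiable_pdiff by blast

lemma hom_poly_pdiff: "hom_poly (Suc k) P \<Longrightarrow> hom_poly k (pdiff P i)"
  using hom_poly_differentiable_pdiff[of "Suc k" P] by simp

lemma hom_poly_0_pdiff: "hom_poly 0 P \<Longrightarrow> pdiff P i x = 0"
  using hom_poly_differentiable_pdiff[of 0 P] by simp

lemma hom_poly_continuous_on: "hom_poly k P \<Longrightarrow> continuous_on S P"
  by (intro continuous_at_imp_continuous_on ballI differentiable_imp_continuous_within hom_poly_differentiable)

lemma hom_poly_scale_arg: "hom_poly k P \<Longrightarrow> P (t *\<^sub>R x) = t ^ k *\<^sub>R P x"
  by (induction rule: hom_poly_induct) (simp_all add: scaleR_add_right)

lemma hom_poly_euler: "hom_poly k P \<Longrightarrow> (\<Sum>i\<in>UNIV. x $ i *\<^sub>R pdiff P i x) = real k *\<^sub>R P x"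
proof (induction rule: hom_poly_induct)
  case (const c)
  show ?case by simp
next
  case (add k P Q)
  then show ?case
    by (simp add: pdiff_add[OF hom_poly_differentiable hom_poly_differentiable] scaleR_add_right sum.distrib)
next
  case (coord k j P)
  have "(\<Sum>i\<in>UNIV. x $ i *\<^sub>R pdiff (\<lambda>x. x $ j *\<^sub>R P x) i x)
      = x $ j *\<^sub>R (\<Sum>i\<in>UNIV. x $ i *\<^sub>R pdiff P i x) + (\<Sum>i\<in>UNIV. if i = j then x $ i *\<^sub>R P x else 0)"
    unfolding scaleR_sum_right sum.distrib[symmetric]
    by (intro sum.cong refl)
      (simp add: pdiff_coord_scaleR[OF hom_poly_differentiable[OF coord(1)]] scaleR_add_right mult.commute)
  also have "\<dots> = real (Suc k) *\<^sub>R (x $ j *\<^sub>R P x)"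
    using coord by (simp add: algebra_simps)
  finally show ?case .
qed

section \<open>The Dirac operator, the Euler operator and multiplication by the vector
  variable\<close>

definition dirac :: "(real ^ 'n::{finite,linorder} \<Rightarrow> 'n clif) \<Rightarrow> (real, 'n) vec \<Rightarrow> 'n clif" where
  "dirac F x = (\<Sum>i\<in>UNIV. cl_e i \<star> pdiff F i x)"

definition euler :: "(real ^ 'n::{finite,linorder} \<Rightarrow> 'n clif) \<Rightarrow> (real, 'n) vec \<Rightarrow> 'n clif" where
  "euler F x = (\<Sum>i\<in>UNIV. x $ i *\<^sub>R pdiff F i x)"

definition vmul :: "(real ^ 'n::{finite,linorder} \<Rightarrow> 'n clif) \<Rightarrow> (real, 'n) vec \<Rightarrow> 'n clif" where
  "vmul F x = cl_vec x \<star> F x"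

lemma monogenic_hom_iff: "monogenic_hom k P \<longleftrightarrow> hom_poly k P \<and> (\<forall>x. dirac P x = 0)"
  by (simp add: monogenic_hom_def dirac_def pdiff_def)

lemma vmul_eq_sum: "vmul F = (\<lambda>x. \<Sum>i\<in>UNIV. x $ i *\<^sub>R (cl_e i \<star> F x))"
  by (simp add: fun_eq_iff vmul_def cl_vec_mult)

lemma hom_poly_vmul: "hom_poly k P \<Longrightarrow> hom_poly (Suc k) (vmul P)"
  unfolding vmul_eq_sum by (intro hom_poly_sum hom_poly_coord hom_poly_cl_mult)

lemma pdiff_vmul:
  assumes "F differentiable at x"
  shows "pdiff (vmul F) i x = cl_e i \<star> F x + cl_vec x \<star> pdiff F i x"
  unfolding vmul_def[abs_def]
  using pdiff_eq[OF cl_mult.FDERIV[OF bounded_linear.has_derivative[OF bounded_linear_cl_vec has_derivative_ident]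
        frechet_derivative_works[THEN iffD1, OF assms]]]
  by (simp add: pdiff_def cl_vec_axis add.commute)

text \<open>Moving \<open>e_i\<close> past \<open>x\<close> leaves the anticommutator -2 x_i, which
  sums to the Euler operator, while the derivative of the factor \<open>x\<close> contributes
  \<open>e_i e_i = -1\<close> once per dimension.\<close>

lemma dirac_vmul:
  fixes F :: "real ^ 'n::{finite,linorder} \<Rightarrow> 'n clif"
  assumes "F differentiable at x"
  shows "dirac (vmul F) x = - (real CARD('n) *\<^sub>R F x) - 2 *\<^sub>R euler F x - cl_vec x \<star> dirac F x"
proof -
  have sq: "cl_e i \<star> (cl_e i \<star> y) = - y" for i :: 'n and y
    using cl_vec_square[of "axis i 1" y] by (simp add: cl_vec_axis)
  have ac: "cl_e i \<star> (cl_vec x \<star> y) = - (cl_vec x \<star> (cl_e i \<star> y)) - (2 * x $ i) *\<^sub>R y" for i y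
    using cl_vec_anticommute[of "axis i 1" x y]
    by (simp add: cl_vec_axis inner_axis' algebra_simps eq_neg_iff_add_eq_0)
  have "dirac (vmul F) x = (\<Sum>i\<in>UNIV. - F x - cl_vec x \<star> (cl_e i \<star> pdiff F i x) - (2 * x $ i) *\<^sub>R pdiff F i x)"
    unfolding dirac_def
    by (intro sum.cong refl) (simp add: pdiff_vmul[OF assms] cl_mult.add_right sq ac)
  also have "\<dots> = - (real CARD('n) *\<^sub>R F x) - 2 *\<^sub>R euler F x - cl_vec x \<star> dirac F x"
    by (simp add: sum_subtractf sum_negf sum_constant_scaleR euler_def dirac_def cl_mult.sum_right
        scaleR_sum_right del: sum_constant)
  finally show ?thesis .
qed

lemma dirac_diff:
  "F differentiable at x \<Longrightarrow> G differentiable at x \<Longrightarrow> dirac (\<lambda>x. F x - G x) x = dirac F x - dirac G x"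
  by (simp add: dirac_def pdiff_diff cl_mult.diff_right sum_subtractf)

lemma dirac_sum:
  "(\<And>j. j \<in> A \<Longrightarrow> F j differentiable at x) \<Longrightarrow> dirac (\<lambda>x. \<Sum>j\<in>A. F j x) x = (\<Sum>j\<in>A. dirac (F j) x)"
  unfolding dirac_def by (subst sum.swap) (simp add: pdiff_sum cl_mult.sum_right)

lemma dirac_scaleR: "F differentiable at x \<Longrightarrow> dirac (\<lambda>x. c *\<^sub>R F x) x = c *\<^sub>R dirac F x"
  by (simp add: dirac_def pdiff_linear[OF bounded_linear_scaleR_right] cl_mult.scaleR_right scaleR_sum_right)

lemma hom_poly_dirac: "hom_poly (Suc k) P \<Longrightarrow> hom_poly k (dirac P)"
  unfolding dirac_def[abs_def] by (intro hom_poly_sum hom_poly_cl_mult hom_poly_pdiff)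

lemma monogenic_hom_scaleR: "monogenic_hom k P \<Longrightarrow> monogenic_hom k (\<lambda>x. c *\<^sub>R P x)"
  by (auto simp: monogenic_hom_iff dirac_scaleR[OF hom_poly_differentiable] intro: hom_poly_scaleR)

lemma monogenic_hom_zero: "monogenic_hom k (\<lambda>x. 0)"
  by (auto simp: monogenic_hom_iff dirac_def cl_mult.zero_right intro: hom_poly_zero)

lemma hom_poly_vmul_funpow: "hom_poly k P \<Longrightarrow> hom_poly (k + s) ((vmul ^^ s) P)"
  by (induction s) (auto intro: hom_poly_vmul)

lemma vmul_funpow_scaleR: "(vmul ^^ s) (\<lambda>x. c *\<^sub>R P x) = (\<lambda>x. c *\<^sub>R (vmul ^^ s) P x)"
  by (induction s) (auto simp: vmul_def fun_eq_iff cl_mult.scaleR_right)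

text \<open>The commutation rule gives c(s+1) = n + 2(l+s+1) - c(s) with c(0) = n + 2l for the
  factors, so they alternate between n + 2l + s and s + 1. What matters is that they never vanish:
  up to a nonzero factor the Dirac operator removes one power of \<open>x\<close>.\<close>

lemma dirac_vmul_funpow:
  fixes Q :: "real ^ 'n::{finite,linorder} \<Rightarrow> 'n clif"
  assumes "monogenic_hom l Q"
  shows "dirac ((vmul ^^ Suc s) Q) x
    = - (if even s then real CARD('n) + 2 * l + s else real s + 1) *\<^sub>R (vmul ^^ s) Q x"
proof (induction s)
  case 0
  show ?case
    using assms hom_poly_euler[of l Q x] dirac_vmul[OF hom_poly_differentiable[of l Q], of x]
    by (simp add: monogenic_hom_iff euler_def cl_mult.zero_right algebra_simps)
next
  case (Suc s)
  have h: "hom_poly (l + Suc s) ((vmul ^^ Suc s) Q)"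
    using assms hom_poly_vmul_funpow[of l Q "Suc s"] unfolding monogenic_hom_iff by blast
  have "dirac ((vmul ^^ Suc (Suc s)) Q) x = dirac (vmul ((vmul ^^ Suc s) Q)) x" by simp
  also have "\<dots> = - ((real CARD('n) + 2 * real (l + Suc s)) *\<^sub>R (vmul ^^ Suc s) Q x)
      - cl_vec x \<star> dirac ((vmul ^^ Suc s) Q) x"
    using hom_poly_euler[OF h, of x]
    by (simp add: dirac_vmul[OF hom_poly_differentiable[OF h]] euler_def algebra_simps del: funpow.simps)
  also have "cl_vec x \<star> dirac ((vmul ^^ Suc s) Q) x
      = - (if even s then real CARD('n) + 2 * l + s else real s + 1) *\<^sub>R (vmul ^^ Suc s) Q x"
    unfolding Suc cl_mult.scaleR_right by (simp add: vmul_def[of "(vmul ^^ s) Q"])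
  also have "- ((real CARD('n) + 2 * real (l + Suc s)) *\<^sub>R (vmul ^^ Suc s) Q x)
      - - (if even s then real CARD('n) + 2 * l + s else real s + 1) *\<^sub>R (vmul ^^ Suc s) Q x
      = (- (real CARD('n) + 2 * real (l + Suc s)) + (if even s then real CARD('n) + 2 * l + s else real s + 1))
        *\<^sub>R (vmul ^^ Suc s) Q x"
    by (simp only: scaleR_add_left scaleR_minus_left diff_minus_eq_add)
  also have "- (real CARD('n) + 2 * real (l + Suc s)) + (if even s then real CARD('n) + 2 * l + s else real s + 1)
      = - (if even (Suc s) then real CARD('n) + 2 * l + Suc s else real (Suc s) + 1)"
    by simp
  finally show ?case .
qed

text \<open>The induction hypothesis decomposes \<open>dirac P\<close>; lifting each component x^s Q
  to x^(s+1) Q, divided by its nonzero factor, gives a polynomial with the same Dirac derivative as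
  \<open>P\<close>, and the difference is monogenic. This constructive route avoids a scalar product
  on polynomials.\<close>

lemma fischer_decomposition:
  fixes P :: "real ^ 'n::{finite,linorder} \<Rightarrow> 'n clif"
  assumes "hom_poly k P"
  shows "\<exists>Q. (\<forall>s\<le>k. monogenic_hom (k - s) (Q s)) \<and> P = (\<lambda>x. \<Sum>s\<le>k. (vmul ^^ s) (Q s) x)"
  using assms
proof (induction k arbitrary: P)
  case 0
  then have "monogenic_hom 0 P"
    by (simp add: monogenic_hom_iff dirac_def hom_poly_0_pdiff cl_mult.zero_right)
  then show ?case by (intro exI[of _ "\<lambda>_. P"]) simp
next
  case (Suc k)
  obtain Q where Q: "\<And>s. s \<le> k \<Longrightarrow> monogenic_hom (k - s) (Q s)"
    and D: "dirac P = (\<lambda>x. \<Sum>s\<le>k. (vmul ^^ s) (Q s) x)"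
    using Suc(1)[OF hom_poly_dirac[OF Suc(2)]] by blast
  \<comment> \<open>The factor relating x^(s+1) Q to x^s Q when Q is monogenic of degree k -
    s.\<close>
  define c where "c s = - (if even s then real CARD('n) + 2 * real (k - s) + s else real s + 1)" for s :: nat
  have c0: "c s \<noteq> 0" for s
    unfolding c_def by (smt (verit) of_nat_0_le_iff zero_less_card_finite of_nat_0_less_iff mult_nonneg_nonneg)
  define R where "R s = (\<lambda>x. (1 / c s) *\<^sub>R Q s x)" for s
  have R: "monogenic_hom (k - s) (R s)" if "s \<le> k" for s
    using Q[OF that] by (simp add: R_def monogenic_hom_scaleR)
  have hR: "hom_poly (Suc k) ((vmul ^^ Suc s) (R s))" if "s \<le> k" for s
    using hom_poly_vmul_funpow[of "k - s" "R s" "Suc s"] R[OF that] that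
    by (simp add: monogenic_hom_iff del: funpow.simps)
  have dR: "dirac ((vmul ^^ Suc s) (R s)) x = (vmul ^^ s) (Q s) x" if "s \<le> k" for s x
    unfolding dirac_vmul_funpow[OF R[OF that]] unfolding R_def vmul_funpow_scaleR
    using c0[of s] by (cases "even s") (simp_all add: c_def)
  define M where "M x = P x - (\<Sum>s\<le>k. (vmul ^^ Suc s) (R s) x)" for x
  have hS: "hom_poly (Suc k) (\<lambda>x. \<Sum>s\<le>k. (vmul ^^ Suc s) (R s) x)"
    by (intro hom_poly_sum hR) simp
  have "dirac M x = dirac P x - (\<Sum>s\<le>k. dirac ((vmul ^^ Suc s) (R s)) x)" for x
    unfolding M_def[abs_def]
    using hom_poly_differentiable[OF Suc(2)] hom_poly_differentiable[OF hS] hom_poly_differentiable[OF hR]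
      dirac_sum[of "{..k}" "\<lambda>s. (vmul ^^ Suc s) (R s)" x]
    by (subst dirac_diff) (auto simp del: funpow.simps)
  also have "\<dots>x = 0" for x
    by (simp add: dR D del: funpow.simps)
  finally have "monogenic_hom (Suc k) M"
    unfolding monogenic_hom_iff M_def[abs_def] using hom_poly_diff[OF Suc(2) hS] by blast
  moreover have "P = (\<lambda>x. \<Sum>s\<le>Suc k. (vmul ^^ s) (case s of 0 \<Rightarrow> M | Suc s \<Rightarrow> R s) x)"
    unfolding sum.atMost_Suc_shift by (simp add: M_def fun_eq_iff)
  ultimately show ?case
    using R by (intro exI[of _ "\<lambda>s. case s of 0 \<Rightarrow> M | Suc s \<Rightarrow> R s"]) (auto split: nat.split)
qed

lemma vmul_funpow_sphere:
  assumes "norm w = 1"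
  shows "(vmul ^^ s) P w = cact w (\<i> ^ s) (P w)"
  by (induction s) (simp_all add: vmul_def cact_mult[OF assms] cact_simps)

text \<open>Grouping by degree makes the polynomials supplied by Weierstrass approximation
  accessible to the Fischer decomposition.\<close>

definition sum_hom :: "(real ^ 'n::{finite,linorder} \<Rightarrow> 'n clif) \<Rightarrow> bool" where
  "sum_hom p \<longleftrightarrow> (\<exists>K H. (\<forall>d. hom_poly d (H d)) \<and> p = (\<lambda>x. \<Sum>d<K::nat. H d x))"

lemma sum_hom_hom_poly:
  assumes "hom_poly k P"
  shows "sum_hom P"
proof -
  have "hom_poly d (if d = k then P else (\<lambda>x. 0))" for d
    using assms by (auto intro: hom_poly_zero)
  moreover have "P = (\<lambda>x. \<Sum>d<Suc k. (if d = k then P else (\<lambda>x. 0)) x)"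
    by (simp add: if_distribR)
  ultimately show ?thesis
    unfolding sum_hom_def by (intro exI[of _ "Suc k"] exI[of _ "\<lambda>d. if d = k then P else (\<lambda>x. 0)"]) blast
qed

lemma sum_hom_add:
  assumes "sum_hom p" "sum_hom q"
  shows "sum_hom (\<lambda>x. p x + q x)"
proof -
  obtain K H K' H' where H: "\<And>d. hom_poly d (H d)" "p = (\<lambda>x. \<Sum>d<K::nat. H d x)"
    and H': "\<And>d. hom_poly d (H' d)" "q = (\<lambda>x. \<Sum>d<K'::nat. H' d x)"
    using assms by (auto simp: sum_hom_def)
  have ext: "(\<Sum>d<k. G d x) = (\<Sum>d<K + K'. if d < k then G d x else 0)" if "k \<le> K + K'"
    for k x and G :: "nat \<Rightarrow> (real, 'a) vec \<Rightarrow> 'a clif"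
  proof -
    have "{..<K + K'} \<inter> {d. d < k} = {..<k}" using that by auto
    then show ?thesis by (simp add: sum.If_cases)
  qed
  have "hom_poly d (\<lambda>x. (if d < K then H d x else 0) + (if d < K' then H' d x else 0))" for d
    using H(1)[of d] H'(1)[of d] hom_poly_add[of d "H d" "H' d"]
    by (cases "d < K"; cases "d < K'") (auto intro: hom_poly_zero)
  moreover have "(\<lambda>x. p x + q x) = (\<lambda>x. \<Sum>d<K + K'. (if d < K then H d x else 0) + (if d < K' then H' d x else 0))"
    by (simp add: H(2) H'(2) ext sum.distrib)
  ultimately show ?thesis unfolding sum_hom_def
    by (intro exI[of _ "K + K'"] exI[of _ "\<lambda>d x. (if d < K then H d x else 0) + (if d < K' then H' d x else 0)"]) blast
qed

lemma sum_hom_sum: "(\<And>i. i \<in> A \<Longrightarrow> sum_hom (p i)) \<Longrightarrow> sum_hom (\<lambda>x. \<Sum>i\<in>A. p i x)"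
  by (induction A rule: infinite_finite_induct)
    (auto intro: sum_hom_hom_poly[OF hom_poly_zero] sum_hom_add)

lemma sum_hom_coord:
  assumes "sum_hom p"
  shows "sum_hom (\<lambda>x. x $ i *\<^sub>R p x)"
proof -
  obtain K H where H: "\<And>d. hom_poly d (H d)" "p = (\<lambda>x. \<Sum>d<K::nat. H d x)"
    using assms by (auto simp: sum_hom_def)
  have "sum_hom (\<lambda>x. \<Sum>d<K. x $ i *\<^sub>R H d x)"
    using H(1) by (intro sum_hom_sum sum_hom_hom_poly[OF hom_poly_coord])
  then show ?thesis by (simp add: H(2) scaleR_sum_right)
qed

lemma sum_hom_scaleR:
  assumes "sum_hom p"
  shows "sum_hom (\<lambda>x. c *\<^sub>R p x)"
proof -
  obtain K H where H: "\<And>d. hom_poly d (H d)" "p = (\<lambda>x. \<Sum>d<K::nat. H d x)"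
    using assms by (auto simp: sum_hom_def)
  have "sum_hom (\<lambda>x. \<Sum>d<K. c *\<^sub>R H d x)"
    using H(1) by (intro sum_hom_sum sum_hom_hom_poly[OF hom_poly_scaleR])
  then show ?thesis by (simp add: H(2) scaleR_sum_right)
qed

text \<open>Asking for the product with an arbitrary \<open>p\<close>, rather than for
  \<open>r\<close> itself, turns the multiplicative step into two successive uses of the induction
  hypothesis.\<close>

lemma sum_hom_real_polynomial:
  fixes r :: "real ^ 'n::{finite,linorder} \<Rightarrow> real"
  assumes "real_polynomial_function r" "sum_hom p"
  shows "sum_hom (\<lambda>x. r x *\<^sub>R p x)"
  using assms
proof (induction arbitrary: p rule: real_polynomial_function.induct)
  case (linear f)
  have L: "linear f" using linear(1) by (rule bounded_linear.linear)
  have eq: "f x = (\<Sum>i\<in>UNIV. x $ i * f (axis i 1))" for x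
  proof -
    have "f x = f (\<Sum>i\<in>UNIV. x $ i *\<^sub>R axis i 1)"
      using basis_expansion[of x] by (simp add: scalar_mult_eq_scaleR)
    then show ?thesis by (simp add: linear_sum[OF L] linear_scale[OF L])
  qed
  have eq': "(\<lambda>x. f x *\<^sub>R p x) = (\<lambda>x. \<Sum>i\<in>UNIV. x $ i *\<^sub>R (f (axis i 1) *\<^sub>R p x))"
    by (rule ext, subst eq) (simp add: scaleR_sum_left)
  show ?case
    unfolding eq' using linear(2) by (intro sum_hom_sum sum_hom_coord sum_hom_scaleR)
next
  case (const c)
  then show ?case by (rule sum_hom_scaleR)
next
  case (add f g)
  then show ?case unfolding scaleR_add_left by (intro sum_hom_add)
next
  case (mult f g)
  then have "sum_hom (\<lambda>x. f x *\<^sub>R (g x *\<^sub>R p x))" by blast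
  then show ?case by simp
qed

lemma sum_hom_polynomial:
  fixes p :: "real ^ 'n::{finite,linorder} \<Rightarrow> 'n clif"
  assumes "polynomial_function p"
  shows "sum_hom p"
proof -
  have "sum_hom (\<lambda>x. \<Sum>b\<in>Basis. inner (p x) b *\<^sub>R b)"
    using assms
    by (intro sum_hom_sum sum_hom_real_polynomial sum_hom_hom_poly[OF hom_poly_const])
      (auto simp: polynomial_function_iff_Basis_inner)
  then show ?thesis by (simp add: euclidean_representation)
qed

section \<open>The rotation invariant probability measure on the sphere\<close>

lemma nn_integral_lborel_translate:
  fixes f :: "'a::euclidean_space \<Rightarrow> ennreal"
  assumes [measurable]: "f \<in> borel_measurable borel"
  shows "(\<integral>\<^sup>+x. f (c + x) \<partial>lborel) = (\<integral>\<^sup>+x. f x \<partial>lborel)"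
proof -
  have "(\<integral>\<^sup>+x. f x \<partial>lborel) = (\<integral>\<^sup>+x. f x \<partial>distr lborel borel ((+) c))"
    by (simp only: lborel_distr_plus)
  also have "\<dots> = (\<integral>\<^sup>+x. f (c + x) \<partial>lborel)"
    by (rule nn_integral_distr) auto
  finally show ?thesis by simp
qed

text \<open>Uniqueness of Haar measure: Fubini applied to $1_B(y)\,1_A(Tx+y)$ with $B$ the unit ball,
  which $T$ preserves.\<close>

lemma lborel_distr_orthogonal:
  fixes T :: "'a::euclidean_space \<Rightarrow> 'a"
  assumes T: "orthogonal_transformation T"
  shows "distr lborel borel T = lborel"
proof (rule measure_eqI)
  fix A assume "A \<in> sets (distr lborel borel T)"
  then have A [measurable]: "A \<in> sets borel" by simp
  have lin: "linear T" using T by (rule orthogonal_transformation_linear)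
  have mT [measurable]: "T \<in> borel_measurable borel"
    using linear_continuous_on[OF linear_conv_bounded_linear[THEN iffD1, OF lin]]
    by (rule borel_measurable_continuous_onI)
  let ?B = "ball 0 1 :: 'a set"
  have Bm [measurable]: "?B \<in> sets borel" by (rule borel_open[OF open_ball])
  define S where "S = inv T"
  have TS: "T (S y) = y" for y
    using orthogonal_transformation_surj[OF T] by (simp add: S_def surj_f_inv_f)
  have B: "0 < emeasure lborel ?B" "emeasure lborel ?B < \<infinity>"
    by (auto simp: emeasure_ball unit_ball_vol_pos)
  have eA: "emeasure (distr lborel borel T) A = (\<integral>\<^sup>+x. indicator A (T x) \<partial>lborel)"
    by (simp add: nn_integral_distr[of T lborel borel "indicator A", symmetric])
  have "emeasure lborel ?B * emeasure (distr lborel borel T) A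
      = (\<integral>\<^sup>+y. indicator ?B y * (\<integral>\<^sup>+x. indicator A (T x) \<partial>lborel) \<partial>lborel)"
    by (subst nn_integral_multc) (measurable, simp add: eA)
  also have "\<dots> = (\<integral>\<^sup>+y. (\<integral>\<^sup>+x. indicator ?B y * indicator A (y + T x) \<partial>lborel) \<partial>lborel)"
  proof (rule nn_integral_cong)
    fix y
    have "(\<integral>\<^sup>+x. indicator A (T x) \<partial>lborel) = (\<integral>\<^sup>+x. indicator A (T (S y + x)) \<partial>lborel)"
      by (rule nn_integral_lborel_translate[symmetric]) measurable
    also have "\<dots> = (\<integral>\<^sup>+x. indicator A (y + T x) \<partial>lborel)"
      by (simp add: linear_add[OF lin] TS)
    finally show "indicator ?B y * (\<integral>\<^sup>+x. indicator A (T x) \<partial>lborel)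
        = (\<integral>\<^sup>+x. indicator ?B y * indicator A (y + T x) \<partial>lborel)"
      by (simp add: nn_integral_cmult)
  qed
  also have "\<dots> = (\<integral>\<^sup>+x. (\<integral>\<^sup>+y. indicator ?B y * indicator A (y + T x) \<partial>lborel) \<partial>lborel)"
    by (rule lborel_pair.Fubini'[symmetric]) measurable
  also have "\<dots> = (\<integral>\<^sup>+x. (\<integral>\<^sup>+y. indicator ?B (y - T x) * indicator A y \<partial>lborel) \<partial>lborel)"
  proof (rule nn_integral_cong)
    fix x
    have "(\<integral>\<^sup>+y. indicator ?B (y - T x) * indicator A y \<partial>lborel)
      = (\<integral>\<^sup>+y. indicator ?B ((T x + y) - T x) * indicator A (T x + y) \<partial>lborel)"
      by (rule nn_integral_lborel_translate[symmetric]) measurable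
    then show "(\<integral>\<^sup>+y. indicator ?B y * indicator A (y + T x) \<partial>lborel)
      = (\<integral>\<^sup>+y. indicator ?B (y - T x) * indicator A y \<partial>lborel)"
      by (simp add: add.commute)
  qed
  also have "\<dots> = (\<integral>\<^sup>+y. (\<integral>\<^sup>+x. indicator ?B (y - T x) * indicator A y \<partial>lborel) \<partial>lborel)"
    by (rule lborel_pair.Fubini') measurable
  also have "\<dots> = (\<integral>\<^sup>+y. emeasure lborel ?B * indicator A y \<partial>lborel)"
  proof (rule nn_integral_cong)
    fix y
    have "indicator ?B (y - T x) = (indicator (ball (S y) 1) x :: ennreal)" for x
    proof -
      have "norm (y - T x) = norm (T (S y - x))"
        by (simp add: linear_diff[OF lin] TS)
      also have "\<dots> = norm (S y - x)"
        using T by (simp add: orthogonal_transformation)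
      finally show ?thesis
        using norm_minus_commute[of y "T x"] by (simp add: indicator_def dist_norm)
    qed
    moreover have b: "ball (S y) 1 \<in> sets lborel" unfolding sets_lborel by (rule borel_open[OF open_ball])
    ultimately have "(\<integral>\<^sup>+x. indicator ?B (y - T x) * indicator A y \<partial>lborel)
        = (\<integral>\<^sup>+x. indicator (ball (S y) 1) x * indicator A y \<partial>lborel)" by simp
    also have "\<dots> = (\<integral>\<^sup>+x. indicator (ball (S y) 1) x \<partial>lborel) * indicator A y"
      by (rule nn_integral_multc[OF borel_measurable_indicator[OF b]])
    also have "(\<integral>\<^sup>+x. indicator (ball (S y) 1) x \<partial>lborel) = emeasure lborel (ball (S y) 1)"
      by (rule nn_integral_indicator[OF b])
    finally have "(\<integral>\<^sup>+x. indicator ?B (y - T x) * indicator A y \<partial>lborel)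
        = emeasure lborel (ball (S y) 1) * indicator A y" .
    then show "(\<integral>\<^sup>+x. indicator ?B (y - T x) * indicator A y \<partial>lborel) = emeasure lborel ?B * indicator A y"
      by (simp add: emeasure_ball)
  qed
  also have "\<dots> = emeasure lborel ?B * emeasure lborel A"
    by (simp add: nn_integral_cmult)
  finally show "emeasure (distr lborel borel T) A = emeasure lborel A"
    using B by (auto simp: ennreal_mult_cancel_left)
qed simp

text \<open>Normalised surface measure by the cone construction, in agreement with
  \<open>L2_norm_S\<close>. It is a measure on the whole space; normalisation sends the origin to 0,
  but the origin is a null set, so the sphere has full measure.\<close>

definition sphm :: "'a::euclidean_space measure" where
  "sphm = distr (uniform_measure lborel (ball 0 1)) borel (\<lambda>x. (1 / norm x) *\<^sub>R x)"

lemma sets_sphm [simp, measurable_cong]: "sets sphm = sets borel"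
  and space_sphm [simp]: "space sphm = UNIV"
  by (simp_all add: sphm_def)

lemma measurable_normalize [measurable]: "(\<lambda>x::'a::euclidean_space. (1 / norm x) *\<^sub>R x) \<in> borel_measurable borel"
  by measurable

lemma emeasure_unit_ball: "emeasure lborel (ball (0::'a::euclidean_space) 1) \<noteq> 0"
    "emeasure lborel (ball (0::'a::euclidean_space) 1) \<noteq> \<infinity>"
proof -
  have "0 < unit_ball_vol (real DIM('a))" by (simp add: unit_ball_vol_pos)
  then have "unit_ball_vol (real DIM('a)) \<noteq> 0" by linarith
  then show "emeasure lborel (ball (0::'a::euclidean_space) 1) \<noteq> 0"
    "emeasure lborel (ball (0::'a::euclidean_space) 1) \<noteq> \<infinity>"
    by (simp_all add: emeasure_ball)
qed

lemma emeasure_sphm: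
  fixes A :: "'a::euclidean_space set"
  assumes [measurable]: "A \<in> sets borel"
  shows "emeasure sphm A = emeasure lborel (ball 0 1 \<inter> {x. (1 / norm x) *\<^sub>R x \<in> A}) / emeasure lborel (ball (0::'a) 1)"
  unfolding sphm_def
  by (subst emeasure_distr) (auto simp: vimage_def)

lemma finite_measure_sphm: "finite_measure (sphm :: 'a::euclidean_space measure)"
  and emeasure_sphm_UNIV: "emeasure sphm (UNIV :: 'a set) = 1"
proof -
  show 1: "emeasure sphm (UNIV :: 'a set) = 1"
    using emeasure_unit_ball[where 'a='a] by (simp add: emeasure_sphm ennreal_divide_self less_top)
  show "finite_measure (sphm :: 'a::euclidean_space measure)"
    by (rule finite_measureI) (simp add: 1)
qed

lemma AE_sphm: "AE w in sphm. norm (w::'a::euclidean_space) = 1"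
proof -
  have "emeasure sphm (- sphere (0::'a) 1) \<le> emeasure lborel {0::'a} / emeasure lborel (ball (0::'a) 1)"
    by (subst emeasure_sphm) (auto intro!: divide_right_mono_ennreal emeasure_mono)
  then have "emeasure sphm (- sphere (0::'a) 1) = 0" by simp
  then have "- sphere (0::'a) 1 \<in> null_sets sphm" by auto
  then show ?thesis by (rule AE_I') auto
qed

text \<open>Orthogonal maps commute with radial normalisation and preserve the ball, so the
  invariance of Lebesgue measure passes to the sphere.\<close>

lemma sphm_distr_orthogonal:
  fixes T :: "'a::euclidean_space \<Rightarrow> 'a"
  assumes T: "orthogonal_transformation T"
  shows "distr sphm borel T = sphm"
proof (rule measure_eqI)
  fix A assume "A \<in> sets (distr sphm borel T)"
  then have A [measurable]: "A \<in> sets borel" by simp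
  have lin: "linear T" using T by (rule orthogonal_transformation_linear)
  have mT [measurable]: "T \<in> borel_measurable borel"
    using linear_continuous_on[OF linear_conv_bounded_linear[THEN iffD1, OF lin]]
    by (rule borel_measurable_continuous_onI)
  have nT: "norm (T x) = norm x" for x using T by (simp add: orthogonal_transformation)
  let ?E = "ball 0 1 \<inter> {x. (1 / norm x) *\<^sub>R x \<in> A}"
  have "emeasure (distr sphm borel T) A = emeasure sphm (T -` A)"
    by (subst emeasure_distr) auto
  also have "\<dots> = emeasure lborel (ball 0 1 \<inter> {x. (1 / norm x) *\<^sub>R x \<in> T -` A}) / emeasure lborel (ball (0::'a) 1)"
    by (rule emeasure_sphm) (rule measurable_sets_borel[OF mT A])
  also have "ball 0 1 \<inter> {x. (1 / norm x) *\<^sub>R x \<in> T -` A} = T -` ?E"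
    by (auto simp: nT linear_scale[OF lin])
  also have "emeasure lborel (T -` ?E) = emeasure (distr lborel borel T) ?E"
    by (subst emeasure_distr) auto
  also have "\<dots> / emeasure lborel (ball (0::'a) 1) = emeasure sphm A"
    by (simp add: lborel_distr_orthogonal[OF T] emeasure_sphm)
  finally show "emeasure (distr sphm borel T) A = emeasure sphm A" .
qed simp

lemma bounded_on_sphere:
  fixes h :: "'a::euclidean_space \<Rightarrow> 'b::real_normed_vector"
  assumes "continuous_on (sphere 0 1) h"
  obtains B where "0 \<le> B" "\<And>w. norm w = 1 \<Longrightarrow> norm (h w) \<le> B"
proof -
  have "bounded (h ` sphere 0 1)"
    by (intro compact_imp_bounded compact_continuous_image assms compact_sphere)
  then obtain B where "\<forall>x\<in>h ` sphere 0 1. norm x \<le> B" unfolding bounded_iff by blast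
  then have "norm (h w) \<le> \<bar>B\<bar>" if "norm w = 1" for w
    using that by (auto intro: order_trans[OF _ abs_ge_self])
  then show ?thesis using that[of "\<bar>B\<bar>"] by simp
qed

text \<open>Written as an integral over the sphere rather than the whole space, so that only the
  values there count and continuity on the sphere suffices.\<close>

definition sint :: "('a::euclidean_space \<Rightarrow> real) \<Rightarrow> real" where
  "sint h = (LINT w:sphere 0 1|sphm. h w)"

lemma sint_integrable:
  assumes "continuous_on (sphere 0 1) h"
  shows "set_integrable sphm (sphere 0 1) (h :: 'a::euclidean_space \<Rightarrow> real)"
proof -
  interpret finite_measure "sphm :: 'a measure" by (rule finite_measure_sphm)
  obtain B where B: "0 \<le> B" "\<And>w. norm w = 1 \<Longrightarrow> norm (h w) \<le> B"
    using bounded_on_sphere[OF assms] by blast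
  have "(\<lambda>w. indicator (sphere 0 1) w *\<^sub>R h w) \<in> borel_measurable borel"
    using assms by (intro borel_measurable_continuous_on_indicator) auto
  then show ?thesis
    unfolding set_integrable_def
    by (intro integrable_const_bound[where B=B]) (use B in \<open>auto intro!: AE_I2 simp: indicator_def\<close>)
qed

lemma sint_add:
  "continuous_on (sphere 0 1) f \<Longrightarrow> continuous_on (sphere 0 1) g \<Longrightarrow> sint (\<lambda>w. f w + g w) = sint f + sint g"
  unfolding sint_def by (intro set_integral_add sint_integrable)

lemma sint_diff:
  "continuous_on (sphere 0 1) f \<Longrightarrow> continuous_on (sphere 0 1) g \<Longrightarrow> sint (\<lambda>w. f w - g w) = sint f - sint g"
  unfolding sint_def by (intro set_integral_diff sint_integrable)

lemma sint_cmult: "sint (\<lambda>w. c * f w) = c * sint f"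
  unfolding sint_def by (rule set_integral_mult_right)

lemma sint_zero [simp]: "sint (\<lambda>w. 0) = 0"
  by (simp add: sint_def)

lemma sint_minus: "sint (\<lambda>w. - f w) = - sint f"
  using sint_cmult[of "-1" f] by simp

lemma sint_sum:
  "(\<And>i. i \<in> I \<Longrightarrow> continuous_on (sphere 0 1) (f i)) \<Longrightarrow> sint (\<lambda>w. \<Sum>i\<in>I. f i w) = (\<Sum>i\<in>I. sint (f i))"
  by (induction I rule: infinite_finite_induct) (auto simp: sint_add continuous_on_sum)

lemma sint_cong: "(\<And>w. norm w = 1 \<Longrightarrow> f w = g w) \<Longrightarrow> sint f = sint g"
  unfolding sint_def by (rule set_lebesgue_integral_cong) auto

lemma sint_mono:
  "continuous_on (sphere 0 1) f \<Longrightarrow> continuous_on (sphere 0 1) g \<Longrightarrow> (\<And>w. norm w = 1 \<Longrightarrow> f w \<le> g w) \<Longrightarrow> sint f \<le> sint g"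
  unfolding sint_def by (intro set_integral_mono sint_integrable) auto

lemma sint_const: "sint (\<lambda>w::'a::euclidean_space. c) = c"
proof -
  interpret finite_measure "sphm :: 'a measure" by (rule finite_measure_sphm)
  have "sint (\<lambda>w::'a. c) = (LINT w|(sphm::'a measure). c)"
    unfolding sint_def set_lebesgue_integral_def
    using AE_sphm by (intro integral_cong_AE) (auto simp: indicator_def)
  also have "\<dots> = c" using emeasure_sphm_UNIV[where 'a='a] by (simp add: measure_def)
  finally show ?thesis .
qed

lemma sint_nonneg: "(\<And>w. norm w = 1 \<Longrightarrow> 0 \<le> f w) \<Longrightarrow> 0 \<le> sint f"
  unfolding sint_def set_lebesgue_integral_def
  by (intro Bochner_Integration.integral_nonneg) (auto simp: indicator_def)

lemma sint_abs_le:
  fixes f :: "'a::euclidean_space \<Rightarrow> real"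
  assumes "continuous_on (sphere 0 1) f" "\<And>w. norm w = 1 \<Longrightarrow> \<bar>f w\<bar> \<le> B"
  shows "\<bar>sint f\<bar> \<le> B"
proof -
  have "sint f \<le> sint (\<lambda>w::'a. B)" "sint (\<lambda>w::'a. - B) \<le> sint f"
    using assms(2) by (auto intro!: sint_mono assms(1) simp: abs_le_iff minus_le_iff)
  then show ?thesis by (simp add: sint_const)
qed

lemma sint_orthogonal:
  fixes T :: "'a::euclidean_space \<Rightarrow> 'a"
  assumes T: "orthogonal_transformation T" and h: "continuous_on (sphere 0 1) h"
  shows "sint (\<lambda>w. h (T w)) = sint h"
proof -
  have lin: "linear T" using T by (rule orthogonal_transformation_linear)
  have mT [measurable]: "T \<in> borel_measurable borel"
    using linear_continuous_on[OF linear_conv_bounded_linear[THEN iffD1, OF lin]]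
    by (rule borel_measurable_continuous_onI)
  have nT: "norm (T x) = norm x" for x using T by (simp add: orthogonal_transformation)
  have m: "(\<lambda>w. indicator (sphere 0 1) w *\<^sub>R h w) \<in> borel_measurable borel"
    using h by (intro borel_measurable_continuous_on_indicator) auto
  have "sint h = (LINT w|distr sphm borel T. indicator (sphere 0 1) w *\<^sub>R h w)"
    by (simp add: sint_def set_lebesgue_integral_def sphm_distr_orthogonal[OF T])
  also have "\<dots> = (LINT w|sphm. indicator (sphere 0 1) (T w) *\<^sub>R h (T w))"
    using m by (intro integral_distr) auto
  also have "\<dots> = sint (\<lambda>w. h (T w))"
    by (simp add: sint_def set_lebesgue_integral_def indicator_def nT)
  finally show ?thesis by simp
qed

text \<open>Replacing |x| by r in the normalisation costs at most one further copy of |x - r y|;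
  hence the factor 2.\<close>

lemma dist_normalize_le:
  fixes x y :: "'a::real_inner"
  assumes "x \<noteq> 0" "norm y = 1" "0 < r"
  shows "norm ((1 / norm x) *\<^sub>R x - y) \<le> 2 * norm (x - r *\<^sub>R y) / r"
proof -
  have "(1 / norm x) *\<^sub>R x - y = (1 / r) *\<^sub>R (((r - norm x) / norm x) *\<^sub>R x + (x - r *\<^sub>R y))"
    using assms by (simp add: algebra_simps diff_divide_distrib)
  also have "norm \<dots> \<le> (1 / r) * (norm (((r - norm x) / norm x) *\<^sub>R x) + norm (x - r *\<^sub>R y))"
    using mult_left_mono[OF norm_triangle_ineq[of "((r - norm x) / norm x) *\<^sub>R x" "x - r *\<^sub>R y"], of "1 / r"]
      assms(3) by simp
  also have "norm (((r - norm x) / norm x) *\<^sub>R x) = \<bar>norm (r *\<^sub>R y) - norm x\<bar>"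
    using assms by simp
  also have "\<dots> \<le> norm (x - r *\<^sub>R y)"
    by (metis norm_minus_commute norm_triangle_ineq3)
  finally show ?thesis using assms by (simp add: divide_simps mult.commute)
qed

text \<open>The ball of radius d/4 about y/2 lies in the unit ball and is normalised into the ball
  of radius d about y, because normalisation multiplies the distance to y/2 by at most 4. Its
  relative volume is the bound.\<close>

lemma measure_sphm_ball:
  fixes y :: "'a::euclidean_space"
  assumes y: "norm y = 1" and d: "0 < d" "d \<le> 1"
  shows "(d / 4) ^ DIM('a) \<le> measure sphm (ball y d)"
proof -
  interpret finite_measure "sphm :: 'a measure" by (rule finite_measure_sphm)
  have sub: "ball ((1/2) *\<^sub>R y) (d / 4) \<subseteq> ball 0 1 \<inter> {x. (1 / norm x) *\<^sub>R x \<in> ball y d}"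
  proof
    fix x assume x: "x \<in> ball ((1/2) *\<^sub>R y) (d / 4)"
    then have n: "norm (x - (1/2) *\<^sub>R y) < d / 4" by (simp add: dist_norm norm_minus_commute)
    have "\<bar>norm x - 1/2\<bar> \<le> norm (x - (1/2) *\<^sub>R y)"
      using norm_triangle_ineq3[of x "(1/2) *\<^sub>R y"] y by simp
    then have nx: "norm x < 1" "x \<noteq> 0" using n d by auto
    have "norm ((1 / norm x) *\<^sub>R x - y) \<le> 2 * norm (x - (1/2) *\<^sub>R y) / (1/2)"
      using nx y by (intro dist_normalize_le) auto
    also have "\<dots> < d" using n by simp
    finally show "x \<in> ball 0 1 \<inter> {x. (1 / norm x) *\<^sub>R x \<in> ball y d}"
      using nx by (simp add: dist_norm norm_minus_commute)
  qed
  have v: "unit_ball_vol (real DIM('a)) > 0" by (simp add: unit_ball_vol_pos)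
  have "ennreal ((d / 4) ^ DIM('a)) = emeasure lborel (ball ((1/2) *\<^sub>R y) (d / 4)) / emeasure lborel (ball (0::'a) 1)"
    using d v less_imp_neq[OF v] by (simp add: emeasure_ball divide_ennreal)
  also have "\<dots> \<le> emeasure sphm (ball y d)"
    unfolding emeasure_sphm[OF borel_open[OF open_ball]]
    using measurable_sets_borel[OF measurable_normalize borel_open[OF open_ball], of y d]
    by (intro divide_right_mono_ennreal emeasure_mono sub) (auto simp: vimage_def)
  finally show ?thesis
    unfolding emeasure_eq_measure by (simp add: ennreal_le_iff)
qed

text \<open>Serves twice: a nonnegative continuous function with integral 0 vanishes, and the
  supremum of a polynomial is controlled by its mean square.\<close>

lemma sint_lower_bound:
  fixes h :: "'a::euclidean_space \<Rightarrow> real"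
  assumes h: "continuous_on (sphere 0 1) h" "\<And>w. norm w = 1 \<Longrightarrow> 0 \<le> h w"
    and y: "norm y = 1" and d: "0 < d" "d \<le> 1" and c: "0 \<le> c"
    and low: "\<And>w. norm w = 1 \<Longrightarrow> dist y w < d \<Longrightarrow> c \<le> h w"
  shows "c * (d / 4) ^ DIM('a) \<le> sint h"
proof -
  interpret finite_measure "sphm :: 'a measure" by (rule finite_measure_sphm)
  have "c * (d / 4) ^ DIM('a) \<le> c * measure sphm (ball y d)"
    using measure_sphm_ball[OF y d] c by (rule mult_left_mono)
  also have "\<dots> = (LINT w|sphm. c * indicator (ball y d) w)" by simp
  also have "\<dots> \<le> (LINT w|sphm. indicator (sphere 0 1) w *\<^sub>R h w)"
  proof (rule integral_mono_AE)
    show "integrable sphm (\<lambda>w. indicator (sphere 0 1) w *\<^sub>R h w)"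
      using sint_integrable[OF h(1)] by (simp add: set_integrable_def)
    show "AE w in sphm. c * indicator (ball y d) w \<le> indicator (sphere 0 1) w *\<^sub>R h w"
      using AE_sphm by eventually_elim (auto simp: indicator_def h(2) low)
  qed (auto simp: integrable_real_indicator emeasure_eq_measure)
  also have "\<dots> = sint h" by (simp add: sint_def set_lebesgue_integral_def)
  finally show ?thesis .
qed

lemma sint_eq_0_iff:
  fixes h :: "'a::euclidean_space \<Rightarrow> real"
  assumes h: "continuous_on (sphere 0 1) h" "\<And>w. norm w = 1 \<Longrightarrow> 0 \<le> h w" and 0: "sint h = 0"
    and y: "norm y = 1"
  shows "h y = 0"
proof (rule ccontr)
  assume "h y \<noteq> 0"
  then have hy: "0 < h y" using h(2)[OF y] by simp
  obtain d where d: "0 < d" "\<And>w. norm w = 1 \<Longrightarrow> dist w y < d \<Longrightarrow> dist (h w) (h y) < h y / 2"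
    using h(1)[unfolded continuous_on_iff, rule_format, of y "h y / 2"] y hy by auto
  have "h y / 2 * (min d 1 / 4) ^ DIM('a) \<le> sint h"
  proof (rule sint_lower_bound[OF h y])
    fix w :: 'a assume "norm w = 1" "dist y w < min d 1"
    then have "\<bar>h w - h y\<bar> < h y / 2" using d(2)[of w] by (simp add: dist_commute dist_real_def)
    then show "h y / 2 \<le> h w" by linarith
  qed (use d hy in auto)
  moreover have "0 < h y / 2 * (min d 1 / 4) ^ DIM('a)" using hy d(1) by simp
  ultimately show False using 0 by simp
qed

lemma L2_norm_S_eq:
  fixes g :: "real ^ 'n::{finite,linorder} \<Rightarrow> 'n clif"
  assumes "continuous_on UNIV g"
  shows "L2_norm_S g = sqrt (sint (\<lambda>w. (norm (g w))\<^sup>2))"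
proof -
  have [measurable]: "g \<in> borel_measurable borel"
    using assms by (rule borel_measurable_continuous_onI)
  have v: "0 < measure lborel (ball (0::(real, 'n) vec) 1)" by simp
  have [measurable]: "ball (0::(real, 'n) vec) 1 \<in> sets borel" by (rule borel_open[OF open_ball])
  have um: "uniform_measure lborel (ball (0::(real, 'n) vec) 1)
      = density lborel (\<lambda>x. ennreal (indicator (ball 0 1) x / measure lborel (ball (0::(real, 'n) vec) 1)))"
    unfolding uniform_measure_def
    using v by (intro arg_cong[of _ _ "density lborel"] ext)
      (auto simp: indicator_def emeasure_eq_ennreal_measure emeasure_unit_ball[simplified] divide_ennreal ennreal_1[symmetric] simp del: ennreal_1)
  have "sint (\<lambda>w. (norm (g w))\<^sup>2) = (LINT w|sphm. (norm (g w))\<^sup>2)"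
    unfolding sint_def set_lebesgue_integral_def
    using AE_sphm by (intro integral_cong_AE) (auto simp: indicator_def)
  also have "\<dots> = (LINT x|uniform_measure lborel (ball (0::(real, 'n) vec) 1). (norm (g ((1 / norm x) *\<^sub>R x)))\<^sup>2)"
    unfolding sphm_def by (rule integral_distr) auto
  also have "\<dots> = (LINT x|lborel. (indicator (ball (0::(real, 'n) vec) 1) x / measure lborel (ball (0::(real, 'n) vec) 1)) *\<^sub>R (norm (g ((1 / norm x) *\<^sub>R x)))\<^sup>2)"
    unfolding um
  proof (rule integral_density)
    show "(\<lambda>x. indicat_real (ball (0::(real, 'n) vec) 1) x / measure lborel (ball (0::(real, 'n) vec) 1)) \<in> borel_measurable lborel"
      by (intro borel_measurable_divide borel_measurable_const borel_measurable_indicator)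
        (simp only: sets_lborel, rule borel_open[OF open_ball])
  qed (use v in auto)
  also have "\<dots> = (LINT x|lborel. indicator (ball (0::(real, 'n) vec) 1) x * (norm (g ((1 / norm x) *\<^sub>R x)))\<^sup>2)
      / measure lborel (ball (0::(real, 'n) vec) 1)"
    by simp
  finally show ?thesis by (simp add: L2_norm_S_def)
qed

text \<open>The infinitesimal generator, at the point \<open>x\<close>, of the rotation in the plane
  of the axes \<open>i\<close> and \<open>j\<close>.\<close>

definition rotg :: "'n::finite \<Rightarrow> 'n \<Rightarrow> real ^ 'n \<Rightarrow> (real, 'n) vec" where
  "rotg i j x = x $ i *\<^sub>R axis j 1 - x $ j *\<^sub>R axis i 1"

definition rot :: "'n::finite \<Rightarrow> 'n \<Rightarrow> real \<Rightarrow> real ^ 'n \<Rightarrow> (real, 'n) vec" where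
  "rot i j t x = x + ((cos t - 1) * x $ i - sin t * x $ j) *\<^sub>R axis i 1
                   + ((cos t - 1) * x $ j + sin t * x $ i) *\<^sub>R axis j 1"

lemma orthogonal_transformation_rot:
  assumes "i \<noteq> j"
  shows "orthogonal_transformation (rot i j t)"
  unfolding orthogonal_transformation
proof (intro conjI allI)
  show "linear (rot i j t)"
    by (rule linearI) (simp_all add: rot_def algebra_simps)
  fix x :: "real ^ 'a"
  let ?a = "(cos t - 1) * x $ i - sin t * x $ j" and ?b = "(cos t - 1) * x $ j + sin t * x $ i"
  have ip: "inner (axis i 1) (axis i (1::real)) = 1" "inner (axis j 1) (axis j (1::real)) = 1"
    "inner (axis i 1) (axis j (1::real)) = 0" "inner (axis j 1) (axis i (1::real)) = 0"
    "inner x (axis l 1) = x $ l" "inner (axis l 1) x = x $ l" for l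
    using assms by (simp_all only: inner_axis_axis) (simp_all add: inner_axis inner_axis')
  have "inner (rot i j t x) (rot i j t x)
      = inner x x + 2 * ?a * x $ i + 2 * ?b * x $ j + ?a\<^sup>2 + ?b\<^sup>2"
    by (simp add: rot_def inner_add_left inner_add_right ip power2_eq_square algebra_simps)
  also have "\<dots> = inner x x + ((sin t)\<^sup>2 + (cos t)\<^sup>2 - 1) * ((x $ i)\<^sup>2 + (x $ j)\<^sup>2)"
  proof -
    have "e + 2 * ((c - 1) * p - s * q) * p + 2 * ((c - 1) * q + s * p) * q + ((c - 1) * p - s * q)\<^sup>2
      + ((c - 1) * q + s * p)\<^sup>2 = e + (s\<^sup>2 + c\<^sup>2 - 1) * (p\<^sup>2 + q\<^sup>2)" for c s p q e :: real
      by (simp add: power2_eq_square algebra_simps)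
    then show ?thesis .
  qed
  also have "\<dots> = inner x x" by simp
  finally show "norm (rot i j t x) = norm x" by (simp add: norm_eq_sqrt_inner)
qed

lemma has_vector_derivative_rot:
  assumes "i \<noteq> j"
  shows "((\<lambda>t. rot i j t x) has_vector_derivative rotg i j (rot i j t x)) (at t within T)"
proof -
  have "((\<lambda>t. rot i j t x) has_vector_derivative
      ((- sin t * x $ i - cos t * x $ j) *\<^sub>R axis i 1 + (- sin t * x $ j + cos t * x $ i) *\<^sub>R axis j 1)) (at t within T)"
    unfolding rot_def
    by (auto intro!: derivative_eq_intros simp: algebra_simps)
  moreover have "rotg i j (rot i j t x)
    = (- sin t * x $ i - cos t * x $ j) *\<^sub>R axis i 1 + (- sin t * x $ j + cos t * x $ i) *\<^sub>R axis j 1"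
    using assms by (simp add: rotg_def rot_def axis_def algebra_simps)
  ultimately show ?thesis by simp
qed

lemma rot_0 [simp]: "rot i j 0 x = x"
  by (simp add: rot_def)

text \<open>Difference quotients along the rotation flow integrate to 0 by invariance. The mean
  value theorem bounds them by the supremum of the derivative along the flow, so dominated
  convergence passes to the limit. This is the integration by parts formula on the sphere.\<close>

lemma sint_rotg:
  fixes h :: "real ^ 'n \<Rightarrow> real"
  assumes h: "\<And>w. norm w = 1 \<Longrightarrow> (h has_derivative h' w) (at w)" and ij: "i \<noteq> j"
    and cont: "continuous_on (sphere 0 1) (\<lambda>w. h' w (rotg i j w))"
  shows "sint (\<lambda>w. h' w (rotg i j w)) = 0"
proof -
  define k where "k w = h' w (rotg i j w)" for w
  obtain C where C: "\<And>w. norm w = 1 \<Longrightarrow> norm (k w) \<le> C"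
    using bounded_on_sphere[OF cont] unfolding k_def by blast
  have nT: "norm (rot i j t x) = norm x" for t x
    using orthogonal_transformation_rot[OF ij] by (simp add: orthogonal_transformation)
  have hc: "continuous_on (sphere 0 1) h"
    using has_derivative_continuous[OF h] by (auto intro!: continuous_at_imp_continuous_on)
  have der: "((\<lambda>t. h (rot i j t w)) has_real_derivative k (rot i j t w)) (at t within T)" if "norm w = 1" for w t T
  proof -
    have "((\<lambda>t. h (rot i j t w)) has_vector_derivative h' (rot i j t w) (rotg i j (rot i j t w))) (at t within T)"
      using vector_derivative_diff_chain_within[OF has_vector_derivative_rot[OF ij, of w t T]
          has_derivative_at_withinI[OF h]] that nT by (simp add: o_def)
    then show ?thesis by (simp add: k_def has_real_derivative_iff_has_vector_derivative)
  qed
  define s where "s m w = real (Suc m) * (h (rot i j (1 / real (Suc m)) w) - h w)" for m :: nat and w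
  have sc: "continuous_on (sphere 0 1) (\<lambda>w. h (rot i j t w))" for t
  proof (rule continuous_on_compose2[OF hc])
    show "continuous_on (sphere 0 1) (rot i j t)"
      using orthogonal_transformation_linear[OF orthogonal_transformation_rot[OF ij]] linear_continuous_on
        linear_conv_bounded_linear by blast
  qed (simp add: nT image_subset_iff)
  have s0: "sint (s m) = 0" for m
    unfolding s_def sint_cmult using sint_orthogonal[OF orthogonal_transformation_rot[OF ij] hc] sc hc
    by (simp add: sint_diff)
  have "(\<lambda>m. LINT w|sphm. indicator (sphere 0 1) w *\<^sub>R s m w) \<longlonglongrightarrow> (LINT w|sphm. indicator (sphere 0 1) w *\<^sub>R k w)"
  proof (rule integral_dominated_convergence[where w="\<lambda>_. C"])
    interpret finite_measure "sphm :: (real, 'n) vec measure" by (rule finite_measure_sphm)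
    show "integrable sphm (\<lambda>_::(real, 'n) vec. C)" by simp
    show "(\<lambda>w. indicator (sphere 0 1) w *\<^sub>R k w) \<in> borel_measurable sphm"
      using sint_integrable[OF cont] by (simp add: set_integrable_def k_def integrable_iff_bounded)
    show "(\<lambda>w. indicator (sphere 0 1) w *\<^sub>R s m w) \<in> borel_measurable sphm" for m
    proof -
      have "continuous_on (sphere 0 1) (s m)"
        unfolding s_def using sc[of "1 / real (Suc m)"] hc by (intro continuous_intros)
      from sint_integrable[OF this] show ?thesis by (simp add: set_integrable_def integrable_iff_bounded)
    qed
    show "AE w in sphm. norm (indicator (sphere 0 1) w *\<^sub>R s m w) \<le> C" for m
      using AE_sphm
    proof eventually_elim
      fix w :: "(real, 'n) vec" assume w: "norm w = 1"
      obtain t where "h (rot i j (1 / real (Suc m)) w) - h (rot i j 0 w) = (1 / real (Suc m) - 0) * k (rot i j t w)"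
        using MVT2[of 0 "1 / real (Suc m)" "\<lambda>t. h (rot i j t w)" "\<lambda>t. k (rot i j t w)"] der[OF w] by auto
      then have "s m w = k (rot i j t w)" by (simp add: s_def field_simps)
      then show "norm (indicator (sphere 0 1) w *\<^sub>R s m w) \<le> C"
        using C[of "rot i j t w"] w nT by simp
    qed
    show "AE w in sphm. (\<lambda>m. indicator (sphere 0 1) w *\<^sub>R s m w) \<longlonglongrightarrow> indicator (sphere 0 1) w *\<^sub>R k w"
      using AE_sphm
    proof eventually_elim
      fix w :: "(real, 'n) vec" assume w: "norm w = 1"
      have "((\<lambda>t. (h (rot i j t w) - h (rot i j 0 w)) / (t - 0)) \<longlongrightarrow> k (rot i j 0 w)) (at 0)"
        using der[OF w, of 0 UNIV] by (simp add: has_field_derivative_iff)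
      moreover have "filterlim (\<lambda>m. 1 / real (Suc m)) (at 0) sequentially"
        using LIMSEQ_inverse_real_of_nat by (simp add: filterlim_at inverse_eq_divide)
      ultimately have "(\<lambda>m. (h (rot i j (1 / real (Suc m)) w) - h w) / (1 / real (Suc m))) \<longlonglongrightarrow> k w"
        using filterlim_compose[of "\<lambda>t. (h (rot i j t w) - h w) / t" "nhds (k w)" "at 0" "\<lambda>m. 1 / real (Suc m)"] by simp
      then have "(\<lambda>m. s m w) \<longlonglongrightarrow> k w" by (simp add: s_def mult.commute)
      then show "(\<lambda>m. indicator (sphere 0 1) w *\<^sub>R s m w) \<longlonglongrightarrow> indicator (sphere 0 1) w *\<^sub>R k w"
        using w by simp
    qed
  qed
  then have "(\<lambda>m. sint (s m)) \<longlonglongrightarrow> sint k"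
    by (simp add: sint_def set_lebesgue_integral_def)
  then have "sint k = 0" by (simp add: s0 LIMSEQ_const_iff)
  then show ?thesis by (simp add: k_def[abs_def])
qed

section \<open>The spherical Dirac operator\<close>

definition gam :: "(real ^ 'n::{finite,linorder} \<Rightarrow> 'n clif) \<Rightarrow> (real, 'n) vec \<Rightarrow> 'n clif" where
  "gam F x = - (cl_vec x \<star> dirac F x) - euler F x"

text \<open>Adding the Euler operator to \<open>x\<close> times the Dirac operator cancels the
  diagonal terms \<open>e_i e_i\<close>; the others pair up into rotations, each plane being counted
  twice. So only tangential derivatives occur, and these can be integrated by parts.\<close>

lemma gam_eq_rotations:
  fixes F :: "real ^ 'n::{finite,linorder} \<Rightarrow> 'n clif"
  shows
  "gam F x = - ((1/2) *\<^sub>R (\<Sum>i\<in>UNIV. \<Sum>j\<in>UNIV. cl_e i \<star> (cl_e j \<star> (x $ i *\<^sub>R pdiff F j x - x $ j *\<^sub>R pdiff F i x))))"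
proof -
  let ?A = "\<Sum>i\<in>UNIV. \<Sum>j\<in>UNIV. x $ i *\<^sub>R (cl_e i \<star> (cl_e j \<star> pdiff F j x))"
  have A: "cl_vec x \<star> dirac F x = ?A"
    by (subst cl_vec_mult) (simp add: dirac_def cl_mult.sum_right scaleR_sum_right)
  have "(\<Sum>i\<in>UNIV. \<Sum>j\<in>UNIV. x $ j *\<^sub>R (cl_e i \<star> (cl_e j \<star> pdiff F i x)))
      = (\<Sum>i\<in>UNIV. \<Sum>j\<in>UNIV. x $ i *\<^sub>R (cl_e j \<star> (cl_e i \<star> pdiff F j x)))"
    by (rule sum.swap)
  also have "\<dots> = (\<Sum>i\<in>UNIV. \<Sum>j\<in>UNIV. (if i = j then - (2 *\<^sub>R (x $ i *\<^sub>R pdiff F i x)) else 0)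
      - x $ i *\<^sub>R (cl_e i \<star> (cl_e j \<star> pdiff F j x)))"
  proof (intro sum.cong refl)
    fix i j :: 'n
    have "cl_e j \<star> (cl_e i \<star> y) = (if i = j then -2 else 0) *\<^sub>R y - cl_e i \<star> (cl_e j \<star> y)" for y
      using cl_e_anticommute[of i j y] by (simp add: algebra_simps)
    then have "x $ i *\<^sub>R (cl_e j \<star> (cl_e i \<star> pdiff F j x)) = x $ i *\<^sub>R ((if i = j then -2 else 0) *\<^sub>R pdiff F j x)
        - x $ i *\<^sub>R (cl_e i \<star> (cl_e j \<star> pdiff F j x))"
      by (simp only: scaleR_diff_right)
    then show "x $ i *\<^sub>R (cl_e j \<star> (cl_e i \<star> pdiff F j x)) = (if i = j then - (2 *\<^sub>R (x $ i *\<^sub>R pdiff F i x)) else 0)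
        - x $ i *\<^sub>R (cl_e i \<star> (cl_e j \<star> pdiff F j x))"
      by (auto simp: mult.commute)
  qed
  also have "\<dots> = - (2 *\<^sub>R euler F x) - ?A"
    by (simp add: sum_subtractf euler_def sum_negf scaleR_sum_right)
  finally have B: "(\<Sum>i\<in>UNIV. \<Sum>j\<in>UNIV. x $ j *\<^sub>R (cl_e i \<star> (cl_e j \<star> pdiff F i x))) = - (2 *\<^sub>R euler F x) - ?A" .
  have "(\<Sum>i\<in>UNIV. \<Sum>j\<in>UNIV. cl_e i \<star> (cl_e j \<star> (x $ i *\<^sub>R pdiff F j x - x $ j *\<^sub>R pdiff F i x)))
      = ?A - (\<Sum>i\<in>UNIV. \<Sum>j\<in>UNIV. x $ j *\<^sub>R (cl_e i \<star> (cl_e j \<star> pdiff F i x)))"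
    by (simp add: cl_mult.diff_right cl_mult.scaleR_right sum_subtractf)
  also have "\<dots> = 2 *\<^sub>R (?A + euler F x)"
    unfolding B by (simp add: scaleR_add_right scaleR_2)
  finally show ?thesis
    unfolding gam_def A by simp
qed

text \<open>Differentiability in the ambient space, at points of the sphere, with partial
  derivatives continuous along it: the regularity that the symmetry of \<open>gam\<close>
  consumes.\<close>

definition C1_sphere :: "(real ^ 'n::{finite,linorder} \<Rightarrow> 'n clif) \<Rightarrow> bool" where
  "C1_sphere F \<longleftrightarrow> (\<forall>w. norm w = 1 \<longrightarrow> F differentiable at w) \<and> (\<forall>i. continuous_on (sphere 0 1) (pdiff F i))"

lemma C1_sphere_continuous: "C1_sphere F \<Longrightarrow> continuous_on (sphere 0 1) F"
  unfolding C1_sphere_def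
  by (intro continuous_at_imp_continuous_on ballI differentiable_imp_continuous_within) simp

lemma C1_sphere_hom_poly:
  assumes "hom_poly k P"
  shows "C1_sphere P"
proof -
  have "continuous_on (sphere 0 1) (pdiff P i)" for i
    using hom_poly_differentiable_pdiff[OF assms] by (cases "k = 0") (auto intro: hom_poly_continuous_on)
  then show ?thesis using hom_poly_differentiable[OF assms] by (simp add: C1_sphere_def)
qed

lemma continuous_on_cl_mult [continuous_intros]:
  "continuous_on S f \<Longrightarrow> continuous_on S g \<Longrightarrow> continuous_on S (\<lambda>x. f x \<star> g x)"
  by (rule cl_mult.continuous_on)

lemma continuous_on_cl_vec [continuous_intros]:
  "continuous_on S f \<Longrightarrow> continuous_on S (\<lambda>x. cl_vec (f x))"
  by (rule bounded_linear.continuous_on[OF bounded_linear_cl_vec])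

lemma derivative_rotg:
  assumes "F differentiable at x"
  shows "frechet_derivative F (at x) (rotg i j x) = x $ i *\<^sub>R pdiff F j x - x $ j *\<^sub>R pdiff F i x"
proof -
  have "linear (frechet_derivative F (at x))" using assms by (rule linear_frechet_derivative)
  then show ?thesis by (simp add: rotg_def pdiff_def linear_diff linear_scale)
qed

text \<open>For distinct i and j both the multiplication by \<open>e_i e_j\<close> and the rotation
  derivative are skew-adjoint, and they commute, so each summand is symmetric; the diagonal summands
  vanish.\<close>

lemma gam_symmetric:
  assumes F: "C1_sphere F" and G: "C1_sphere G"
  shows "sint (\<lambda>w. inner (gam F w) (G w)) = sint (\<lambda>w. inner (F w) (gam G w))"
proof -
  define L where "L H i j w = w $ i *\<^sub>R pdiff H j w - w $ j *\<^sub>R pdiff H i w"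
    for H :: "(real, 'a) vec \<Rightarrow> 'a clif" and i j w
  have Lc: "continuous_on (sphere 0 1) (L H i j)" if "C1_sphere H" for H i j
    using that unfolding L_def[abs_def] C1_sphere_def by (intro continuous_intros) auto
  note c = C1_sphere_continuous[OF F] C1_sphere_continuous[OF G] Lc[OF F] Lc[OF G]
  have ij: "sint (\<lambda>w. inner (cl_e i \<star> (cl_e j \<star> L F i j w)) (G w)) = sint (\<lambda>w. inner (F w) (cl_e i \<star> (cl_e j \<star> L G i j w)))"
    for i j
  proof (cases "i = j")
    case True
    then have "L H i j w = 0" for H w by (simp add: L_def)
    then show ?thesis by (simp add: cl_mult.zero_right)
  next
    case False
    define h where "h w = inner (F w) (cl_e j \<star> (cl_e i \<star> G w))" for w
    define h' where "h' w v = inner (F w) (cl_e j \<star> (cl_e i \<star> frechet_derivative G (at w) v))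
      + inner (frechet_derivative F (at w) v) (cl_e j \<star> (cl_e i \<star> G w))" for w v
    have der: "(h has_derivative h' w) (at w)" if "norm w = 1" for w
    proof -
      have dF: "(F has_derivative frechet_derivative F (at w)) (at w)"
        using F that unfolding C1_sphere_def frechet_derivative_works[symmetric] by blast
      have dG: "(G has_derivative frechet_derivative G (at w)) (at w)"
        using G that unfolding C1_sphere_def frechet_derivative_works[symmetric] by blast
      have "((\<lambda>w. cl_e j \<star> (cl_e i \<star> G w)) has_derivative (\<lambda>v. cl_e j \<star> (cl_e i \<star> frechet_derivative G (at w) v))) (at w)"
        by (intro bounded_linear.has_derivative[OF cl_mult.bounded_linear_right] dG)
      from has_derivative_inner[OF dF this] show ?thesis
        unfolding h_def[abs_def] h'_def .
    qed
    have h'L: "h' w (rotg i j w) = inner (F w) (cl_e j \<star> (cl_e i \<star> L G i j w)) + inner (L F i j w) (cl_e j \<star> (cl_e i \<star> G w))"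
      if "norm w = 1" for w
      using F G that unfolding h'_def L_def by (simp add: C1_sphere_def derivative_rotg)
    have cL: "continuous_on (sphere 0 1) (\<lambda>w. inner (F w) (cl_e j \<star> (cl_e i \<star> L G i j w)) + inner (L F i j w) (cl_e j \<star> (cl_e i \<star> G w)))"
      by (intro continuous_intros c)
    then have "continuous_on (sphere 0 1) (\<lambda>w. h' w (rotg i j w))"
      by (rule continuous_on_eq) (simp add: h'L)
    then have "sint (\<lambda>w. h' w (rotg i j w)) = 0"
      by (rule sint_rotg[OF _ False, rotated]) (rule der)
    then have "sint (\<lambda>w. inner (F w) (cl_e j \<star> (cl_e i \<star> L G i j w)) + inner (L F i j w) (cl_e j \<star> (cl_e i \<star> G w))) = 0"
      using sint_cong[of "\<lambda>w. h' w (rotg i j w)", OF h'L] by simp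
    then have "sint (\<lambda>w. inner (F w) (cl_e j \<star> (cl_e i \<star> L G i j w))) + sint (\<lambda>w. inner (L F i j w) (cl_e j \<star> (cl_e i \<star> G w))) = 0"
      by (subst (asm) sint_add) (intro continuous_intros c)+
    moreover have "inner (F w) (cl_e j \<star> (cl_e i \<star> L G i j w)) = - inner (F w) (cl_e i \<star> (cl_e j \<star> L G i j w))" for w
      using cl_e_anticommute[of i j "L G i j w"] False by (simp add: add_eq_0_iff)
    moreover have "inner (L F i j w) (cl_e j \<star> (cl_e i \<star> G w)) = inner (cl_e i \<star> (cl_e j \<star> L F i j w)) (G w)" for w
      by (simp add: inner_cl_e_mult)
    ultimately show ?thesis by (simp add: sint_minus)
  qed
  have eF: "inner (gam F w) (G w) = (- 1/2) * (\<Sum>i\<in>UNIV. \<Sum>j\<in>UNIV. inner (cl_e i \<star> (cl_e j \<star> L F i j w)) (G w))" for w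
    unfolding gam_eq_rotations L_def by (simp add: inner_sum_left)
  have eG: "inner (F w) (gam G w) = (- 1/2) * (\<Sum>i\<in>UNIV. \<Sum>j\<in>UNIV. inner (F w) (cl_e i \<star> (cl_e j \<star> L G i j w)))" for w
    unfolding gam_eq_rotations L_def by (simp add: inner_sum_right)
  have "sint (\<lambda>w. inner (gam F w) (G w))
      = (- 1/2) * (\<Sum>i\<in>UNIV. \<Sum>j\<in>UNIV. sint (\<lambda>w. inner (cl_e i \<star> (cl_e j \<star> L F i j w)) (G w)))"
    unfolding eF sint_cmult
    by (subst sint_sum, intro continuous_intros c, subst sint_sum, intro continuous_intros c, rule refl)
  also have "\<dots> = sint (\<lambda>w. inner (F w) (gam G w))"
    unfolding ij eG sint_cmult
    by (subst sint_sum, intro continuous_intros c, subst sint_sum, intro continuous_intros c, rule refl)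
  finally show ?thesis .
qed

text \<open>On the sphere this is omega^k P up to the sign in \<open>cact_sph\<close>. Dropping the
  sign, and multiplying by the variable instead of omega, leaves a polynomial on the whole space
  which is homogeneous of even degree.\<close>

definition sph :: "nat \<Rightarrow> (real ^ 'n::{finite,linorder} \<Rightarrow> 'n clif) \<Rightarrow> (real, 'n) vec \<Rightarrow> 'n clif" where
  "sph k P = (if even k then P else vmul P)"

definition lam :: "nat \<Rightarrow> nat \<Rightarrow> real" where
  "lam n k = (if even k then - real k else real n + real k - 1)"

lemma cact_sph:
  assumes "norm w = 1"
  shows "cact w (\<i> ^ k) (P w) = (-1) ^ (k div 2) *\<^sub>R sph k P w"
proof (cases "even k")
  case True
  then have "\<i> ^ k = of_real ((-1) ^ (k div 2))" by (elim evenE) (simp add: power_mult)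
  then show ?thesis using True unfolding sph_def by (simp only: cact_simps if_True)
next
  case False
  then have "\<i> ^ k = of_real ((-1) ^ (k div 2)) * \<i>" by (elim oddE) (simp add: power_mult power_add)
  then show ?thesis using False unfolding sph_def by (simp only: cact_mult[OF assms] cact_simps if_False vmul_def)
qed

lemma norm_sph: "norm w = 1 \<Longrightarrow> norm (sph k P w) = norm (P w)"
  by (simp add: sph_def vmul_def norm_cl_vec_mult)

lemma hom_poly_sph: "hom_poly k P \<Longrightarrow> hom_poly (if even k then k else Suc k) (sph k P)"
  by (auto simp: sph_def intro: hom_poly_vmul)

lemma continuous_on_sph: "hom_poly k P \<Longrightarrow> continuous_on S (sph k P)"
  using hom_poly_sph hom_poly_continuous_on by blast

lemma C1_sphere_sph: "hom_poly k P \<Longrightarrow> C1_sphere (sph k P)"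
  using hom_poly_sph C1_sphere_hom_poly by blast

lemma gam_sph:
  fixes P :: "real ^ 'n::{finite,linorder} \<Rightarrow> 'n clif"
  assumes "monogenic_hom k P"
  shows "gam (sph k P) x = lam CARD('n) k *\<^sub>R sph k P x"
proof -
  have P: "hom_poly k P" "dirac P x = 0" using assms by (auto simp: monogenic_hom_iff)
  show ?thesis
  proof (cases "even k")
    case True
    then show ?thesis
      using P hom_poly_euler[OF P(1), of x] by (simp add: gam_def sph_def lam_def euler_def cl_mult.zero_right)
  next
    case False
    have "dirac (vmul P) x = - ((real CARD('n) + 2 * real k) *\<^sub>R P x)"
      using dirac_vmul_funpow[OF assms, of 0 x] by (simp add: scaleR_left_diff_distrib scaleR_add_left)
    moreover have "euler (vmul P) x = real (Suc k) *\<^sub>R vmul P x"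
      using hom_poly_euler[OF hom_poly_vmul[OF P(1)], of x] by (simp add: euler_def)
    ultimately have "gam (vmul P) x = (real CARD('n) + 2 * real k) *\<^sub>R vmul P x - real (Suc k) *\<^sub>R vmul P x"
      by (simp add: gam_def cl_mult.minus_right cl_mult.scaleR_right vmul_def)
    also have "\<dots> = (real CARD('n) + 2 * real k - real (Suc k)) *\<^sub>R vmul P x"
      by (simp only: scaleR_left_diff_distrib)
    finally show ?thesis using False by (simp add: sph_def lam_def algebra_simps)
  qed
qed

text \<open>Even indices give values at most 0 and odd indices values at least n, so the two
  branches do not meet.\<close>

lemma lam_inj: "0 < n \<Longrightarrow> lam n k = lam n l \<Longrightarrow> k = l"
  by (auto simp: lam_def split: if_splits)

lemma abs_lam_ge: "0 < n \<Longrightarrow> real k \<le> \<bar>lam n k\<bar>"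
  by (auto simp: lam_def)

lemma sph_orthogonal:
  fixes P Q :: "real ^ 'n::{finite,linorder} \<Rightarrow> 'n clif"
  assumes P: "monogenic_hom k P" and Q: "monogenic_hom l Q" and "k \<noteq> l"
  shows "sint (\<lambda>w. inner (sph k P w) (sph l Q w)) = 0"
proof -
  have "hom_poly k P" "hom_poly l Q" using P Q by (auto simp: monogenic_hom_iff)
  from gam_symmetric[OF C1_sphere_sph[OF this(1)] C1_sphere_sph[OF this(2)]]
  have "lam CARD('n) k * sint (\<lambda>w. inner (sph k P w) (sph l Q w)) = lam CARD('n) l * sint (\<lambda>w. inner (sph k P w) (sph l Q w))"
    by (simp add: gam_sph[OF P] gam_sph[OF Q] sint_cmult)
  then show ?thesis using lam_inj[of "CARD('n)" k l] \<open>k \<noteq> l\<close> by auto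
qed

section \<open>Fourier coefficients\<close>

text \<open>Fourier coefficient with \<open>w\<close> as the imaginary unit; the weight acts from
  the left because the slice equation does.\<close>

definition fc :: "real ^ 'n::{finite,linorder} \<Rightarrow> int \<Rightarrow> (real \<Rightarrow> 'n clif) \<Rightarrow> 'n clif" where
  "fc w m T = (1 / (2 * pi)) *\<^sub>R integral {0..2 * pi} (\<lambda>\<theta>. cact w (cis (- (real_of_int m * \<theta>))) (T \<theta>))"

lemma continuous_on_cact [continuous_intros]:
  assumes "continuous_on S g" "continuous_on S f" "continuous_on S h"
  shows "continuous_on S (\<lambda>x. cact (h x) (g x) (f x))"
  unfolding cact_def using assms by (intro continuous_intros)

lemma fc_integrable:
  assumes "continuous_on {0..2 * pi} T"
  shows "(\<lambda>\<theta>. cact w (cis (- (real_of_int m * \<theta>))) (T \<theta>)) integrable_on {0..2 * pi}"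
  using assms unfolding cis_conv_exp
  by (intro integrable_continuous_real continuous_intros)

lemma fc_add:
  "continuous_on {0..2 * pi} T \<Longrightarrow> continuous_on {0..2 * pi} U \<Longrightarrow> fc w m (\<lambda>\<theta>. T \<theta> + U \<theta>) = fc w m T + fc w m U"
  unfolding fc_def by (simp add: cact_simps integral_add fc_integrable scaleR_add_right)

lemma fc_diff:
  "continuous_on {0..2 * pi} T \<Longrightarrow> continuous_on {0..2 * pi} U \<Longrightarrow> fc w m (\<lambda>\<theta>. T \<theta> - U \<theta>) = fc w m T - fc w m U"
  unfolding fc_def by (simp add: cact_simps integral_diff fc_integrable scaleR_diff_right)

lemma fc_scaleR: "fc w m (\<lambda>\<theta>. c *\<^sub>R T \<theta>) = c *\<^sub>R fc w m T"
  unfolding fc_def by (simp add: cact_simps)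

lemma norm_fc_le:
  assumes "continuous_on {0..2 * pi} T" "\<And>\<theta>. \<theta> \<in> {0..2 * pi} \<Longrightarrow> norm (T \<theta>) \<le> M" "norm w = 1"
  shows "norm (fc w m T) \<le> M"
proof -
  have "norm (integral {0..2 * pi} (\<lambda>\<theta>. cact w (cis (- (real_of_int m * \<theta>))) (T \<theta>))) \<le> M * (2 * pi - 0)"
    using assms unfolding cis_conv_exp[abs_def]
    by (intro integral_bound continuous_intros) (auto simp: norm_cact)
  then show ?thesis by (simp add: fc_def field_simps)
qed

lemma integral_cis:
  assumes "norm w = 1"
  shows "integral {0..2 * pi} (\<lambda>\<theta>. cact w (cis (real_of_int m * \<theta>)) x) = (if m = 0 then (2 * pi) *\<^sub>R x else 0)"
proof (cases "m = 0")
  case False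
  let ?G = "\<lambda>\<theta>. cact w (cis (real_of_int m * \<theta>) / (\<i> * of_int m)) x"
  have "((\<lambda>\<theta>. cact w (cis (real_of_int m * \<theta>)) x) has_integral (?G (2 * pi) - ?G 0)) {0..2 * pi}"
  proof (rule fundamental_theorem_of_calculus)
    fix \<theta> :: real
    have "((\<lambda>\<theta>. cis (real_of_int m * \<theta>) / (\<i> * of_int m)) has_vector_derivative cis (real_of_int m * \<theta>)) (at \<theta> within {0..2 * pi})"
    proof -
      have "((\<lambda>z. exp (\<i> * of_int m * z) / (\<i> * of_int m)) has_field_derivative exp (\<i> * of_int m * of_real \<theta>)) (at (of_real \<theta>))"
        using False by (auto intro!: derivative_eq_intros)
      from has_vector_derivative_real_field[OF this] show ?thesis
        by (simp add: cis_conv_exp mult_ac)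
    qed
    from bounded_linear.has_vector_derivative[OF bounded_bilinear.bounded_linear_left[OF bounded_bilinear_cact] this]
    show "(?G has_vector_derivative cact w (cis (real_of_int m * \<theta>)) x) (at \<theta> within {0..2 * pi})" .
  qed simp
  moreover have "?G (2 * pi) = ?G 0"
    using cis_multiple_2pi[of "real_of_int m"] by (simp add: mult.commute mult.left_commute)
  ultimately show ?thesis using False by (simp add: integral_unique)
qed (simp add: cact_simps)

lemma fc_cis:
  assumes "norm w = 1"
  shows "fc w m (\<lambda>\<theta>. cact w (cis (real_of_int l * \<theta>)) x) = (if m = l then x else 0)"
proof -
  have "cact w (cis (- (real_of_int m * \<theta>))) (cact w (cis (real_of_int l * \<theta>)) x) = cact w (cis (real_of_int (l - m) * \<theta>)) x" for \<theta>
    by (simp add: cact_mult[OF assms, symmetric] cis_mult algebra_simps)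
  then show ?thesis unfolding fc_def by (simp only: integral_cis[OF assms]) simp
qed

lemma fc_sum:
  assumes "\<And>i. i \<in> A \<Longrightarrow> continuous_on {0..2 * pi} (T i)"
  shows "fc w m (\<lambda>\<theta>. \<Sum>i\<in>A. T i \<theta>) = (\<Sum>i\<in>A. fc w m (T i))"
  using assms
proof (induction A rule: infinite_finite_induct)
  case (insert i A)
  then show ?case by (simp add: fc_add continuous_on_sum)
qed (simp_all add: fc_def cact_simps)

section \<open>Bounds for homogeneous polynomials on the sphere\<close>

text \<open>Phrased as being reproduced by the own truncated Fourier series, not as existence of
  some coefficients: the coefficients are then integrals of \<open>T\<close> and hence bounded by
  its supremum. The vector \<open>w\<close> supplies the imaginary unit.\<close>

definition trig_poly :: "real ^ 'n::{finite,linorder} \<Rightarrow> nat \<Rightarrow> (real \<Rightarrow> 'n clif) \<Rightarrow> bool" where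
  "trig_poly w k T \<longleftrightarrow> continuous_on UNIV T \<and>
     (\<forall>\<theta>. T \<theta> = (\<Sum>m\<in>{- int k..int k}. cact w (cis (real_of_int m * \<theta>)) (fc w m T)))"

lemma continuous_on_cact_cis: "continuous_on S (\<lambda>\<theta>. cact w (cis (real_of_int m * \<theta>)) x)"
  unfolding cis_conv_exp by (intro continuous_intros)

lemma trig_poly_cis:
  assumes "norm w = 1" "\<bar>l\<bar> \<le> int k"
  shows "trig_poly w k (\<lambda>\<theta>. cact w (cis (real_of_int l * \<theta>)) x)"
  unfolding trig_poly_def
proof (intro conjI allI continuous_on_cact_cis)
  fix \<theta>
  have "(\<Sum>m\<in>{- int k..int k}. cact w (cis (real_of_int m * \<theta>)) (fc w m (\<lambda>\<theta>. cact w (cis (real_of_int l * \<theta>)) x)))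
      = (\<Sum>m\<in>{- int k..int k}. if m = l then cact w (cis (real_of_int l * \<theta>)) x else 0)"
    by (intro sum.cong refl) (simp add: fc_cis[OF assms(1)] cact_simps)
  also have "\<dots> = cact w (cis (real_of_int l * \<theta>)) x"
    using assms(2) by (simp add: abs_le_iff)
  finally show "cact w (cis (real_of_int l * \<theta>)) x = (\<Sum>m\<in>{- int k..int k}. cact w (cis (real_of_int m * \<theta>))
      (fc w m (\<lambda>\<theta>. cact w (cis (real_of_int l * \<theta>)) x)))" by simp
qed

lemma cact_sum_right: "cact w z (\<Sum>i\<in>A. f i) = (\<Sum>i\<in>A. cact w z (f i))"
  by (induction A rule: infinite_finite_induct) (simp_all add: cact_simps)

lemma trig_poly_sum:
  assumes "\<And>i. i \<in> A \<Longrightarrow> trig_poly w k (T i)"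
  shows "trig_poly w k (\<lambda>\<theta>. \<Sum>i\<in>A. T i \<theta>)"
  unfolding trig_poly_def
proof (intro conjI allI)
  have c: "continuous_on S (T i)" if "i \<in> A" for i S
    using assms[OF that] continuous_on_subset unfolding trig_poly_def by blast
  then show "continuous_on UNIV (\<lambda>\<theta>. \<Sum>i\<in>A. T i \<theta>)" by (intro continuous_on_sum)
  fix \<theta>
  have "(\<Sum>i\<in>A. T i \<theta>) = (\<Sum>i\<in>A. \<Sum>m\<in>{- int k..int k}. cact w (cis (real_of_int m * \<theta>)) (fc w m (T i)))"
    using assms unfolding trig_poly_def by (intro sum.cong refl) blast
  also have "\<dots> = (\<Sum>m\<in>{- int k..int k}. \<Sum>i\<in>A. cact w (cis (real_of_int m * \<theta>)) (fc w m (T i)))"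
    by (rule sum.swap)
  also have "\<dots> = (\<Sum>m\<in>{- int k..int k}. cact w (cis (real_of_int m * \<theta>)) (fc w m (\<lambda>\<theta>. \<Sum>i\<in>A. T i \<theta>)))"
    using c by (simp add: fc_sum cact_sum_right)
  finally show "(\<Sum>i\<in>A. T i \<theta>) = (\<Sum>m\<in>{- int k..int k}. cact w (cis (real_of_int m * \<theta>)) (fc w m (\<lambda>\<theta>. \<Sum>i\<in>A. T i \<theta>)))" .
qed

lemma trig_poly_add:
  assumes "trig_poly w k T" "trig_poly w k U"
  shows "trig_poly w k (\<lambda>\<theta>. T \<theta> + U \<theta>)"
  using trig_poly_sum[of "UNIV :: bool set" w k "\<lambda>b. if b then T else U"] assms by (simp add: UNIV_bool add.commute)

lemma trig_poly_mult_trig: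
  assumes w: "norm w = 1" and T: "trig_poly w k T"
  shows "trig_poly w (Suc k) (\<lambda>\<theta>. (a * cos \<theta> + b * sin \<theta>) *\<^sub>R T \<theta>)"
proof -
  \<comment> \<open>The Fourier coefficients of \<open>a * cos + b * sin\<close> at the frequencies
    1 and -1, which shift an index up or down by one.\<close>
  define \<alpha> \<beta> where "\<alpha> = Complex (a / 2) (- b / 2)" and "\<beta> = Complex (a / 2) (b / 2)"
  have key: "of_real (a * cos \<theta> + b * sin \<theta>) * cis (real_of_int m * \<theta>)
      = cis (real_of_int (m + 1) * \<theta>) * \<alpha> + cis (real_of_int (m - 1) * \<theta>) * \<beta>" for \<theta> m
  proof -
    have "cis (real_of_int (m + 1) * \<theta>) = cis (real_of_int m * \<theta>) * cis \<theta>"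
      "cis (real_of_int (m - 1) * \<theta>) = cis (real_of_int m * \<theta>) * cis (- \<theta>)"
      by (simp_all add: cis_mult algebra_simps)
    moreover have "of_real (a * cos \<theta> + b * sin \<theta>) = cis \<theta> * \<alpha> + cis (- \<theta>) * \<beta>"
      by (simp add: \<alpha>_def \<beta>_def complex_eq_iff)
    ultimately show ?thesis by (simp only: algebra_simps)
  qed
  have "(\<lambda>\<theta>. (a * cos \<theta> + b * sin \<theta>) *\<^sub>R T \<theta>) = (\<lambda>\<theta>. \<Sum>m\<in>{- int k..int k}.
      cact w (cis (real_of_int (m + 1) * \<theta>)) (cact w \<alpha> (fc w m T)) + cact w (cis (real_of_int (m - 1) * \<theta>)) (cact w \<beta> (fc w m T)))"
  proof
    fix \<theta>
    have "(a * cos \<theta> + b * sin \<theta>) *\<^sub>R T \<theta> = (\<Sum>m\<in>{- int k..int k}.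
        (a * cos \<theta> + b * sin \<theta>) *\<^sub>R cact w (cis (real_of_int m * \<theta>)) (fc w m T))"
      using T unfolding trig_poly_def by (metis (no_types, lifting) scaleR_sum_right sum.cong)
    also have "\<dots> = (\<Sum>m\<in>{- int k..int k}. cact w (of_real (a * cos \<theta> + b * sin \<theta>) * cis (real_of_int m * \<theta>)) (fc w m T))"
      by (simp only: cact_mult[OF w] cact_simps)
    finally show "(a * cos \<theta> + b * sin \<theta>) *\<^sub>R T \<theta> = (\<Sum>m\<in>{- int k..int k}.
      cact w (cis (real_of_int (m + 1) * \<theta>)) (cact w \<alpha> (fc w m T)) + cact w (cis (real_of_int (m - 1) * \<theta>)) (cact w \<beta> (fc w m T)))"
      unfolding key by (simp only: cact_mult[OF w] cact_simps)
  qed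
  moreover have "trig_poly w (Suc k) \<dots>"
    by (intro trig_poly_sum trig_poly_add trig_poly_cis w) auto
  ultimately show ?thesis by simp
qed

lemma trig_poly_hom_poly:
  assumes "hom_poly k P" "norm w = 1"
  shows "trig_poly w k (\<lambda>\<theta>. P (cos \<theta> *\<^sub>R u + sin \<theta> *\<^sub>R v))"
  using assms(1)
proof (induction rule: hom_poly_induct)
  case (const c)
  then show ?case using trig_poly_cis[OF assms(2), of 0 0 c] by (simp add: cact_simps)
next
  case (add k P Q)
  then show ?case by (intro trig_poly_add)
next
  case (coord k i P)
  from trig_poly_mult_trig[OF assms(2) coord(2), of "u $ i" "v $ i"] show ?case
    by (simp add: mult.commute)
qed

text \<open>There are 2k + 1 frequencies of modulus at most k, with coefficients bounded by
  \<open>M\<close>. The loss against the sharp Bernstein inequality is harmless, as only polynomial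
  growth in k matters.\<close>

lemma trig_poly_derivative_bound:
  assumes T: "trig_poly w k T" and w: "norm w = 1" and M: "\<And>\<theta>. norm (T \<theta>) \<le> M"
    and D: "(T has_vector_derivative D) (at 0)"
  shows "norm D \<le> real (2 * k + 1) * real k * M"
proof -
  let ?I = "{- int k..int k}"
  have Teq: "T = (\<lambda>\<theta>. \<Sum>m\<in>?I. cact w (cis (real_of_int m * \<theta>)) (fc w m T))"
    using T unfolding trig_poly_def by blast
  have "((\<lambda>\<theta>. \<Sum>m\<in>?I. cact w (cis (real_of_int m * \<theta>)) (fc w m T)) has_vector_derivative
      (\<Sum>m\<in>?I. cact w (\<i> * of_int m) (fc w m T))) (at 0)"
  proof (intro has_vector_derivative_sum)
    fix m
    have "((\<lambda>z. exp (\<i> * of_int m * z)) has_field_derivative \<i> * of_int m) (at (of_real 0))"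
      by (auto intro!: derivative_eq_intros)
    from has_vector_derivative_real_field[OF this]
    have "((\<lambda>\<theta>. cis (real_of_int m * \<theta>)) has_vector_derivative \<i> * of_int m) (at 0)"
      by (simp add: cis_conv_exp mult_ac)
    from bounded_linear.has_vector_derivative[OF bounded_bilinear.bounded_linear_left[OF bounded_bilinear_cact] this]
    show "((\<lambda>\<theta>. cact w (cis (real_of_int m * \<theta>)) (fc w m T)) has_vector_derivative cact w (\<i> * of_int m) (fc w m T)) (at 0)" .
  qed
  then have "D = (\<Sum>m\<in>?I. cact w (\<i> * of_int m) (fc w m T))"
    using D Teq vector_derivative_unique_at by metis
  also have "norm \<dots> \<le> (\<Sum>m\<in>?I. real k * M)"
  proof (rule sum_norm_le)
    fix m assume m: "m \<in> ?I"
    have "norm (fc w m T) \<le> M"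
      using T w M unfolding trig_poly_def by (intro norm_fc_le) (auto intro: continuous_on_subset)
    moreover have "\<bar>real_of_int m\<bar> \<le> real k" using m by auto
    ultimately show "norm (cact w (\<i> * of_int m) (fc w m T)) \<le> real k * M"
      by (simp add: norm_cact[OF w] norm_mult mult_mono)
  qed
  also have "\<dots> = real (2 * k + 1) * real k * M" by simp
  finally show ?thesis .
qed

text \<open>A weak Markov--Bernstein inequality: tangential derivatives are derivatives of trigonometric
  polynomials along great circles, whose coefficients are bounded by the supremum; the radial
  derivative is given by Euler's identity.\<close>

lemma markov_sphere:
  fixes P :: "real ^ 'n::{finite,linorder} \<Rightarrow> 'n clif"
  assumes P: "hom_poly k P" and M: "\<And>y. norm y = 1 \<Longrightarrow> norm (P y) \<le> M" and w: "norm w = 1"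
  shows "norm (pdiff P i w) \<le> 2 * (real k + 1)\<^sup>2 * M"
proof -
  let ?D = "frechet_derivative P (at w)"
  have D: "(P has_derivative ?D) (at w)"
    using hom_poly_differentiable[OF P] frechet_derivative_works by blast
  have lin: "linear ?D" using hom_poly_differentiable[OF P] by (rule linear_frechet_derivative)
  have M0: "0 \<le> M" using M[OF w] norm_ge_zero order_trans by blast
  have tang: "norm (?D v) \<le> real (2 * k + 1) * real k * M" if v: "norm v = 1" "inner w v = 0" for v
  proof (rule trig_poly_derivative_bound[OF trig_poly_hom_poly[OF P w, of w v] w])
    fix \<theta>
    have "inner (cos \<theta> *\<^sub>R w + sin \<theta> *\<^sub>R v) (cos \<theta> *\<^sub>R w + sin \<theta> *\<^sub>R v) = (cos \<theta>)\<^sup>2 * inner w w + (sin \<theta>)\<^sup>2 * inner v v"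
      using v by (simp add: inner_add_left inner_add_right inner_commute power2_eq_square)
    also have "\<dots> = 1" using w v by (simp add: norm_eq_1)
    finally show "norm (P (cos \<theta> *\<^sub>R w + sin \<theta> *\<^sub>R v)) \<le> M" by (intro M) (simp add: norm_eq_1)
  next
    have "((\<lambda>\<theta>. cos \<theta> *\<^sub>R w + sin \<theta> *\<^sub>R v) has_vector_derivative v) (at 0)"
      by (auto intro!: derivative_eq_intros)
    from vector_derivative_diff_chain_within[OF this, of P ?D] D
    show "((\<lambda>\<theta>. P (cos \<theta> *\<^sub>R w + sin \<theta> *\<^sub>R v)) has_vector_derivative ?D v) (at 0)"
      by (simp add: o_def has_derivative_at_withinI)
  qed
  \<comment> \<open>The axis vector is split into its component along \<open>w\<close> and a
    tangential remainder \<open>u\<close> of length at most 1.\<close>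
  define e where "e = (axis i 1 :: (real, 'n) vec)"
  define c where "c = inner e w"
  define u where "u = e - c *\<^sub>R w"
  have ww: "inner w w = 1" using w by (simp add: norm_eq_1)
  have uw: "inner w u = 0" by (simp add: u_def c_def inner_diff_right ww inner_commute)
  have ne: "norm e = 1" by (simp add: e_def)
  have c1: "\<bar>c\<bar> \<le> 1" using Cauchy_Schwarz_ineq2[of e w] w ne by (simp add: c_def)
  have "norm u ^ 2 = inner e e - c\<^sup>2"
    unfolding power2_norm_eq_inner by (simp add: u_def c_def inner_diff_left inner_diff_right ww inner_commute power2_eq_square)
  then have "norm u ^ 2 \<le> 1\<^sup>2" using ne by (simp add: norm_eq_1)
  then have u1: "norm u \<le> 1" by (rule power2_le_imp_le) simp
  have Du: "norm (?D u) \<le> real (2 * k + 1) * real k * M"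
  proof (cases "u = 0")
    case True
    then show ?thesis using M0 linear_0[OF lin] by simp
  next
    case False
    have "norm (?D ((1 / norm u) *\<^sub>R u)) \<le> real (2 * k + 1) * real k * M"
      using False uw by (intro tang) auto
    then have "norm (?D u) \<le> norm u * (real (2 * k + 1) * real k * M)"
      using False by (simp add: linear_scale[OF lin] field_simps)
    also have "\<dots> \<le> 1 * (real (2 * k + 1) * real k * M)"
      using M0 u1 by (intro mult_right_mono) auto
    finally show ?thesis by simp
  qed
  have Dw: "norm (?D w) \<le> real k * M"
  proof -
    have "?D w = ?D (\<Sum>i\<in>UNIV. w $ i *\<^sub>R axis i 1)"
      using basis_expansion[of w] by (simp add: scalar_mult_eq_scaleR)
    also have "\<dots> = real k *\<^sub>R P w"
      using hom_poly_euler[OF P, of w] by (simp add: linear_sum[OF lin] linear_scale[OF lin] pdiff_def)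
    finally show ?thesis using M[OF w] by (simp add: mult_left_mono)
  qed
  have "pdiff P i w = ?D (u + c *\<^sub>R w)" by (simp add: pdiff_def u_def e_def)
  also have "\<dots> = ?D u + c *\<^sub>R ?D w" by (simp add: linear_add[OF lin] linear_scale[OF lin])
  also have "norm \<dots> \<le> norm (?D u) + \<bar>c\<bar> * norm (?D w)"
    using norm_triangle_ineq[of "?D u" "c *\<^sub>R ?D w"] by simp
  also have "\<dots> \<le> real (2 * k + 1) * real k * M + 1 * (real k * M)"
    using Du Dw c1 by (intro add_mono mult_mono) auto
  also have "\<dots> = (2 * (real k)\<^sup>2 + 2 * real k) * M" by (simp add: power2_eq_square algebra_simps)
  also have "\<dots> \<le> 2 * (real k + 1)\<^sup>2 * M"
    using M0 by (intro mult_right_mono) (simp_all add: power2_eq_square algebra_simps)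
  finally show ?thesis .
qed

text \<open>Carries bounds from the sphere into the ball, in particular the Markov bound for the
  partial derivatives.\<close>

lemma hom_poly_norm_le:
  assumes P: "hom_poly k P" and M: "\<And>y. norm y = 1 \<Longrightarrow> norm (P y) \<le> M" and x: "norm x \<le> 1"
  shows "norm (P x) \<le> M"
proof -
  obtain y :: "(real, 'a) vec" where y: "norm y = 1" using vector_choose_size[of 1] by auto
  define z where "z = (if x = 0 then y else (1 / norm x) *\<^sub>R x)"
  have z: "norm z = 1" "x = norm x *\<^sub>R z" using y by (auto simp: z_def)
  have "norm (P x) = norm x ^ k * norm (P z)"
    by (subst z(2)) (simp add: hom_poly_scale_arg[OF P])
  also have "\<dots> \<le> 1 * M"
    using x M[OF z(1)] by (intro mult_mono) (auto simp: power_le_one)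
  finally show ?thesis by simp
qed

text \<open>The mean value inequality on the convex ball; the gradient is controlled inside because
  the partial derivatives are again homogeneous.\<close>

lemma hom_poly_lipschitz:
  fixes P :: "real ^ 'n::{finite,linorder} \<Rightarrow> 'n clif"
  assumes P: "hom_poly k P" and M: "\<And>y. norm y = 1 \<Longrightarrow> norm (P y) \<le> M" and x: "norm x \<le> 1" "norm y \<le> 1"
  shows "norm (P x - P y) \<le> real CARD('n) * (2 * (real k + 1)\<^sup>2 * M) * norm (x - y)"
proof (rule differentiable_bound)
  show "convex (cball (0::(real, 'n) vec) 1)" by simp
  fix z :: "(real, 'n) vec" assume z: "z \<in> cball 0 1"
  let ?D = "frechet_derivative P (at z)"
  show "(P has_derivative ?D) (at z within cball 0 1)"
    using hom_poly_differentiable[OF P] frechet_derivative_works has_derivative_at_withinI by blast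
  have lin: "linear ?D" using hom_poly_differentiable[OF P] by (rule linear_frechet_derivative)
  have M0: "0 \<le> M"
  proof -
    obtain y :: "(real, 'n) vec" where "norm y = 1" using vector_choose_size[of 1] by auto
    from M[OF this] show ?thesis using norm_ge_zero order_trans by blast
  qed
  have pd: "norm (pdiff P i z) \<le> 2 * (real k + 1)\<^sup>2 * M" for i
  proof (cases k)
    case 0
    then show ?thesis using P M0 by (simp add: hom_poly_0_pdiff)
  next
    case (Suc l)
    show ?thesis
    proof (rule hom_poly_norm_le[of l "pdiff P i"])
      show "hom_poly l (pdiff P i)" using P Suc by (auto intro: hom_poly_pdiff)
      show "norm (pdiff P i y) \<le> 2 * (real k + 1)\<^sup>2 * M" if "norm y = 1" for y
        using markov_sphere[OF P M that] .
    qed (use z in simp)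
  qed
  show "onorm ?D \<le> real CARD('n) * (2 * (real k + 1)\<^sup>2 * M)"
  proof (rule onorm_bound)
    fix v :: "(real, 'n) vec"
    have "?D v = ?D (\<Sum>i\<in>UNIV. v $ i *\<^sub>R axis i 1)"
      using basis_expansion[of v] by (simp add: scalar_mult_eq_scaleR)
    also have "\<dots> = (\<Sum>i\<in>UNIV. v $ i *\<^sub>R pdiff P i z)"
      by (simp add: linear_sum[OF lin] linear_scale[OF lin] pdiff_def)
    also have "norm \<dots> \<le> (\<Sum>i\<in>(UNIV::'n set). norm v * (2 * (real k + 1)\<^sup>2 * M))"
      by (intro sum_norm_le) (auto intro!: mult_mono pd component_le_norm_cart)
    also have "\<dots> = real CARD('n) * (2 * (real k + 1)\<^sup>2 * M) * norm v" by simp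
    finally show "norm (?D v) \<le> real CARD('n) * (2 * (real k + 1)\<^sup>2 * M) * norm v" .
  qed (use M0 in simp)
qed (use x in auto)

lemma sup_norm_S_attained:
  fixes g :: "real ^ 'n::{finite,linorder} \<Rightarrow> 'n clif"
  assumes "continuous_on (sphere 0 1) g"
  obtains w where "norm w = 1" "sup_norm_S g = norm (g w)" "\<And>y. norm y = 1 \<Longrightarrow> norm (g y) \<le> norm (g w)"
proof -
  have "sphere (0::(real, 'n) vec) 1 \<noteq> {}" using vector_choose_size[of 1] by auto
  moreover have "continuous_on (sphere 0 1) (\<lambda>w. norm (g w))" using assms by (intro continuous_intros)
  ultimately obtain w where w: "w \<in> sphere 0 1" "\<forall>y\<in>sphere 0 1. norm (g y) \<le> norm (g w)"
    using continuous_attains_sup[OF compact_sphere] by blast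
  have "sup_norm_S g = norm (g w)"
    unfolding sup_norm_S_def using w by (intro cSup_eq_maximum) auto
  with w show ?thesis by (intro that) auto
qed

lemma sup_norm_S_ge:
  assumes "continuous_on (sphere 0 1) g" "norm w = 1"
  shows "norm (g w) \<le> sup_norm_S g"
  using sup_norm_S_attained[OF assms(1)] assms(2) by metis

lemma L2_le_sup_norm:
  fixes g :: "real ^ 'n::{finite,linorder} \<Rightarrow> 'n clif"
  assumes "continuous_on UNIV g"
  shows "L2_norm_S g \<le> sup_norm_S g"
proof -
  have c: "continuous_on (sphere 0 1) g" using assms continuous_on_subset by blast
  obtain w where w: "norm w = 1" "sup_norm_S g = norm (g w)" using sup_norm_S_attained[OF c] by blast
  have "sint (\<lambda>w. (norm (g w))\<^sup>2) \<le> (sup_norm_S g)\<^sup>2"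
    using sint_abs_le[of "\<lambda>w. (norm (g w))\<^sup>2" "(sup_norm_S g)\<^sup>2"] c sup_norm_S_ge[OF c]
    by (fastforce intro!: continuous_intros power_mono)
  then show ?thesis unfolding L2_norm_S_eq[OF assms] by (intro real_le_lsqrt) (auto simp: w(2))
qed

text \<open>By the Lipschitz bound the polynomial stays above half its maximum on a cap of radius of
  order (k + 1)^(-2), whose measure is only polynomially small in k. So the two norms are equivalent
  up to a power of k + 1.\<close>

lemma sup_le_L2_norm:
  fixes P :: "real ^ 'n::{finite,linorder} \<Rightarrow> 'n clif"
  assumes P: "hom_poly k P"
  shows "sup_norm_S P \<le> 2 * (16 * real CARD('n)) ^ CARD('n) * (real k + 1) ^ CARD('n) * L2_norm_S P"
proof -
  let ?n = "CARD('n)"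
  have c: "continuous_on S P" for S using P by (rule hom_poly_continuous_on)
  obtain w where w: "norm w = 1" "sup_norm_S P = norm (P w)" "\<And>y. norm y = 1 \<Longrightarrow> norm (P y) \<le> norm (P w)"
    using sup_norm_S_attained[OF c] by blast
  define M where "M = norm (P w)"
  \<comment> \<open>Chosen so that the Lipschitz bound over the cap, 2 n (k + 1)^2 M d, equals
    M/2.\<close>
  define d where "d = 1 / (4 * real ?n * (real k + 1)\<^sup>2)"
  have n1: "real ?n \<ge> 1" by (simp add: Suc_leI)
  have k1: "(real k + 1)\<^sup>2 \<ge> 1" by simp
  have nk: "1 \<le> real ?n * (real k + 1)\<^sup>2" using mult_mono[OF n1 k1] by simp
  have d: "0 < d" "d \<le> 1" using nk by (auto simp: d_def)
  have low: "(M / 2)\<^sup>2 \<le> (norm (P y))\<^sup>2" if y: "norm y = 1" "dist w y < d" for y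
  proof -
    have "norm (P w - P y) \<le> real ?n * (2 * (real k + 1)\<^sup>2 * M) * norm (w - y)"
      using w y unfolding M_def by (intro hom_poly_lipschitz[OF P]) auto
    also have "\<dots> \<le> real ?n * (2 * (real k + 1)\<^sup>2 * M) * d"
      using y by (intro mult_left_mono) (auto simp: dist_norm M_def)
    also have "\<dots> = M / 2" using nk by (simp add: d_def field_simps)
    finally have "M / 2 \<le> norm (P y)"
      using norm_triangle_ineq2[of "P w" "P y"] by (simp add: M_def)
    then show ?thesis by (intro power_mono) (auto simp: M_def)
  qed
  have L: "(L2_norm_S P)\<^sup>2 = sint (\<lambda>w. (norm (P w))\<^sup>2)"
    unfolding L2_norm_S_eq[OF c] by (intro real_sqrt_pow2 sint_nonneg) simp
  define X where "X = 16 * real ?n * (real k + 1)\<^sup>2"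
  have X: "0 < X" "d / 4 = 1 / X" using nk by (auto simp: X_def d_def)
  have "(M / 2)\<^sup>2 * (d / 4) ^ DIM((real, 'n) vec) \<le> sint (\<lambda>w. (norm (P w))\<^sup>2)"
    using c low d by (intro sint_lower_bound[OF _ _ w(1)] continuous_intros) auto
  then have "M\<^sup>2 \<le> 4 * (L2_norm_S P)\<^sup>2 * (16 * real ?n * (real k + 1)\<^sup>2) ^ ?n"
    using zero_less_power[OF X(1), of ?n] unfolding L X(2) X_def[symmetric]
    by (simp add: power_one_over power_divide pos_divide_le_eq mult_ac)
  also have "\<dots> = 4 * (L2_norm_S P)\<^sup>2 * ((real k + 1) ^ ?n)\<^sup>2 * (16 * real ?n) ^ ?n"
    by (simp add: power_mult_distrib power_mult[symmetric] mult.commute)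
  \<comment> \<open>Squaring the last factor, which is at least 1, makes the right-hand side a
    perfect square; this is why the statement has the full n-th power of 16 n instead of its
    root.\<close>
  also have "\<dots> \<le> 4 * (L2_norm_S P)\<^sup>2 * ((real k + 1) ^ ?n)\<^sup>2 * ((16 * real ?n) ^ ?n)\<^sup>2"
  proof (rule mult_left_mono)
    have "1 \<le> (16 * real ?n) ^ ?n" by (intro one_le_power) (use n1 in linarith)
    then show "(16 * real ?n) ^ ?n \<le> ((16 * real ?n) ^ ?n)\<^sup>2" by (simp add: power2_eq_square mult_le_cancel_left1)
  qed simp
  also have "\<dots> = (2 * (16 * real ?n) ^ ?n * (real k + 1) ^ ?n * L2_norm_S P)\<^sup>2"
    by (simp add: power_mult_distrib)
  finally show ?thesis
    unfolding w(2) M_def[symmetric]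
    by (rule power2_le_imp_le) (auto simp: L2_norm_S_eq[OF c] intro!: mult_nonneg_nonneg sint_nonneg)
qed

section \<open>Completeness of the spherical monogenics\<close>

definition sip :: "(real ^ 'n::{finite,linorder} \<Rightarrow> 'n clif) \<Rightarrow> ((real, 'n) vec \<Rightarrow> 'n clif) \<Rightarrow> real" where
  "sip f g = sint (\<lambda>w. inner (f w) (g w))"

lemma sip_cong: "(\<And>w. norm w = 1 \<Longrightarrow> f w = f' w) \<Longrightarrow> (\<And>w. norm w = 1 \<Longrightarrow> g w = g' w) \<Longrightarrow> sip f g = sip f' g'"
  unfolding sip_def by (rule sint_cong) simp

lemma sip_commute: "sip f g = sip g f"
  by (simp add: sip_def inner_commute)

lemma sip_scaleR_right: "sip f (\<lambda>w. c *\<^sub>R g w) = c * sip f g"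
  by (simp add: sip_def sint_cmult)

lemma sip_scaleR_left: "sip (\<lambda>w. c *\<^sub>R f w) g = c * sip f g"
  by (simp add: sip_def sint_cmult)

lemma sip_add_right:
  "continuous_on (sphere 0 1) f \<Longrightarrow> continuous_on (sphere 0 1) g \<Longrightarrow> continuous_on (sphere 0 1) h
    \<Longrightarrow> sip f (\<lambda>w. g w + h w) = sip f g + sip f h"
  unfolding sip_def inner_add_right by (intro sint_add continuous_intros)

lemma sip_diff_right:
  "continuous_on (sphere 0 1) f \<Longrightarrow> continuous_on (sphere 0 1) g \<Longrightarrow> continuous_on (sphere 0 1) h
    \<Longrightarrow> sip f (\<lambda>w. g w - h w) = sip f g - sip f h"
  unfolding sip_def inner_diff_right by (intro sint_diff continuous_intros)

lemma sip_diff_left: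
  "continuous_on (sphere 0 1) f \<Longrightarrow> continuous_on (sphere 0 1) g \<Longrightarrow> continuous_on (sphere 0 1) h
    \<Longrightarrow> sip (\<lambda>w. g w - h w) f = sip g f - sip h f"
  by (subst (1 2 3) sip_commute) (rule sip_diff_right)

lemma sip_sum_right:
  "continuous_on (sphere 0 1) f \<Longrightarrow> (\<And>i. i \<in> I \<Longrightarrow> continuous_on (sphere 0 1) (g i))
    \<Longrightarrow> sip f (\<lambda>w. \<Sum>i\<in>I. g i w) = (\<Sum>i\<in>I. sip f (g i))"
  unfolding sip_def inner_sum_right by (intro sint_sum continuous_intros)

lemma sip_sum_left:
  "continuous_on (sphere 0 1) f \<Longrightarrow> (\<And>i. i \<in> I \<Longrightarrow> continuous_on (sphere 0 1) (g i))
    \<Longrightarrow> sip (\<lambda>w. \<Sum>i\<in>I. g i w) f = (\<Sum>i\<in>I. sip (g i) f)"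
  by (subst (1 2) sip_commute) (rule sip_sum_right)

lemma sip_self_eq_0:
  assumes "continuous_on (sphere 0 1) f" "sip f f = 0" "norm w = 1"
  shows "f w = 0"
proof -
  have "inner (f w) (f w) = 0"
    by (rule sint_eq_0_iff[of "\<lambda>w. inner (f w) (f w)"])
      (use assms in \<open>auto simp: sip_def intro!: continuous_intros\<close>)
  then show ?thesis by simp
qed

text \<open>One Gram-Schmidt step per element. The elements of \<open>B\<close> may be dependent on
  the sphere, so the new direction \<open>b'\<close> may have norm 0; its coefficient is then set to
  0.\<close>

lemma projection_exists:
  fixes f :: "real ^ 'n::{finite,linorder} \<Rightarrow> 'n clif"
  assumes "finite B" "\<And>b. b \<in> B \<Longrightarrow> continuous_on (sphere 0 1) b" "continuous_on (sphere 0 1) f"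
  shows "\<exists>c. \<forall>b\<in>B. sip (\<lambda>w. f w - (\<Sum>b\<in>B. c b *\<^sub>R b w)) b = 0"
  using assms
proof (induction B arbitrary: f rule: finite_induct)
  case (insert b0 B)
  have cB: "continuous_on (sphere 0 1) (\<lambda>w. \<Sum>b\<in>B. c b *\<^sub>R b w)" for c
    using insert.prems(1) by (intro continuous_intros) auto
  have c0: "continuous_on (sphere 0 1) b0" and cf: "continuous_on (sphere 0 1) f"
    using insert.prems by auto
  obtain c1 where c1: "\<And>b. b \<in> B \<Longrightarrow> sip (\<lambda>w. f w - (\<Sum>b\<in>B. c1 b *\<^sub>R b w)) b = 0"
    using insert.IH[of f] insert.prems by auto
  obtain c2 where c2: "\<And>b. b \<in> B \<Longrightarrow> sip (\<lambda>w. b0 w - (\<Sum>b\<in>B. c2 b *\<^sub>R b w)) b = 0"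
    using insert.IH[of b0] insert.prems by auto
  define p q where "p w = (\<Sum>b\<in>B. c1 b *\<^sub>R b w)" and "q w = (\<Sum>b\<in>B. c2 b *\<^sub>R b w)" for w
  define b' where "b' w = b0 w - q w" for w
  define t where "t = (if sip b' b' = 0 then 0 else sip f b' / sip b' b')"
  define r where "r w = f w - p w - t *\<^sub>R b' w" for w
  have cont: "continuous_on (sphere 0 1) p" "continuous_on (sphere 0 1) q" "continuous_on (sphere 0 1) b'"
    "continuous_on (sphere 0 1) r" "continuous_on (sphere 0 1) (\<lambda>w. f w - p w)"
    "continuous_on (sphere 0 1) (\<lambda>w. t *\<^sub>R b' w)"
    unfolding r_def b'_def p_def q_def by (intro continuous_intros cf c0 cB)+
  have cb: "continuous_on (sphere 0 1) b" if "b \<in> B" for b using insert.prems that by auto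
  have rb: "sip r b = 0" if "b \<in> B" for b
    using c1[OF that] c2[OF that] cont cb[OF that] unfolding r_def
    by (subst sip_diff_left) (auto simp: sip_scaleR_left p_def q_def b'_def)
  have b'b: "sip b' b = 0" if "b \<in> B" for b
    using c2[OF that] by (simp add: b'_def[abs_def] q_def[abs_def])
  have bp: "sip b' (\<lambda>w. \<Sum>b\<in>B. c b *\<^sub>R b w) = 0" for c
    using b'b cb cont by (subst sip_sum_right) (auto simp: sip_scaleR_right intro!: continuous_intros)
  have rq: "sip r q = 0"
    unfolding q_def using rb cb cont
    by (subst sip_sum_right) (auto simp: sip_scaleR_right intro!: continuous_intros)
  have "sip r b' = sip f b' - sip p b' - t * sip b' b'"
    unfolding r_def using cont cf by (simp add: sip_diff_left sip_scaleR_left)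
  also have "sip p b' = 0" unfolding p_def using bp[of c1] by (simp add: sip_commute)
  also have "sip f b' - 0 - t * sip b' b' = 0"
  proof (cases "sip b' b' = 0")
    case True
    \<comment> \<open>A direction of norm 0 vanishes on the sphere and is therefore orthogonal to
      \<open>f\<close>.\<close>
    have "sip f b' = sip f (\<lambda>w. 0)"
      by (intro sip_cong refl sip_self_eq_0[OF cont(3) True])
    then show ?thesis using True by (simp add: sip_def)
  qed (simp add: t_def)
  finally have rb': "sip r b' = 0" .
  have "sip r b0 = sip r (\<lambda>w. b' w + q w)" by (simp add: b'_def)
  also have "\<dots> = 0" using cont rb' rq by (simp add: sip_add_right)
  finally have rb0: "sip r b0 = 0" .
  define c where "c b = (if b = b0 then t else c1 b - t * c2 b)" for b
  have "f w - (\<Sum>b\<in>insert b0 B. c b *\<^sub>R b w) = r w" for w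
  proof -
    have "(\<Sum>b\<in>B. c b *\<^sub>R b w) = (\<Sum>b\<in>B. c1 b *\<^sub>R b w - t *\<^sub>R (c2 b *\<^sub>R b w))"
      using insert.hyps(2) by (intro sum.cong refl) (auto simp: c_def scaleR_left_diff_distrib)
    then have "(\<Sum>b\<in>insert b0 B. c b *\<^sub>R b w) = t *\<^sub>R b0 w + (p w - t *\<^sub>R q w)"
      using insert.hyps by (simp add: c_def[of b0] p_def q_def sum_subtractf scaleR_sum_right)
    then show ?thesis by (simp add: r_def b'_def algebra_simps)
  qed
  then show ?case using rb rb0 by (intro exI[of _ c]) auto
qed auto

text \<open>Monomials times the basis vectors of the algebra span the homogeneous polynomials of
  degree \<open>d\<close>, so projecting onto these finitely many functions represents all the
  functionals at once.\<close>

lemma sip_projection_hom_poly: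
  fixes f :: "real ^ 'n::{finite,linorder} \<Rightarrow> 'n clif"
  assumes f: "continuous_on (sphere 0 1) f"
  shows "\<exists>q. hom_poly d q \<and> (\<forall>H. hom_poly d H \<longrightarrow> sip f H = sip q H)"
proof -
  let ?m = "\<lambda>(\<alpha>::'n \<Rightarrow> nat) (e::'n clif) (x::(real, 'n) vec). (\<Prod>i\<in>UNIV. (x $ i) ^ \<alpha> i) *\<^sub>R e"
  define B where "B = (\<lambda>(\<alpha>, e). ?m \<alpha> e) ` ({\<alpha>. sum \<alpha> UNIV = d} \<times> Basis)"
  have B: "finite B" unfolding B_def by (intro finite_imageI finite_cartesian_product finite_multi_index finite_Basis)
  have hB: "hom_poly d b" if "b \<in> B" for b
    using that hom_poly_monomial by (auto simp: B_def)
  have cB: "continuous_on (sphere 0 1) b" if "b \<in> B" for b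
    using hB[OF that] by (rule hom_poly_continuous_on)
  obtain c where c: "\<And>b. b \<in> B \<Longrightarrow> sip (\<lambda>w. f w - (\<Sum>b\<in>B. c b *\<^sub>R b w)) b = 0"
    using projection_exists[OF B cB f] by blast
  define q where "q w = (\<Sum>b\<in>B. c b *\<^sub>R b w)" for w
  have hq: "hom_poly d q" unfolding q_def[abs_def] by (intro hom_poly_sum hom_poly_scaleR hB)
  have cq: "continuous_on (sphere 0 1) q" using hq by (rule hom_poly_continuous_on)
  have "sip f H = sip q H" if H: "hom_poly d H" for H
  proof -
    have cfq: "continuous_on (sphere 0 1) (\<lambda>w. f w - q w)" by (intro continuous_intros f cq)
    obtain a where a: "H = (\<lambda>x. \<Sum>\<alpha> | sum \<alpha> UNIV = d. (\<Prod>i\<in>UNIV. (x $ i) ^ \<alpha> i) *\<^sub>R a \<alpha>)"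
      using hom_poly_eq_sum_monomials[OF H] .
    have Heq: "H = (\<lambda>x. \<Sum>\<alpha> | sum \<alpha> UNIV = d. \<Sum>e\<in>Basis. inner (a \<alpha>) e *\<^sub>R ?m \<alpha> e x)"
    proof
      fix x
      show "H x = (\<Sum>\<alpha> | sum \<alpha> UNIV = d. \<Sum>e\<in>Basis. inner (a \<alpha>) e *\<^sub>R ?m \<alpha> e x)"
        unfolding a
      proof (intro sum.cong refl)
        fix \<alpha> :: "'n \<Rightarrow> nat"
        have "(\<Prod>i\<in>UNIV. (x $ i) ^ \<alpha> i) *\<^sub>R a \<alpha> = (\<Prod>i\<in>UNIV. (x $ i) ^ \<alpha> i) *\<^sub>R (\<Sum>e\<in>Basis. inner (a \<alpha>) e *\<^sub>R e)"
          by (simp only: euclidean_representation)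
        then show "(\<Prod>i\<in>UNIV. (x $ i) ^ \<alpha> i) *\<^sub>R a \<alpha> = (\<Sum>e\<in>Basis. inner (a \<alpha>) e *\<^sub>R ?m \<alpha> e x)"
          by (simp add: scaleR_sum_right mult.commute)
      qed
    qed
    have mB: "?m \<alpha> e \<in> B" if "sum \<alpha> UNIV = d" "e \<in> Basis" for \<alpha> e
      using that by (auto simp: B_def)
    have z: "sip (\<lambda>w. f w - q w) (?m \<alpha> e) = 0" "continuous_on (sphere 0 1) (?m \<alpha> e)"
      if "sum \<alpha> UNIV = d" "e \<in> Basis" for \<alpha> e
      using c[OF mB[OF that]] cB[OF mB[OF that]] by (simp_all add: q_def)
    have "sip (\<lambda>w. f w - q w) H = (\<Sum>\<alpha> | sum \<alpha> UNIV = d. sip (\<lambda>w. f w - q w) (\<lambda>x. \<Sum>e\<in>Basis. inner (a \<alpha>) e *\<^sub>R ?m \<alpha> e x))"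
      unfolding Heq by (intro sip_sum_right cfq continuous_on_sum continuous_on_scaleR[OF continuous_on_const z(2)]) auto
    also have "\<dots> = 0"
    proof (intro sum.neutral ballI)
      fix \<alpha> :: "'n \<Rightarrow> nat" assume "\<alpha> \<in> {\<alpha>. sum \<alpha> UNIV = d}"
      then have \<alpha>: "sum \<alpha> UNIV = d" by simp
      have "sip (\<lambda>w. f w - q w) (\<lambda>x. \<Sum>e\<in>Basis. inner (a \<alpha>) e *\<^sub>R ?m \<alpha> e x)
          = (\<Sum>e\<in>Basis. sip (\<lambda>w. f w - q w) (\<lambda>x. inner (a \<alpha>) e *\<^sub>R ?m \<alpha> e x))"
        by (intro sip_sum_right cfq continuous_on_scaleR[OF continuous_on_const z(2)] \<alpha>) auto
      also have "\<dots> = 0"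
      proof (intro sum.neutral ballI)
        fix e :: "'n clif" assume "e \<in> Basis"
        then show "sip (\<lambda>w. f w - q w) (\<lambda>x. inner (a \<alpha>) e *\<^sub>R ?m \<alpha> e x) = 0"
          unfolding sip_scaleR_right[of "\<lambda>w. f w - q w" "inner (a \<alpha>) e" "?m \<alpha> e"]
          using z(1)[OF \<alpha>, of e] by simp
      qed
      finally show "sip (\<lambda>w. f w - q w) (\<lambda>x. \<Sum>e\<in>Basis. inner (a \<alpha>) e *\<^sub>R ?m \<alpha> e x) = 0" .
    qed
    finally show ?thesis
      using sip_diff_left[OF hom_poly_continuous_on[OF H] f cq] by simp
  qed
  with hq show ?thesis by blast
qed

lemma vmul_funpow_eq_sph:
  assumes "norm w = 1" "even (s + l)"
  shows "(vmul ^^ s) Q w = (-1) ^ (s div 2) *\<^sub>R sph l Q w"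
  using assms vmul_funpow_sphere[OF assms(1), of s Q] cact_sph[OF assms(1), of s Q]
  by (auto simp: sph_def)

text \<open>In even degree d the exponent s and the degree d - s have the same parity, so on the
  sphere every Fischer component is, up to sign, some \<open>sph (d - s)\<close>.\<close>

lemma sip_fischer:
  fixes H :: "real ^ 'n::{finite,linorder} \<Rightarrow> 'n clif"
  assumes f: "continuous_on (sphere 0 1) f" and H: "hom_poly d H" "even d"
  shows "\<exists>Q. (\<forall>s\<le>d. monogenic_hom (d - s) (Q s)) \<and>
    (\<forall>f. continuous_on (sphere 0 1) f \<longrightarrow> sip H f = (\<Sum>s\<le>d. (-1) ^ (s div 2) * sip (sph (d - s) (Q s)) f))"
proof -
  obtain Q where Q: "\<And>s. s \<le> d \<Longrightarrow> monogenic_hom (d - s) (Q s)" "H = (\<lambda>x. \<Sum>s\<le>d. (vmul ^^ s) (Q s) x)"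
    using fischer_decomposition[OF H(1)] by blast
  have "sip H f = (\<Sum>s\<le>d. (-1) ^ (s div 2) * sip (sph (d - s) (Q s)) f)" if f: "continuous_on (sphere 0 1) f" for f
  proof -
    have c: "continuous_on (sphere 0 1) (\<lambda>w. (-1) ^ (s div 2) *\<^sub>R sph (d - s) (Q s) w)" if "s \<le> d" for s
      using Q(1)[OF that] by (intro continuous_intros continuous_on_sph) (simp add: monogenic_hom_iff)
    have "sip H f = sip (\<lambda>w. \<Sum>s\<le>d. (-1) ^ (s div 2) *\<^sub>R sph (d - s) (Q s) w) f"
      unfolding Q(2) using H(2) by (intro sip_cong sum.cong refl vmul_funpow_eq_sph) auto
    also have "\<dots> = (\<Sum>s\<le>d. sip (\<lambda>w. (-1) ^ (s div 2) *\<^sub>R sph (d - s) (Q s) w) f)"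
      using c by (intro sip_sum_left f) auto
    finally show ?thesis by (simp add: sip_scaleR_left)
  qed
  with Q(1) show ?thesis by blast
qed

text \<open>In the even one of the degrees k and k + 1 every \<open>sph k Q\<close> is a homogeneous
  polynomial. After projecting onto that degree \<open>d\<close>, orthogonality leaves only the
  Fischer component with s = d - k, whose monogenic part has degree k.\<close>

lemma spherical_projection:
  fixes f :: "real ^ 'n::{finite,linorder} \<Rightarrow> 'n clif"
  assumes f: "continuous_on (sphere 0 1) f"
  shows "\<exists>P. monogenic_hom k P \<and> (\<forall>Q. monogenic_hom k Q \<longrightarrow> sip f (sph k Q) = sip (sph k P) (sph k Q))"
proof -
  define d where "d = (if even k then k else Suc k)"
  have d: "even d" "k \<le> d" by (auto simp: d_def)
  obtain q where q: "hom_poly d q" "\<And>H. hom_poly d H \<Longrightarrow> sip f H = sip q H"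
    using sip_projection_hom_poly[OF f] by blast
  obtain R where R: "\<And>s. s \<le> d \<Longrightarrow> monogenic_hom (d - s) (R s)"
    "\<And>f. continuous_on (sphere 0 1) f \<Longrightarrow> sip q f = (\<Sum>s\<le>d. (-1) ^ (s div 2) * sip (sph (d - s) (R s)) f)"
    using sip_fischer[OF f q(1) d(1)] by blast
  define P where "P x = (-1) ^ ((d - k) div 2) *\<^sub>R R (d - k) x" for x
  have P: "monogenic_hom k P"
    unfolding P_def using R(1)[of "d - k"] d by (intro monogenic_hom_scaleR) simp
  have "sip f (sph k Q) = sip (sph k P) (sph k Q)" if Q: "monogenic_hom k Q" for Q
  proof -
    have hQ: "hom_poly k Q" using Q by (simp add: monogenic_hom_iff)
    have "sip f (sph k Q) = sip q (sph k Q)"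
      by (rule q(2)) (use hom_poly_sph[OF hQ] in \<open>simp add: d_def\<close>)
    also have "\<dots> = (\<Sum>s\<le>d. (-1) ^ (s div 2) * sip (sph (d - s) (R s)) (sph k Q))"
      by (rule R(2)) (rule continuous_on_sph[OF hQ])
    also have "\<dots> = (\<Sum>s\<in>{d - k}. (-1) ^ (s div 2) * sip (sph (d - s) (R s)) (sph k Q))"
    proof (rule sum.mono_neutral_right)
      show "\<forall>s\<in>{..d} - {d - k}. (-1) ^ (s div 2) * sip (sph (d - s) (R s)) (sph k Q) = 0"
      proof
        fix s assume s: "s \<in> {..d} - {d - k}"
        then have "d - s \<noteq> k" using d by auto
        with s show "(-1) ^ (s div 2) * sip (sph (d - s) (R s)) (sph k Q) = 0"
          using sph_orthogonal[OF R(1) Q] by (simp add: sip_def)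
      qed
    qed auto
    also have "\<dots> = sip (sph k P) (sph k Q)"
    proof -
      have "sph k P = (\<lambda>w. (-1) ^ ((d - k) div 2) *\<^sub>R sph k (R (d - k)) w)"
        by (auto simp: sph_def P_def fun_eq_iff vmul_def cl_mult.scaleR_right)
      then show ?thesis using d by (simp add: sip_scaleR_left)
    qed
    finally show ?thesis .
  qed
  with P show ?thesis by blast
qed

text \<open>Polynomials of odd degree are orthogonal to \<open>g\<close> by the antipodal symmetry,
  those of even degree by the Fischer decomposition; approximating \<open>g\<close> itself by
  polynomials then gives norm 0.\<close>

lemma spherical_completeness:
  fixes g :: "real ^ 'n::{finite,linorder} \<Rightarrow> 'n clif"
  assumes g: "continuous_on (sphere 0 1) g" and even: "\<And>w. norm w = 1 \<Longrightarrow> g (- w) = g w"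
    and orth: "\<And>k Q. monogenic_hom k Q \<Longrightarrow> sip g (sph k Q) = 0" and y: "norm y = 1"
  shows "g y = 0"
proof -
  have hom: "sip g H = 0" if H: "hom_poly d H" for d H
  proof (cases "even d")
    case True
    obtain Q where Q: "\<And>s. s \<le> d \<Longrightarrow> monogenic_hom (d - s) (Q s)"
      "\<And>f. continuous_on (sphere 0 1) f \<Longrightarrow> sip H f = (\<Sum>s\<le>d. (-1) ^ (s div 2) * sip (sph (d - s) (Q s)) f)"
      using sip_fischer[OF g H True] by blast
    have "sip g H = (\<Sum>s\<le>d. (-1) ^ (s div 2) * sip g (sph (d - s) (Q s)))"
      using Q(2)[OF g] by (simp add: sip_commute)
    then show ?thesis using Q(1) orth by simp
  next
    case False
    have c: "continuous_on (sphere 0 1) (\<lambda>w. inner (g w) (H w))"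
      by (intro continuous_intros g hom_poly_continuous_on[OF H])
    have "orthogonal_transformation (uminus :: (real, 'n) vec \<Rightarrow> _)"
      by (simp add: orthogonal_transformation linear_uminus)
    from sint_orthogonal[OF this c]
    have "sip g H = sint (\<lambda>w. inner (g (- w)) (H (- w)))" by (simp add: sip_def)
    also have "\<dots> = sint (\<lambda>w. - inner (g w) (H w))"
      using hom_poly_scale_arg[OF H, of "-1"] False by (intro sint_cong) (simp add: even)
    finally show ?thesis by (simp add: sint_minus sip_def)
  qed
  have poly: "sip g p = 0" if p: "polynomial_function p" for p
  proof -
    obtain K H where H: "\<And>d. hom_poly d (H d)" "p = (\<lambda>x. \<Sum>d<K::nat. H d x)"
      using sum_hom_polynomial[OF p] by (auto simp: sum_hom_def)
    show ?thesis
      unfolding H(2) using hom[OF H(1)]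
      by (subst sip_sum_right) (auto intro: g hom_poly_continuous_on[OF H(1)])
  qed
  obtain B where B: "0 \<le> B" "\<And>w. norm w = 1 \<Longrightarrow> norm (g w) \<le> B"
    using bounded_on_sphere[OF g] by blast
  have "\<bar>sip g g\<bar> \<le> B * e" if e: "0 < e" for e
  proof -
    obtain p where p: "polynomial_function p" "\<And>w. norm w = 1 \<Longrightarrow> norm (g w - p w) < e"
      using Stone_Weierstrass_polynomial_function[OF compact_sphere g e] by auto
    have cp: "continuous_on (sphere 0 1) p" using continuous_on_polymonial_function[OF p(1)] .
    have "sip g g = sip g (\<lambda>w. g w - p w)"
      using sip_diff_right[OF g g cp] poly[OF p(1)] by simp
    also have "\<bar>\<dots>\<bar> \<le> B * e"
      unfolding sip_def
    proof (rule sint_abs_le)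
      show "continuous_on (sphere 0 1) (\<lambda>w. inner (g w) (g w - p w))" by (intro continuous_intros g cp)
      fix w :: "(real, 'n) vec" assume w: "norm w = 1"
      have "\<bar>inner (g w) (g w - p w)\<bar> \<le> norm (g w) * norm (g w - p w)" by (rule Cauchy_Schwarz_ineq2)
      also have "\<dots> \<le> B * e" using B p(2)[OF w] w by (intro mult_mono) auto
      finally show "\<bar>inner (g w) (g w - p w)\<bar> \<le> B * e" .
    qed
    finally show ?thesis .
  qed
  then have "sip g g = 0"
  proof -
    assume *: "\<And>e. 0 < e \<Longrightarrow> \<bar>sip g g\<bar> \<le> B * e"
    have "\<bar>sip g g\<bar> \<le> 0"
    proof (rule field_le_epsilon)
      fix e :: real assume "0 < e"
      then have "\<bar>sip g g\<bar> \<le> B * (e / (B + 1))" using B(1) by (intro *) simp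
      also have "\<dots> \<le> e" using B(1) \<open>0 < e\<close> by (simp add: field_simps)
      finally show "\<bar>sip g g\<bar> \<le> 0 + e" by simp
    qed
    then show ?thesis by simp
  qed
  then show ?thesis using sip_self_eq_0[OF g _ y] by simp
qed

text \<open>Symmetry moves \<open>m\<close> applications of \<open>gam\<close> from the
  eigenfunction to \<open>F\<close>; in this way smoothness of \<open>F\<close> becomes decay in
  k.\<close>

lemma sip_gam_funpow:
  fixes F :: "real ^ 'n::{finite,linorder} \<Rightarrow> 'n clif"
  assumes "\<And>l. l < m \<Longrightarrow> C1_sphere ((gam ^^ l) F)" and Q: "monogenic_hom k Q"
  shows "lam CARD('n) k ^ m * sip F (sph k Q) = sip ((gam ^^ m) F) (sph k Q)"
  using assms(1)
proof (induction m)
  case (Suc m)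
  have "hom_poly k Q" using Q by (simp add: monogenic_hom_iff)
  then have "sip ((gam ^^ Suc m) F) (sph k Q) = sint (\<lambda>w. inner ((gam ^^ m) F w) (gam (sph k Q) w))"
    using gam_symmetric[OF Suc.prems C1_sphere_sph] by (simp add: sip_def)
  also have "\<dots> = lam CARD('n) k * sip ((gam ^^ m) F) (sph k Q)"
    by (simp add: gam_sph[OF Q] sip_def sint_cmult)
  finally show ?case using Suc by simp
qed simp

section \<open>Smooth functions and smoothly convergent series\<close>

lemma frechet_derivative_cong_open:
  assumes "open S" "x \<in> S" "\<And>y. y \<in> S \<Longrightarrow> f y = g y"
  shows "frechet_derivative f (at x) = frechet_derivative g (at x)"
proof -
  have "(f has_derivative D) (at x) \<longleftrightarrow> (g has_derivative D) (at x)" for D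
    using has_derivative_transform_within_open[of f D x UNIV S g] has_derivative_transform_within_open[of g D x UNIV S f] assms
    by auto
  then show ?thesis by (simp add: frechet_derivative_def)
qed

lemma smooth_k_cong:
  assumes S: "open S" and eq: "\<And>x. x \<in> S \<Longrightarrow> f x = g x" and f: "smooth_k k S f"
  shows "smooth_k k S g"
  using eq f
proof (induction k arbitrary: f g)
  case 0
  then show ?case using continuous_on_cong[of S S f g] by simp
next
  case (Suc k)
  have "g differentiable at x" if x: "x \<in> S" for x
  proof -
    obtain D where "(f has_derivative D) (at x)"
      using Suc.prems(2) x S by (auto simp: differentiable_on_eq_differentiable_at differentiable_def)
    from has_derivative_transform_within_open[OF this S x Suc.prems(1)] show ?thesis
      by (auto simp: differentiable_def)
  qed
  then have "g differentiable_on S" using S by (simp add: differentiable_on_eq_differentiable_at)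
  moreover have "smooth_k k S (\<lambda>x. frechet_derivative g (at x) v)" if "v \<in> Basis" for v
  proof (rule Suc.IH)
    show "smooth_k k S (\<lambda>x. frechet_derivative f (at x) v)" using Suc.prems(2) that by simp
    show "frechet_derivative f (at x) v = frechet_derivative g (at x) v" if "x \<in> S" for x
      by (simp only: frechet_derivative_cong_open[OF S that Suc.prems(1)])
  qed
  ultimately show ?case by simp
qed

lemma smooth_on_differentiable:
  assumes "smooth_on S f" "open S" "x \<in> S"
  shows "f differentiable at x"
proof -
  have "smooth_k (Suc 0) S f" using assms(1) unfolding smooth_on_def by blast
  then show ?thesis using assms(2,3) by (simp add: differentiable_on_eq_differentiable_at)
qed

lemma smooth_on_continuous: "smooth_on S f \<Longrightarrow> continuous_on S f"
  unfolding smooth_on_def by (drule spec[of _ 0]) simp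

lemma smooth_on_derivative: "smooth_on S f \<Longrightarrow> v \<in> Basis \<Longrightarrow> smooth_on S (\<lambda>x. frechet_derivative f (at x) v)"
  unfolding smooth_on_def by (rule allI, drule_tac x="Suc k" in spec) simp

text \<open>Allows any explicit derivative to take the place of the
  \<open>frechet_derivative\<close> in the definition of smoothness.\<close>

lemma smooth_k_Suc_open:
  assumes S: "open S" and D: "\<And>x. x \<in> S \<Longrightarrow> (f has_derivative D x) (at x)"
    and k: "\<And>v. v \<in> Basis \<Longrightarrow> smooth_k k S (\<lambda>x. D x v)"
  shows "smooth_k (Suc k) S f"
proof -
  have "f differentiable_on S"
    unfolding differentiable_on_eq_differentiable_at[OF S] using D by (auto simp: differentiable_def)
  moreover have "smooth_k k S (\<lambda>x. frechet_derivative f (at x) v)" if "v \<in> Basis" for v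
    using frechet_derivative_at[OF D] by (intro smooth_k_cong[OF S _ k[OF that]]) auto
  ultimately show ?thesis by simp
qed

lemma smooth_on_has_derivative:
  assumes "smooth_on S f" "open S" "x \<in> S"
  shows "(f has_derivative frechet_derivative f (at x)) (at x)"
  using smooth_on_differentiable[OF assms] by (simp only: frechet_derivative_works)

lemma smooth_on_linear:
  assumes S: "open S" and L: "bounded_linear L" and f: "smooth_on S f"
  shows "smooth_on S (\<lambda>x. L (f x))"
  unfolding smooth_on_def
proof
  fix k show "smooth_k k S (\<lambda>x. L (f x))"
    using f
  proof (induction k arbitrary: f)
    case 0
    then show ?case using smooth_on_continuous bounded_linear.continuous_on[OF L] by auto
  next
    case (Suc k)
    show ?case
      by (rule smooth_k_Suc_open[OF S bounded_linear.has_derivative[OF L smooth_on_has_derivative[OF Suc.prems S]]])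
        (auto intro: Suc.IH smooth_on_derivative[OF Suc.prems])
  qed
qed

lemma smooth_on_add:
  assumes S: "open S" and f: "smooth_on S f" and g: "smooth_on S g"
  shows "smooth_on S (\<lambda>x. f x + g x)"
  unfolding smooth_on_def
proof
  fix k show "smooth_k k S (\<lambda>x. f x + g x)"
    using f g
  proof (induction k arbitrary: f g)
    case 0
    then show ?case using smooth_on_continuous by (auto intro: continuous_on_add)
  next
    case (Suc k)
    show ?case
      by (rule smooth_k_Suc_open[OF S has_derivative_add[OF smooth_on_has_derivative[OF Suc.prems(1) S]
              smooth_on_has_derivative[OF Suc.prems(2) S]]])
        (auto intro: Suc.IH smooth_on_derivative[OF Suc.prems(1)] smooth_on_derivative[OF Suc.prems(2)])
  qed
qed

lemma smooth_on_const: "open S \<Longrightarrow> smooth_on S (\<lambda>x. c)"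
  unfolding smooth_on_def
proof
  fix k assume S: "open S"
  show "smooth_k k S (\<lambda>x. c)"
  proof (induction k arbitrary: c)
    case (Suc k)
    show ?case by (rule smooth_k_Suc_open[OF S has_derivative_const]) (auto intro: Suc)
  qed simp
qed

lemma smooth_on_sum:
  assumes S: "open S" and f: "\<And>i. i \<in> A \<Longrightarrow> smooth_on S (f i)"
  shows "smooth_on S (\<lambda>x. \<Sum>i\<in>A. f i x)"
  using f
proof (induction A rule: infinite_finite_induct)
  case (insert i A)
  then show ?case by (simp add: smooth_on_add[OF S])
qed (simp_all add: smooth_on_const[OF S])

lemma smooth_on_linear_scaleR:
  fixes c :: "'a::euclidean_space \<Rightarrow> real" and f :: "'a \<Rightarrow> 'b::euclidean_space"
  assumes S: "open S" and c: "bounded_linear c" and f: "smooth_on S f"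
  shows "smooth_on S (\<lambda>x. c x *\<^sub>R f x)"
  unfolding smooth_on_def
proof
  fix k show "smooth_k k S (\<lambda>x. c x *\<^sub>R f x)"
    using f
  proof (induction k arbitrary: f)
    case 0
    then show ?case
      using smooth_on_continuous bounded_linear.continuous_on[OF c continuous_on_id] by (auto intro!: continuous_intros)
  next
    case (Suc k)
    \<comment> \<open>Additivity at a fixed order is required, because the induction hypothesis
      provides the first summand of the product rule at order k only.\<close>
    have add: "smooth_k k S (\<lambda>x. g x + h x)" if "smooth_k k S g" "smooth_k k S h" for g h :: "'a \<Rightarrow> 'b" and k
      using that
    proof (induction k arbitrary: g h)
      case (Suc k)
      then have "(g has_derivative frechet_derivative g (at x)) (at x)" "(h has_derivative frechet_derivative h (at x)) (at x)"
        if "x \<in> S" for x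
        using that S by (auto simp: differentiable_on_eq_differentiable_at frechet_derivative_works[symmetric])
      then show ?case
        using Suc by (intro smooth_k_Suc_open[OF S has_derivative_add]) auto
    qed (auto intro: continuous_on_add)
    show ?case
    proof (rule smooth_k_Suc_open[OF S has_derivative_scaleR[OF bounded_linear.has_derivative[OF c has_derivative_ident]
            smooth_on_has_derivative[OF Suc.prems S]]])
      fix v :: 'a assume v: "v \<in> Basis"
      have "smooth_k k S (\<lambda>x. c v *\<^sub>R f x)"
        using smooth_on_linear[OF S bounded_linear_scaleR_right Suc.prems] unfolding smooth_on_def by blast
      then show "smooth_k k S (\<lambda>x. c x *\<^sub>R frechet_derivative f (at x) v + c v *\<^sub>R f x)"
        using Suc.IH[OF smooth_on_derivative[OF Suc.prems v]] by (rule add[rotated])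
    qed
  qed
qed

text \<open>The hypothesis of the Weierstrass M-test on a neighbourhood of each point.\<close>

definition loc_summable :: "'a::metric_space set \<Rightarrow> (nat \<Rightarrow> 'a \<Rightarrow> 'b::real_normed_vector) \<Rightarrow> bool" where
  "loc_summable W f \<longleftrightarrow> (\<forall>x\<in>W. \<exists>e>0. \<exists>M. summable M \<and> (\<forall>y\<in>ball x e. \<forall>n. norm (f n y) \<le> M n))"

lemma loc_summable_summable:
  fixes f :: "nat \<Rightarrow> 'a::metric_space \<Rightarrow> 'b::banach"
  assumes "loc_summable W f" "x \<in> W"
  shows "summable (\<lambda>n. f n x)"
proof -
  obtain e M where e: "0 < e" "summable M" "\<And>y n. y \<in> ball x e \<Longrightarrow> norm (f n y) \<le> M n"
    using assms unfolding loc_summable_def by blast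
  have "norm (f n x) \<le> M n" for n using e(1) by (intro e(3)) simp
  then show ?thesis by (rule summable_comparison_test'[OF e(2), of 0])
qed

lemma loc_summable_continuous:
  fixes f :: "nat \<Rightarrow> 'a::metric_space \<Rightarrow> 'b::banach"
  assumes W: "open W" and f: "loc_summable W f" and c: "\<And>n. continuous_on W (f n)"
  shows "continuous_on W (\<lambda>x. \<Sum>n. f n x)"
  unfolding continuous_on_eq_continuous_at[OF W]
proof
  fix x assume x: "x \<in> W"
  obtain e M where e: "0 < e" "summable M" "\<And>y n. y \<in> ball x e \<Longrightarrow> norm (f n y) \<le> M n"
    using f x unfolding loc_summable_def by blast
  have o: "open (ball x e \<inter> W)" using W by auto
  have "uniform_limit (ball x e \<inter> W) (\<lambda>n x. \<Sum>i<n. f i x) (\<lambda>x. \<Sum>n. f n x) sequentially"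
    by (rule Weierstrass_m_test[OF _ e(2)]) (use e(3) in auto)
  then have "continuous_on (ball x e \<inter> W) (\<lambda>x. \<Sum>n. f n x)"
    by (rule uniform_limit_theorem[rotated])
      (auto intro!: always_eventually continuous_on_sum continuous_on_subset[OF c])
  then show "isCont (\<lambda>x. \<Sum>n. f n x) x"
    using o x e(1) by (simp add: continuous_on_eq_continuous_at)
qed

text \<open>Summability of the derivatives is assumed in the basis directions only; finitely many
  neighbourhoods are intersected, and linearity extends the uniform convergence to all
  directions.\<close>

lemma series_has_derivative:
  fixes f :: "nat \<Rightarrow> 'a::euclidean_space \<Rightarrow> 'b::euclidean_space"
  assumes W: "open W" and d: "\<And>n x. x \<in> W \<Longrightarrow> (f n has_derivative D n x) (at x)"
    and f: "loc_summable W f" and Df: "\<And>b. b \<in> Basis \<Longrightarrow> loc_summable W (\<lambda>n x. D n x b)" and x: "x \<in> W"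
  shows "((\<lambda>x. \<Sum>n. f n x) has_derivative (\<lambda>v. \<Sum>b\<in>Basis. inner v b *\<^sub>R (\<Sum>n. D n x b))) (at x)"
proof -
  have "\<exists>e>0. \<exists>M. summable M \<and> (\<forall>y\<in>ball x e. \<forall>n. norm (D n y b) \<le> M n)" if "b \<in> Basis" for b
    using Df[OF that] x unfolding loc_summable_def by blast
  then obtain e M where e: "\<And>b. b \<in> Basis \<Longrightarrow> 0 < e b" and M: "\<And>b. b \<in> Basis \<Longrightarrow> summable (M b)"
    and le: "\<And>b y n. b \<in> Basis \<Longrightarrow> y \<in> ball x (e b) \<Longrightarrow> norm (D n y b) \<le> M b n"
    by metis
  obtain e0 where e0: "0 < e0" "ball x e0 \<subseteq> W" using W x openE by blast
  define r where "r = Min (insert e0 (e ` Basis))"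
  have fin: "finite (insert e0 (e ` Basis))" by simp
  have r: "0 < r" "r \<le> e0" "\<And>b. b \<in> Basis \<Longrightarrow> r \<le> e b"
  proof -
    show "0 < r" unfolding r_def using e0(1) e by (subst Min_gr_iff) auto
    show "r \<le> e0" unfolding r_def by (rule Min_le[OF fin]) simp
    show "r \<le> e b" if "b \<in> Basis" for b unfolding r_def using that by (intro Min_le[OF fin]) simp
  qed
  define S where "S = ball x r"
  have S: "convex S" "open S" "x \<in> S" "S \<subseteq> W" using r e0 by (auto simp: S_def)
  define g' where "g' y v = (\<Sum>b\<in>Basis. inner v b *\<^sub>R (\<Sum>n. D n y b))" for y v
  have lin: "D n y v = (\<Sum>b\<in>Basis. inner v b *\<^sub>R D n y b)" if "y \<in> W" for n y v
  proof -
    have L: "linear (D n y)" using d[OF that] by (rule has_derivative_linear)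
    have "D n y v = D n y (\<Sum>b\<in>Basis. inner v b *\<^sub>R b)" by (simp only: euclidean_representation)
    then show ?thesis by (simp add: linear_sum[OF L] linear_scale[OF L])
  qed
  have "\<exists>g. \<forall>x\<in>S. (\<lambda>n. f n x) sums g x \<and> (g has_derivative g' x) (at x within S)"
  proof (rule has_derivative_series[OF S(1) _ _ S(3)])
    show "(f n has_derivative D n y) (at y within S)" if "y \<in> S" for n y
      using d that S(4) has_derivative_at_withinI by blast
    show "(\<lambda>n. f n x) sums (\<Sum>n. f n x)"
      using loc_summable_summable[OF f x] by (rule summable_sums)
    fix \<epsilon> :: real assume \<epsilon>: "0 < \<epsilon>"
    \<comment> \<open>Each of the \<open>DIM('a)\<close> basis directions contributes an error of at
      most \<delta> times the norm of h.\<close>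
    define \<delta> where "\<delta> = \<epsilon> / (real DIM('a) + 1)"
    have \<delta>: "0 < \<delta>" using \<epsilon> by (simp add: \<delta>_def)
    have "\<forall>\<^sub>F n in sequentially. \<forall>y\<in>S. norm ((\<Sum>i<n. D i y b) - (\<Sum>i. D i y b)) < \<delta>" if b: "b \<in> Basis" for b
    proof -
      have "uniform_limit S (\<lambda>n y. \<Sum>i<n. D i y b) (\<lambda>y. \<Sum>i. D i y b) sequentially"
        by (rule Weierstrass_m_test[OF _ M[OF b]]) (use le[OF b] r(3)[OF b] in \<open>auto simp: S_def\<close>)
      then show ?thesis using \<delta> unfolding uniform_limit_iff by (simp add: dist_norm)
    qed
    then have "\<forall>\<^sub>F n in sequentially. \<forall>b\<in>Basis. \<forall>y\<in>S. norm ((\<Sum>i<n. D i y b) - (\<Sum>i. D i y b)) < \<delta>"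
      by (simp add: eventually_ball_finite_distrib)
    then show "\<forall>\<^sub>F n in sequentially. \<forall>y\<in>S. \<forall>h. norm ((\<Sum>i<n. D i y h) - g' y h) \<le> \<epsilon> * norm h"
    proof eventually_elim
      case (elim n)
      show ?case
      proof (intro ballI allI)
        fix y h assume y: "y \<in> S"
        have "(\<Sum>i<n. D i y h) = (\<Sum>i<n. \<Sum>b\<in>Basis. inner h b *\<^sub>R D i y b)"
          using lin y S(4) by (intro sum.cong refl) blast
        also have "\<dots> = (\<Sum>b\<in>Basis. inner h b *\<^sub>R (\<Sum>i<n. D i y b))"
          by (subst sum.swap) (simp add: scaleR_sum_right)
        finally have "(\<Sum>i<n. D i y h) - g' y h = (\<Sum>b\<in>Basis. inner h b *\<^sub>R ((\<Sum>i<n. D i y b) - (\<Sum>i. D i y b)))"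
          by (simp add: g'_def scaleR_diff_right sum_subtractf)
        also have "norm \<dots> \<le> (\<Sum>b\<in>(Basis::'a set). norm h * \<delta>)"
          using elim y by (intro sum_norm_le) (auto intro!: mult_mono Basis_le_norm simp: less_imp_le)
        also have "\<dots> \<le> \<epsilon> * norm h"
        proof -
          have "real DIM('a) * \<delta> \<le> \<epsilon>" using \<epsilon> by (simp add: \<delta>_def field_simps)
          then show ?thesis using mult_right_mono[of "real DIM('a) * \<delta>" \<epsilon> "norm h"] by (simp add: mult_ac)
        qed
        finally show "norm ((\<Sum>i<n. D i y h) - g' y h) \<le> \<epsilon> * norm h" .
      qed
    qed
  qed
  then obtain g where g: "\<And>y. y \<in> S \<Longrightarrow> (\<lambda>n. f n y) sums g y" "(g has_derivative g' x) (at x within S)"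
    using S(3) by blast
  have "(g has_derivative g' x) (at x)" using g(2) by (simp only: at_within_open[OF S(3,2)])
  then have "((\<lambda>x. \<Sum>n. f n x) has_derivative g' x) (at x)"
    by (rule has_derivative_transform_within_open[OF _ S(2,3)]) (simp add: sums_unique[OF g(1)])
  then show ?thesis by (simp add: g'_def[abs_def])
qed

text \<open>The induction on the order runs over all members of the class at once, so closure of the
  class under termwise differentiation replaces formulas for higher derivatives.\<close>

lemma series_smooth:
  fixes \<C> :: "(nat \<Rightarrow> 'a::euclidean_space \<Rightarrow> 'b::euclidean_space) \<Rightarrow> bool"
  assumes W: "open W" and sum: "\<And>f. \<C> f \<Longrightarrow> loc_summable W f"
    and der: "\<And>f. \<C> f \<Longrightarrow> \<exists>D. (\<forall>n. \<forall>x\<in>W. (f n has_derivative D n x) (at x)) \<and> (\<forall>b\<in>Basis. \<C> (\<lambda>n x. D n x b))"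
    and f: "\<C> f"
  shows "smooth_on W (\<lambda>x. \<Sum>n. f n x)"
  unfolding smooth_on_def
proof
  fix k show "smooth_k k W (\<lambda>x. \<Sum>n. f n x)"
    using f
  proof (induction k arbitrary: f)
    case 0
    obtain D where "\<And>n x. x \<in> W \<Longrightarrow> (f n has_derivative D n x) (at x)" using der[OF 0] by blast
    then have "continuous_on W (f n)" for n
      using has_derivative_continuous continuous_at_imp_continuous_on by blast
    then show ?case using loc_summable_continuous[OF W sum[OF 0]] by simp
  next
    case (Suc k)
    obtain D where D: "\<And>n x. x \<in> W \<Longrightarrow> (f n has_derivative D n x) (at x)" "\<And>b. b \<in> Basis \<Longrightarrow> \<C> (\<lambda>n x. D n x b)"
      using der[OF Suc.prems] by blast
    show ?case
    proof (rule smooth_k_Suc_open[OF W series_has_derivative[OF W D(1) sum[OF Suc.prems] sum[OF D(2)]]])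
      fix v :: 'a assume v: "v \<in> Basis"
      have "(\<Sum>b\<in>Basis. inner v b *\<^sub>R (\<Sum>n. D n x b)) = (\<Sum>n. D n x v)" for x
        using v by (simp add: inner_Basis if_distrib[of "\<lambda>c. c *\<^sub>R _"] if_distribR cong: if_cong)
      then show "smooth_k k W (\<lambda>x. \<Sum>b\<in>Basis. inner v b *\<^sub>R (\<Sum>n. D n x b))"
        using Suc.IH[OF D(2)[OF v]] by simp
    qed
  qed
qed

section \<open>Sums of rapidly decreasing expansions are slice monogenic\<close>

text \<open>Turns unordered sums over pairs into ordinary series, for which termwise differentiation
  is set up.\<close>

definition enum_jk :: "nat \<Rightarrow> int \<times> nat" where
  "enum_jk = from_nat_into UNIV"

lemma bij_enum_jk: "bij enum_jk"
proof -
  have "infinite (UNIV :: (int \<times> nat) set)" by (simp add: finite_prod)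
  then show ?thesis unfolding enum_jk_def by (intro bij_betw_from_nat_into) auto
qed

text \<open>The summable majorant to which the estimates are reduced: geometric in |j|, quadratic in
  1/(k + 1).\<close>

definition wt :: "int \<times> nat \<Rightarrow> real" where
  "wt = (\<lambda>(j, k). (1/2) ^ nat \<bar>j\<bar> / (real k + 1)\<^sup>2)"

lemma summable_on_half_powers: "(\<lambda>j::int. (1/2::real) ^ nat \<bar>j\<bar>) summable_on UNIV"
proof -
  have s: "(\<lambda>n. (1/2::real) ^ n) summable_on UNIV"
    by (intro norm_summable_imp_summable_on) (simp add: summable_geometric)
  have "(\<lambda>j::int. (1/2::real) ^ nat \<bar>j\<bar>) summable_on range int"
    by (subst summable_on_reindex) (use s in \<open>auto simp: o_def\<close>)
  moreover have "(\<lambda>j::int. (1/2::real) ^ nat \<bar>j\<bar>) summable_on range (\<lambda>n. - int (Suc n))"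
  proof (subst summable_on_reindex)
    show "((\<lambda>j::int. (1/2::real) ^ nat \<bar>j\<bar>) \<circ> (\<lambda>n. - int (Suc n))) summable_on UNIV"
      using summable_on_cmult_right[OF s, of "1/2"] by (simp add: o_def nat_add_distrib)
  qed (auto simp: inj_on_def)
  moreover have "(UNIV :: int set) = range int \<union> range (\<lambda>n. - int (Suc n))"
  proof -
    have "j \<in> range int \<union> range (\<lambda>n. - int (Suc n))" for j by (cases j) auto
    then show ?thesis by blast
  qed
  moreover have "range int \<inter> range (\<lambda>n. - int (Suc n)) = {}" by auto
  ultimately show ?thesis using summable_on_Un_disjoint by metis
qed

lemma wt_summable_on: "wt summable_on UNIV"
proof -
  have s: "(\<lambda>k. 1 / (real k + 1)\<^sup>2) summable_on (UNIV :: nat set)"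
  proof (intro norm_summable_imp_summable_on)
    have "summable (\<lambda>k. 1 / (real (Suc k))\<^sup>2)"
      using summable_Suc_iff[of "\<lambda>k. inverse ((real k)\<^sup>2)"] inverse_power_summable[of 2, where 'a=real]
      by (simp add: inverse_eq_divide)
    then show "summable (\<lambda>k. norm (1 / (real k + 1)\<^sup>2))" by (simp add: add.commute)
  qed
  have "(\<lambda>x. norm (wt x)) summable_on (Sigma UNIV (\<lambda>_. UNIV))"
    unfolding Infinite_Sum.abs_summable_on_Sigma_iff
  proof (intro conjI ballI)
    show "(\<lambda>k. norm (wt (j, k))) summable_on UNIV" for j
      using summable_on_cmult_right[OF s, of "(1/2) ^ nat \<bar>j\<bar>"] by (simp add: wt_def)
    have "(\<Sum>\<^sub>\<infinity>k. norm (wt (j, k))) = (1/2) ^ nat \<bar>j\<bar> * (\<Sum>\<^sub>\<infinity>k. 1 / (real k + 1)\<^sup>2)" for j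
      using infsum_cmult_right[OF s, of "(1/2) ^ nat \<bar>j\<bar>"] by (simp add: wt_def)
    then show "(\<lambda>j. norm (\<Sum>\<^sub>\<infinity>k. norm (wt (j, k)))) summable_on UNIV"
      using summable_on_cmult_left[OF summable_on_half_powers] by (simp add: abs_mult infsum_nonneg)
  qed
  moreover have "norm (wt x) = wt x" for x by (cases x) (simp add: wt_def)
  ultimately show ?thesis by simp
qed

lemma summable_wt: "summable (\<lambda>n. wt (enum_jk n))"
  using wt_summable_on summable_on_reindex_bij_betw[OF bij_enum_jk, of wt] summable_on_imp_summable by blast

text \<open>Growth B^|j| with a locally uniform base is what the powers z^j satisfy. It is
  compensated by coefficients that decay like a^|j| for every positive a.\<close>

definition holo_family :: "complex set \<Rightarrow> (int \<Rightarrow> nat \<Rightarrow> complex \<Rightarrow> complex) \<Rightarrow> bool" where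
  "holo_family U u \<longleftrightarrow> (\<forall>j k. u j k holomorphic_on U) \<and>
     (\<forall>z\<in>U. \<exists>e>0. \<exists>C\<ge>0. \<exists>B\<ge>0. \<forall>j k. \<forall>x\<in>ball z e. norm (u j k x) \<le> C * B ^ nat \<bar>j\<bar>)"

text \<open>The shift \<open>t\<close> records that every derivative in the sphere variable raises
  the degree by one, while decay is still measured in the original index k.\<close>

definition rapid_family :: "nat \<Rightarrow> (nat \<Rightarrow> int \<Rightarrow> real ^ 'n::{finite,linorder} \<Rightarrow> 'n clif) \<Rightarrow> bool" where
  "rapid_family t G \<longleftrightarrow> (\<forall>k j. hom_poly (k + t) (G k j)) \<and>
     (\<forall>m::nat. \<forall>a>0. \<exists>C>0. \<forall>k j w. norm w = 1 \<longrightarrow> norm (G k j w) \<le> C * a ^ nat \<bar>j\<bar> / (real k + 1) ^ m)"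

text \<open>Cauchy's inequality on discs of a fixed radius changes only the constant
  \<open>C\<close> and keeps the base \<open>B\<close>.\<close>

lemma holo_family_deriv:
  assumes U: "open U" and u: "holo_family U u"
  shows "holo_family U (\<lambda>j k. deriv (u j k))"
  unfolding holo_family_def
proof (intro conjI allI ballI)
  show "deriv (u j k) holomorphic_on U" for j k
    using u U by (auto simp: holo_family_def intro: holomorphic_deriv)
  fix z assume z: "z \<in> U"
  obtain e C B where e: "0 < e" "0 \<le> C" "0 \<le> B" "\<And>j k x. x \<in> ball z e \<Longrightarrow> norm (u j k x) \<le> C * B ^ nat \<bar>j\<bar>"
    using u z unfolding holo_family_def by meson
  obtain e' where e': "0 < e'" "ball z e' \<subseteq> U" using U z openE by blast
  \<comment> \<open>A third, so that a disc of radius \<open>r\<close> about a point within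
    \<open>r\<close> of \<open>z\<close> lies in both balls.\<close>
  define r where "r = min e e' / 3"
  have r: "0 < r" using e e' by (simp add: r_def)
  have sub: "cball x r \<subseteq> ball z e \<inter> U" if "x \<in> ball z r" for x
  proof -
    have "cball x r \<subseteq> ball z (3 * r)"
      using that by (auto simp: dist_commute) (smt (verit) dist_triangle dist_commute)
    moreover have "ball z (3 * r) \<subseteq> ball z e \<inter> U" using e' by (auto simp: r_def)
    ultimately show ?thesis by blast
  qed
  have "norm (deriv (u j k) x) \<le> (C / r) * B ^ nat \<bar>j\<bar>" if "x \<in> ball z r" for j k x
  proof -
    have h: "u j k holomorphic_on cball x r"
      using u sub[OF that] by (auto simp: holo_family_def intro: holomorphic_on_subset)
    have "norm ((deriv ^^ 1) (u j k) x) \<le> fact 1 * (C * B ^ nat \<bar>j\<bar>) / r ^ 1"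
    proof (rule Cauchy_inequality[OF _ _ r])
      show "u j k holomorphic_on ball x r" using h by (rule holomorphic_on_subset) auto
      show "continuous_on (cball x r) (u j k)" using h by (rule holomorphic_on_imp_continuous_on)
      show "norm (u j k y) \<le> C * B ^ nat \<bar>j\<bar>" if "norm (x - y) = r" for y
        using e(4)[of y] sub[OF \<open>x \<in> ball z r\<close>] that by (auto simp: subset_iff dist_norm)
    qed
    then show ?thesis by simp
  qed
  then show "\<exists>e>0. \<exists>C\<ge>0. \<exists>B\<ge>0. \<forall>j k. \<forall>x\<in>ball z e. norm (deriv (u j k) x) \<le> C * B ^ nat \<bar>j\<bar>"
    using r e by (intro exI[of _ r] conjI exI[of _ "C / r"] exI[of _ B]) auto
qed

lemma holo_family_cmult:
  assumes "holo_family U u"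
  shows "holo_family U (\<lambda>j k z. c * u j k z)"
  unfolding holo_family_def
proof (intro conjI allI ballI)
  show "(\<lambda>z. c * u j k z) holomorphic_on U" for j k
    using assms by (auto simp: holo_family_def intro!: holomorphic_intros)
  fix z assume z: "z \<in> U"
  obtain e C B where e: "0 < e" "0 \<le> C" "0 \<le> B" "\<And>j k x. x \<in> ball z e \<Longrightarrow> norm (u j k x) \<le> C * B ^ nat \<bar>j\<bar>"
    using assms z unfolding holo_family_def by meson
  then show "\<exists>e>0. \<exists>C\<ge>0. \<exists>B\<ge>0. \<forall>j k. \<forall>x\<in>ball z e. norm (c * u j k x) \<le> C * B ^ nat \<bar>j\<bar>"
    by (intro exI[of _ e] conjI exI[of _ "norm c * C"] exI[of _ B])
      (auto simp: norm_mult mult.assoc intro!: mult_left_mono)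
qed

text \<open>The partial derivative in direction \<open>i\<close> of $G(y)/|y|^N$ is $(|y|^2\partial_iG(y)-N y_iG(y))/|y|^{N+2}$.\<close>

definition ydiff :: "nat \<Rightarrow> 'n \<Rightarrow> (real ^ 'n::{finite,linorder} \<Rightarrow> 'n clif) \<Rightarrow> (real, 'n) vec \<Rightarrow> 'n clif" where
  "ydiff N i G y = (norm y)\<^sup>2 *\<^sub>R pdiff G i y - (real N * y $ i) *\<^sub>R G y"

lemma hom_poly_ydiff:
  assumes G: "hom_poly d G"
  shows "hom_poly (Suc d) (ydiff N i G)"
proof -
  have "hom_poly (Suc d) (\<lambda>y. (norm y)\<^sup>2 *\<^sub>R pdiff G i y)"
  proof (cases d)
    case 0
    then show ?thesis using G by (simp add: hom_poly_0_pdiff hom_poly_zero)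
  next
    case (Suc l)
    have "hom_poly (Suc (Suc l)) (\<lambda>y. \<Sum>m\<in>UNIV. y $ m *\<^sub>R (y $ m *\<^sub>R pdiff G i y))"
      using G Suc by (intro hom_poly_sum hom_poly_coord hom_poly_pdiff) simp
    moreover have "(norm y)\<^sup>2 *\<^sub>R pdiff G i y = (\<Sum>m\<in>UNIV. y $ m *\<^sub>R (y $ m *\<^sub>R pdiff G i y))" for y
      by (simp add: power2_norm_eq_inner inner_vec_def scaleR_sum_left)
    ultimately show ?thesis using Suc by simp
  qed
  moreover have "hom_poly (Suc d) (\<lambda>y. real N *\<^sub>R (y $ i *\<^sub>R G y))"
    by (intro hom_poly_scaleR hom_poly_coord G)
  ultimately show ?thesis
    unfolding ydiff_def[abs_def] using hom_poly_diff[of "Suc d"] by simp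
qed

text \<open>The Markov inequality costs a factor (k + 1)^2, which is paid for by using the decay of
  order \<open>m + 2\<close>.\<close>

lemma rapid_family_ydiff:
  fixes G :: "nat \<Rightarrow> int \<Rightarrow> real ^ 'n::{finite,linorder} \<Rightarrow> 'n clif"
  assumes G: "rapid_family t G"
  shows "rapid_family (Suc t) (\<lambda>k j. ydiff (s + (k + t)) i (G k j))"
  unfolding rapid_family_def
proof (intro conjI allI impI)
  have hG: "hom_poly (k + t) (G k j)" for k j using G by (simp add: rapid_family_def)
  show "hom_poly (k + Suc t) (ydiff (s + (k + t)) i (G k j))" for k j
    using hom_poly_ydiff[OF hG] by simp
  fix m :: nat and a :: real assume a: "0 < a"
  obtain C where C: "0 < C" "\<And>k j w. norm w = 1 \<Longrightarrow> norm (G k j w) \<le> C * a ^ nat \<bar>j\<bar> / (real k + 1) ^ (m + 2)"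
    using G a unfolding rapid_family_def by metis
  define K where "K = 2 * (real t + 1)\<^sup>2 + real s + real t + 1"
  have "norm (ydiff (s + (k + t)) i (G k j) w) \<le> (K * C) * a ^ nat \<bar>j\<bar> / (real k + 1) ^ m"
    if w: "norm w = 1" for k j and w :: "(real, 'n) vec"
  proof -
    define M where "M = C * a ^ nat \<bar>j\<bar> / (real k + 1) ^ (m + 2)"
    have M0: "0 \<le> M" using C a by (simp add: M_def)
    have "norm (pdiff (G k j) i w) \<le> 2 * (real (k + t) + 1)\<^sup>2 * M"
      using markov_sphere[OF hG _ w] C(2) unfolding M_def by blast
    also have "\<dots> \<le> 2 * ((real k + 1) * (real t + 1))\<^sup>2 * M"
      using M0 by (intro mult_right_mono mult_left_mono power_mono) (auto simp: algebra_simps)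
    finally have 1: "norm (pdiff (G k j) i w) \<le> 2 * ((real k + 1) * (real t + 1))\<^sup>2 * M" .
    have "norm ((real (s + (k + t)) * w $ i) *\<^sub>R G k j w) \<le> (real (s + (k + t)) * 1) * M"
      unfolding norm_scaleR abs_mult using C(2)[OF w, of k j] component_le_norm_cart[of w i] w M0
      by (intro mult_mono) (auto simp: M_def)
    also have "\<dots> \<le> ((real s + real t + 1) * (real k + 1)\<^sup>2) * M"
    proof (rule mult_right_mono[OF _ M0])
      have "real (s + (k + t)) \<le> (real s + real t + 1) * (real k + 1)" by (simp add: algebra_simps)
      also have "\<dots> \<le> (real s + real t + 1) * (real k + 1)\<^sup>2"
        by (intro mult_left_mono) (auto simp: power2_eq_square algebra_simps)
      finally show "real (s + (k + t)) * 1 \<le> (real s + real t + 1) * (real k + 1)\<^sup>2" by simp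
    qed
    finally have 2: "norm ((real (s + (k + t)) * w $ i) *\<^sub>R G k j w) \<le> ((real s + real t + 1) * (real k + 1)\<^sup>2) * M" .
    have "norm (ydiff (s + (k + t)) i (G k j) w)
        \<le> norm (pdiff (G k j) i w) + norm ((real (s + (k + t)) * w $ i) *\<^sub>R G k j w)"
      unfolding ydiff_def w power_one scaleR_one by (rule norm_triangle_ineq4)
    also have "\<dots> \<le> 2 * ((real k + 1) * (real t + 1))\<^sup>2 * M + ((real s + real t + 1) * (real k + 1)\<^sup>2) * M"
      using 1 2 by (rule add_mono)
    also have "\<dots> = K * (real k + 1)\<^sup>2 * M" by (simp only: K_def power_mult_distrib) (simp add: algebra_simps)
    also have "\<dots> = (K * C) * a ^ nat \<bar>j\<bar> / (real k + 1) ^ m"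
      by (simp add: M_def power_add power2_eq_square)
    finally show ?thesis .
  qed
  moreover have "0 < K * C" using C by (intro mult_pos_pos) (auto simp: K_def add_nonneg_pos)
  ultimately show "\<exists>C>0. \<forall>k j w. norm w = 1 \<longrightarrow>
      norm (ydiff (s + (k + t)) i (G k j) w) \<le> C * a ^ nat \<bar>j\<bar> / (real k + 1) ^ m" by blast
qed

text \<open>When \<open>N\<close> is \<open>s\<close> plus the degree of \<open>G\<close>, this
  extension of \<open>G\<close> from the sphere is homogeneous of degree -s, so its size near the
  sphere is controlled uniformly in k. The polynomial alone would scale like |y|^k, which decay
  faster than every power of k cannot absorb.\<close>

definition yterm :: "nat \<Rightarrow> (real ^ 'n::{finite,linorder} \<Rightarrow> 'n clif) \<Rightarrow> (real, 'n) vec \<Rightarrow> 'n clif" where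
  "yterm N G y = (1 / norm y ^ N) *\<^sub>R G y"

lemma has_derivative_yterm:
  fixes y :: "real ^ 'n::{finite,linorder}"
  assumes G: "hom_poly d G" and y: "y \<noteq> 0"
  shows "(yterm N G has_derivative (\<lambda>v. \<Sum>i\<in>UNIV. v $ i *\<^sub>R yterm (Suc (Suc N)) (ydiff N i G) y)) (at y)"
proof -
  let ?D = "frechet_derivative G (at y)"
  have D: "(G has_derivative ?D) (at y)"
    using hom_poly_differentiable[OF G] frechet_derivative_works by blast
  have lin: "linear ?D" using hom_poly_differentiable[OF G] by (rule linear_frechet_derivative)
  have n: "((\<lambda>x. norm x) has_derivative (\<lambda>h. inner h (sgn y))) (at y)"
    using has_derivative_norm[OF y] by simp
  have p: "((\<lambda>y. 1 / norm y ^ N) has_derivative (\<lambda>h. - (real N * inner y h) / norm y ^ Suc (Suc N))) (at y)"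
  proof (cases N)
    case (Suc M)
    have "((\<lambda>y. 1 / norm y ^ N) has_derivative (\<lambda>h. - (real N * (inner h (sgn y) * norm y ^ (N - 1))) / (norm y ^ N * norm y ^ N))) (at y)"
      using y by (auto intro!: derivative_eq_intros n simp: fun_eq_iff)
    moreover have "real N * (inner h (sgn y) * norm y ^ (N - 1)) / (norm y ^ N * norm y ^ N) = real N * inner y h / norm y ^ Suc (Suc N)" for h
      using y by (simp add: Suc sgn_div_norm inner_commute divide_simps)
    ultimately show ?thesis by simp
  qed simp
  have "(yterm N G has_derivative (\<lambda>v. (1 / norm y ^ N) *\<^sub>R ?D v + (- (real N * inner y v) / norm y ^ Suc (Suc N)) *\<^sub>R G y)) (at y)"
    unfolding yterm_def[abs_def] by (rule has_derivative_scaleR[OF p D])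
  moreover have "(1 / norm y ^ N) *\<^sub>R ?D v + (- (real N * inner y v) / norm y ^ Suc (Suc N)) *\<^sub>R G y
      = (\<Sum>i\<in>UNIV. v $ i *\<^sub>R yterm (Suc (Suc N)) (ydiff N i G) y)" for v
  proof -
    have "?D v = ?D (\<Sum>i\<in>UNIV. v $ i *\<^sub>R axis i 1)"
      using basis_expansion[of v] by (simp add: scalar_mult_eq_scaleR)
    then have Dv: "?D v = (\<Sum>i\<in>UNIV. v $ i *\<^sub>R pdiff G i y)"
      by (simp add: linear_sum[OF lin] linear_scale[OF lin] pdiff_def)
    have "yterm (Suc (Suc N)) (ydiff N i G) y = (1 / norm y ^ N) *\<^sub>R pdiff G i y
        - (real N * y $ i / norm y ^ Suc (Suc N)) *\<^sub>R G y" for i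
      using y by (simp add: yterm_def ydiff_def scaleR_diff_right power2_eq_square)
    then show ?thesis
      by (simp add: Dv scaleR_sum_right scaleR_diff_right sum_subtractf inner_vec_def mult_ac
          scaleR_sum_left[symmetric] sum_distrib_left sum_divide_distrib)
  qed
  ultimately show ?thesis by simp
qed

lemma norm_yterm_le:
  assumes G: "hom_poly d G" and M: "\<And>w. norm w = 1 \<Longrightarrow> norm (G w) \<le> M" and y: "0 < \<rho>" "\<rho> \<le> norm y"
  shows "norm (yterm (s + d) G y) \<le> M / \<rho> ^ s"
proof -
  have y0: "0 < norm y" using y by linarith
  define w where "w = (1 / norm y) *\<^sub>R y"
  have w: "norm w = 1" "y = norm y *\<^sub>R w" using y0 by (auto simp: w_def)
  have "norm (G y) = norm y ^ d * norm (G w)"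
    by (subst w(2)) (simp add: hom_poly_scale_arg[OF G])
  then have "norm (yterm (s + d) G y) = norm (G w) / norm y ^ s"
    using y0 by (simp add: yterm_def power_add)
  also have "\<dots> \<le> M / \<rho> ^ s"
    using M[OF w(1)] y y0 by (intro frac_le power_mono) (auto intro: order_trans[OF norm_ge_zero])
  finally show ?thesis .
qed

text \<open>Only the real part of the complex factor occurs, so that a term is a real multiple of a
  function of \<open>y\<close> and the class is closed under all partial derivatives. The imaginary
  part enters through a second series, with factor -i u and polynomials x P.\<close>

definition fterm :: "(int \<Rightarrow> nat \<Rightarrow> complex \<Rightarrow> complex) \<Rightarrow> (nat \<Rightarrow> int \<Rightarrow> real ^ 'n::{finite,linorder} \<Rightarrow> 'n clif)
    \<Rightarrow> nat \<Rightarrow> nat \<Rightarrow> nat \<Rightarrow> real \<times> real \<times> (real, 'n) vec \<Rightarrow> 'n clif" where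
  "fterm u G s t n = (\<lambda>(x0, p, y). case enum_jk n of (j, k) \<Rightarrow>
     Re (u j k (Complex x0 p)) *\<^sub>R yterm (s + (k + t)) (G k j) y)"

definition fdom :: "complex set \<Rightarrow> (real \<times> real \<times> (real ^ 'n)) set" where
  "fdom U = {(x0, p, y). Complex x0 p \<in> U \<and> y \<noteq> 0}"

lemma continuous_on_Complex [continuous_intros]:
  "continuous_on S f \<Longrightarrow> continuous_on S g \<Longrightarrow> continuous_on S (\<lambda>x. Complex (f x) (g x))"
  unfolding Complex_eq by (intro continuous_intros)

lemma open_fdom: "open U \<Longrightarrow> open (fdom U :: (real \<times> real \<times> (real ^ 'n)) set)"
proof -
  assume U: "open U"
  have "fdom U = (\<lambda>z::real \<times> real \<times> (real ^ 'n). Complex (fst z) (fst (snd z))) -` U \<inter> {z. snd (snd z) \<noteq> 0}"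
    by (auto simp: fdom_def)
  also have "open \<dots>"
    by (intro open_Int open_vimage[OF U] open_Collect_neq continuous_intros)
  finally show ?thesis .
qed

lemma loc_summable_fterm:
  fixes G :: "nat \<Rightarrow> int \<Rightarrow> real ^ 'n::{finite,linorder} \<Rightarrow> 'n clif"
  assumes u: "holo_family U u" and G: "rapid_family t G"
  shows "loc_summable (fdom U) (fterm u G s t)"
  unfolding loc_summable_def
proof
  fix z0 :: "real \<times> real \<times> (real, 'n) vec" assume "z0 \<in> fdom U"
  then obtain x0 p y where z0: "z0 = (x0, p, y)" and c: "Complex x0 p \<in> U" and y: "y \<noteq> 0"
    by (auto simp: fdom_def)
  obtain e C B where e: "0 < e" "0 \<le> C" "0 \<le> B"
    "\<And>j k x. x \<in> ball (Complex x0 p) e \<Longrightarrow> norm (u j k x) \<le> C * B ^ nat \<bar>j\<bar>"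
    using u c unfolding holo_family_def by meson
  \<comment> \<open>Makes B a at most 1/2, so that growth times decay in j is dominated by the
    geometric factor of \<open>wt\<close>.\<close>
  define a where "a = 1 / (2 * (B + 1))"
  have a: "0 < a" "B * a \<le> 1/2" using e(3) by (auto simp: a_def field_simps)
  obtain C' where C': "0 < C'" "\<And>k j w. norm w = 1 \<Longrightarrow> norm (G k j w) \<le> C' * a ^ nat \<bar>j\<bar> / (real k + 1)\<^sup>2"
    using G a(1) unfolding rapid_family_def by metis
  define \<rho> where "\<rho> = norm y / 2"
  have \<rho>: "0 < \<rho>" using y by (simp add: \<rho>_def)
  define K where "K = C * C' / \<rho> ^ s"
  have K: "0 \<le> K" using e C' \<rho> by (simp add: K_def)
  have bound: "norm (fterm u G s t n z) \<le> K * wt (enum_jk n)" if z: "z \<in> ball z0 (min (e / 2) \<rho>)" for z n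
  proof -
    obtain x1 q v where zz: "z = (x1, q, v)" by (cases z)
    obtain j k where jk: "enum_jk n = (j, k)" by (cases "enum_jk n")
    have d: "dist x0 x1 < e / 2" "dist p q < e / 2" "dist y v < \<rho>"
      using z dist_fst_le[of z0 z] dist_snd_le[of z0 z] dist_fst_le[of "snd z0" "snd z"] dist_snd_le[of "snd z0" "snd z"]
      by (auto simp: z0 zz)
    have "dist (Complex x0 p) (Complex x1 q) \<le> \<bar>x0 - x1\<bar> + \<bar>p - q\<bar>"
      using cmod_le[of "Complex x0 p - Complex x1 q"] by (simp add: dist_norm)
    then have "Complex x1 q \<in> ball (Complex x0 p) e" using d by (simp add: dist_real_def)
    then have 1: "norm (u j k (Complex x1 q)) \<le> C * B ^ nat \<bar>j\<bar>" by (rule e(4))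
    have "norm y \<le> norm v + dist y v" by (metis dist_norm norm_triangle_sub)
    then have v: "\<rho> \<le> norm v" using d(3) by (simp add: \<rho>_def)
    have 2: "norm (yterm (s + (k + t)) (G k j) v) \<le> (C' * a ^ nat \<bar>j\<bar> / (real k + 1)\<^sup>2) / \<rho> ^ s"
      using G C'(2) v \<rho> by (intro norm_yterm_le) (auto simp: rapid_family_def)
    have "norm (fterm u G s t n z) = \<bar>Re (u j k (Complex x1 q))\<bar> * norm (yterm (s + (k + t)) (G k j) v)"
      by (simp add: fterm_def zz jk)
    also have "\<dots> \<le> (C * B ^ nat \<bar>j\<bar>) * ((C' * a ^ nat \<bar>j\<bar> / (real k + 1)\<^sup>2) / \<rho> ^ s)"
      using 1 2 abs_Re_le_cmod[of "u j k (Complex x1 q)"] e by (intro mult_mono) auto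
    also have "\<dots> = K * ((B * a) ^ nat \<bar>j\<bar> / (real k + 1)\<^sup>2)" by (simp add: K_def power_mult_distrib mult_ac)
    also have "\<dots> \<le> K * ((1/2) ^ nat \<bar>j\<bar> / (real k + 1)\<^sup>2)"
      using K a e by (intro mult_left_mono divide_right_mono power_mono) auto
    finally show ?thesis by (simp add: wt_def jk)
  qed
  then show "\<exists>e>0. \<exists>M. summable M \<and> (\<forall>z\<in>ball z0 e. \<forall>n. norm (fterm u G s t n z) \<le> M n)"
    using e(1) \<rho> summable_mult[OF summable_wt]
    by (intro exI[of _ "min (e / 2) \<rho>"] conjI exI[of _ "\<lambda>n. K * wt (enum_jk n)"]) auto
qed

definition fder :: "(int \<Rightarrow> nat \<Rightarrow> complex \<Rightarrow> complex) \<Rightarrow> (nat \<Rightarrow> int \<Rightarrow> real ^ 'n::{finite,linorder} \<Rightarrow> 'n clif)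
    \<Rightarrow> nat \<Rightarrow> nat \<Rightarrow> nat \<Rightarrow> real \<times> real \<times> (real, 'n) vec \<Rightarrow> real \<times> real \<times> (real, 'n) vec \<Rightarrow> 'n clif" where
  "fder u G s t n = (\<lambda>(x0, p, y) (v0, vp, v). case enum_jk n of (j, k) \<Rightarrow>
     Re (u j k (Complex x0 p)) *\<^sub>R (\<Sum>i\<in>UNIV. v $ i *\<^sub>R yterm (Suc (Suc (s + (k + t)))) (ydiff (s + (k + t)) i (G k j)) y)
     + Re (deriv (u j k) (Complex x0 p) * Complex v0 vp) *\<^sub>R yterm (s + (k + t)) (G k j) y)"

lemma has_derivative_fterm:
  fixes G :: "nat \<Rightarrow> int \<Rightarrow> real ^ 'n::{finite,linorder} \<Rightarrow> 'n clif"
  assumes U: "open U" and u: "holo_family U u" and G: "rapid_family t G" and z: "z \<in> fdom U"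
  shows "(fterm u G s t n has_derivative fder u G s t n z) (at z)"
proof -
  obtain x0 p y where z': "z = (x0, p, y)" and c: "Complex x0 p \<in> U" and y: "y \<noteq> 0"
    using z by (auto simp: fdom_def)
  obtain j k where jk: "enum_jk n = (j, k)" by (cases "enum_jk n")
  let ?N = "s + (k + t)"
  let ?C = "\<lambda>v::real \<times> real \<times> (real, 'n) vec. Complex (fst v) (fst (snd v))"
  have C: "(?C has_derivative ?C) (at z)"
    unfolding Complex_eq by (auto intro!: derivative_eq_intros)
  have "(u j k has_field_derivative deriv (u j k) (?C z)) (at (?C z))"
    using u U c by (auto simp: holo_family_def z' intro: holomorphic_derivI)
  then have "((\<lambda>z. u j k (?C z)) has_derivative (\<lambda>v. deriv (u j k) (?C z) * ?C v)) (at z)"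
    unfolding has_field_derivative_def by (rule has_derivative_compose[OF C])
  then have 1: "((\<lambda>z. Re (u j k (?C z))) has_derivative (\<lambda>v. Re (deriv (u j k) (?C z) * ?C v))) (at z)"
    by (rule bounded_linear.has_derivative[OF bounded_linear_Re])
  have hG: "hom_poly (k + t) (G k j)" using G by (simp add: rapid_family_def)
  have "((\<lambda>z::real \<times> real \<times> (real, 'n) vec. snd (snd z)) has_derivative (\<lambda>v. snd (snd v))) (at z)"
    by (auto intro!: derivative_eq_intros)
  moreover have "(yterm ?N (G k j) has_derivative (\<lambda>v. \<Sum>i\<in>UNIV. v $ i *\<^sub>R yterm (Suc (Suc ?N)) (ydiff ?N i (G k j)) (snd (snd z)))) (at (snd (snd z)))"
    using has_derivative_yterm[OF hG y] by (simp add: z')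
  ultimately have 2: "((\<lambda>z::real \<times> real \<times> (real, 'n) vec. yterm ?N (G k j) (snd (snd z))) has_derivative
      (\<lambda>v. \<Sum>i\<in>UNIV. snd (snd v) $ i *\<^sub>R yterm (Suc (Suc ?N)) (ydiff ?N i (G k j)) (snd (snd z)))) (at z)"
    by (rule has_derivative_compose)
  have "fterm u G s t n = (\<lambda>z. Re (u j k (?C z)) *\<^sub>R yterm ?N (G k j) (snd (snd z)))"
    by (auto simp: fterm_def jk fun_eq_iff)
  moreover have "fder u G s t n z = (\<lambda>v. Re (u j k (?C z)) *\<^sub>R (\<Sum>i\<in>UNIV. snd (snd v) $ i *\<^sub>R yterm (Suc (Suc ?N)) (ydiff ?N i (G k j)) (snd (snd z)))
      + Re (deriv (u j k) (?C z) * ?C v) *\<^sub>R yterm ?N (G k j) (snd (snd z)))"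
    by (auto simp: fder_def jk z' fun_eq_iff)
  ultimately show ?thesis using has_derivative_scaleR[OF 1 2] by simp
qed

lemma Basis_domain_cases:
  fixes b :: "real \<times> real \<times> (real ^ 'n)"
  assumes "b \<in> Basis"
  obtains "b = (1, 0, 0)" | "b = (0, 1, 0)" | i where "b = (0, 0, axis i 1)"
proof -
  have "b = (1, 0, 0) \<or> b = (0, 1, 0) \<or> (\<exists>i. b = (0, 0, axis i 1))"
    using assms by (auto simp: Basis_prod_def Basis_vec_def zero_prod_def)
  then show ?thesis using that by blast
qed

text \<open>Partial derivatives of a term are terms of the same kind: the two scalar directions act
  on \<open>u\<close> through its complex derivative, a sphere direction acts through
  \<open>ydiff\<close> and raises \<open>s\<close> and \<open>t\<close> by one each.\<close>

lemma fder_Basis: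
  "(\<lambda>n z. fder u G s t n z (1, 0, 0)) = fterm (\<lambda>j k. deriv (u j k)) G s t"
  "(\<lambda>n z. fder u G s t n z (0, 1, 0)) = fterm (\<lambda>j k z. \<i> * deriv (u j k) z) G s t"
  "(\<lambda>n z. fder u G s t n z (0, 0, axis i 1)) = fterm u (\<lambda>k j. ydiff (s + (k + t)) i (G k j)) (Suc s) (Suc t)"
proof -
  have c: "Complex 1 0 = 1" "Complex 0 0 = 0" "Complex 0 1 = \<i>" by (auto simp: complex_eq_iff)
  show "(\<lambda>n z. fder u G s t n z (1, 0, 0)) = fterm (\<lambda>j k. deriv (u j k)) G s t"
    "(\<lambda>n z. fder u G s t n z (0, 1, 0)) = fterm (\<lambda>j k z. \<i> * deriv (u j k) z) G s t"
    by (auto simp: fun_eq_iff fder_def fterm_def c mult.commute split: prod.split)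
  have "(\<Sum>l\<in>UNIV. axis i (1::real) $ l *\<^sub>R h l) = h i" for h :: "'a \<Rightarrow> 'a clif"
    by (simp add: axis_def if_distrib if_distribR cong: if_cong)
  then show "(\<lambda>n z. fder u G s t n z (0, 0, axis i 1)) = fterm u (\<lambda>k j. ydiff (s + (k + t)) i (G k j)) (Suc s) (Suc t)"
    by (auto simp: fun_eq_iff fder_def fterm_def c split: prod.split)
qed

lemma loc_summable_fder:
  fixes G :: "nat \<Rightarrow> int \<Rightarrow> real ^ 'n::{finite,linorder} \<Rightarrow> 'n clif"
  assumes U: "open U" and u: "holo_family U u" and G: "rapid_family t G" and b: "b \<in> Basis"
  shows "\<exists>u' G' s' t'. holo_family U u' \<and> rapid_family t' G' \<and> (\<lambda>n z. fder u G s t n z b) = fterm u' G' s' t'"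
  using b
proof (cases rule: Basis_domain_cases)
  case 1
  then show ?thesis using fder_Basis(1) holo_family_deriv[OF U u] G by blast
next
  case 2
  then show ?thesis using fder_Basis(2) holo_family_cmult[OF holo_family_deriv[OF U u]] G by blast
next
  case (3 i)
  then show ?thesis using fder_Basis(3) rapid_family_ydiff[OF G] u by blast
qed

lemma smooth_on_fterm_sum:
  fixes G :: "nat \<Rightarrow> int \<Rightarrow> real ^ 'n::{finite,linorder} \<Rightarrow> 'n clif"
  assumes U: "open U" and u: "holo_family U u" and G: "rapid_family t G"
  shows "smooth_on (fdom U) (\<lambda>z. \<Sum>n. fterm u G s t n z)"
proof (rule series_smooth[where \<C>="\<lambda>f. \<exists>u G s t. holo_family U u \<and> rapid_family t G \<and> f = fterm u G s t"])
  show "open (fdom U :: (real \<times> real \<times> (real, 'n) vec) set)" using U by (rule open_fdom)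
next
  fix f :: "nat \<Rightarrow> real \<times> real \<times> (real, 'n) vec \<Rightarrow> 'n clif"
  assume "\<exists>u G s t. holo_family U u \<and> rapid_family t G \<and> f = fterm u G s t"
  then obtain u G s t where f: "holo_family U u" "rapid_family t G" "f = fterm u G s t" by blast
  then show "loc_summable (fdom U) f" by (simp add: loc_summable_fterm)
  show "\<exists>D. (\<forall>n. \<forall>x\<in>fdom U. (f n has_derivative D n x) (at x)) \<and>
      (\<forall>b\<in>Basis. \<exists>u G s t. holo_family U u \<and> rapid_family t G \<and> (\<lambda>n x. D n x b) = fterm u G s t)"
    using has_derivative_fterm[OF U f(1,2)] loc_summable_fder[OF U f(1,2)] unfolding f(3)
    by (intro exI[of _ "fder u G s t"]) blast
next
  show "\<exists>u' G' s' t'. holo_family U u' \<and> rapid_family t' G' \<and> fterm u G s t = fterm u' G' s' t'"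
    by (intro exI conjI) (rule u, rule G, rule refl)
qed

lemma fterm_sum_partial:
  fixes G :: "nat \<Rightarrow> int \<Rightarrow> real ^ 'n::{finite,linorder} \<Rightarrow> 'n clif"
  assumes U: "open U" and u: "holo_family U u" and G: "rapid_family t G" and z: "(x0, p, y) \<in> fdom U"
  shows "((\<lambda>r. \<Sum>n. fterm u G s t n (r, p, y)) has_vector_derivative
      (\<Sum>n. fterm (\<lambda>j k. deriv (u j k)) G s t n (x0, p, y))) (at x0)" (is ?A)
    and "((\<lambda>r. \<Sum>n. fterm u G s t n (x0, r, y)) has_vector_derivative
      (\<Sum>n. fterm (\<lambda>j k z. \<i> * deriv (u j k) z) G s t n (x0, p, y))) (at p)" (is ?B)
proof -
  let ?D = "\<lambda>v. \<Sum>b\<in>Basis. inner v b *\<^sub>R (\<Sum>n. fder u G s t n (x0, p, y) b)"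
  have ls: "loc_summable (fdom U) (\<lambda>n z. fder u G s t n z b)" if b: "b \<in> Basis" for b
  proof -
    obtain u' G' s' t' where h: "holo_family U u'" "rapid_family t' G'" "(\<lambda>n z. fder u G s t n z b) = fterm u' G' s' t'"
      using loc_summable_fder[OF U u G b, of s] by blast
    show ?thesis unfolding h(3) by (rule loc_summable_fterm[OF h(1,2)])
  qed
  have D: "((\<lambda>z. \<Sum>n. fterm u G s t n z) has_derivative ?D) (at (x0, p, y))"
    by (rule series_has_derivative[OF open_fdom[OF U] has_derivative_fterm[OF U u G] loc_summable_fterm[OF u G] ls z])
  have DB: "?D b = (\<Sum>n. fder u G s t n (x0, p, y) b)" if "b \<in> Basis" for b
    using that by (simp add: inner_Basis if_distrib[of "\<lambda>c. c *\<^sub>R _"] if_distribR cong: if_cong)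
  have B: "(1, 0, 0) \<in> (Basis :: (real \<times> real \<times> (real, 'n) vec) set)" "(0, 1, 0) \<in> (Basis :: (real \<times> real \<times> (real, 'n) vec) set)"
    by (auto simp: Basis_prod_def zero_prod_def)
  have "((\<lambda>r. (r, p, y)) has_vector_derivative (1, 0, 0)) (at x0)"
    by (auto simp: has_vector_derivative_def zero_prod_def intro!: derivative_eq_intros)
  from vector_derivative_diff_chain_within[OF this, of "\<lambda>z. \<Sum>n. fterm u G s t n z" ?D] D
  have "((\<lambda>r. \<Sum>n. fterm u G s t n (r, p, y)) has_vector_derivative ?D (1, 0, 0)) (at x0)"
    by (simp add: o_def has_derivative_at_withinI)
  then show ?A unfolding DB[OF B(1)] fder_Basis(1)[THEN fun_cong, THEN fun_cong] .
  have "((\<lambda>r. (x0, r, y)) has_vector_derivative (0, 1, 0)) (at p)"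
    by (auto simp: has_vector_derivative_def zero_prod_def intro!: derivative_eq_intros)
  from vector_derivative_diff_chain_within[OF this, of "\<lambda>z. \<Sum>n. fterm u G s t n z" ?D] D
  have "((\<lambda>r. \<Sum>n. fterm u G s t n (x0, r, y)) has_vector_derivative ?D (0, 1, 0)) (at p)"
    by (simp add: o_def has_derivative_at_withinI)
  then show ?B unfolding DB[OF B(2)] fder_Basis(2)[THEN fun_cong, THEN fun_cong] .
qed

section \<open>From real series to slice monogenic functions\<close>

lemma rapid_family_vmul: "rapid_family 0 P \<Longrightarrow> rapid_family 1 (\<lambda>k j. vmul (P k j))"
  unfolding rapid_family_def using hom_poly_vmul by (auto simp: vmul_def norm_cl_vec_mult)

definition eterm :: "(int \<Rightarrow> nat \<Rightarrow> complex \<Rightarrow> complex) \<Rightarrow> (nat \<Rightarrow> int \<Rightarrow> real ^ 'n::{finite,linorder} \<Rightarrow> 'n clif)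
    \<Rightarrow> real \<Rightarrow> real \<Rightarrow> (real, 'n) vec \<Rightarrow> int \<times> nat \<Rightarrow> 'n clif" where
  "eterm u P x0 p w = (\<lambda>(j, k). cact w (u j k (Complex x0 p)) (P k j w))"

text \<open>On the sphere the denominators are 1, and Re (-i u) = Im u recombines the two real
  series to the action of \<open>u\<close>.\<close>

lemma fterm_sphere:
  assumes "norm w = 1"
  shows "fterm u P 0 0 n (x0, p, w) + fterm (\<lambda>j k z. - \<i> * u j k z) (\<lambda>k j. vmul (P k j)) 0 1 n (x0, p, w)
    = eterm u P x0 p w (enum_jk n)"
  using assms by (auto simp: fterm_def yterm_def eterm_def cact_def vmul_def split: prod.split)

lemma summable_eterm:
  assumes u: "holo_family U u" and P: "rapid_family 0 P" and z: "Complex x0 p \<in> U" and w: "norm w = 1"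
  shows "summable (\<lambda>n. eterm u P x0 p w (enum_jk n))"
    and "(\<Sum>n. eterm u P x0 p w (enum_jk n)) = (\<Sum>n. fterm u P 0 0 n (x0, p, w))
      + (\<Sum>n. fterm (\<lambda>j k z. - \<i> * u j k z) (\<lambda>k j. vmul (P k j)) 0 1 n (x0, p, w))"
proof -
  have "(x0, p, w) \<in> fdom U" using z w by (auto simp: fdom_def)
  note s = loc_summable_summable[OF loc_summable_fterm[OF u P] this, of 0]
    loc_summable_summable[OF loc_summable_fterm[OF holo_family_cmult[OF u, of "- \<i>"] rapid_family_vmul[OF P]] this, of 0]
  show "summable (\<lambda>n. eterm u P x0 p w (enum_jk n))"
    using summable_add[OF s] by (simp only: fterm_sphere[OF w])
  show "(\<Sum>n. eterm u P x0 p w (enum_jk n)) = (\<Sum>n. fterm u P 0 0 n (x0, p, w))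
      + (\<Sum>n. fterm (\<lambda>j k z. - \<i> * u j k z) (\<lambda>k j. vmul (P k j)) 0 1 n (x0, p, w))"
    unfolding suminf_add[OF s] fterm_sphere[OF w] ..
qed

text \<open>The two real series together form a smooth extension to all nonzero \<open>y\<close>.
  Differentiation in p multiplies the complex derivative of each factor by i, and omega times the
  action of i is -1, which is the slice equation term by term.\<close>

lemma expansion_slice_monogenic:
  fixes P :: "nat \<Rightarrow> int \<Rightarrow> real ^ 'n::{finite,linorder} \<Rightarrow> 'n clif"
  assumes U: "open U" and u: "holo_family U u" and P: "rapid_family 0 P"
    and f: "\<And>x0 p w. Complex x0 p \<in> U \<Longrightarrow> norm w = 1 \<Longrightarrow> f (x0, p, w) = (\<Sum>n. eterm u P x0 p w (enum_jk n))"
  shows "slice_monogenic {(x0, p). Complex x0 p \<in> U} f"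
proof -
  let ?u' = "\<lambda>j k z. - \<i> * u j k z" and ?P' = "\<lambda>k j. vmul (P k j)"
  define F where "F z = (\<Sum>n. fterm u P 0 0 n z) + (\<Sum>n. fterm ?u' ?P' 0 1 n z)" for z
  have u': "holo_family U ?u'" using u by (rule holo_family_cmult)
  have P': "rapid_family 1 ?P'" using P by (rule rapid_family_vmul)
  have oU: "open {(x0, p). Complex x0 p \<in> U}"
  proof -
    have "{(x0, p). Complex x0 p \<in> U} = (\<lambda>z. Complex (fst z) (snd z)) -` U" by auto
    moreover have "continuous_on UNIV (\<lambda>z::real \<times> real. Complex (fst z) (snd z))" by (intro continuous_intros)
    ultimately show ?thesis using open_vimage[OF U] by simp
  qed
  have fF: "F z = f z" if "z \<in> sdom {(x0, p). Complex x0 p \<in> U}" for z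
    using that f summable_eterm(2)[OF u P] by (auto simp: sdom_def F_def)
  have "smooth_on (fdom U) F"
    unfolding F_def[abs_def] by (intro smooth_on_add open_fdom U smooth_on_fterm_sum u u' P P')
  moreover have "sdom {(x0, p). Complex x0 p \<in> U} \<subseteq> (fdom U :: (real \<times> real \<times> (real, 'n) vec) set)"
    by (auto simp: sdom_def fdom_def)
  ultimately have "smooth_on_sdom {(x0, p). Complex x0 p \<in> U} f"
    unfolding smooth_on_sdom_def using open_fdom[OF U] fF by blast
  moreover have "\<exists>D0 Dp. ((\<lambda>t. f (t, p, w)) has_vector_derivative D0) (at x0) \<and>
      ((\<lambda>t. f (x0, t, w)) has_vector_derivative Dp) (at p) \<and> (1/2) *\<^sub>R (D0 + cl_vec w \<star> Dp) = 0"
    if z: "Complex x0 p \<in> U" and w: "norm w = 1" for x0 p and w :: "(real, 'n) vec"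
  proof -
    have zf: "(x0, p, w) \<in> fdom U" using z w by (auto simp: fdom_def)
    let ?d = "\<lambda>j k. deriv (u j k)" and ?id = "\<lambda>j k z. \<i> * deriv (u j k) z"
    have d': "deriv (\<lambda>z. - \<i> * u j k z) (Complex x0 p) = - \<i> * deriv (u j k) (Complex x0 p)" for j k
      using u U z by (intro deriv_cmult) (auto simp: holo_family_def intro: holomorphic_on_imp_differentiable_at)
    have e1: "fterm (\<lambda>j k. deriv (\<lambda>z. - \<i> * u j k z)) ?P' 0 1 n (x0, p, w) = fterm (\<lambda>j k z. - \<i> * ?d j k z) ?P' 0 1 n (x0, p, w)" for n
      by (cases "enum_jk n") (simp only: fterm_def prod.case d')
    have e2: "fterm (\<lambda>j k z. \<i> * deriv (\<lambda>z. - \<i> * u j k z) z) ?P' 0 1 n (x0, p, w) = fterm (\<lambda>j k z. - \<i> * ?id j k z) ?P' 0 1 n (x0, p, w)" for n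
      by (cases "enum_jk n") (simp only: fterm_def prod.case d' mult.left_commute[of "\<i>"])
    define D0 where "D0 = (\<Sum>n. eterm ?d P x0 p w (enum_jk n))"
    define Dp where "Dp = (\<Sum>n. eterm ?id P x0 p w (enum_jk n))"
    have hd: "holo_family U ?d" by (rule holo_family_deriv[OF U u])
    have hid: "holo_family U ?id" by (rule holo_family_cmult[OF hd])
    have "((\<lambda>t. F (t, p, w)) has_vector_derivative D0) (at x0)"
      using has_vector_derivative_add[OF fterm_sum_partial(1)[OF U u P zf, of 0] fterm_sum_partial(1)[OF U u' P' zf, of 0]]
      unfolding F_def D0_def summable_eterm(2)[OF hd P z w] e1 .
    moreover have "open {t. Complex t p \<in> U}"
      using open_vimage[OF U continuous_on_Complex[OF continuous_on_id continuous_on_const, of _ p]] by (simp add: vimage_def)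
    ultimately have 0: "((\<lambda>t. f (t, p, w)) has_vector_derivative D0) (at x0)"
      by (rule has_vector_derivative_transform_within_open) (use z w fF in \<open>auto simp: sdom_def\<close>)
    have "((\<lambda>t. F (x0, t, w)) has_vector_derivative Dp) (at p)"
      using has_vector_derivative_add[OF fterm_sum_partial(2)[OF U u P zf, of 0] fterm_sum_partial(2)[OF U u' P' zf, of 0]]
      unfolding F_def Dp_def summable_eterm(2)[OF hid P z w] e2 .
    moreover have "open {t. Complex x0 t \<in> U}"
      using open_vimage[OF U continuous_on_Complex[OF continuous_on_const continuous_on_id, of _ x0]] by (simp add: vimage_def)
    ultimately have p: "((\<lambda>t. f (x0, t, w)) has_vector_derivative Dp) (at p)"
      by (rule has_vector_derivative_transform_within_open) (use z w fF in \<open>auto simp: sdom_def\<close>)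
    have "cl_vec w \<star> Dp = (\<Sum>n. cl_vec w \<star> eterm ?id P x0 p w (enum_jk n))"
      unfolding Dp_def by (rule bounded_linear.suminf[OF cl_mult.bounded_linear_right summable_eterm(1)[OF hid P z w]])
    also have "\<dots> = (\<Sum>n. - eterm ?d P x0 p w (enum_jk n))"
    proof -
      have "cl_vec w \<star> cact w (\<i> * c) x = - cact w c x" for c x
        unfolding cact_mult[OF w] cact_simps cl_vec_square by (simp add: w)
      then show ?thesis by (simp add: eterm_def split_def)
    qed
    also have "\<dots> = - D0" unfolding D0_def by (rule suminf_minus[OF summable_eterm(1)[OF hd P z w]])
    finally have "(1/2) *\<^sub>R (D0 + cl_vec w \<star> Dp) = 0" by simp
    with 0 p show ?thesis by blast
  qed
  ultimately show ?thesis unfolding slice_monogenic_def using oU by auto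
qed

section \<open>Laurent coefficients of slice monogenic functions\<close>

lemma continuous_on_cis [continuous_intros]: "continuous_on S f \<Longrightarrow> continuous_on S (\<lambda>x. cis (f x))"
  unfolding cis_conv_exp by (intro continuous_intros)

lemma bounded_linear_cact: "bounded_linear (cact w z)"
  by (rule bounded_bilinear.bounded_linear_right[OF bounded_bilinear_cact])

lemma has_vector_derivative_cis:
  "((\<lambda>\<theta>. cis (c * \<theta>)) has_vector_derivative (\<i> * of_real c * cis (c * \<theta>))) (at \<theta> within S)"
proof -
  have "((\<lambda>z. exp (\<i> * of_real c * z)) has_field_derivative \<i> * of_real c * exp (\<i> * of_real c * of_real \<theta>)) (at (of_real \<theta>))"
    by (auto intro!: derivative_eq_intros)
  from has_vector_derivative_real_field[OF this] show ?thesis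
    by (simp add: cis_conv_exp mult_ac has_vector_derivative_at_within)
qed

text \<open>In polar coordinates the slice equation reads $r\,\partial_r h=-\underline\omega\,\partial_\theta h$;
  hence the $j$-th Fourier coefficient $\varphi$ on the circle of radius $r$ satisfies $r\varphi'=j\varphi$.\<close>

lemma fc_scaling:
  fixes h E :: "real \<Rightarrow> real \<Rightarrow> 'n::{finite,linorder} clif"
  assumes w: "norm w = 1"
    and hr: "\<And>r \<theta>. 0 < r \<Longrightarrow> ((\<lambda>r. h r \<theta>) has_vector_derivative cact w (- \<i> * cis \<theta>) (E r \<theta>)) (at r)"
    and ht: "\<And>r \<theta>. 0 < r \<Longrightarrow> ((\<lambda>\<theta>. h r \<theta>) has_vector_derivative r *\<^sub>R cact w (cis \<theta>) (E r \<theta>)) (at \<theta>)"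
    and per: "\<And>r. 0 < r \<Longrightarrow> h r (2 * pi) = h r 0"
    and cE: "continuous_on ({0<..} \<times> UNIV) (\<lambda>(r, \<theta>). E r \<theta>)" and r: "0 < r"
  shows "fc w j (h r) = r powi j *\<^sub>R fc w j (h 1)"
proof -
  define c where "c \<theta> = cis (- (real_of_int j * \<theta>))" for \<theta>
  define I where "I r = integral {0..2 * pi} (\<lambda>\<theta>. cact w (c \<theta>) (h r \<theta>))" for r
  define K where "K r = integral {0..2 * pi} (\<lambda>\<theta>. cact w (c \<theta>) (cact w (cis \<theta>) (E r \<theta>)))" for r
  have cc: "continuous_on S c" for S unfolding c_def[abs_def] by (intro continuous_intros)
  have ch: "continuous_on S (h r)" if "0 < r" for r S
    using ht[OF that] has_vector_derivative_continuous by (intro continuous_at_imp_continuous_on) blast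
  have cEr: "continuous_on S (E r)" if "0 < r" for r S
    by (rule continuous_on_compose2[OF cE, of S "\<lambda>\<theta>. (r, \<theta>)", simplified]) (use that in \<open>auto intro!: continuous_intros\<close>)
  have Kint: "(\<lambda>\<theta>. cact w (c \<theta>) (cact w (cis \<theta>) (E r \<theta>))) integrable_on {0..2 * pi}" if "0 < r" for r
    by (intro integrable_continuous_real continuous_intros cc cEr that)
  have Iint: "(\<lambda>\<theta>. cact w (c \<theta>) (h r \<theta>)) integrable_on {0..2 * pi}" if "0 < r" for r
    by (intro integrable_continuous_real continuous_intros cc ch that)
  have dI: "(I has_vector_derivative cact w (- \<i>) (K r)) (at r)" if r: "0 < r" for r
  proof -
    have A: "((\<lambda>r. integral (cbox 0 (2 * pi)) (\<lambda>\<theta>. cact w (c \<theta>) (h r \<theta>))) has_vector_derivative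
        integral (cbox 0 (2 * pi)) (\<lambda>\<theta>. cact w (c \<theta>) (cact w (- \<i> * cis \<theta>) (E r \<theta>)))) (at r within {0<..})"
    proof (rule leibniz_rule_vector_derivative)
      show "((\<lambda>r. cact w (c \<theta>) (h r \<theta>)) has_vector_derivative cact w (c \<theta>) (cact w (- \<i> * cis \<theta>) (E r \<theta>))) (at r within {0<..})"
        if "r \<in> {0<..}" for r \<theta>
        using that by (intro bounded_linear.has_vector_derivative[OF bounded_linear_cact] has_vector_derivative_at_within[OF hr]) simp
      show "(\<lambda>\<theta>. cact w (c \<theta>) (h r \<theta>)) integrable_on cbox 0 (2 * pi)" if "r \<in> {0<..}" for r
        using Iint that by simp
      have "continuous_on ({0<..} \<times> cbox 0 (2 * pi)) (\<lambda>(r, \<theta>). E r \<theta>)"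
        by (rule continuous_on_subset[OF cE]) auto
      then show "continuous_on ({0<..} \<times> cbox 0 (2 * pi)) (\<lambda>(r, \<theta>). cact w (c \<theta>) (cact w (- \<i> * cis \<theta>) (E r \<theta>)))"
        unfolding split_def by (intro continuous_intros continuous_on_compose2[OF cc[of UNIV]]) auto
    qed (use r in auto)
    have B: "(\<lambda>\<theta>. cact w (c \<theta>) (cact w (- \<i> * cis \<theta>) (E r \<theta>)))
        = (\<lambda>\<theta>. cact w (- \<i>) (cact w (c \<theta>) (cact w (cis \<theta>) (E r \<theta>))))"
      by (simp add: cact_mult[OF w, symmetric] mult_ac)
    have C: "integral {0..2 * pi} (\<lambda>\<theta>. cact w (- \<i>) (cact w (c \<theta>) (cact w (cis \<theta>) (E r \<theta>)))) = cact w (- \<i>) (K r)"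
      unfolding K_def using integral_linear[OF Kint[OF r] bounded_linear_cact] by (simp add: o_def)
    have o: "at r within {0<..} = at r" using r by (intro at_within_open) auto
    show ?thesis using A unfolding B box_real C o I_def[abs_def] .
  qed
  \<comment> \<open>Integrating the angular derivative of the weighted function over a full period
    gives 0, which trades the angular derivative for the factor j.\<close>
  have parts: "cact w (- \<i> * of_int j) (I r) + r *\<^sub>R K r = 0" if r: "0 < r" for r
  proof -
    have "((\<lambda>\<theta>. cact w (- \<i> * of_int j) (cact w (c \<theta>) (h r \<theta>)) + r *\<^sub>R cact w (c \<theta>) (cact w (cis \<theta>) (E r \<theta>)))
        has_integral (cact w (c (2 * pi)) (h r (2 * pi)) - cact w (c 0) (h r 0))) {0..2 * pi}"
    proof (rule fundamental_theorem_of_calculus)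
      fix \<theta> :: real
      have "(c has_vector_derivative - \<i> * of_int j * c \<theta>) (at \<theta> within {0..2 * pi})"
        using has_vector_derivative_cis[of "- real_of_int j" \<theta>] by (simp add: c_def[abs_def])
      from bounded_bilinear.has_vector_derivative[OF bounded_bilinear_cact this has_vector_derivative_at_within[OF ht[OF r]], of w]
      show "((\<lambda>\<theta>. cact w (c \<theta>) (h r \<theta>)) has_vector_derivative
          cact w (- \<i> * of_int j) (cact w (c \<theta>) (h r \<theta>)) + r *\<^sub>R cact w (c \<theta>) (cact w (cis \<theta>) (E r \<theta>))) (at \<theta> within {0..2 * pi})"
        by (simp only: cact_mult[OF w] cact_simps add.commute)
    qed simp
    moreover have "c (2 * pi) = c 0"
      using cis_multiple_2pi[of "- real_of_int j"] by (simp add: c_def mult_ac)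
    ultimately have "((\<lambda>\<theta>. cact w (- \<i> * of_int j) (cact w (c \<theta>) (h r \<theta>)) + r *\<^sub>R cact w (c \<theta>) (cact w (cis \<theta>) (E r \<theta>)))
        has_integral 0) {0..2 * pi}"
      using per[OF r] by simp
    moreover have "((\<lambda>\<theta>. cact w (- \<i> * of_int j) (cact w (c \<theta>) (h r \<theta>)) + r *\<^sub>R cact w (c \<theta>) (cact w (cis \<theta>) (E r \<theta>)))
        has_integral (cact w (- \<i> * of_int j) (I r) + r *\<^sub>R K r)) {0..2 * pi}"
      unfolding I_def K_def
      using has_integral_add[OF has_integral_linear[OF integrable_integral[OF Iint[OF r]] bounded_linear_cact]
          has_integral_cmul[OF integrable_integral[OF Kint[OF r]]], of w "- \<i> * of_int j" r]
      by (simp add: o_def)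
    ultimately show ?thesis by (rule has_integral_unique[symmetric])
  qed
  have dI': "(I has_vector_derivative (real_of_int j / r) *\<^sub>R I r) (at r)" if r: "0 < r" for r
  proof -
    have rK: "r *\<^sub>R K r = cact w (\<i> * of_int j) (I r)"
      using parts[OF r] by (simp add: cact_simps add_eq_0_iff)
    have "K r = (1 / r) *\<^sub>R (r *\<^sub>R K r)" using r by simp
    then have "K r = (1 / r) *\<^sub>R cact w (\<i> * of_int j) (I r)" unfolding rK .
    then have "cact w (- \<i>) (K r) = (1 / r) *\<^sub>R cact w (- \<i> * (\<i> * of_int j)) (I r)"
      by (simp only: cact_simps cact_mult[OF w])
    also have "- \<i> * (\<i> * of_int j) = of_real (real_of_int j)" by (simp add: mult.assoc[symmetric])
    finally have "cact w (- \<i>) (K r) = (1 / r) *\<^sub>R (real_of_int j *\<^sub>R I r)" by (simp only: cact_simps)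
    with dI[OF r] show ?thesis by simp
  qed
  \<comment> \<open>The integrating factor r^(-j) for the equation r I' = j I; its product with
    \<open>I\<close> has derivative 0 and is constant on the half-line.\<close>
  define J where "J r = r powi (- j) *\<^sub>R I r" for r
  have dJ: "(J has_vector_derivative 0) (at r within {0<..})" if r: "0 < r" for r
  proof -
    have p: "((\<lambda>r. r powi (- j)) has_field_derivative (- real_of_int j * r powi (- j - 1))) (at r)"
      using r by (auto intro!: derivative_eq_intros)
    have "(J has_vector_derivative (r powi (- j) *\<^sub>R ((real_of_int j / r) *\<^sub>R I r) + (- real_of_int j * r powi (- j - 1)) *\<^sub>R I r)) (at r)"
      unfolding J_def[abs_def] by (rule has_vector_derivative_scaleR[OF p dI'[OF r]])
    moreover have "r powi (- j) * (real_of_int j / r) + (- real_of_int j * r powi (- j - 1)) = 0"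
      using r by (simp add: power_int_diff)
    then have "r powi (- j) *\<^sub>R ((real_of_int j / r) *\<^sub>R I r) + (- real_of_int j * r powi (- j - 1)) *\<^sub>R I r = 0"
      by (simp only: scaleR_scaleR scaleR_add_left[symmetric] scaleR_zero_left)
    ultimately show ?thesis by (simp only: has_vector_derivative_at_within)
  qed
  obtain k where "\<And>r. r \<in> {0<..} \<Longrightarrow> J r = k"
    using has_vector_derivative_zero_constant[of "{0<..}" J] dJ by auto
  then have "J r = J 1" using r by simp
  then have "r powi j *\<^sub>R J r = r powi j *\<^sub>R I 1" by (simp add: J_def)
  then have "I r = r powi j *\<^sub>R I 1"
    using r by (simp add: J_def power_int_minus)
  then show ?thesis by (simp add: fc_def I_def c_def)
qed

text \<open>Both polar derivatives are expressed through one function, the p-derivative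
  \<open>Dp\<close> of the smooth extension, since by the slice equation the x0-derivative is -omega
  times \<open>Dp\<close>.\<close>

lemma slice_monogenic_polar:
  fixes f :: "real \<times> real \<times> (real ^ 'n::{finite,linorder}) \<Rightarrow> 'n clif"
  assumes f: "slice_monogenic punct f" and w: "norm w = 1" and r: "0 < r"
  shows "fc w j (\<lambda>\<theta>. f (r * cos \<theta>, r * sin \<theta>, w)) = r powi j *\<^sub>R fc w j (\<lambda>\<theta>. f (cos \<theta>, sin \<theta>, w))"
proof -
  obtain W F where W: "open W" "sdom punct \<subseteq> W" "smooth_on W F" and F: "\<And>z. z \<in> sdom punct \<Longrightarrow> F z = f z"
    using f unfolding slice_monogenic_def smooth_on_sdom_def by blast
  have inW: "(x0, p, w) \<in> sdom punct" "(x0, p, w) \<in> W" if "(x0, p) \<noteq> (0, 0)" for x0 p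
    using that W(2) w by (auto simp: sdom_def)
  let ?D = "\<lambda>x0 p. frechet_derivative F (at (x0, p, w))"
  define Dp where "Dp x0 p = ?D x0 p (0, 1, 0)" for x0 p
  have D: "(F has_derivative ?D x0 p) (at (x0, p, w))" if "(x0, p) \<noteq> (0, 0)" for x0 p
    by (rule smooth_on_has_derivative[OF W(3,1) inW(2)[OF that]])
  \<comment> \<open>Lines in the directions x0 and p remain in the domain near the point, so along
    them the extension and \<open>f\<close> have the same derivatives.\<close>
  have slice: "?D x0 p (1, 0, 0) = - (cl_vec w \<star> Dp x0 p)" if z: "(x0, p) \<noteq> (0, 0)" for x0 p
  proof -
    obtain D0 D1 where d: "((\<lambda>t. f (t, p, w)) has_vector_derivative D0) (at x0)"
      "((\<lambda>t. f (x0, t, w)) has_vector_derivative D1) (at p)" "(1/2) *\<^sub>R (D0 + cl_vec w \<star> D1) = 0"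
      using f[unfolded slice_monogenic_def, THEN conjunct2, THEN conjunct2, rule_format, of x0 p w] z w
      by (auto simp del: Diff_iff)
    have o: "open {t. (t, p) \<in> (punct :: (real \<times> real) set)}" "open {t. (x0, t) \<in> (punct :: (real \<times> real) set)}"
      by (cases "p = 0"; cases "x0 = 0"; auto intro: open_Collect_neq continuous_intros)+
    have "((\<lambda>t. (t, p, w)) has_vector_derivative (1, 0, 0)) (at x0)" "((\<lambda>t. (x0, t, w)) has_vector_derivative (0, 1, 0)) (at p)"
      by (auto simp: has_vector_derivative_def zero_prod_def intro!: derivative_eq_intros)
    then have "((\<lambda>t. F (t, p, w)) has_vector_derivative ?D x0 p (1, 0, 0)) (at x0)"
      "((\<lambda>t. F (x0, t, w)) has_vector_derivative Dp x0 p) (at p)"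
      using vector_derivative_diff_chain_within[of _ "(1, 0, 0)" x0 UNIV F "?D x0 p"]
        vector_derivative_diff_chain_within[of _ "(0, 1, 0)" p UNIV F "?D x0 p"] D[OF z]
      by (auto simp: o_def Dp_def has_derivative_at_withinI)
    then have "((\<lambda>t. f (t, p, w)) has_vector_derivative ?D x0 p (1, 0, 0)) (at x0)"
      "((\<lambda>t. f (x0, t, w)) has_vector_derivative Dp x0 p) (at p)"
      using has_vector_derivative_transform_within_open[OF _ o(1), of "\<lambda>t. F (t, p, w)" _ x0 "\<lambda>t. f (t, p, w)"]
        has_vector_derivative_transform_within_open[OF _ o(2), of "\<lambda>t. F (x0, t, w)" _ p "\<lambda>t. f (x0, t, w)"] F inW(1) z
      by auto
    then have "?D x0 p (1, 0, 0) = D0" "Dp x0 p = D1"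
      using d vector_derivative_unique_at by blast+
    then show ?thesis using d(3) by (simp add: add_eq_0_iff)
  qed
  have dir: "?D x0 p (a, b, 0) = a *\<^sub>R - (cl_vec w \<star> Dp x0 p) + b *\<^sub>R Dp x0 p" if z: "(x0, p) \<noteq> (0, 0)" for x0 p a b
  proof -
    have L: "linear (?D x0 p)" using D[OF z] by (rule has_derivative_linear)
    have "(a, b, 0) = a *\<^sub>R (1, 0, 0) + b *\<^sub>R ((0, 1, 0) :: real \<times> real \<times> (real, 'n) vec)" by simp
    then show ?thesis unfolding Dp_def by (simp only: linear_add[OF L] linear_scale[OF L] slice[OF z, unfolded Dp_def])
  qed
  have nz: "(r * cos \<theta>, r * sin \<theta>) \<noteq> (0, 0)" if "0 < r" for r \<theta> :: real
    using that sin_zero_norm_cos_one[of \<theta>] by auto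
  define h where "h r \<theta> = F (r * cos \<theta>, r * sin \<theta>, w)" for r \<theta>
  define E where "E r \<theta> = Dp (r * cos \<theta>) (r * sin \<theta>)" for r \<theta>
  have "fc w j (h r) = r powi j *\<^sub>R fc w j (h 1)"
  proof (rule fc_scaling[OF w _ _ _ _ r])
    show "((\<lambda>r. h r \<theta>) has_vector_derivative cact w (- \<i> * cis \<theta>) (E r \<theta>)) (at r)" if r: "0 < r" for r \<theta>
    proof -
      have "((\<lambda>r. (r * cos \<theta>, r * sin \<theta>, w)) has_vector_derivative (cos \<theta>, sin \<theta>, 0)) (at r)"
        by (auto simp: has_vector_derivative_def zero_prod_def intro!: derivative_eq_intros)
      from vector_derivative_diff_chain_within[OF this, of F "?D (r * cos \<theta>) (r * sin \<theta>)"]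
      have "((\<lambda>r. h r \<theta>) has_vector_derivative ?D (r * cos \<theta>) (r * sin \<theta>) (cos \<theta>, sin \<theta>, 0)) (at r)"
        using D[OF nz[OF r]] by (simp add: o_def h_def[abs_def] has_derivative_at_withinI)
      then show ?thesis unfolding dir[OF nz[OF r]] by (simp add: cact_def E_def add.commute)
    qed
    show "((\<lambda>\<theta>. h r \<theta>) has_vector_derivative r *\<^sub>R cact w (cis \<theta>) (E r \<theta>)) (at \<theta>)" if r: "0 < r" for r \<theta>
    proof -
      have "((\<lambda>\<theta>. (r * cos \<theta>, r * sin \<theta>, w)) has_vector_derivative (- r * sin \<theta>, r * cos \<theta>, 0)) (at \<theta>)"
        by (auto simp: has_vector_derivative_def zero_prod_def fun_eq_iff intro!: derivative_eq_intros)
      from vector_derivative_diff_chain_within[OF this, of F "?D (r * cos \<theta>) (r * sin \<theta>)"]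
      have "((\<lambda>\<theta>. h r \<theta>) has_vector_derivative ?D (r * cos \<theta>) (r * sin \<theta>) (- r * sin \<theta>, r * cos \<theta>, 0)) (at \<theta>)"
        using D[OF nz[OF r]] by (simp add: o_def h_def[abs_def] has_derivative_at_withinI)
      then show ?thesis unfolding dir[OF nz[OF r]] by (simp add: cact_def E_def algebra_simps)
    qed
    show "h r (2 * pi) = h r 0" for r by (simp add: h_def)
    have "continuous_on W (\<lambda>z. frechet_derivative F (at z) (0, 1, 0))"
      by (rule smooth_on_continuous[OF smooth_on_derivative[OF W(3)]]) (auto simp: Basis_prod_def zero_prod_def)
    then show "continuous_on ({0<..} \<times> UNIV) (\<lambda>(r, \<theta>). E r \<theta>)"
      unfolding E_def Dp_def split_def
      by (rule continuous_on_compose2) (use inW(2) nz in \<open>auto intro!: continuous_intros\<close>)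
  qed
  moreover have "h r = (\<lambda>\<theta>. f (r * cos \<theta>, r * sin \<theta>, w))" if "0 < r" for r
    unfolding h_def by (rule ext) (rule F[OF inW(1)[OF nz[OF that]]])
  ultimately show ?thesis using r by simp
qed

text \<open>A linear function on the circle couples a coefficient to its two neighbours, so
  vanishing of all coefficients survives multiplication by polynomials.\<close>

lemma fc_mult_trig:
  assumes w: "norm w = 1" and T: "continuous_on {0..2 * pi} T"
  shows "fc w m (\<lambda>\<theta>. (a * cos \<theta> + b * sin \<theta>) *\<^sub>R T \<theta>)
    = cact w (Complex (a / 2) (- b / 2)) (fc w (m - 1) T) + cact w (Complex (a / 2) (b / 2)) (fc w (m + 1) T)"
proof -
  define \<alpha> \<beta> where "\<alpha> = Complex (a / 2) (- b / 2)" and "\<beta> = Complex (a / 2) (b / 2)"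
  have key: "cis (- (real_of_int m * \<theta>)) * of_real (a * cos \<theta> + b * sin \<theta>)
      = \<alpha> * cis (- (real_of_int (m - 1) * \<theta>)) + \<beta> * cis (- (real_of_int (m + 1) * \<theta>))" for \<theta>
  proof -
    have "cis (- (real_of_int (m - 1) * \<theta>)) = cis (- (real_of_int m * \<theta>)) * cis \<theta>"
      "cis (- (real_of_int (m + 1) * \<theta>)) = cis (- (real_of_int m * \<theta>)) * cis (- \<theta>)"
      by (simp_all add: cis_mult algebra_simps)
    moreover have "of_real (a * cos \<theta> + b * sin \<theta>) = \<alpha> * cis \<theta> + \<beta> * cis (- \<theta>)"
      by (simp add: \<alpha>_def \<beta>_def complex_eq_iff)
    ultimately show ?thesis by (simp only: algebra_simps)
  qed
  have *: "cact w (cis (- (real_of_int m * \<theta>))) ((a * cos \<theta> + b * sin \<theta>) *\<^sub>R T \<theta>)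
      = cact w \<alpha> (cact w (cis (- (real_of_int (m - 1) * \<theta>))) (T \<theta>)) + cact w \<beta> (cact w (cis (- (real_of_int (m + 1) * \<theta>))) (T \<theta>))" for \<theta>
  proof -
    have "cact w (cis (- (real_of_int m * \<theta>))) ((a * cos \<theta> + b * sin \<theta>) *\<^sub>R T \<theta>)
        = cact w (cis (- (real_of_int m * \<theta>)) * of_real (a * cos \<theta> + b * sin \<theta>)) (T \<theta>)"
      by (simp only: cact_mult[OF w] cact_simps)
    then show ?thesis unfolding key by (simp only: cact_mult[OF w] cact_simps)
  qed
  then have "integral {0..2 * pi} (\<lambda>\<theta>. cact w (cis (- (real_of_int m * \<theta>))) ((a * cos \<theta> + b * sin \<theta>) *\<^sub>R T \<theta>))
      = cact w \<alpha> (integral {0..2 * pi} (\<lambda>\<theta>. cact w (cis (- (real_of_int (m - 1) * \<theta>))) (T \<theta>)))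
      + cact w \<beta> (integral {0..2 * pi} (\<lambda>\<theta>. cact w (cis (- (real_of_int (m + 1) * \<theta>))) (T \<theta>)))"
  proof -
    note i1 = fc_integrable[OF T, of w "m - 1"] and i2 = fc_integrable[OF T, of w "m + 1"]
    have "((\<lambda>\<theta>. cact w \<alpha> (cact w (cis (- (real_of_int (m - 1) * \<theta>))) (T \<theta>)) + cact w \<beta> (cact w (cis (- (real_of_int (m + 1) * \<theta>))) (T \<theta>)))
      has_integral cact w \<alpha> (integral {0..2 * pi} (\<lambda>\<theta>. cact w (cis (- (real_of_int (m - 1) * \<theta>))) (T \<theta>)))
      + cact w \<beta> (integral {0..2 * pi} (\<lambda>\<theta>. cact w (cis (- (real_of_int (m + 1) * \<theta>))) (T \<theta>)))) {0..2 * pi}"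
      using has_integral_add[OF has_integral_linear[OF integrable_integral[OF i1] bounded_linear_cact[of w \<alpha>]]
          has_integral_linear[OF integrable_integral[OF i2] bounded_linear_cact[of w \<beta>]]]
      by (simp only: o_def)
    with * show ?thesis by (simp only: integral_unique)
  qed
  then show ?thesis unfolding fc_def \<alpha>_def[symmetric] \<beta>_def[symmetric]
    by (simp only: scaleR_add_right cact_simps)
qed

lemma continuous_on_circle: "continuous_on (sphere 0 1) g \<Longrightarrow> continuous_on S (\<lambda>\<theta>. g (cis \<theta>))"
  by (rule continuous_on_compose2[of "sphere 0 1" g]) (auto intro!: continuous_intros)

lemma fc_real_polynomial_zero:
  fixes g :: "complex \<Rightarrow> 'n::{finite,linorder} clif"
  assumes p: "real_polynomial_function p" and w: "norm w = 1"
    and g: "continuous_on (sphere 0 1) g" "\<And>m. fc w m (\<lambda>\<theta>. g (cis \<theta>)) = 0"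
  shows "fc w m (\<lambda>\<theta>. p (cis \<theta>) *\<^sub>R g (cis \<theta>)) = 0"
  using p g
proof (induction arbitrary: g m rule: real_polynomial_function.induct)
  case (linear p)
  have L: "linear p" using linear(1) by (rule bounded_linear.linear)
  have "p (cis \<theta>) = p 1 * cos \<theta> + p \<i> * sin \<theta>" for \<theta>
  proof -
    have "cis \<theta> = cos \<theta> *\<^sub>R 1 + sin \<theta> *\<^sub>R \<i>" by (simp add: complex_eq_iff)
    then have "p (cis \<theta>) = p (cos \<theta> *\<^sub>R 1 + sin \<theta> *\<^sub>R \<i>)" by (rule arg_cong)
    then show ?thesis by (simp add: linear_add[OF L] linear_scale[OF L] mult.commute)
  qed
  then show ?case
    using fc_mult_trig[OF w continuous_on_circle[OF linear(2)], of m "p 1" "p \<i>"] linear(3) by (simp add: cact_simps)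
next
  case (const c)
  then show ?case by (simp add: fc_scaleR)
next
  case (add p q)
  have c: "continuous_on {0..2 * pi} (\<lambda>\<theta>. q (cis \<theta>) *\<^sub>R g (cis \<theta>))" if "real_polynomial_function q" for q
    using that add.prems(1)
    by (intro continuous_on_circle[of "\<lambda>z. q z *\<^sub>R g z"] continuous_intros)
      (auto simp: real_polynomial_function_eq intro: continuous_on_polymonial_function)
  show ?case
    unfolding scaleR_add_left fc_add[OF c[OF add.hyps(1)] c[OF add.hyps(2)]] using add.IH add.prems by simp
next
  case (mult p q)
  have "continuous_on (sphere 0 1) (\<lambda>z. q z *\<^sub>R g z)"
    using mult.hyps(2) mult.prems(1) by (intro continuous_intros)
      (auto simp: real_polynomial_function_eq intro: continuous_on_polymonial_function)
  from mult.IH(1)[OF this] mult.IH(2)[OF mult.prems] show ?case by simp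
qed

text \<open>Vanishing coefficients make each real component orthogonal to all polynomials on the
  circle; approximating the component by a polynomial shows that its mean square is 0.\<close>

lemma fourier_uniqueness:
  fixes g :: "complex \<Rightarrow> 'n::{finite,linorder} clif"
  assumes w: "norm w = 1" and g: "continuous_on (sphere 0 1) g" "\<And>m. fc w m (\<lambda>\<theta>. g (cis \<theta>)) = 0"
    and z: "norm z = 1"
  shows "g z = 0"
proof -
  have comp: "inner (g (cis \<theta>)) b = 0" if b: "b \<in> Basis" and t: "\<theta> \<in> {0..2 * pi}" for b \<theta>
  proof -
    let ?q = "\<lambda>z. inner (g z) b"
    have cq: "continuous_on (sphere 0 1) ?q" by (intro continuous_intros g)
    have cqt: "continuous_on S (\<lambda>\<theta>. ?q (cis \<theta>))" for S by (rule continuous_on_circle[OF cq])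
    have orth: "integral {0..2 * pi} (\<lambda>\<theta>. p (cis \<theta>) * ?q (cis \<theta>)) = 0" if p: "real_polynomial_function p" for p
    proof -
      have c: "continuous_on {0..2 * pi} (\<lambda>\<theta>. p (cis \<theta>) *\<^sub>R g (cis \<theta>))"
        using p g(1) by (intro continuous_on_circle[of "\<lambda>z. p z *\<^sub>R g z"] continuous_intros)
          (auto simp: real_polynomial_function_eq intro: continuous_on_polymonial_function)
      have "integral {0..2 * pi} (\<lambda>\<theta>. p (cis \<theta>) *\<^sub>R g (cis \<theta>)) = 0"
        using fc_real_polynomial_zero[OF p w g, of 0] by (simp add: fc_def cact_simps)
      then have "inner (integral {0..2 * pi} (\<lambda>\<theta>. p (cis \<theta>) *\<^sub>R g (cis \<theta>))) b = 0" by simp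
      then show ?thesis
        using integral_linear[OF integrable_continuous_real[OF c] bounded_linear_inner_left, of b] by (simp add: o_def)
    qed
    obtain B where B: "0 \<le> B" "\<And>z. norm z = 1 \<Longrightarrow> norm (?q z) \<le> B"
      using bounded_on_sphere[OF cq] by blast
    have le: "integral {0..2 * pi} (\<lambda>\<theta>. (?q (cis \<theta>))\<^sup>2) \<le> B * e * (2 * pi)" if e: "0 < e" for e
    proof -
      obtain p where p: "real_polynomial_function p" "\<And>z. norm z = 1 \<Longrightarrow> \<bar>?q z - p z\<bar> < e"
        using Stone_Weierstrass_real_polynomial_function[OF compact_sphere cq e] by auto
      have cp: "continuous_on (sphere 0 1) p"
        using p(1) by (auto simp: real_polynomial_function_eq intro: continuous_on_polymonial_function)
      have c1: "continuous_on {0..2 * pi} (\<lambda>\<theta>. p (cis \<theta>))" by (rule continuous_on_circle[OF cp])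
      have "integral {0..2 * pi} (\<lambda>\<theta>. (?q (cis \<theta>))\<^sup>2)
          = integral {0..2 * pi} (\<lambda>\<theta>. ?q (cis \<theta>) * (?q (cis \<theta>) - p (cis \<theta>)) + p (cis \<theta>) * ?q (cis \<theta>))"
        by (simp add: power2_eq_square algebra_simps)
      also have "\<dots> = integral {0..2 * pi} (\<lambda>\<theta>. ?q (cis \<theta>) * (?q (cis \<theta>) - p (cis \<theta>)))
          + integral {0..2 * pi} (\<lambda>\<theta>. p (cis \<theta>) * ?q (cis \<theta>))"
        by (intro integral_add integrable_continuous_real continuous_on_mult continuous_on_diff cqt c1)
      also have "\<dots> = integral {0..2 * pi} (\<lambda>\<theta>. ?q (cis \<theta>) * (?q (cis \<theta>) - p (cis \<theta>)))"
        by (simp add: orth[OF p(1)])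
      also have "\<dots> \<le> norm (integral {0..2 * pi} (\<lambda>\<theta>. ?q (cis \<theta>) * (?q (cis \<theta>) - p (cis \<theta>))))" by simp
      also have "\<dots> \<le> B * e * (2 * pi - 0)"
      proof (rule integral_bound)
        show "continuous_on {0..2 * pi} (\<lambda>\<theta>. ?q (cis \<theta>) * (?q (cis \<theta>) - p (cis \<theta>)))"
          by (intro continuous_on_mult continuous_on_diff cqt c1)
        show "norm (?q (cis \<theta>) * (?q (cis \<theta>) - p (cis \<theta>))) \<le> B * e" for \<theta>
          unfolding norm_mult using B p(2)[of "cis \<theta>"] by (intro mult_mono) auto
      qed simp
      finally show ?thesis by simp
    qed
    have "integral {0..2 * pi} (\<lambda>\<theta>. (?q (cis \<theta>))\<^sup>2) \<le> 0"
    proof (rule field_le_epsilon)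
      fix e :: real assume e: "0 < e"
      have "integral {0..2 * pi} (\<lambda>\<theta>. (?q (cis \<theta>))\<^sup>2) \<le> B * (e / (2 * pi * (B + 1))) * (2 * pi)"
        using e B by (intro le) (auto intro!: divide_pos_pos mult_pos_pos)
      also have "\<dots> = e * (B / (B + 1))" using B(1) by (simp add: divide_simps)
      also have "\<dots> \<le> e * 1" using e B by (intro mult_left_mono) auto
      finally show "integral {0..2 * pi} (\<lambda>\<theta>. (?q (cis \<theta>))\<^sup>2) \<le> 0 + e" by simp
    qed
    moreover have "0 \<le> integral {0..2 * pi} (\<lambda>\<theta>. (?q (cis \<theta>))\<^sup>2)"
      by (intro integral_nonneg integrable_continuous_real continuous_on_power cqt) auto
    ultimately have "integral {0..2 * pi} (\<lambda>\<theta>. (?q (cis \<theta>))\<^sup>2) = 0" by simp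
    then have "(?q (cis \<theta>))\<^sup>2 = 0"
      using t by (subst (asm) integral_eq_0_iff) (auto intro!: continuous_on_power cqt)
    then show ?thesis by simp
  qed
  have "z = cis (Arg2pi z)" using z by (metis complex_norm_eq_1_exp cis_conv_exp Arg2pi_eq z mult.left_neutral of_real_1)
  moreover have "Arg2pi z \<in> {0..2 * pi}" using Arg2pi_ge_0[of z] Arg2pi_lt_2pi[of z] by simp
  ultimately show ?thesis using comp by (metis euclidean_all_zero_iff)
qed

section \<open>Decay of the spherical components of the Laurent coefficients\<close>

text \<open>Fubini for Lebesgue measure on the interval and the finite measure \<open>sphm\<close>;
  continuity on a compact product provides integrability.\<close>

lemma sint_integral_swap:
  fixes K :: "real \<Rightarrow> 'a::euclidean_space \<Rightarrow> real"
  assumes K: "continuous_on ({a..b} \<times> sphere 0 1) (\<lambda>(\<theta>, w). K \<theta> w)"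
  shows "sint (\<lambda>w. integral {a..b} (\<lambda>\<theta>. K \<theta> w)) = integral {a..b} (\<lambda>\<theta>. sint (K \<theta>))"
proof -
  interpret S: finite_measure "sphm :: 'a measure" by (rule finite_measure_sphm)
  interpret pair_sigma_finite lborel "sphm :: 'a measure"
    by (intro pair_sigma_finite.intro lborel.sigma_finite_measure_axioms S.sigma_finite_measure_axioms)
  let ?A = "{a..b} \<times> sphere (0::'a) 1"
  define H where "H \<theta> w = indicator ?A (\<theta>, w) *\<^sub>R K \<theta> w" for \<theta> w
  have sets: "sets (lborel \<Otimes>\<^sub>M (sphm :: 'a measure)) = sets borel"
    by (simp add: borel_prod[symmetric] cong: sets_pair_measure_cong)
  have Hc: "case_prod H = (\<lambda>x. indicator ?A x *\<^sub>R (\<lambda>(\<theta>, w). K \<theta> w) x)"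
    by (auto simp: H_def fun_eq_iff)
  have "case_prod H \<in> borel_measurable borel"
    unfolding Hc using K by (intro borel_measurable_continuous_on_indicator borel_closed closed_Times) auto
  then have Hm: "case_prod H \<in> borel_measurable (lborel \<Otimes>\<^sub>M (sphm :: 'a measure))"
    using measurable_cong_sets[OF sets refl] by blast
  have "bounded ((\<lambda>(\<theta>, w). K \<theta> w) ` ?A)"
    by (intro compact_imp_bounded compact_continuous_image K compact_Times compact_sphere) auto
  then obtain B where B: "\<And>x. x \<in> ?A \<Longrightarrow> norm ((\<lambda>(\<theta>, w). K \<theta> w) x) \<le> B"
    unfolding bounded_iff by blast
  have int: "integrable (lborel \<Otimes>\<^sub>M (sphm :: 'a measure)) (case_prod H)"
  proof (rule integrableI_bounded_set[where A="{a..b} \<times> UNIV" and B="\<bar>B\<bar>"])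
    show "{a..b} \<times> UNIV \<in> sets (lborel \<Otimes>\<^sub>M (sphm :: 'a measure))" by auto
    show "emeasure (lborel \<Otimes>\<^sub>M (sphm :: 'a measure)) ({a..b} \<times> UNIV) < \<infinity>"
      by (subst S.emeasure_pair_measure_Times) (auto simp: emeasure_sphm_UNIV emeasure_lborel_Icc_eq)
    show "AE x in lborel \<Otimes>\<^sub>M (sphm :: 'a measure). x \<in> {a..b} \<times> UNIV \<longrightarrow> norm (case_prod H x) \<le> \<bar>B\<bar>"
    proof (intro AE_I2 impI)
      fix x show "norm (case_prod H x) \<le> \<bar>B\<bar>"
        unfolding Hc using B[of x] by (cases "x \<in> ?A") (auto intro: order_trans[OF _ abs_ge_self])
    qed
    show "AE x in lborel \<Otimes>\<^sub>M (sphm :: 'a measure). x \<notin> {a..b} \<times> UNIV \<longrightarrow> case_prod H x = 0"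
      unfolding Hc by (auto simp: indicator_def)
  qed (rule Hm)
  have L: "(LINT \<theta>|lborel. H \<theta> w) = indicator (sphere 0 1) w *\<^sub>R integral {a..b} (\<lambda>\<theta>. K \<theta> w)" for w
  proof (cases "w \<in> sphere 0 1")
    case True
    have "continuous_on {a..b} (\<lambda>\<theta>. K \<theta> w)"
      by (rule continuous_on_compose2[OF K, of _ "\<lambda>\<theta>. (\<theta>, w)", simplified]) (use True in \<open>auto intro!: continuous_intros\<close>)
    from set_borel_integral_eq_integral(2)[OF borel_integrable_atLeastAtMost'[OF this]]
    show ?thesis using True by (simp add: H_def set_lebesgue_integral_def indicator_def)
  qed (simp add: H_def indicator_def)
  have R: "(LINT w|sphm. H \<theta> w) = indicator {a..b} \<theta> *\<^sub>R sint (K \<theta>)" for \<theta>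
    by (cases "\<theta> \<in> {a..b}") (auto simp: H_def sint_def set_lebesgue_integral_def indicator_def)
  have "set_integrable lborel {a..b} (\<lambda>\<theta>. sint (K \<theta>))"
    unfolding set_integrable_def R[symmetric] by (rule integrable_fst[OF int])
  then have "integral {a..b} (\<lambda>\<theta>. sint (K \<theta>)) = (LINT \<theta>|lborel. LINT w|sphm. H \<theta> w)"
    unfolding R by (simp add: set_borel_integral_eq_integral(2)[symmetric] set_lebesgue_integral_def)
  also have "\<dots> = (LINT w|sphm. LINT \<theta>|lborel. H \<theta> w)" by (rule Fubini_integral[OF int, symmetric])
  also have "\<dots> = sint (\<lambda>w. integral {a..b} (\<lambda>\<theta>. K \<theta> w))"
    unfolding L by (simp add: sint_def set_lebesgue_integral_def)
  finally show ?thesis by simp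
qed

definition slice_gam :: "(real \<times> real \<times> (real ^ 'n::{finite,linorder}) \<Rightarrow> 'n clif) \<Rightarrow> real \<times> real \<times> (real, 'n) vec \<Rightarrow> 'n clif" where
  "slice_gam F = (\<lambda>(x0, p, y). gam (\<lambda>y. F (x0, p, y)) y)"

definition slice_vmul :: "(real \<times> real \<times> (real ^ 'n::{finite,linorder}) \<Rightarrow> 'n clif) \<Rightarrow> real \<times> real \<times> (real, 'n) vec \<Rightarrow> 'n clif" where
  "slice_vmul F = (\<lambda>(x0, p, y). vmul (\<lambda>y. F (x0, p, y)) y)"

section \<open>The spherical operator applied in the last variable\<close>

lemma Basis_axis: "(0, 0, axis i 1) \<in> (Basis :: (real \<times> real \<times> (real ^ 'n)) set)"
  by (auto simp: Basis_prod_def Basis_vec_def zero_prod_def)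

lemma slice_has_derivative:
  assumes F: "smooth_on W F" "open W" "(x0, p, y) \<in> W"
  shows "((\<lambda>y. F (x0, p, y)) has_derivative (\<lambda>v. frechet_derivative F (at (x0, p, y)) (0, 0, v))) (at y)"
proof -
  have "((\<lambda>y. (x0, p, y)) has_derivative (\<lambda>v. (0, 0, v))) (at y)"
    by (auto intro!: derivative_eq_intros)
  from has_derivative_compose[OF this smooth_on_has_derivative[OF F]] show ?thesis .
qed

lemma pdiff_slice:
  assumes "smooth_on W F" "open W" "(x0, p, y) \<in> W"
  shows "pdiff (\<lambda>y. F (x0, p, y)) i y = frechet_derivative F (at (x0, p, y)) (0, 0, axis i 1)"
  by (rule pdiff_eq[OF slice_has_derivative[OF assms]])

lemma smooth_on_cong:
  assumes "open S" "\<And>x. x \<in> S \<Longrightarrow> f x = g x" "smooth_on S f"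
  shows "smooth_on S g"
  using assms smooth_k_cong unfolding smooth_on_def by blast

lemma bounded_linear_coord3: "bounded_linear (\<lambda>z :: real \<times> real \<times> (real ^ 'n). snd (snd z) $ i)"
  by (intro bounded_linear_compose[OF bounded_linear_vec_nth] bounded_linear_compose[OF bounded_linear_snd] bounded_linear_snd)

lemma smooth_on_slice_vmul:
  assumes W: "open W" and F: "smooth_on W F"
  shows "smooth_on W (slice_vmul F)"
proof (rule smooth_on_cong[OF W])
  show "smooth_on W (\<lambda>z. \<Sum>i\<in>UNIV. snd (snd z) $ i *\<^sub>R (cl_e i \<star> F z))"
    by (intro smooth_on_sum W smooth_on_linear_scaleR bounded_linear_coord3 smooth_on_linear[OF W cl_mult.bounded_linear_right] F)
qed (auto simp: slice_vmul_def vmul_def cl_vec_mult)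

lemma smooth_on_slice_gam:
  assumes W: "open W" and F: "smooth_on W F"
  shows "smooth_on W (slice_gam F)"
proof (rule smooth_on_cong[OF W])
  let ?G = "\<lambda>i z. frechet_derivative F (at z) (0, 0, axis i 1)"
  let ?D = "\<lambda>z. \<Sum>i\<in>UNIV. cl_e i \<star> ?G i z"
  have G: "smooth_on W (?G i)" for i by (rule smooth_on_derivative[OF F Basis_axis])
  have D: "smooth_on W ?D" by (intro smooth_on_sum W smooth_on_linear[OF W cl_mult.bounded_linear_right] G)
  show "smooth_on W (\<lambda>z. - (\<Sum>i\<in>UNIV. snd (snd z) $ i *\<^sub>R (cl_e i \<star> ?D z)) + - (\<Sum>i\<in>UNIV. snd (snd z) $ i *\<^sub>R ?G i z))"
    by (intro smooth_on_add W smooth_on_linear[OF W bounded_linear_minus[OF bounded_linear_ident]] smooth_on_sum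
        smooth_on_linear_scaleR bounded_linear_coord3 smooth_on_linear[OF W cl_mult.bounded_linear_right] G D)
  fix z assume z: "z \<in> W"
  obtain x0 p y where z': "z = (x0, p, y)" by (cases z)
  have "pdiff (\<lambda>y. F (x0, p, y)) i y = ?G i z" for i
    using pdiff_slice[OF F W] z by (simp add: z')
  then show "- (\<Sum>i\<in>UNIV. snd (snd z) $ i *\<^sub>R (cl_e i \<star> ?D z)) + - (\<Sum>i\<in>UNIV. snd (snd z) $ i *\<^sub>R ?G i z) = slice_gam F z"
    by (simp add: slice_gam_def gam_def z' cl_vec_mult dirac_def euler_def)
qed

lemma slice_gam_funpow: "(\<lambda>y. (slice_gam ^^ m) F (x0, p, y)) = (gam ^^ m) (\<lambda>y. F (x0, p, y))"
  by (induction m) (simp_all add: slice_gam_def)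

lemma C1_sphere_slice:
  fixes F :: "real \<times> real \<times> (real ^ 'n::{finite,linorder}) \<Rightarrow> 'n clif"
  assumes F: "smooth_on W F" "open W" and W: "\<And>w. norm w = 1 \<Longrightarrow> (x0, p, w) \<in> W"
  shows "C1_sphere (\<lambda>y. F (x0, p, y))"
  unfolding C1_sphere_def
proof (intro conjI allI impI)
  show "(\<lambda>y. F (x0, p, y)) differentiable at w" if "norm w = 1" for w
    using slice_has_derivative[OF F W[OF that]] unfolding differentiable_def by blast
  fix i
  have "continuous_on (sphere 0 1) (\<lambda>w. frechet_derivative F (at (x0, p, w)) (0, 0, axis i 1))"
    by (rule continuous_on_compose2[OF smooth_on_continuous[OF smooth_on_derivative[OF F(1) Basis_axis]]])
      (use W in \<open>auto intro!: continuous_intros\<close>)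
  then show "continuous_on (sphere 0 1) (pdiff (\<lambda>y. F (x0, p, y)) i)"
    by (rule continuous_on_eq) (simp add: pdiff_slice[OF F W])
qed

lemma circle_nonzero: "0 < (r::real) \<Longrightarrow> (r * cos \<theta>, r * sin \<theta>) \<noteq> (0, 0)"
  using sin_zero_norm_cos_one[of \<theta>] by auto

text \<open>The iterated operator gives a continuous function on the compact product of circle and
  sphere, so one bound serves all angles, all k and all monogenic \<open>Q\<close>.\<close>

lemma slice_gam_decay:
  fixes F :: "real \<times> real \<times> (real ^ 'n::{finite,linorder}) \<Rightarrow> 'n clif"
  assumes F: "smooth_on W F" "open W" and W: "sdom punct \<subseteq> W" and r: "0 < r"
  shows "\<exists>B\<ge>0. \<forall>\<theta>\<in>{0..2 * pi}. \<forall>k Q. monogenic_hom k Q \<longrightarrow>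
    \<bar>lam CARD('n) k ^ m * sip (\<lambda>w. F (r * cos \<theta>, r * sin \<theta>, w)) (sph k Q)\<bar> \<le> B * sup_norm_S Q"
proof -
  have sm: "smooth_on W ((slice_gam ^^ l) F)" for l
    by (induction l) (auto intro: F smooth_on_slice_gam)
  have inW: "(r * cos \<theta>, r * sin \<theta>, w) \<in> W" if "norm w = 1" for \<theta> w
    using W circle_nonzero[OF r, of \<theta>] that by (auto simp: sdom_def)
  let ?q = "\<lambda>(\<theta>, w). (slice_gam ^^ m) F (r * cos \<theta>, r * sin \<theta>, w)"
  have "continuous_on ({0..2 * pi} \<times> sphere 0 1) ?q"
    unfolding split_def
    by (rule continuous_on_compose2[OF smooth_on_continuous[OF sm]]) (use inW in \<open>auto intro!: continuous_intros\<close>)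
  then have "bounded (?q ` ({0..2 * pi} \<times> sphere 0 1))"
    by (intro compact_imp_bounded compact_continuous_image compact_Times compact_sphere) auto
  then obtain B where B: "\<And>\<theta> w. \<theta> \<in> {0..2 * pi} \<Longrightarrow> norm w = 1 \<Longrightarrow> norm (?q (\<theta>, w)) \<le> B"
    unfolding bounded_iff by force
  have "\<bar>lam CARD('n) k ^ m * sip (\<lambda>w. F (r * cos \<theta>, r * sin \<theta>, w)) (sph k Q)\<bar> \<le> \<bar>B\<bar> * sup_norm_S Q"
    if t: "\<theta> \<in> {0..2 * pi}" and Q: "monogenic_hom k Q" for \<theta> k Q
  proof -
    let ?f = "\<lambda>w. F (r * cos \<theta>, r * sin \<theta>, w)"
    have C1: "C1_sphere ((gam ^^ l) ?f)" for l
      unfolding slice_gam_funpow[symmetric] using C1_sphere_slice[OF sm F(2) inW] .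
    have hQ: "hom_poly k Q" using Q by (simp add: monogenic_hom_iff)
    have "lam CARD('n) k ^ m * sip ?f (sph k Q) = sip ((gam ^^ m) ?f) (sph k Q)"
      by (rule sip_gam_funpow[OF C1 Q])
    also have "\<bar>\<dots>\<bar> \<le> \<bar>B\<bar> * sup_norm_S Q"
      unfolding sip_def
    proof (rule sint_abs_le)
      show "continuous_on (sphere 0 1) (\<lambda>w. inner ((gam ^^ m) ?f w) (sph k Q w))"
        by (intro continuous_intros C1_sphere_continuous[OF C1] continuous_on_sph[OF hQ])
      fix w :: "(real, 'n) vec" assume w: "norm w = 1"
      have "(gam ^^ m) ?f w = ?q (\<theta>, w)" by (simp add: slice_gam_funpow[symmetric])
      then have "norm ((gam ^^ m) ?f w) \<le> \<bar>B\<bar>" using B[OF t w] by simp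
      moreover have "norm (sph k Q w) \<le> sup_norm_S Q"
        using sup_norm_S_ge[OF hom_poly_continuous_on[OF hQ] w] by (simp add: norm_sph[OF w])
      ultimately have "norm ((gam ^^ m) ?f w) * norm (sph k Q w) \<le> \<bar>B\<bar> * sup_norm_S Q" by (intro mult_mono) auto
      then show "\<bar>inner ((gam ^^ m) ?f w) (sph k Q w)\<bar> \<le> \<bar>B\<bar> * sup_norm_S Q"
        using Cauchy_Schwarz_ineq2 order_trans by blast
    qed
    finally show ?thesis .
  qed
  then show ?thesis by (intro exI[of _ "\<bar>B\<bar>"]) auto
qed

lemma continuous_on_fc:
  fixes T :: "real \<Rightarrow> real ^ 'n::{finite,linorder} \<Rightarrow> 'n clif"
  assumes T: "continuous_on ({0..2 * pi} \<times> sphere 0 1) (\<lambda>(\<theta>, w). T \<theta> w)"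
  shows "continuous_on (sphere 0 1) (\<lambda>w. fc w j (\<lambda>\<theta>. T \<theta> w))"
proof -
  have "continuous_on (sphere 0 1 \<times> cbox 0 (2 * pi)) (\<lambda>(w, \<theta>). cact w (cis (- (real_of_int j * \<theta>))) (T \<theta> w))"
    unfolding split_def
    by (intro continuous_intros continuous_on_compose2[OF T, of _ "\<lambda>x. (snd x, fst x)", simplified])
      auto
  from integral_continuous_on_param[OF this] show ?thesis
    unfolding fc_def by (intro continuous_intros) simp
qed

text \<open>The exponential weight acts through omega, which does not commute with
  \<open>gam\<close>. Splitting it into real and imaginary part moves omega onto the function, and
  the decay bound is applied to \<open>F\<close> and to omega \<open>F\<close> separately.\<close>

lemma laurent_decay:
  fixes f :: "real \<times> real \<times> (real ^ 'n::{finite,linorder}) \<Rightarrow> 'n clif"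
  assumes f: "slice_monogenic punct f" and r: "0 < r"
  shows "\<exists>B\<ge>0. \<forall>j k Q. monogenic_hom k Q \<longrightarrow>
    \<bar>lam CARD('n) k ^ m * sip (\<lambda>w. fc w j (\<lambda>\<theta>. f (r * cos \<theta>, r * sin \<theta>, w))) (sph k Q)\<bar> \<le> B * sup_norm_S Q"
proof -
  obtain W F where W: "open W" "sdom punct \<subseteq> W" "smooth_on W F" and F: "\<And>z. z \<in> sdom punct \<Longrightarrow> F z = f z"
    using f unfolding slice_monogenic_def smooth_on_sdom_def by blast
  have inS: "(r * cos \<theta>, r * sin \<theta>, w) \<in> sdom punct" if "norm w = 1" for \<theta> and w :: "(real, 'n) vec"
    using circle_nonzero[OF r, of \<theta>] that by (auto simp: sdom_def)
  obtain B1 where B1: "0 \<le> B1" "\<And>\<theta> k Q. \<theta> \<in> {0..2 * pi} \<Longrightarrow> monogenic_hom k Q \<Longrightarrow>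
      \<bar>lam CARD('n) k ^ m * sip (\<lambda>w. F (r * cos \<theta>, r * sin \<theta>, w)) (sph k Q)\<bar> \<le> B1 * sup_norm_S Q"
    using slice_gam_decay[OF W(3,1,2) r, of m] by blast
  obtain B2 where B2: "0 \<le> B2" "\<And>\<theta> k Q. \<theta> \<in> {0..2 * pi} \<Longrightarrow> monogenic_hom k Q \<Longrightarrow>
      \<bar>lam CARD('n) k ^ m * sip (\<lambda>w. slice_vmul F (r * cos \<theta>, r * sin \<theta>, w)) (sph k Q)\<bar> \<le> B2 * sup_norm_S Q"
    using slice_gam_decay[OF smooth_on_slice_vmul[OF W(1,3)] W(1,2) r, of m] by blast
  have "\<bar>lam CARD('n) k ^ m * sip (\<lambda>w. fc w j (\<lambda>\<theta>. f (r * cos \<theta>, r * sin \<theta>, w))) (sph k Q)\<bar> \<le> (B1 + B2) * sup_norm_S Q"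
    if Q: "monogenic_hom k Q" for j k Q
  proof -
    have hQ: "hom_poly k Q" using Q by (simp add: monogenic_hom_iff)
    let ?F = "\<lambda>\<theta> w. F (r * cos \<theta>, r * sin \<theta>, w)"
    let ?c = "\<lambda>\<theta>. cis (- (real_of_int j * \<theta>))"
    define K where "K \<theta> w = inner (cact w (?c \<theta>) (?F \<theta> w)) (sph k Q w)" for \<theta> w
    have cF: "continuous_on ({0..2 * pi} \<times> sphere 0 1) (\<lambda>(\<theta>, w). ?F \<theta> w)"
      unfolding split_def
      by (rule continuous_on_compose2[OF smooth_on_continuous[OF W(3)]]) (use inS W(2) in \<open>auto intro!: continuous_intros\<close>)
    have cK: "continuous_on ({0..2 * pi} \<times> sphere 0 1) (\<lambda>(\<theta>, w). K \<theta> w)"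
      unfolding K_def split_def using cF
      by (intro continuous_intros continuous_on_compose2[OF continuous_on_sph[OF hQ, of UNIV]]) (auto simp: split_def)
    have ct: "continuous_on {0..2 * pi} (\<lambda>\<theta>. ?F \<theta> w)" if "norm w = 1" for w
      by (rule continuous_on_compose2[OF cF, of _ "\<lambda>\<theta>. (\<theta>, w)", simplified]) (use that in \<open>auto intro!: continuous_intros\<close>)
    have cw: "continuous_on (sphere 0 1) (?F \<theta>)" for \<theta>
      by (rule continuous_on_compose2[OF smooth_on_continuous[OF W(3)]]) (use inS W(2) in \<open>auto intro!: continuous_intros\<close>)
    have "sip (\<lambda>w. fc w j (\<lambda>\<theta>. f (r * cos \<theta>, r * sin \<theta>, w))) (sph k Q)
        = sint (\<lambda>w. (1 / (2 * pi)) * integral {0..2 * pi} (\<lambda>\<theta>. K \<theta> w))"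
      unfolding sip_def
    proof (rule sint_cong)
      fix w :: "(real, 'n) vec" assume w: "norm w = 1"
      have "fc w j (\<lambda>\<theta>. f (r * cos \<theta>, r * sin \<theta>, w)) = fc w j (\<lambda>\<theta>. ?F \<theta> w)"
        using F inS[OF w] by simp
      moreover have "integral {0..2 * pi} (\<lambda>\<theta>. K \<theta> w) = inner (integral {0..2 * pi} (\<lambda>\<theta>. cact w (?c \<theta>) (?F \<theta> w))) (sph k Q w)"
        using integral_linear[OF fc_integrable[OF ct[OF w], of w j] bounded_linear_inner_left, of "sph k Q w"]
        by (simp add: o_def K_def)
      ultimately show "inner (fc w j (\<lambda>\<theta>. f (r * cos \<theta>, r * sin \<theta>, w))) (sph k Q w) = (1 / (2 * pi)) * integral {0..2 * pi} (\<lambda>\<theta>. K \<theta> w)"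
        by (simp add: fc_def)
    qed
    also have "\<dots> = (1 / (2 * pi)) * integral {0..2 * pi} (\<lambda>\<theta>. sint (K \<theta>))"
      by (simp only: sint_cmult sint_integral_swap[OF cK])
    finally have eq: "lam CARD('n) k ^ m * sip (\<lambda>w. fc w j (\<lambda>\<theta>. f (r * cos \<theta>, r * sin \<theta>, w))) (sph k Q)
        = (1 / (2 * pi)) * integral {0..2 * pi} (\<lambda>\<theta>. lam CARD('n) k ^ m * sint (K \<theta>))"
      by simp
    have bd: "\<bar>lam CARD('n) k ^ m * sint (K \<theta>)\<bar> \<le> (B1 + B2) * sup_norm_S Q" if t: "\<theta> \<in> {0..2 * pi}" for \<theta>
    proof -
      let ?s1 = "sip (?F \<theta>) (sph k Q)" and ?s2 = "sip (\<lambda>w. slice_vmul F (r * cos \<theta>, r * sin \<theta>, w)) (sph k Q)"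
      have cv: "continuous_on (sphere 0 1) (\<lambda>w. slice_vmul F (r * cos \<theta>, r * sin \<theta>, w))"
        unfolding slice_vmul_def vmul_def split_conv by (intro continuous_intros cw)
      have "sint (K \<theta>) = sint (\<lambda>w. Re (?c \<theta>) * inner (?F \<theta> w) (sph k Q w) + Im (?c \<theta>) * inner (slice_vmul F (r * cos \<theta>, r * sin \<theta>, w)) (sph k Q w))"
        unfolding K_def cact_def slice_vmul_def vmul_def by (simp add: inner_add_left inner_diff_left)
      also have "\<dots> = Re (?c \<theta>) * ?s1 + Im (?c \<theta>) * ?s2"
        unfolding sip_def
        by (subst sint_add) (intro continuous_intros cw cv continuous_on_sph[OF hQ] | simp only: sint_cmult)+
      finally have e: "lam CARD('n) k ^ m * sint (K \<theta>) = Re (?c \<theta>) * (lam CARD('n) k ^ m * ?s1) + Im (?c \<theta>) * (lam CARD('n) k ^ m * ?s2)"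
        by (simp only: algebra_simps)
      have "\<bar>lam CARD('n) k ^ m * sint (K \<theta>)\<bar>
          \<le> \<bar>Re (?c \<theta>)\<bar> * \<bar>lam CARD('n) k ^ m * ?s1\<bar> + \<bar>Im (?c \<theta>)\<bar> * \<bar>lam CARD('n) k ^ m * ?s2\<bar>"
        unfolding e abs_mult[of "Re (?c \<theta>)", symmetric] abs_mult[of "Im (?c \<theta>)", symmetric] by (rule abs_triangle_ineq)
      also have "\<dots> \<le> 1 * (B1 * sup_norm_S Q) + 1 * (B2 * sup_norm_S Q)"
      proof (rule add_mono)
        show "\<bar>Re (?c \<theta>)\<bar> * \<bar>lam CARD('n) k ^ m * ?s1\<bar> \<le> 1 * (B1 * sup_norm_S Q)"
          by (rule mult_mono[OF _ B1(2)[OF t Q]]) (simp_all only: cis.sel abs_cos_le_one zero_le_one abs_ge_zero)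
        show "\<bar>Im (?c \<theta>)\<bar> * \<bar>lam CARD('n) k ^ m * ?s2\<bar> \<le> 1 * (B2 * sup_norm_S Q)"
          by (rule mult_mono[OF _ B2(2)[OF t Q]]) (simp_all only: cis.sel abs_sin_le_one zero_le_one abs_ge_zero)
      qed
      finally show ?thesis by (simp add: distrib_right)
    qed
    have "norm (integral {0..2 * pi} (\<lambda>\<theta>. lam CARD('n) k ^ m * sint (K \<theta>))) \<le> (B1 + B2) * sup_norm_S Q * (2 * pi)"
    \<comment> \<open>The integral of a function that is not integrable has the value 0, so the
      bound holds in either case.\<close>
    proof (cases "(\<lambda>\<theta>. lam CARD('n) k ^ m * sint (K \<theta>)) integrable_on {0..2 * pi}")
      case True
      have "0 \<le> (B1 + B2) * sup_norm_S Q" using bd[of 0] by simp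
      then show ?thesis
        using has_integral_bound[OF _ integrable_integral[OF True, unfolded box_real(2)[symmetric]], of "(B1 + B2) * sup_norm_S Q"] bd by simp
    next
      case False
      have "0 \<le> (B1 + B2) * sup_norm_S Q" using bd[of 0] by simp
      then show ?thesis unfolding not_integrable_integral[OF False] by simp
    qed
    then show ?thesis unfolding eq by (simp add: abs_mult field_simps)
  qed
  then show ?thesis using B1(1) B2(1) by (intro exI[of _ "B1 + B2"]) auto
qed

section \<open>Coefficients of an expansion\<close>

text \<open>Coefficients are bounded by the supremum, hence pass through uniform
  convergence.\<close>

lemma fc_sums:
  assumes w: "norm w = 1" and c: "\<And>n. continuous_on {0..2 * pi} (\<tau> n)"
    and M: "\<And>n \<theta>. \<theta> \<in> {0..2 * pi} \<Longrightarrow> norm (\<tau> n \<theta>) \<le> M n" "summable M"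
  shows "continuous_on {0..2 * pi} (\<lambda>\<theta>. \<Sum>n. \<tau> n \<theta>)"
    and "(\<lambda>n. fc w j (\<tau> n)) sums fc w j (\<lambda>\<theta>. \<Sum>n. \<tau> n \<theta>)"
proof -
  have u: "uniform_limit {0..2 * pi} (\<lambda>n \<theta>. \<Sum>i<n. \<tau> i \<theta>) (\<lambda>\<theta>. \<Sum>n. \<tau> n \<theta>) sequentially"
    by (rule Weierstrass_m_test[OF M])
  have cs: "continuous_on {0..2 * pi} (\<lambda>\<theta>. \<Sum>i<n. \<tau> i \<theta>)" for n by (intro continuous_on_sum c)
  show cT: "continuous_on {0..2 * pi} (\<lambda>\<theta>. \<Sum>n. \<tau> n \<theta>)"
    by (rule uniform_limit_theorem[OF _ u]) (use cs in \<open>auto intro: always_eventually\<close>)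
  show "(\<lambda>n. fc w j (\<tau> n)) sums fc w j (\<lambda>\<theta>. \<Sum>n. \<tau> n \<theta>)"
    unfolding sums_def
  proof (rule tendstoI)
    fix e :: real assume e: "0 < e"
    then have "0 < e / 2" by simp
    from u[unfolded uniform_limit_iff, rule_format, OF this]
    show "\<forall>\<^sub>F n in sequentially. dist (\<Sum>i<n. fc w j (\<tau> i)) (fc w j (\<lambda>\<theta>. \<Sum>n. \<tau> n \<theta>)) < e"
    proof eventually_elim
      case (elim n)
      have "(\<Sum>i<n. fc w j (\<tau> i)) - fc w j (\<lambda>\<theta>. \<Sum>n. \<tau> n \<theta>) = fc w j (\<lambda>\<theta>. (\<Sum>i<n. \<tau> i \<theta>) - (\<Sum>n. \<tau> n \<theta>))"
        using c by (simp add: fc_sum[symmetric] fc_diff[OF cs cT])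
      also have "norm \<dots> \<le> e / 2"
        using elim by (intro norm_fc_le[OF continuous_on_diff[OF cs cT] _ w]) (auto simp: dist_norm less_imp_le)
      finally show ?case using e by (simp add: dist_norm)
    qed
  qed
qed

lemma sip_sums:
  fixes g :: "nat \<Rightarrow> real ^ 'n::{finite,linorder} \<Rightarrow> 'n clif"
  assumes c: "\<And>n. continuous_on (sphere 0 1) (g n)" and M: "\<And>n w. norm w = 1 \<Longrightarrow> norm (g n w) \<le> M n" "summable M"
    and q: "continuous_on (sphere 0 1) q"
  shows "continuous_on (sphere 0 1) (\<lambda>w. \<Sum>n. g n w)"
    and "(\<lambda>n. sip (g n) q) sums sip (\<lambda>w. \<Sum>n. g n w) q"
proof -
  have u: "uniform_limit (sphere 0 1) (\<lambda>n w. \<Sum>i<n. g i w) (\<lambda>w. \<Sum>n. g n w) sequentially"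
    by (rule Weierstrass_m_test[OF _ M(2)]) (simp add: M(1))
  have cs: "continuous_on (sphere 0 1) (\<lambda>w. \<Sum>i<n. g i w)" for n by (intro continuous_on_sum c)
  show cT: "continuous_on (sphere 0 1) (\<lambda>w. \<Sum>n. g n w)"
    by (rule uniform_limit_theorem[OF _ u]) (use cs in \<open>auto intro: always_eventually\<close>)
  obtain B where B: "0 \<le> B" "\<And>w. norm w = 1 \<Longrightarrow> norm (q w) \<le> B"
    using bounded_on_sphere[OF q] by blast
  show "(\<lambda>n. sip (g n) q) sums sip (\<lambda>w. \<Sum>n. g n w) q"
    unfolding sums_def
  proof (rule tendstoI)
    fix e :: real assume e: "0 < e"
    define d where "d = e / (B + 1)"
    have d: "0 < d" using e B(1) by (simp add: d_def)
    then have "\<forall>\<^sub>F n in sequentially. \<forall>w\<in>sphere 0 1. dist (\<Sum>i<n. g i w) (\<Sum>n. g n w) < d"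
      using u unfolding uniform_limit_iff by simp
    then show "\<forall>\<^sub>F n in sequentially. dist (\<Sum>i<n. sip (g i) q) (sip (\<lambda>w. \<Sum>n. g n w) q) < e"
    proof eventually_elim
      case (elim n)
      have "(\<Sum>i<n. sip (g i) q) - sip (\<lambda>w. \<Sum>n. g n w) q = sip (\<lambda>w. (\<Sum>i<n. g i w) - (\<Sum>n. g n w)) q"
        using c by (simp add: sip_sum_left[OF q, symmetric] sip_diff_left[OF q cs cT])
      also have "\<bar>\<dots>\<bar> \<le> d * B"
        unfolding sip_def
      proof (rule sint_abs_le)
        show "continuous_on (sphere 0 1) (\<lambda>w. inner ((\<Sum>i<n. g i w) - (\<Sum>n. g n w)) (q w))"
          by (intro continuous_intros cs cT q c)
        fix w :: "(real, 'n) vec" assume w: "norm w = 1"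
        have "norm ((\<Sum>i<n. g i w) - (\<Sum>n. g n w)) * norm (q w) \<le> d * B"
          using elim w B d by (intro mult_mono) (auto simp: dist_norm less_imp_le)
        then show "\<bar>inner ((\<Sum>i<n. g i w) - (\<Sum>n. g n w)) (q w)\<bar> \<le> d * B"
          using Cauchy_Schwarz_ineq2 order_trans by blast
      qed
      also have "d * B < e" using e B(1) by (simp add: d_def field_simps)
      finally show ?case by (simp add: dist_real_def)
    qed
  qed
qed

definition zpow_family :: "int \<Rightarrow> nat \<Rightarrow> complex \<Rightarrow> complex" where
  "zpow_family j k z = z powi j * \<i> ^ k"

text \<open>Cut off at negative j so as to be holomorphic at 0 too; it can replace
  \<open>zpow_family\<close> whenever the coefficients of negative index vanish.\<close>

definition pow_family :: "int \<Rightarrow> nat \<Rightarrow> complex \<Rightarrow> complex" where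
  "pow_family j k z = (if j < 0 then 0 else z ^ nat j * \<i> ^ k)"

lemma holo_zpow_family: "holo_family (- {0}) zpow_family"
  unfolding holo_family_def
proof (intro conjI allI ballI)
  show "zpow_family j k holomorphic_on - {0}" for j k
    unfolding zpow_family_def[abs_def] by (intro holomorphic_intros) auto
  fix z :: complex assume z: "z \<in> - {0}"
  \<comment> \<open>Dominates both |x| and 1/|x| on the disc of radius |z|/2, hence the powers of
    either sign.\<close>
  define B where "B = 2 * norm z + 2 / norm z"
  have B: "0 \<le> B" by (simp add: B_def)
  have "norm (zpow_family j k x) \<le> 1 * B ^ nat \<bar>j\<bar>" if x: "x \<in> ball z (norm z / 2)" for j k x
  proof -
    have d: "norm (z - x) < norm z / 2" using x by (simp add: dist_norm)
    then have n: "norm x \<le> 2 * norm z" "norm z / 2 \<le> norm x"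
      using norm_triangle_ineq2[of x z] norm_triangle_ineq2[of z x] norm_minus_commute[of x z] by linarith+
    have z0: "0 < norm z" using z by simp
    have x0: "0 < norm x" using n(2) z0 by linarith
    show ?thesis
    proof (cases "0 \<le> j")
      case True
      have "norm x ^ nat j \<le> B ^ nat j"
        using n by (intro power_mono) (auto simp: B_def add_increasing2)
      then show ?thesis using True by (simp add: zpow_family_def norm_mult norm_power power_int_def)
    next
      case False
      have "inverse (norm x) \<le> inverse (norm z / 2)" using n(2) z0 by (intro le_imp_inverse_le) auto
      also have "\<dots> \<le> B" by (simp add: B_def field_simps)
      finally have "inverse (norm x) ^ nat (- j) \<le> B ^ nat (- j)" by (intro power_mono) auto
      then show ?thesis using False by (simp add: zpow_family_def norm_mult norm_power power_int_def norm_inverse)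
    qed
  qed
  then show "\<exists>e>0. \<exists>C\<ge>0. \<exists>B\<ge>0. \<forall>j k. \<forall>x\<in>ball z e. norm (zpow_family j k x) \<le> C * B ^ nat \<bar>j\<bar>"
    using z B by (intro exI[of _ "norm z / 2"] conjI exI[of _ 1] exI[of _ B]) auto
qed

lemma holo_pow_family: "holo_family UNIV pow_family"
  unfolding holo_family_def
proof (intro conjI allI ballI)
  show "pow_family j k holomorphic_on UNIV" for j k
    unfolding pow_family_def[abs_def] by (cases "j < 0") (auto intro!: holomorphic_intros)
  fix z :: complex
  have "norm (pow_family j k x) \<le> 1 * (norm z + 1) ^ nat \<bar>j\<bar>" if x: "x \<in> ball z 1" for j k x
  proof (cases "j < 0")
    case False
    have "norm x \<le> norm z + 1"
      using x norm_triangle_ineq2[of x z] norm_minus_commute[of x z] by (simp add: dist_norm)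
    then have "norm x ^ nat j \<le> (norm z + 1) ^ nat j" by (intro power_mono) auto
    then show ?thesis using False by (simp add: pow_family_def norm_mult norm_power)
  qed (simp add: pow_family_def)
  then show "\<exists>e>0. \<exists>C\<ge>0. \<exists>B\<ge>0. \<forall>j k. \<forall>x\<in>ball z e. norm (pow_family j k x) \<le> C * B ^ nat \<bar>j\<bar>"
    by (intro exI[of _ 1] conjI exI[of _ "norm z + 1"]) auto
qed

section \<open>Termwise Fourier coefficients and scalar products of an expansion\<close>

lemma rapid_family_bound:
  assumes "rapid_family 0 P" "0 < a"
  obtains C where "0 < C" "\<And>k j w. norm w = 1 \<Longrightarrow> norm (P k j w) \<le> C * a ^ nat \<bar>j\<bar> / (real k + 1) ^ m"
proof -
  have "\<exists>C>0. \<forall>k j w. norm w = 1 \<longrightarrow> norm (P k j w) \<le> C * a ^ nat \<bar>j\<bar> / (real k + 1) ^ m"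
    using assms unfolding rapid_family_def by blast
  then show ?thesis using that by blast
qed

lemma rapid_family_continuous: "rapid_family 0 P \<Longrightarrow> continuous_on S (P k j)"
  by (rule hom_poly_continuous_on[of k]) (simp add: rapid_family_def)

lemma eterm_bound:
  assumes u: "holo_family U u" and P: "rapid_family 0 P" and z: "Complex x0 p \<in> U"
  shows "\<exists>K\<ge>0. \<forall>w jk. norm w = 1 \<longrightarrow> norm (eterm u P x0 p w jk) \<le> K * wt jk"
proof -
  obtain e C B where e: "0 < e" "0 \<le> C" "0 \<le> B"
    "\<And>j k x. x \<in> ball (Complex x0 p) e \<Longrightarrow> norm (u j k x) \<le> C * B ^ nat \<bar>j\<bar>"
    using u z unfolding holo_family_def by meson
  define a where "a = 1 / (2 * (B + 1))"
  have a: "0 < a" "B * a \<le> 1/2" using e(3) by (auto simp: a_def field_simps)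
  obtain C' where C': "0 < C'" "\<And>k j w. norm w = 1 \<Longrightarrow> norm (P k j w) \<le> C' * a ^ nat \<bar>j\<bar> / (real k + 1)\<^sup>2"
    using rapid_family_bound[OF P a(1), of 2] by blast
  have "norm (eterm u P x0 p w jk) \<le> (C * C') * wt jk" if w: "norm w = 1" for w jk
  proof -
    obtain j k where jk: "jk = (j, k)" by (cases jk)
    have "norm (eterm u P x0 p w jk) = norm (u j k (Complex x0 p)) * norm (P k j w)"
      by (simp add: eterm_def jk norm_cact[OF w])
    also have "\<dots> \<le> (C * B ^ nat \<bar>j\<bar>) * (C' * a ^ nat \<bar>j\<bar> / (real k + 1)\<^sup>2)"
      using e C'(2)[OF w] by (intro mult_mono) auto
    also have "\<dots> = (C * C') * ((B * a) ^ nat \<bar>j\<bar> / (real k + 1)\<^sup>2)" by (simp add: power_mult_distrib mult_ac)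
    also have "\<dots> \<le> (C * C') * ((1/2) ^ nat \<bar>j\<bar> / (real k + 1)\<^sup>2)"
      using a e C' by (intro mult_left_mono divide_right_mono power_mono) auto
    finally show ?thesis by (simp add: wt_def jk)
  qed
  then show ?thesis using e C' by (intro exI[of _ "C * C'"]) auto
qed

text \<open>Under the majorant the series converges absolutely, so unordered and ordered summation
  agree.\<close>

lemma has_sum_enum_jk:
  fixes c :: "int \<times> nat \<Rightarrow> 'a::banach"
  assumes "\<And>jk. norm (c jk) \<le> K * wt jk"
  shows "(c has_sum s) UNIV \<longleftrightarrow> (\<lambda>n. c (enum_jk n)) sums s"
proof -
  have s: "summable (\<lambda>n. norm (c (enum_jk n)))"
    by (rule summable_comparison_test'[OF summable_mult[OF summable_wt, of K], of 0]) (simp add: assms)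
  have "((\<lambda>n. c (enum_jk n)) has_sum s) UNIV \<longleftrightarrow> (\<lambda>n. c (enum_jk n)) sums s"
    by (rule iffI) (erule has_sum_imp_sums, erule norm_summable_imp_has_sum[OF s])
  then show ?thesis using has_sum_reindex_bij_betw[OF bij_enum_jk, of c s] by simp
qed

text \<open>The j-th Laurent coefficient of an expansion, as a function on the sphere assembled from
  all k.\<close>

definition bcoef :: "(nat \<Rightarrow> int \<Rightarrow> real ^ 'n::{finite,linorder} \<Rightarrow> 'n clif) \<Rightarrow> int \<Rightarrow> (real, 'n) vec \<Rightarrow> 'n clif" where
  "bcoef P j w = (\<Sum>k. cact w (\<i> ^ k) (P k j w))"

lemma summable_inverse_squares: "summable (\<lambda>k. C / (real k + 1)\<^sup>2)"
proof -
  have "summable (\<lambda>k. 1 / (real (Suc k))\<^sup>2)"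
    using summable_Suc_iff[of "\<lambda>k. inverse ((real k)\<^sup>2)"] inverse_power_summable[of 2, where 'a=real]
    by (simp add: inverse_eq_divide)
  from summable_mult[OF this, of C] show ?thesis by (simp add: add.commute)
qed

lemma bcoef_bound:
  assumes P: "rapid_family 0 P"
  obtains C where "\<And>k w. norm w = 1 \<Longrightarrow> norm (cact w (\<i> ^ k) (P k j w)) \<le> C / (real k + 1)\<^sup>2"
proof -
  obtain C where "0 < C" "\<And>k j w. norm w = 1 \<Longrightarrow> norm (P k j w) \<le> C * 1 ^ nat \<bar>j\<bar> / (real k + 1)\<^sup>2"
    using rapid_family_bound[OF P zero_less_one, of 2] by blast
  then show ?thesis by (intro that[of C]) (simp add: norm_cact norm_power)
qed

lemma summable_bcoef:
  assumes "rapid_family 0 P" "norm w = 1"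
  shows "summable (\<lambda>k. cact w (\<i> ^ k) (P k j w))"
proof -
  obtain C where "\<And>k w. norm w = 1 \<Longrightarrow> norm (cact w (\<i> ^ k) (P k j w)) \<le> C / (real k + 1)\<^sup>2"
    using bcoef_bound[OF assms(1)] by blast
  then show ?thesis
    by (intro summable_comparison_test'[OF summable_inverse_squares[of C], of 0]) (simp add: assms(2))
qed

lemma zpow_family_polar:
  assumes r: "0 < r"
  shows "zpow_family j k (Complex (r * cos \<theta>) (r * sin \<theta>)) = of_real (r powi j) * (cis (real_of_int j * \<theta>) * \<i> ^ k)"
proof -
  have "Complex (r * cos \<theta>) (r * sin \<theta>) = of_real r * cis \<theta>" by (simp add: complex_eq_iff)
  moreover have "cis \<theta> powi j = cis (real_of_int j * \<theta>)"
  proof (cases "0 \<le> j")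
    case True
    then have "real_of_int j = real (nat j)" by simp
    then show ?thesis using True by (simp only: power_int_def if_True Complex.DeMoivre)
  next
    case False
    then have "real_of_int j = - real (nat (- j))" by simp
    then show ?thesis using False by (simp add: power_int_def cis_inverse Complex.DeMoivre)
  qed
  ultimately show ?thesis
    by (simp add: zpow_family_def power_int_mult_distrib of_real_power_int)
qed

lemma eterm_polar:
  assumes r: "0 < r" and w: "norm w = 1"
  shows "eterm zpow_family P (r * cos \<theta>) (r * sin \<theta>) w (j, k) = cact w (cis (real_of_int j * \<theta>)) (r powi j *\<^sub>R cact w (\<i> ^ k) (P k j w))"
  unfolding eterm_def prod.case zpow_family_polar[OF r] by (simp only: cact_mult[OF w] cact_simps)

text \<open>On a circle the norm of each term does not depend on the angle, so the series converges
  uniformly and coefficients may be taken termwise; only pairs with first index \<open>j\<close>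
  survive.\<close>

lemma fc_expansion:
  assumes P: "rapid_family 0 P" and r: "0 < r" and w: "norm w = 1"
  shows "fc w j (\<lambda>\<theta>. \<Sum>n. eterm zpow_family P (r * cos \<theta>) (r * sin \<theta>) w (enum_jk n)) = r powi j *\<^sub>R bcoef P j w"
    and "continuous_on {0..2 * pi} (\<lambda>\<theta>. \<Sum>n. eterm zpow_family P (r * cos \<theta>) (r * sin \<theta>) w (enum_jk n))"
proof -
  let ?T = "\<lambda>jk \<theta>. eterm zpow_family P (r * cos \<theta>) (r * sin \<theta>) w jk"
  let ?C = "\<lambda>(l, k). if j = l then r powi l *\<^sub>R cact w (\<i> ^ k) (P k l w) else 0"
  have "Complex (r * cos 0) (r * sin 0) \<in> - {0}" using r by (simp add: complex_eq_iff)
  from eterm_bound[OF holo_zpow_family P this]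
  obtain K where K: "0 \<le> K" "\<And>jk. norm (?T jk 0) \<le> K * wt jk" using w by blast
  have nT: "norm (?T jk \<theta>) \<le> K * wt jk" for jk \<theta>
    using K(2)[of jk] by (cases jk) (simp only: eterm_polar[OF r w] norm_cact[OF w] norm_cis)
  have cT: "continuous_on S (?T jk)" for jk S
    by (cases jk) (simp only: eterm_polar[OF r w], intro continuous_intros)
  have fcT: "fc w j (?T jk) = ?C jk" for jk
    by (cases jk) (simp add: eterm_polar[OF r w] fc_cis[OF w])
  have nC: "norm (?C jk) \<le> K * wt jk" for jk
  proof -
    obtain l k where jk: "jk = (l, k)" by (cases jk)
    have "norm (?C jk) \<le> norm (?T jk 0)"
      unfolding jk eterm_polar[OF r w] norm_cact[OF w] by simp
    then show ?thesis using K(2)[of jk] by linarith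
  qed
  note S = fc_sums[of w "\<lambda>n. ?T (enum_jk n)" "\<lambda>n. K * wt (enum_jk n)", OF w cT nT summable_mult[OF summable_wt]]
  show "continuous_on {0..2 * pi} (\<lambda>\<theta>. \<Sum>n. ?T (enum_jk n) \<theta>)" by (rule S(1))
  have "(\<lambda>n. ?C (enum_jk n)) sums fc w j (\<lambda>\<theta>. \<Sum>n. ?T (enum_jk n) \<theta>)"
    using S(2)[of j] by (simp only: fcT)
  then have "(?C has_sum fc w j (\<lambda>\<theta>. \<Sum>n. ?T (enum_jk n) \<theta>)) UNIV"
    using has_sum_enum_jk[of ?C K] nC by blast
  \<comment> \<open>The sum is restricted to the pairs over \<open>j\<close>, outside of which all
    terms are 0.\<close>
  then have "(?C has_sum fc w j (\<lambda>\<theta>. \<Sum>n. ?T (enum_jk n) \<theta>)) (Pair j ` UNIV)"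
    by (subst has_sum_cong_neutral[where T=UNIV and g="?C"]) auto
  then have "((\<lambda>k. r powi j *\<^sub>R cact w (\<i> ^ k) (P k j w)) has_sum fc w j (\<lambda>\<theta>. \<Sum>n. ?T (enum_jk n) \<theta>)) UNIV"
    by (subst (asm) has_sum_reindex) (auto simp: inj_on_def o_def)
  then have "fc w j (\<lambda>\<theta>. \<Sum>n. ?T (enum_jk n) \<theta>) = (\<Sum>k. r powi j *\<^sub>R cact w (\<i> ^ k) (P k j w))"
    using has_sum_imp_sums sums_unique by blast
  also have "\<dots> = r powi j *\<^sub>R bcoef P j w"
    unfolding bcoef_def by (rule suminf_scaleR_right[OF summable_bcoef[OF P w], symmetric])
  finally show "fc w j (\<lambda>\<theta>. \<Sum>n. ?T (enum_jk n) \<theta>) = r powi j *\<^sub>R bcoef P j w" .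
qed

lemma cact_uminus: "cact (- w) z x = cact w (cnj z) x"
  by (simp add: cact_def cl_vec_linear_simps cl_mult.minus_left)

lemma cnj_i_power: "cnj (\<i> ^ k) * (-1) ^ k = \<i> ^ k"
proof -
  have "cnj (\<i> ^ k) * (-1) ^ k = (cnj \<i> * (-1)) ^ k" by (simp only: complex_cnj_power power_mult_distrib)
  then show ?thesis by simp
qed

text \<open>Changing the sign of \<open>w\<close> conjugates the action and so undoes the
  conjugation of \<open>z\<close>; the sign (-1)^k which conjugation produces in i^k cancels the one
  from the degree of \<open>P\<close>. This is how the factor omega^k makes each term even.\<close>

lemma cact_even_term:
  assumes P: "hom_poly k P"
  shows "cact (- w) (cnj z * \<i> ^ k) (P (- w)) = cact w (z * \<i> ^ k) (P w)"
proof -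
  have "P (- w) = (-1) ^ k *\<^sub>R P w" using hom_poly_scale_arg[OF P, of "-1" w] by simp
  then have "cact (- w) (cnj z * \<i> ^ k) (P (- w)) = cact w ((-1) ^ k *\<^sub>R cnj (cnj z * \<i> ^ k)) (P w)"
    by (simp only: cact_uminus cact_simps)
  also have "(-1) ^ k *\<^sub>R cnj (cnj z * \<i> ^ k) = z * (cnj (\<i> ^ k) * (-1) ^ k)"
    by (simp add: scaleR_conv_of_real)
  finally show ?thesis by (simp only: cnj_i_power)
qed

text \<open>Uniform convergence in k carries continuity and scalar products through the sum,
  termwise evenness gives the parity, and orthogonality isolates the component of degree l.\<close>

lemma bcoef_properties:
  fixes P :: "nat \<Rightarrow> int \<Rightarrow> real ^ 'n::{finite,linorder} \<Rightarrow> 'n clif"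
  assumes P: "rapid_family 0 P"
  shows "continuous_on (sphere 0 1) (bcoef P j)" "bcoef P j (- w) = bcoef P j w"
    and "(\<And>k. monogenic_hom k (P k j)) \<Longrightarrow> monogenic_hom l Q \<Longrightarrow>
      sip (bcoef P j) (sph l Q) = (-1) ^ (l div 2) * sip (sph l (P l j)) (sph l Q)"
proof -
  obtain C where C: "\<And>k w. norm w = 1 \<Longrightarrow> norm (cact w (\<i> ^ k) (P k j w)) \<le> C / (real k + 1)\<^sup>2"
    using bcoef_bound[OF P, of j] by blast
  have c: "continuous_on (sphere 0 1) (\<lambda>w. cact w (\<i> ^ k) (P k j w))" for k
    by (intro continuous_intros rapid_family_continuous[OF P])
  have S1: "continuous_on (sphere 0 1) (\<lambda>w. \<Sum>k. cact w (\<i> ^ k) (P k j w))"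
    by (rule sip_sums(1)[OF c _ summable_inverse_squares continuous_on_const]) (rule C)
  have S2: "(\<lambda>k. sip (\<lambda>w. cact w (\<i> ^ k) (P k j w)) q) sums sip (\<lambda>w. \<Sum>k. cact w (\<i> ^ k) (P k j w)) q"
    if "continuous_on (sphere 0 1) q" for q
    by (rule sip_sums(2)[OF c _ summable_inverse_squares that]) (rule C)
  show "continuous_on (sphere 0 1) (bcoef P j)"
    unfolding bcoef_def[abs_def] by (rule S1)
  show "bcoef P j (- w) = bcoef P j w"
    unfolding bcoef_def using cact_even_term[of _ "P _ j" w 1] P
    by (intro suminf_cong) (auto simp: rapid_family_def)
  assume m: "\<And>k. monogenic_hom k (P k j)" and Q: "monogenic_hom l Q"
  have hQ: "hom_poly l Q" using Q by (simp add: monogenic_hom_iff)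
  have "sip (\<lambda>w. cact w (\<i> ^ k) (P k j w)) (sph l Q) = (if k = l then (-1) ^ (l div 2) * sip (sph l (P l j)) (sph l Q) else 0)" for k
  proof -
    have "sip (\<lambda>w. cact w (\<i> ^ k) (P k j w)) (sph l Q) = sip (\<lambda>w. (-1) ^ (k div 2) *\<^sub>R sph k (P k j) w) (sph l Q)"
      by (intro sip_cong cact_sph refl)
    also have "\<dots> = (-1) ^ (k div 2) * sip (sph k (P k j)) (sph l Q)" by (rule sip_scaleR_left)
    finally show ?thesis using sph_orthogonal[OF m Q] by (auto simp: sip_def)
  qed
  then have "(\<lambda>k. if k = l then (-1) ^ (l div 2) * sip (sph l (P l j)) (sph l Q) else 0) sums sip (bcoef P j) (sph l Q)"
    using S2[OF continuous_on_sph[OF hQ]] by (simp add: bcoef_def[abs_def])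
  from sums_unique2[OF this sums_single[of l "\<lambda>_. (-1) ^ (l div 2) * sip (sph l (P l j)) (sph l Q)"]]
  show "sip (bcoef P j) (sph l Q) = (-1) ^ (l div 2) * sip (sph l (P l j)) (sph l Q)" .
qed

lemma monogenic_hom_diff: "monogenic_hom k P \<Longrightarrow> monogenic_hom k Q \<Longrightarrow> monogenic_hom k (\<lambda>x. P x - Q x)"
  unfolding monogenic_hom_iff
  by (auto intro: hom_poly_diff) (subst dirac_diff; simp add: hom_poly_differentiable)

lemma hom_poly_eq_0:
  assumes P: "hom_poly k P" and 0: "\<And>w. norm w = 1 \<Longrightarrow> P w = 0"
  shows "P = (\<lambda>x. 0)"
proof
  fix x
  obtain y :: "(real, 'a) vec" where y: "norm y = 1" using vector_choose_size[of 1] by auto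
  define z where "z = (if x = 0 then y else (1 / norm x) *\<^sub>R x)"
  have z: "norm z = 1" "x = norm x *\<^sub>R z" using y by (auto simp: z_def)
  show "P x = 0" by (subst z(2)) (simp add: hom_poly_scale_arg[OF P] 0[OF z(1)])
qed

text \<open>Testing both coefficients against the difference \<open>R\<close> of the two polynomials
  shows that \<open>R\<close> has norm 0 on the sphere; homogeneity extends this to the whole
  space.\<close>

lemma bcoef_unique:
  fixes P Q :: "nat \<Rightarrow> int \<Rightarrow> real ^ 'n::{finite,linorder} \<Rightarrow> 'n clif"
  assumes P: "rapid_family 0 P" "\<And>k. monogenic_hom k (P k j)" and Q: "rapid_family 0 Q" "\<And>k. monogenic_hom k (Q k j)"
    and eq: "\<And>w. norm w = 1 \<Longrightarrow> bcoef P j w = bcoef Q j w"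
  shows "P k j = Q k j"
proof -
  define R where "R x = P k j x - Q k j x" for x
  have R: "monogenic_hom k R" unfolding R_def[abs_def] by (rule monogenic_hom_diff[OF P(2) Q(2)])
  have hom: "hom_poly k (P k j)" "hom_poly k (Q k j)" "hom_poly k R"
    using P(2) Q(2) R by (auto simp: monogenic_hom_iff)
  have "(-1) ^ (k div 2) * sip (sph k (P k j)) (sph k R) = (-1) ^ (k div 2) * sip (sph k (Q k j)) (sph k R)"
    unfolding bcoef_properties(3)[OF P R, symmetric] bcoef_properties(3)[OF Q R, symmetric]
    by (intro sip_cong eq refl)
  then have "sip (sph k (P k j)) (sph k R) = sip (sph k (Q k j)) (sph k R)" by simp
  moreover have "sph k R = (\<lambda>w. sph k (P k j) w - sph k (Q k j) w)"
    by (simp add: sph_def R_def[abs_def] vmul_def[abs_def] cl_mult.diff_right fun_eq_iff)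
  ultimately have "sip (sph k R) (sph k R) = 0"
    using sip_diff_left[OF continuous_on_sph[OF hom(3)] continuous_on_sph[OF hom(1)] continuous_on_sph[OF hom(2)]] by simp
  then have "norm (R w) = 0" if "norm w = 1" for w
    using sip_self_eq_0[OF continuous_on_sph[OF hom(3)] _ that] norm_sph[OF that, of k R] by simp
  then have "R = (\<lambda>x. 0)" by (intro hom_poly_eq_0[OF hom(3)]) simp
  then show ?thesis by (auto simp: R_def fun_eq_iff)
qed

section \<open>Existence of the expansion\<close>

lemma slice_monogenic_continuous:
  assumes "slice_monogenic U f"
  shows "continuous_on (sdom U) f"
proof -
  obtain W F where W: "sdom U \<subseteq> W" "smooth_on W F" and F: "\<And>z. z \<in> sdom U \<Longrightarrow> F z = f z"
    using assms unfolding slice_monogenic_def smooth_on_sdom_def by blast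
  have "continuous_on (sdom U) F" by (rule continuous_on_subset[OF smooth_on_continuous[OF W(2)] W(1)])
  then show ?thesis by (rule continuous_on_eq) (rule F)
qed

lemma punct_eq: "{(x0, p). Complex x0 p \<in> - {0}} = punct"
  by (auto simp: complex_eq_iff)

lemma expansion_slice_monogenic_punct:
  assumes "rapid_family 0 P"
    and "\<And>x0 p w. (x0, p) \<noteq> (0, 0) \<Longrightarrow> norm w = 1 \<Longrightarrow> f (x0, p, w) = (\<Sum>n. eterm zpow_family P x0 p w (enum_jk n))"
  shows "slice_monogenic punct f"
  using expansion_slice_monogenic[OF _ holo_zpow_family assms(1), of f] assms(2)
  unfolding punct_eq by (auto simp: complex_eq_iff open_Compl)

text \<open>Reflecting the angle compensates the conjugation of the weight caused by -w, and
  periodicity restores the interval of integration.\<close>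

lemma fc_even:
  fixes f :: "real \<times> real \<times> (real ^ 'n::{finite,linorder}) \<Rightarrow> 'n clif"
  assumes f: "\<And>\<theta>. f (cos \<theta>, sin \<theta>, - w) = f (cos \<theta>, - sin \<theta>, w)"
  shows "fc (- w) j (\<lambda>\<theta>. f (cos \<theta>, sin \<theta>, - w)) = fc w j (\<lambda>\<theta>. f (cos \<theta>, sin \<theta>, w))"
proof -
  define G where "G \<theta> = cact w (cis (- (real_of_int j * \<theta>))) (f (cos \<theta>, sin \<theta>, w))" for \<theta>
  have per: "G (\<theta> + 2 * pi) = G \<theta>" for \<theta>
  proof -
    have "cis (- (real_of_int j * (\<theta> + 2 * pi))) = cis (- (real_of_int j * \<theta>)) * cis (2 * pi * of_int (- j))"
      by (simp add: cis_mult algebra_simps)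
    moreover have "cis (2 * pi * of_int (- j)) = 1" by (rule cis_multiple_2pi) simp
    ultimately show ?thesis by (simp only: G_def mult_1_right sin_periodic cos_periodic)
  qed
  have "integral {0..2 * pi} (\<lambda>\<theta>. cact (- w) (cis (- (real_of_int j * \<theta>))) (f (cos \<theta>, sin \<theta>, - w)))
      = integral {- 0..- (- (2 * pi))} (\<lambda>\<theta>. G (- \<theta>))"
    by (simp add: G_def cact_uminus f cis_cnj)
  also have "\<dots> = integral {- (2 * pi)..0} G" by (rule Henstock_Kurzweil_Integration.integral_reflect_real)
  also have "\<dots> = integral {0..2 * pi} G"
    using integral_shift_real_ivl[of 0 "2 * pi" "2 * pi" G] by (simp add: per)
  finally show ?thesis by (simp add: fc_def G_def[abs_def])
qed

text \<open>The circle of radius 1/a is used for nonnegative j and the circle of radius a for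
  negative j: in both cases the scaling factor r^j equals a^(-|j|).\<close>

lemma coefficient_decay:
  fixes f :: "real \<times> real \<times> (real ^ 'n::{finite,linorder}) \<Rightarrow> 'n clif"
  assumes f: "slice_monogenic punct f" and a: "0 < a"
  shows "\<exists>B\<ge>0. \<forall>j k Q. monogenic_hom k Q \<longrightarrow>
    \<bar>lam CARD('n) k\<bar> ^ m * \<bar>sip (\<lambda>w. fc w j (\<lambda>\<theta>. f (cos \<theta>, sin \<theta>, w))) (sph k Q)\<bar> \<le> B * a ^ nat \<bar>j\<bar> * sup_norm_S Q"
proof -
  let ?A = "\<lambda>j w. fc w j (\<lambda>\<theta>. f (cos \<theta>, sin \<theta>, w))"
  have sc: "sip (\<lambda>w. fc w j (\<lambda>\<theta>. f (r * cos \<theta>, r * sin \<theta>, w))) q = r powi j * sip (?A j) q" if "0 < r" for r j q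
    unfolding sip_scaleR_left[symmetric] using slice_monogenic_polar[OF f _ that] by (intro sip_cong) auto
  obtain B1 where B1: "0 \<le> B1" "\<And>j k Q. monogenic_hom k Q \<Longrightarrow> \<bar>lam CARD('n) k ^ m * ((1 / a) powi j * sip (?A j) (sph k Q))\<bar> \<le> B1 * sup_norm_S Q"
  proof -
    have "0 < 1 / a" using a by simp
    from laurent_decay[OF f this, of m] show ?thesis unfolding sc[OF \<open>0 < 1 / a\<close>] using that by blast
  qed
  obtain B2 where B2: "0 \<le> B2" "\<And>j k Q. monogenic_hom k Q \<Longrightarrow> \<bar>lam CARD('n) k ^ m * (a powi j * sip (?A j) (sph k Q))\<bar> \<le> B2 * sup_norm_S Q"
    using laurent_decay[OF f a, of m] unfolding sc[OF a] by blast
  have "\<bar>lam CARD('n) k\<bar> ^ m * \<bar>sip (?A j) (sph k Q)\<bar> \<le> (B1 + B2) * a ^ nat \<bar>j\<bar> * sup_norm_S Q"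
    if Q: "monogenic_hom k Q" for j k Q
  proof -
    let ?X = "\<bar>lam CARD('n) k\<bar> ^ m * \<bar>sip (?A j) (sph k Q)\<bar>"
    have ap: "0 < a ^ nat \<bar>j\<bar>" using a by simp
    have s0: "0 \<le> sup_norm_S Q"
    proof -
      have "continuous_on (sphere 0 1) Q" using Q hom_poly_continuous_on by (auto simp: monogenic_hom_iff)
      then obtain w where "sup_norm_S Q = norm (Q w)" using sup_norm_S_attained by blast
      then show ?thesis by simp
    qed
    have "?X * (1 / a ^ nat \<bar>j\<bar>) \<le> max B1 B2 * sup_norm_S Q"
    proof (cases "0 \<le> j")
      case True
      have "?X * (1 / a ^ nat \<bar>j\<bar>) \<le> B1 * sup_norm_S Q"
        using B1(2)[OF Q, of j] True a by (simp add: abs_mult power_abs power_int_def power_one_over mult_ac)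
      moreover have "B1 * sup_norm_S Q \<le> max B1 B2 * sup_norm_S Q"
        using s0 by (intro mult_right_mono) auto
      ultimately show ?thesis by linarith
    next
      case False
      have "?X * (1 / a ^ nat \<bar>j\<bar>) \<le> B2 * sup_norm_S Q"
        using B2(2)[OF Q, of j] False a by (simp add: abs_mult power_abs power_int_def inverse_eq_divide power_one_over mult_ac)
      moreover have "B2 * sup_norm_S Q \<le> max B1 B2 * sup_norm_S Q"
        using s0 by (intro mult_right_mono) auto
      ultimately show ?thesis by linarith
    qed
    also have "\<dots> \<le> (B1 + B2) * sup_norm_S Q"
      using s0 B1(1) B2(1) by (intro mult_right_mono) auto
    finally have "?X / a ^ nat \<bar>j\<bar> \<le> (B1 + B2) * sup_norm_S Q" by simp
    then show ?thesis using ap by (simp add: pos_divide_le_eq mult_ac)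
  qed
  then show ?thesis using B1(1) B2(1) by (intro exI[of _ "B1 + B2"]) auto
qed

text \<open>Testing with the projection itself puts the square of its L2 norm on the left and its
  supremum on the right. Bounding the supremum by the L2 norm and cancelling one factor leaves an
  estimate of the L2 norm.\<close>

lemma projection_decay:
  fixes R :: "nat \<Rightarrow> int \<Rightarrow> real ^ 'n::{finite,linorder} \<Rightarrow> 'n clif"
  assumes f: "slice_monogenic punct f" and R: "\<And>k j. monogenic_hom k (R k j)"
    and proj: "\<And>k j. sip (\<lambda>w. fc w j (\<lambda>\<theta>. f (cos \<theta>, sin \<theta>, w))) (sph k (R k j)) = sip (sph k (R k j)) (sph k (R k j))"
  shows "rapid_family 0 R"
  unfolding rapid_family_def
proof (intro conjI allI impI)
  have hR: "hom_poly k (R k j)" for k j using R by (simp add: monogenic_hom_iff)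
  then show "hom_poly (k + 0) (R k j)" for k j by simp
  fix m :: nat and a :: real assume a: "0 < a"
  let ?n = "CARD('n)" and ?A = "\<lambda>j w. fc w j (\<lambda>\<theta>. f (cos \<theta>, sin \<theta>, w))"
  \<comment> \<open>One factor (k + 1)^n is lost in bounding the supremum by the L2 norm, and a
    second one in returning from the L2 norm to the supremum.\<close>
  define M where "M = m + 2 * ?n"
  obtain B0 where B0: "0 \<le> B0" "\<And>j k Q. monogenic_hom k Q \<Longrightarrow> \<bar>lam ?n k\<bar> ^ 0 * \<bar>sip (?A j) (sph k Q)\<bar> \<le> B0 * a ^ nat \<bar>j\<bar> * sup_norm_S Q"
    using coefficient_decay[OF f a, of 0] by blast
  obtain BM where BM: "0 \<le> BM" "\<And>j k Q. monogenic_hom k Q \<Longrightarrow> \<bar>lam ?n k\<bar> ^ M * \<bar>sip (?A j) (sph k Q)\<bar> \<le> BM * a ^ nat \<bar>j\<bar> * sup_norm_S Q"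
    using coefficient_decay[OF f a, of M] by blast
  define K0 where "K0 = 2 * (16 * real ?n) ^ ?n"
  define B where "B = B0 + 2 ^ M * BM"
  have K0: "0 \<le> K0" by (simp add: K0_def)
  have B: "0 \<le> B" using B0 BM by (simp add: B_def)
  have bound: "norm (R k j w) \<le> (K0\<^sup>2 * B + 1) * a ^ nat \<bar>j\<bar> / (real k + 1) ^ m" if w: "norm w = 1" for k j w
  proof -
    define L where "L = L2_norm_S (R k j)"
    define s where "s = sup_norm_S (R k j)"
    define A where "A = a ^ nat \<bar>j\<bar>"
    define Kk where "Kk = K0 * (real k + 1) ^ ?n"
    have A: "0 < A" using a by (simp add: A_def)
    have Kk: "0 \<le> Kk" using K0 by (simp add: Kk_def)
    have cR: "continuous_on S (R k j)" for S by (rule hom_poly_continuous_on[OF hR])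
    have sL: "s \<le> Kk * L" using sup_le_L2_norm[OF hR[of k j]] by (simp add: s_def Kk_def K0_def L_def)
    have L0: "0 \<le> L" unfolding L_def L2_norm_S_eq[OF cR] by (intro real_sqrt_ge_zero sint_nonneg) simp
    have "L\<^sup>2 = sint (\<lambda>w. (norm (R k j w))\<^sup>2)"
      unfolding L_def L2_norm_S_eq[OF cR] by (intro real_sqrt_pow2 sint_nonneg) simp
    also have "\<dots> = sip (sph k (R k j)) (sph k (R k j))"
      unfolding sip_def power2_norm_eq_inner[symmetric] by (intro sint_cong) (simp add: norm_sph)
    finally have L2: "sip (?A j) (sph k (R k j)) = L\<^sup>2" using proj by simp
    have step: "x * L \<le> b * A * Kk" if b: "x * L\<^sup>2 \<le> b * A * s" "0 \<le> b" for x b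
    proof (cases "L = 0")
      case True
      then show ?thesis using b(2) A Kk by simp
    next
      case False
      have "x * L\<^sup>2 \<le> b * A * (Kk * L)"
        using b sL A by (meson mult_left_mono mult_nonneg_nonneg less_imp_le order_trans)
      then have "(x * L) * L \<le> (b * A * Kk) * L" by (simp add: power2_eq_square mult_ac)
      then show ?thesis using False L0 by (simp add: mult_le_cancel_right)
    qed
    have "(real k + 1) ^ M * L \<le> B * A * Kk"
    \<comment> \<open>The eigenvalue is 0 at k = 0 and yields nothing there, so the bound without
      any power of it takes over; for positive k it is at least k in modulus, hence at least (k +
      1)/2.\<close>
    proof (cases "k = 0")
      case True
      have "1 * L \<le> B0 * A * Kk" using B0(2)[OF R[of k j], of j] L2 B0(1) by (intro step) (auto simp: A_def s_def)
      also have "\<dots> \<le> B * A * Kk"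
        using A Kk BM(1) by (intro mult_right_mono) (auto simp: B_def)
      finally show ?thesis using True by simp
    next
      case False
      have l: "\<bar>lam ?n k\<bar> ^ M * L \<le> BM * A * Kk" using BM(2)[OF R[of k j], of j] L2 BM(1) by (intro step) (auto simp: A_def s_def)
      have "real k + 1 \<le> 2 * \<bar>lam ?n k\<bar>" using abs_lam_ge[of ?n k] False by simp
      then have "(real k + 1) ^ M \<le> (2 * \<bar>lam ?n k\<bar>) ^ M" by (intro power_mono) auto
      then have "(real k + 1) ^ M * L \<le> (2 * \<bar>lam ?n k\<bar>) ^ M * L" using L0 by (rule mult_right_mono)
      also have "\<dots> = 2 ^ M * (\<bar>lam ?n k\<bar> ^ M * L)" by (simp add: power_mult_distrib)
      also have "\<dots> \<le> 2 ^ M * (BM * A * Kk)" using l by (intro mult_left_mono) auto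
      also have "\<dots> = (2 ^ M * BM) * A * Kk" by simp
      also have "\<dots> \<le> B * A * Kk" using A Kk B0(1) by (intro mult_right_mono) (auto simp: B_def)
      finally show ?thesis .
    qed
    then have "L \<le> B * A * Kk / (real k + 1) ^ M" by (simp add: pos_le_divide_eq mult.commute)
    then have "Kk * L \<le> Kk * (B * A * Kk / (real k + 1) ^ M)" using Kk by (rule mult_left_mono)
    also have "\<dots> = (K0\<^sup>2 * B) * A / (real k + 1) ^ m"
      by (simp add: Kk_def M_def power_add power_mult power2_eq_square power_mult_distrib divide_simps)
    also have "\<dots> \<le> (K0\<^sup>2 * B + 1) * A / (real k + 1) ^ m"
      using A by (intro divide_right_mono mult_right_mono) auto
    finally show ?thesis using sL sup_norm_S_ge[OF cR w] unfolding s_def A_def by linarith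
  qed
  have pos: "0 < K0\<^sup>2 * B + 1" using B by (intro add_nonneg_pos mult_nonneg_nonneg) auto
  show "\<exists>C>0. \<forall>k j w. norm w = 1 \<longrightarrow> norm (R k j w) \<le> C * a ^ nat \<bar>j\<bar> / (real k + 1) ^ m"
    by (rule exI[of _ "K0\<^sup>2 * B + 1"]) (use pos bound in blast)
qed

lemma in_S_expansion:
  fixes f :: "real \<times> real \<times> (real ^ 'n::{finite,linorder}) \<Rightarrow> 'n clif"
  assumes f: "in_S f"
  shows "\<exists>P. (\<forall>k j. monogenic_hom k (P k j)) \<and> rapid_family 0 P \<and>
    (\<forall>x0 p w. (x0, p) \<noteq> (0, 0) \<longrightarrow> norm w = 1 \<longrightarrow> f (x0, p, w) = (\<Sum>n. eterm zpow_family P x0 p w (enum_jk n)))"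
proof -
  have sm: "slice_monogenic punct f" and even: "\<And>x0 p w. (x0, p) \<noteq> (0, 0) \<Longrightarrow> norm w = 1 \<Longrightarrow> f (x0, - p, - w) = f (x0, p, w)"
    using f by (auto simp: in_S_def)
  have cf: "continuous_on (sdom punct) f" by (rule slice_monogenic_continuous[OF sm])
  define a where "a j w = fc w j (\<lambda>\<theta>. f (cos \<theta>, sin \<theta>, w))" for j w
  have nz: "(cos \<theta>, sin \<theta>) \<noteq> (0, 0)" for \<theta> :: real using circle_nonzero[of 1 \<theta>] by simp
  have ca: "continuous_on (sphere 0 1) (a j)" for j
    unfolding a_def[abs_def]
  proof (rule continuous_on_fc)
    show "continuous_on ({0..2 * pi} \<times> sphere 0 1) (\<lambda>(\<theta>, w). f (cos \<theta>, sin \<theta>, w))"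
      unfolding split_def
      by (rule continuous_on_compose2[OF cf]) (use nz in \<open>auto simp: sdom_def intro!: continuous_intros\<close>)
  qed
  have ea: "a j (- w) = a j w" if w: "norm w = 1" for j w
    unfolding a_def
  proof (rule fc_even)
    fix \<theta> :: real
    have "(cos \<theta>, - sin \<theta>) \<noteq> (0, 0)" using nz[of \<theta>] by auto
    from even[OF this w] show "f (cos \<theta>, sin \<theta>, - w) = f (cos \<theta>, - sin \<theta>, w)" by simp
  qed
  have "\<exists>P. monogenic_hom k P \<and> (\<forall>Q. monogenic_hom k Q \<longrightarrow> sip (a j) (sph k Q) = sip (sph k P) (sph k Q))" for k j
    by (rule spherical_projection[OF ca])
  then obtain R where R: "\<And>k j. monogenic_hom k (R k j)"
    "\<And>k j Q. monogenic_hom k Q \<Longrightarrow> sip (a j) (sph k Q) = sip (sph k (R k j)) (sph k Q)"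
    by metis
  have rR: "rapid_family 0 R"
    by (rule projection_decay[OF sm R(1)]) (rule R(2)[OF R(1), unfolded a_def[abs_def]])
  \<comment> \<open>The sign by which omega^k R differs from \<open>sph k R\<close>, inserted so
    that \<open>bcoef P j\<close> has the same projections as the Laurent coefficient.\<close>
  define P where "P k j x = (-1) ^ (k div 2) *\<^sub>R R k j x" for k j x
  have mP: "monogenic_hom k (P k j)" for k j
    unfolding P_def[abs_def] by (rule monogenic_hom_scaleR[OF R(1)])
  have rP: "rapid_family 0 P"
  proof -
    have "norm (P k j w) = norm (R k j w)" for k j w by (simp add: P_def power_abs)
    then show ?thesis using rR mP by (simp add: rapid_family_def monogenic_hom_iff)
  qed
  have ab: "a j w - bcoef P j w = 0" if w: "norm w = 1" for j w
  proof (rule spherical_completeness[where g="\<lambda>w. a j w - bcoef P j w", OF _ _ _ w])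
    show "continuous_on (sphere 0 1) (\<lambda>w. a j w - bcoef P j w)"
      by (intro continuous_intros ca bcoef_properties(1)[OF rP])
    show "a j (- w) - bcoef P j (- w) = a j w - bcoef P j w" if "norm w = 1" for w
      using ea[OF that] bcoef_properties(2)[OF rP] by simp
    fix k and Q :: "(real, 'n) vec \<Rightarrow> 'n clif" assume Q: "monogenic_hom k Q"
    then have hQ: "hom_poly k Q" by (simp add: monogenic_hom_iff)
    have "sph k (P k j) = (\<lambda>w. (-1) ^ (k div 2) *\<^sub>R sph k (R k j) w)"
      by (auto simp: sph_def P_def[abs_def] vmul_def[abs_def] cl_mult.scaleR_right)
    then have "(-1) ^ (k div 2) * sip (sph k (P k j)) (sph k Q) = sip (sph k (R k j)) (sph k Q)"
      by (simp add: sip_scaleR_left flip: mult.assoc power_mult_distrib)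
    then show "sip (\<lambda>w. a j w - bcoef P j w) (sph k Q) = 0"
      using sip_diff_left[OF continuous_on_sph[OF hQ] ca bcoef_properties(1)[OF rP]]
        bcoef_properties(3)[OF rP mP Q] R(2)[OF Q] by simp
  qed
  define h where "h = (\<lambda>(x0, p, w). \<Sum>n. eterm zpow_family P x0 p w (enum_jk n))"
  have ch: "continuous_on (sdom punct) h"
    by (rule slice_monogenic_continuous[OF expansion_slice_monogenic_punct[OF rP]]) (simp add: h_def)
  \<comment> \<open>On every circle about 0 both functions have the same Fourier coefficients, as
    both scale by r^j and agree at r = 1.\<close>
  have "f (x0, p, w) = h (x0, p, w)" if z: "(x0, p) \<noteq> (0, 0)" and w: "norm w = 1" for x0 p w
  proof -
    define r where "r = norm (Complex x0 p)"
    have r: "0 < r" using z by (auto simp: r_def complex_eq_iff)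
    define \<zeta> where "\<zeta> = Complex x0 p / of_real r"
    have \<zeta>: "norm \<zeta> = 1" "r * Re \<zeta> = x0" "r * Im \<zeta> = p"
      using r by (simp_all add: \<zeta>_def norm_divide) (simp add: r_def)
    define g where "g \<xi> = f (r * Re \<xi>, r * Im \<xi>, w) - h (r * Re \<xi>, r * Im \<xi>, w)" for \<xi>
    have inS: "(r * Re \<xi>, r * Im \<xi>, w) \<in> sdom punct" if "norm \<xi> = 1" for \<xi>
      using that r w by (auto simp: sdom_def cmod_def)
    have cc: "continuous_on (sphere 0 1) (\<lambda>\<xi>. q (r * Re \<xi>, r * Im \<xi>, w))" if "continuous_on (sdom punct) q" for q :: "_ \<Rightarrow> 'n clif"
      by (rule continuous_on_compose2[OF that]) (use inS in \<open>auto intro!: continuous_intros\<close>)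
    have cg: "continuous_on (sphere 0 1) g" unfolding g_def by (intro continuous_intros cc cf ch)
    have "g \<zeta> = 0"
    proof (rule fourier_uniqueness[OF w cg _ \<zeta>(1)])
      fix j
      have "fc w j (\<lambda>\<theta>. g (cis \<theta>)) = fc w j (\<lambda>\<theta>. f (r * cos \<theta>, r * sin \<theta>, w)) - fc w j (\<lambda>\<theta>. h (r * cos \<theta>, r * sin \<theta>, w))"
        using fc_diff[OF continuous_on_circle[OF cc[OF cf]] continuous_on_circle[OF cc[OF ch]], of w j] by (simp add: g_def)
      also have "\<dots> = r powi j *\<^sub>R (a j w - bcoef P j w)"
        using slice_monogenic_polar[OF sm w r, of j] fc_expansion(1)[OF rP r w, of j]
        by (simp add: h_def a_def scaleR_diff_right)
      finally show "fc w j (\<lambda>\<theta>. g (cis \<theta>)) = 0" using ab[OF w] by simp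
    qed
    then show ?thesis by (simp add: g_def \<zeta>)
  qed
  with mP rP show ?thesis by (intro exI[of _ P]) (simp add: h_def)
qed

section \<open>The expansion theorem\<close>

text \<open>Working form of \<open>is_expansion\<close>: it does not mention the norm
  \<open>N\<close>, measures decay by the supremum on the sphere and sums along
  \<open>enum_jk\<close>.\<close>

definition expands :: "(real \<times> real \<times> (real ^ 'n::{finite,linorder}) \<Rightarrow> 'n clif)
    \<Rightarrow> (nat \<Rightarrow> int \<Rightarrow> (real, 'n) vec \<Rightarrow> 'n clif) \<Rightarrow> bool" where
  "expands f P \<longleftrightarrow> (\<forall>k j. monogenic_hom k (P k j)) \<and> rapid_family 0 P \<and>
    (\<forall>x0 p w. (x0, p) \<noteq> (0, 0) \<longrightarrow> norm w = 1 \<longrightarrow> f (x0, p, w) = (\<Sum>n. eterm zpow_family P x0 p w (enum_jk n)))"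

text \<open>Either norm differs from the supremum by at most a factor polynomial in k; since
  \<open>m\<close> is arbitrary, the factor is absorbed by using the order m + n.\<close>

lemma decay_iff_rapid_family:
  fixes P :: "nat \<Rightarrow> int \<Rightarrow> real ^ 'n::{finite,linorder} \<Rightarrow> 'n clif"
  assumes N: "N = sup_norm_S \<or> N = L2_norm_S" and P: "\<And>k j. hom_poly k (P k j)"
  shows "(\<forall>m::nat. \<forall>a>0. \<exists>C>0. \<forall>k j. N (P k j) \<le> C * a ^ nat \<bar>j\<bar> / (real k + 1) ^ m) \<longleftrightarrow> rapid_family 0 P"
proof
  let ?n = "CARD('n)"
  define K where "K = 2 * (16 * real ?n) ^ ?n"
  have K: "1 \<le> K"
  proof -
    have "1 \<le> real ?n" by (simp add: Suc_leI)
    then have "1 \<le> (16 * real ?n) ^ ?n" by (intro one_le_power) linarith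
    then show ?thesis unfolding K_def by linarith
  qed
  have c: "continuous_on S (P k j)" for k j S by (rule hom_poly_continuous_on[OF P])
  have s0: "0 \<le> sup_norm_S (P k j)" for k j
    using sup_norm_S_attained[OF c, of k j] norm_ge_zero by metis
  have le: "sup_norm_S (P k j) \<le> K * (real k + 1) ^ ?n * N (P k j)" for k j
    using N
  proof
    assume "N = sup_norm_S"
    moreover have "1 * 1 \<le> K * (real k + 1) ^ ?n" using K by (intro mult_mono one_le_power) auto
    ultimately show ?thesis using mult_right_mono[OF _ s0[of k j], of 1 "K * (real k + 1) ^ ?n"] by simp
  next
    assume "N = L2_norm_S"
    then show ?thesis using sup_le_L2_norm[OF P[of k j]] by (simp add: K_def)
  qed
  have ge: "N (P k j) \<le> sup_norm_S (P k j)" for k j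
    using N L2_le_sup_norm[OF c] by auto
  {
    assume D: "\<forall>m::nat. \<forall>a>0. \<exists>C>0. \<forall>k j. N (P k j) \<le> C * a ^ nat \<bar>j\<bar> / (real k + 1) ^ m"
    show "rapid_family 0 P"
      unfolding rapid_family_def
    proof (intro conjI allI impI)
      show "hom_poly (k + 0) (P k j)" for k j using P by simp
      fix m :: nat and a :: real assume "0 < a"
      then obtain C where C: "0 < C" "\<And>k j. N (P k j) \<le> C * a ^ nat \<bar>j\<bar> / (real k + 1) ^ (m + ?n)"
        using D by blast
      have "norm (P k j w) \<le> (K * C) * a ^ nat \<bar>j\<bar> / (real k + 1) ^ m" if w: "norm w = 1" for k j w
      proof -
        have "norm (P k j w) \<le> K * (real k + 1) ^ ?n * N (P k j)"
          using sup_norm_S_ge[OF c w, of k j] le[of k j] by linarith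
        also have "\<dots> \<le> K * (real k + 1) ^ ?n * (C * a ^ nat \<bar>j\<bar> / (real k + 1) ^ (m + ?n))"
          using K C(2) by (intro mult_left_mono) auto
        also have "\<dots> = (K * C) * a ^ nat \<bar>j\<bar> / (real k + 1) ^ m" by (simp add: power_add)
        finally show ?thesis .
      qed
      moreover have "0 < K * C" using K C(1) by simp
      ultimately show "\<exists>C>0. \<forall>k j w. norm w = 1 \<longrightarrow> norm (P k j w) \<le> C * a ^ nat \<bar>j\<bar> / (real k + 1) ^ m"
        by blast
    qed
  }
  assume R: "rapid_family 0 P"
  show "\<forall>m::nat. \<forall>a>0. \<exists>C>0. \<forall>k j. N (P k j) \<le> C * a ^ nat \<bar>j\<bar> / (real k + 1) ^ m"
  proof (intro allI impI)
    fix m :: nat and a :: real assume a: "0 < a"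
    obtain C where C: "0 < C" "\<And>k j w. norm w = 1 \<Longrightarrow> norm (P k j w) \<le> C * a ^ nat \<bar>j\<bar> / (real k + 1) ^ m"
      using rapid_family_bound[OF R a, of m] by blast
    have "N (P k j) \<le> C * a ^ nat \<bar>j\<bar> / (real k + 1) ^ m" for k j
    proof -
      obtain w where w: "norm w = 1" "sup_norm_S (P k j) = norm (P k j w)" using sup_norm_S_attained[OF c] by blast
      then show ?thesis using ge[of k j] C(2)[OF w(1), of k j] by simp
    qed
    with C(1) show "\<exists>C>0. \<forall>k j. N (P k j) \<le> C * a ^ nat \<bar>j\<bar> / (real k + 1) ^ m" by blast
  qed
qed

lemma eterm_sums:
  assumes P: "rapid_family 0 P" and z: "(x0, p) \<noteq> (0, 0)" and w: "norm w = 1"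
  shows "(eterm zpow_family P x0 p w has_sum (\<Sum>n. eterm zpow_family P x0 p w (enum_jk n))) UNIV"
proof -
  have z': "Complex x0 p \<in> - {0}" using z by (auto simp: complex_eq_iff)
  obtain K where "\<And>jk. norm (eterm zpow_family P x0 p w jk) \<le> K * wt jk"
    using eterm_bound[OF holo_zpow_family P z'] w by blast
  then show ?thesis
    using has_sum_enum_jk summable_sums[OF summable_eterm(1)[OF holo_zpow_family P z' w]] by blast
qed

lemma exp_term_eterm:
  assumes "(x0, p) \<noteq> (0, 0)" "norm w = 1"
  shows "exp_term P x0 p w = eterm zpow_family P x0 p w"
  using exp_term_eq[OF assms(2,1)] by (auto simp: fun_eq_iff eterm_def zpow_family_def)

lemma is_expansion_iff_expands:
  assumes N: "N = sup_norm_S \<or> N = L2_norm_S"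
  shows "is_expansion N f P \<longleftrightarrow> expands f P"
proof -
  have *: "(exp_term P x0 p w has_sum s) UNIV \<longleftrightarrow> s = (\<Sum>n. eterm zpow_family P x0 p w (enum_jk n))"
    if "rapid_family 0 P" "(x0, p) \<noteq> (0, 0)" "norm w = 1" for x0 p w s
    using eterm_sums[OF that] has_sum_unique unfolding exp_term_eterm[OF that(2,3)] by blast
  have d: "(\<forall>m::nat. \<forall>a>0. \<exists>C>0. \<forall>k j. N (P k j) \<le> C * a ^ nat \<bar>j\<bar> / (real k + 1) ^ m) \<longleftrightarrow> rapid_family 0 P"
    if "\<forall>k j. monogenic_hom k (P k j)"
    using that by (intro decay_iff_rapid_family[OF N]) (simp add: monogenic_hom_iff)
  have v: "(\<forall>x0 p w. (x0, p) \<noteq> (0, 0) \<and> w \<in> sphere 0 1 \<longrightarrow> (exp_term P x0 p w has_sum f (x0, p, w)) UNIV)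
    \<longleftrightarrow> (\<forall>x0 p w. (x0, p) \<noteq> (0, 0) \<longrightarrow> norm w = 1 \<longrightarrow> f (x0, p, w) = (\<Sum>n. eterm zpow_family P x0 p w (enum_jk n)))"
    if r: "rapid_family 0 P"
    using *[OF r] by (auto simp del: Pair_inject split_paired_All)
  show ?thesis
  proof
    assume I: "is_expansion N f P"
    note I' = I[unfolded is_expansion_def]
    note m = conjunct1[OF I']
    note R = iffD1[OF d[OF m] conjunct1[OF conjunct2[OF I']]]
    show "expands f P" unfolding expands_def
      by (intro conjI[OF m] conjI[OF R] iffD1[OF v[OF R]]) (rule conjunct2[OF conjunct2[OF I']])
  next
    assume I: "expands f P"
    note I' = I[unfolded expands_def]
    note m = conjunct1[OF I'] and R = conjunct1[OF conjunct2[OF I']]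
    show "is_expansion N f P" unfolding is_expansion_def
      by (intro conjI[OF m] conjI[OF iffD2[OF d[OF m] R]] iffD2[OF v[OF R]]) (rule conjunct2[OF conjunct2[OF I']])
  qed
qed

lemma expands_slice_monogenic:
  assumes "expands f P"
  shows "slice_monogenic punct f"
proof (rule expansion_slice_monogenic_punct)
  note f = assms[unfolded expands_def]
  show "rapid_family 0 P" using f by (elim conjE)
  show "f (x0, p, w) = (\<Sum>n. eterm zpow_family P x0 p w (enum_jk n))" if "(x0, p) \<noteq> (0, 0)" "norm w = 1" for x0 p w
    using conjunct2[OF conjunct2[OF f], rule_format, OF that] .
qed

lemma eterm_even:
  assumes P: "hom_poly k (P k j)"
  shows "eterm zpow_family P x0 (- p) (- w) (j, k) = eterm zpow_family P x0 p w (j, k)"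
proof -
  have "Complex x0 (- p) powi j = cnj (Complex x0 p powi j)"
    by (simp add: complex_cnj)
  then show ?thesis
    unfolding eterm_def prod.case zpow_family_def using cact_even_term[OF P, of w "Complex x0 p powi j"] by simp
qed

lemma expands_in_S:
  assumes f: "expands f P"
  shows "in_S f"
  unfolding in_S_def
proof (intro conjI allI impI)
  show "slice_monogenic punct f" by (rule expands_slice_monogenic[OF f])
  fix x0 p :: real and w :: "(real, 'a) vec" assume "(x0, p) \<noteq> (0, 0) \<and> w \<in> sphere 0 1"
  then have z: "(x0, p) \<noteq> (0, 0)" "(x0, - p) \<noteq> (0, 0)" and w: "norm w = 1" "norm (- w) = 1" by auto
  have h: "hom_poly k (P k j)" for k j using f by (simp add: expands_def monogenic_hom_iff)
  have "eterm zpow_family P x0 (- p) (- w) jk = eterm zpow_family P x0 p w jk" for jk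
  proof -
    obtain j k where jk: "jk = (j, k)" by (cases jk)
    show ?thesis unfolding jk by (rule eterm_even[OF h])
  qed
  moreover have "f (x0, - p, - w) = (\<Sum>n. eterm zpow_family P x0 (- p) (- w) (enum_jk n))"
    using f z(2) w(2) unfolding expands_def by blast
  moreover have "f (x0, p, w) = (\<Sum>n. eterm zpow_family P x0 p w (enum_jk n))"
    using f z(1) w(1) unfolding expands_def by blast
  ultimately show "f (x0, - p, - w) = f (x0, p, w)" by simp
qed

text \<open>Recovers \<open>bcoef P j\<close> from the values of \<open>f\<close> on circles;
  uniqueness and both membership criteria rest on it.\<close>

lemma expands_fc:
  assumes f: "expands f P" and r: "0 < r" and w: "norm w = 1"
  shows "fc w j (\<lambda>\<theta>. f (r * cos \<theta>, r * sin \<theta>, w)) = r powi j *\<^sub>R bcoef P j w"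
proof -
  have "f (r * cos \<theta>, r * sin \<theta>, w) = (\<Sum>n. eterm zpow_family P (r * cos \<theta>) (r * sin \<theta>) w (enum_jk n))" for \<theta>
    using f w circle_nonzero[OF r] unfolding expands_def by blast
  then show ?thesis using fc_expansion(1)[OF _ r w, of P j] f by (simp add: expands_def)
qed

lemma expands_unique:
  assumes P: "expands f P" and Q: "expands f Q"
  shows "P = Q"
proof (intro ext)
  fix k j x
  have "bcoef P j w = bcoef Q j w" if "norm w = 1" for w
    using expands_fc[OF P zero_less_one that, of j] expands_fc[OF Q zero_less_one that, of j] by simp
  then have "P k j = Q k j"
    using P Q by (intro bcoef_unique) (auto simp: expands_def)
  then show "P k j x = Q k j x" by simp
qed

section \<open>Restricting and reindexing expansions\<close>

lemma rapid_family_mask: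
  fixes P :: "nat \<Rightarrow> int \<Rightarrow> real ^ 'n::{finite,linorder} \<Rightarrow> 'n clif"
  assumes "rapid_family 0 P"
  shows "rapid_family 0 (\<lambda>k j. if A j then P k j else (\<lambda>x. 0))"
  unfolding rapid_family_def
proof (intro conjI allI impI)
  show "hom_poly (k + 0) (if A j then P k j else (\<lambda>x. 0))" for k j
    using assms by (cases "A j") (auto simp: rapid_family_def intro: hom_poly_zero)
  fix m :: nat and a :: real assume a: "0 < a"
  obtain C where C: "0 < C" "\<And>k j w. norm w = 1 \<Longrightarrow> norm (P k j w) \<le> C * a ^ nat \<bar>j\<bar> / (real k + 1) ^ m"
    using rapid_family_bound[OF assms a, of m] by blast
  show "\<exists>C>0. \<forall>k j w. norm w = 1 \<longrightarrow> norm ((if A j then P k j else (\<lambda>x. 0)) w) \<le> C * a ^ nat \<bar>j\<bar> / (real k + 1) ^ m"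
    using C a by (intro exI[of _ C]) auto
qed

lemma monogenic_hom_mask: "monogenic_hom k P \<Longrightarrow> monogenic_hom k (if A then P else (\<lambda>x. 0))"
  by (simp add: monogenic_hom_zero)

lemma bcoef_zero_imp:
  assumes f: "expands f P" and b: "\<And>w. norm w = 1 \<Longrightarrow> bcoef P j w = 0"
  shows "P k j = (\<lambda>_. 0)"
proof -
  have P: "rapid_family 0 P" "\<And>k. monogenic_hom k (P k j)" using f by (auto simp: expands_def)
  have Z: "rapid_family 0 (\<lambda>k j. if False then P k j else (\<lambda>x. 0))" by (rule rapid_family_mask[OF P(1)])
  have "P k j = (\<lambda>k j. if False then P k j else (\<lambda>x. 0)) k j"
    by (rule bcoef_unique[OF P Z]) (simp_all add: monogenic_hom_zero b bcoef_def cact_simps b[unfolded bcoef_def])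
  then show ?thesis by simp
qed

text \<open>Meant for j replaced by -j or by -1 - j, which change |j| by at most one; the decay then
  changes by at most one factor a or 1/a, both covered by \<open>D\<close>.\<close>

lemma rapid_family_reindex:
  assumes P: "rapid_family 0 P" and \<sigma>: "\<And>j. \<bar>\<sigma> j\<bar> \<le> \<bar>j\<bar> + 1" "\<And>j. \<bar>j\<bar> \<le> \<bar>\<sigma> j\<bar> + 1"
  shows "rapid_family 0 (\<lambda>k j. P k (\<sigma> j))"
  unfolding rapid_family_def
proof (intro conjI allI impI)
  show "hom_poly (k + 0) (P k (\<sigma> j))" for k j using P by (simp add: rapid_family_def)
  fix m :: nat and a :: real assume a: "0 < a"
  obtain C where C: "0 < C" "\<And>k j w. norm w = 1 \<Longrightarrow> norm (P k j w) \<le> C * a ^ nat \<bar>j\<bar> / (real k + 1) ^ m"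
    using rapid_family_bound[OF P a, of m] by blast
  define D where "D = 1 + a + 1 / a"
  have D: "0 < D" using a by (simp add: D_def add_pos_pos)
  have pw: "a ^ nat \<bar>\<sigma> j\<bar> \<le> D * a ^ nat \<bar>j\<bar>" for j
  proof -
    have ap: "0 < a ^ nat \<bar>j\<bar>" using a by simp
    consider "\<bar>\<sigma> j\<bar> = \<bar>j\<bar>" | "\<bar>\<sigma> j\<bar> = \<bar>j\<bar> + 1" | "\<bar>j\<bar> = \<bar>\<sigma> j\<bar> + 1" using \<sigma>[of j] by linarith
    then show ?thesis
    proof cases
      case 1
      have "1 * a ^ nat \<bar>j\<bar> \<le> D * a ^ nat \<bar>j\<bar>" using ap a by (intro mult_right_mono) (auto simp: D_def)
      then show ?thesis using 1 by simp
    next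
      case 2
      then have "a ^ nat \<bar>\<sigma> j\<bar> = a * a ^ nat \<bar>j\<bar>" by (simp add: nat_add_distrib)
      also have "\<dots> \<le> D * a ^ nat \<bar>j\<bar>" using ap a by (intro mult_right_mono) (auto simp: D_def)
      finally show ?thesis .
    next
      case 3
      then have "a ^ nat \<bar>j\<bar> = a * a ^ nat \<bar>\<sigma> j\<bar>" by (simp add: nat_add_distrib)
      then have "a ^ nat \<bar>\<sigma> j\<bar> = (1 / a) * a ^ nat \<bar>j\<bar>" using a by simp
      also have "\<dots> \<le> D * a ^ nat \<bar>j\<bar>" using ap a by (intro mult_right_mono) (auto simp: D_def)
      finally show ?thesis .
    qed
  qed
  have "norm (P k (\<sigma> j) w) \<le> (C * D) * a ^ nat \<bar>j\<bar> / (real k + 1) ^ m" if w: "norm w = 1" for k j w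
  proof -
    have "norm (P k (\<sigma> j) w) \<le> C * a ^ nat \<bar>\<sigma> j\<bar> / (real k + 1) ^ m" by (rule C(2)[OF w])
    also have "\<dots> \<le> C * (D * a ^ nat \<bar>j\<bar>) / (real k + 1) ^ m"
      using C(1) pw by (intro divide_right_mono mult_left_mono) auto
    finally show ?thesis by (simp add: mult.assoc)
  qed
  then show "\<exists>C>0. \<forall>k j w. norm w = 1 \<longrightarrow> norm (P k (\<sigma> j) w) \<le> C * a ^ nat \<bar>j\<bar> / (real k + 1) ^ m"
    using mult_pos_pos[OF C(1) D] by blast
qed

lemma suminf_enum_reindex:
  fixes c :: "int \<times> nat \<Rightarrow> 'a::banach"
  assumes c: "(c has_sum s) UNIV" and \<sigma>: "bij \<sigma>"
  shows "(\<Sum>n. c (\<sigma> (enum_jk n))) = s"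
proof -
  have "((\<lambda>jk. c (\<sigma> jk)) has_sum s) UNIV" using c has_sum_reindex_bij_betw[OF \<sigma>, of c s] by simp
  then have "((\<lambda>n. c (\<sigma> (enum_jk n))) has_sum s) UNIV"
    using has_sum_reindex_bij_betw[OF bij_enum_jk, of "\<lambda>jk. c (\<sigma> jk)" s] by simp
  then show ?thesis using has_sum_imp_sums sums_unique by metis
qed

lemma inverse_Complex: "inverse (Complex x0 p) = Complex (x0 / (x0\<^sup>2 + p\<^sup>2)) (- p / (x0\<^sup>2 + p\<^sup>2))"
  by (simp add: complex_eq_iff)

lemma inversion_nonzero: "(x0, p) \<noteq> (0, 0) \<Longrightarrow> (x0 / (x0\<^sup>2 + p\<^sup>2), - p / (x0\<^sup>2 + p\<^sup>2)) \<noteq> (0::real, 0)"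
  by (auto simp: sum_power2_eq_zero_iff)

lemma eterm_inversion:
  assumes z: "(x0, p) \<noteq> (0, 0)"
  shows "eterm zpow_family P (x0 / (x0\<^sup>2 + p\<^sup>2)) (- p / (x0\<^sup>2 + p\<^sup>2)) w (j, k)
    = cact w (Complex x0 p powi (- j) * \<i> ^ k) (P k j w)"
  unfolding eterm_def prod.case inverse_Complex[symmetric] zpow_family_def
  by (simp only: power_int_inverse power_int_minus)

lemma zero_bcoef_if_small:
  assumes "\<And>\<epsilon>. 0 < \<epsilon> \<Longrightarrow> norm (x :: 'a::real_normed_vector) \<le> \<epsilon>"
  shows "x = 0"
  using field_le_epsilon[of "norm x" 0] assms by simp

text \<open>An extension is bounded near 0, so r^j times the j-th coefficient stays bounded as r
  tends to 0, which annihilates negative j. Conversely the series of nonnegative powers converges on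
  the whole plane and is the extension.\<close>

lemma expands_S0_iff:
  fixes f :: "real \<times> real \<times> (real ^ 'n::{finite,linorder}) \<Rightarrow> 'n clif"
  assumes f: "expands f P"
  shows "in_S0 f \<longleftrightarrow> (\<forall>k j. j < 0 \<longrightarrow> P k j = (\<lambda>_. 0))"
proof
  assume "in_S0 f"
  then obtain g where g: "slice_monogenic UNIV g"
    and gf: "\<And>x0 p w. (x0, p) \<noteq> (0, 0) \<Longrightarrow> norm w = 1 \<Longrightarrow> g (x0, p, w) = f (x0, p, w)"
    unfolding in_S0_def by auto
  show "\<forall>k j. j < 0 \<longrightarrow> P k j = (\<lambda>_. 0)"
  proof (intro allI impI, rule bcoef_zero_imp[OF f])
    fix j :: int and w :: "(real, 'n) vec" assume j: "j < 0" and w: "norm w = 1"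
    let ?g = "\<lambda>z. g (Re z, Im z, w)"
    have cg: "continuous_on (cball 0 1) ?g"
      by (rule continuous_on_compose2[OF slice_monogenic_continuous[OF g]]) (use w in \<open>auto simp: sdom_def intro!: continuous_intros\<close>)
    have "bounded (?g ` cball 0 1)"
      by (intro compact_imp_bounded compact_continuous_image cg) simp
    then obtain B where B: "\<And>z. norm z \<le> 1 \<Longrightarrow> norm (?g z) \<le> B" unfolding bounded_iff by force
    have B0: "0 \<le> B" using order_trans[OF norm_ge_zero B[of 0]] by simp
    have small: "norm (bcoef P j w) \<le> B * r" if r: "0 < r" "r \<le> 1" for r
    proof -
      have pt: "f (r * cos \<theta>, r * sin \<theta>, w) = ?g (of_real r * cis \<theta>)" for \<theta>
        using gf[OF circle_nonzero[OF r(1)] w] by simp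
      have "norm (fc w j (\<lambda>\<theta>. f (r * cos \<theta>, r * sin \<theta>, w))) \<le> B"
        unfolding pt
      proof (rule norm_fc_le[OF _ _ w])
        show "continuous_on {0..2 * pi} (\<lambda>\<theta>. ?g (of_real r * cis \<theta>))"
          by (rule continuous_on_compose2[OF cg]) (use r in \<open>auto simp: norm_mult intro!: continuous_intros\<close>)
        show "norm (?g (of_real r * cis \<theta>)) \<le> B" for \<theta> by (rule B) (use r in \<open>simp add: norm_mult\<close>)
      qed
      then have "r powi j * norm (bcoef P j w) \<le> B" using expands_fc[OF f r(1) w, of j] r by simp
      then have "norm (bcoef P j w) \<le> B * r ^ nat (- j)"
        using j r by (simp add: power_int_def power_inverse field_simps)
      also have "\<dots> \<le> B * r ^ 1"
        using j r B0 by (intro mult_left_mono power_decreasing) auto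
      finally show ?thesis by simp
    qed
    show "bcoef P j w = 0"
    proof (rule zero_bcoef_if_small)
      fix \<epsilon> :: real assume e: "0 < \<epsilon>"
      define r where "r = min 1 (\<epsilon> / (B + 1))"
      have r: "0 < r" "r \<le> 1" using e B0 by (auto simp: r_def)
      have "B * r \<le> (B + 1) * (\<epsilon> / (B + 1))" using B0 r by (intro mult_mono) (auto simp: r_def)
      also have "\<dots> = \<epsilon>" using B0 by simp
      finally show "norm (bcoef P j w) \<le> \<epsilon>" using small[OF r] by linarith
    qed
  qed
next
  assume Z: "\<forall>k j. j < 0 \<longrightarrow> P k j = (\<lambda>_. 0)"
  define g where "g = (\<lambda>(x0, p, w). \<Sum>n. eterm pow_family P x0 p w (enum_jk n))"
  have rP: "rapid_family 0 P" using f by (simp add: expands_def)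
  have "slice_monogenic {(x0, p). Complex x0 p \<in> UNIV} g"
    by (rule expansion_slice_monogenic[OF open_UNIV holo_pow_family rP]) (simp add: g_def)
  then have "slice_monogenic UNIV g" by simp
  moreover have "g (x0, p, w) = f (x0, p, w)" if z: "(x0, p) \<noteq> (0, 0)" and w: "norm w = 1" for x0 p w
  proof -
    have "eterm pow_family P x0 p w jk = eterm zpow_family P x0 p w jk" for jk
      using Z by (cases jk) (auto simp: eterm_def pow_family_def zpow_family_def power_int_def cact_simps)
    then show ?thesis using f z w unfolding expands_def g_def by simp
  qed
  ultimately show "in_S0 f" unfolding in_S0_def using expands_in_S[OF f] by auto
qed

text \<open>Decay on large circles annihilates every j at least 0, the constant term included.
  Conversely inversion produces a series of positive powers, which extends over 0, and at modulus r
  at least 1 every term has a factor of at most 1/r.\<close>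

lemma expands_Sinf_iff:
  fixes f :: "real \<times> real \<times> (real ^ 'n::{finite,linorder}) \<Rightarrow> 'n clif"
  assumes f: "expands f P"
  shows "in_Sinf f \<longleftrightarrow> (\<forall>k j. 0 \<le> j \<longrightarrow> P k j = (\<lambda>_. 0))"
proof
  assume "in_Sinf f"
  then have dec: "\<And>\<epsilon>. 0 < \<epsilon> \<Longrightarrow> \<exists>R. \<forall>x0 p w. x0\<^sup>2 + p\<^sup>2 \<ge> R \<and> w \<in> sphere 0 1 \<longrightarrow> norm (f (x0, p, w)) < \<epsilon>"
    unfolding in_Sinf_def by blast
  have cf: "continuous_on (sdom punct) f" by (rule slice_monogenic_continuous[OF expands_slice_monogenic[OF f]])
  show "\<forall>k j. 0 \<le> j \<longrightarrow> P k j = (\<lambda>_. 0)"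
  proof (intro allI impI, rule bcoef_zero_imp[OF f], rule zero_bcoef_if_small)
    fix j :: int and w :: "(real, 'n) vec" and \<epsilon> :: real assume j: "0 \<le> j" and w: "norm w = 1" and e: "0 < \<epsilon>"
    obtain R where R: "\<And>x0 p. x0\<^sup>2 + p\<^sup>2 \<ge> R \<Longrightarrow> norm (f (x0, p, w)) < \<epsilon>"
      using dec[OF e] w by auto
    define r where "r = max 1 R"
    have r: "0 < r" "1 \<le> r" by (auto simp: r_def)
    have "r * 1 \<le> r * r" using r by (intro mult_left_mono) auto
    then have r2: "R \<le> r\<^sup>2" by (simp add: r_def power2_eq_square)
    have pt: "norm (f (r * cos \<theta>, r * sin \<theta>, w)) \<le> \<epsilon>" for \<theta>
    proof -
      have "(r * cos \<theta>)\<^sup>2 + (r * sin \<theta>)\<^sup>2 = r\<^sup>2 * ((sin \<theta>)\<^sup>2 + (cos \<theta>)\<^sup>2)"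
        by (simp only: power_mult_distrib) (simp only: distrib_left add.commute)
      then show ?thesis using R[of "r * cos \<theta>" "r * sin \<theta>"] r2 by simp
    qed
    have "norm (fc w j (\<lambda>\<theta>. f (r * cos \<theta>, r * sin \<theta>, w))) \<le> \<epsilon>"
    proof (rule norm_fc_le[OF _ pt w])
      show "continuous_on {0..2 * pi} (\<lambda>\<theta>. f (r * cos \<theta>, r * sin \<theta>, w))"
      proof (rule continuous_on_compose2[OF cf])
        have "(r * cos \<theta>, r * sin \<theta>, w) \<in> sdom punct" for \<theta>
          using circle_nonzero[OF r(1), of \<theta>] w by (auto simp: sdom_def)
        then show "(\<lambda>\<theta>. (r * cos \<theta>, r * sin \<theta>, w)) ` {0..2 * pi} \<subseteq> sdom punct" by blast
      qed (intro continuous_intros)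
    qed
    then have "r powi j * norm (bcoef P j w) \<le> \<epsilon>" using expands_fc[OF f r(1) w, of j] r by simp
    moreover have "1 \<le> r powi j" using j r by (simp add: power_int_def one_le_power)
    then have "1 * norm (bcoef P j w) \<le> r powi j * norm (bcoef P j w)" by (rule mult_right_mono) simp
    ultimately show "norm (bcoef P j w) \<le> \<epsilon>" by simp
  qed
next
  assume Z: "\<forall>k j. 0 \<le> j \<longrightarrow> P k j = (\<lambda>_. 0)"
  have rP: "rapid_family 0 P" using f by (simp add: expands_def)
  have val: "f (x0, p, w) = (\<Sum>n. eterm zpow_family P x0 p w (enum_jk n))" if "(x0, p) \<noteq> (0, 0)" "norm w = 1" for x0 p w
    using f that unfolding expands_def by blast
  define P' where "P' k j = P k (- j)" for k j
  have rP': "rapid_family 0 P'" unfolding P'_def[abs_def] by (rule rapid_family_reindex[OF rP]) auto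
  define g where "g = (\<lambda>(x0, p, w). \<Sum>n. eterm pow_family P' x0 p w (enum_jk n))"
  have "slice_monogenic {(x0, p). Complex x0 p \<in> UNIV} g"
    by (rule expansion_slice_monogenic[OF open_UNIV holo_pow_family rP']) (simp add: g_def)
  then have "slice_monogenic UNIV g" by simp
  moreover have "g (x0, p, w) = f (x0 / (x0\<^sup>2 + p\<^sup>2), - p / (x0\<^sup>2 + p\<^sup>2), w)" if z: "(x0, p) \<noteq> (0, 0)" and w: "norm w = 1" for x0 p w
  proof -
    let ?\<sigma> = "\<lambda>(j::int, k::nat). (- j, k)"
    have b: "bij ?\<sigma>" by (rule o_bij[of ?\<sigma>]) (auto simp: fun_eq_iff)
    have e: "eterm zpow_family P (x0 / (x0\<^sup>2 + p\<^sup>2)) (- p / (x0\<^sup>2 + p\<^sup>2)) w (?\<sigma> jk) = eterm pow_family P' x0 p w jk" for jk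
    proof -
      obtain j k where jk: "jk = (j, k)" by (cases jk)
      show ?thesis
        unfolding jk prod.case eterm_inversion[OF z] using Z
        by (auto simp: eterm_def pow_family_def P'_def power_int_def cact_simps)
    qed
    have "(\<Sum>n. eterm pow_family P' x0 p w (enum_jk n)) = f (x0 / (x0\<^sup>2 + p\<^sup>2), - p / (x0\<^sup>2 + p\<^sup>2), w)"
      unfolding e[symmetric] val[OF inversion_nonzero[OF z] w]
      by (rule suminf_enum_reindex[OF eterm_sums[OF rP inversion_nonzero[OF z] w] b])
    then show ?thesis by (simp add: g_def)
  qed
  moreover have "\<exists>R. \<forall>x0 p w. x0\<^sup>2 + p\<^sup>2 \<ge> R \<and> w \<in> sphere 0 1 \<longrightarrow> norm (f (x0, p, w)) < \<epsilon>" if e: "0 < \<epsilon>" for \<epsilon>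
  proof -
    obtain C where C: "0 < C" "\<And>k j w. norm w = 1 \<Longrightarrow> norm (P k j w) \<le> C * (1/2) ^ nat \<bar>j\<bar> / (real k + 1)\<^sup>2"
      using rapid_family_bound[OF rP, of "1/2" 2] by auto
    define S where "S = (\<Sum>n. wt (enum_jk n))"
    have w0: "0 \<le> wt jk" for jk by (cases jk) (simp add: wt_def)
    have S: "0 \<le> S" unfolding S_def by (rule suminf_nonneg[OF summable_wt w0])
    \<comment> \<open>A radius beyond which the total bound C S / r is below \<epsilon>; the summand
      1 also keeps it at least 1.\<close>
    define T where "T = C * S / \<epsilon> + 1"
    have T: "1 \<le> T" using C S e by (simp add: T_def)
    have "norm (f (x0, p, w)) < \<epsilon>" if R: "T\<^sup>2 \<le> x0\<^sup>2 + p\<^sup>2" and w: "norm w = 1" for x0 p w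
    proof -
      define r where "r = norm (Complex x0 p)"
      have "T\<^sup>2 \<le> r\<^sup>2" using R by (simp add: r_def cmod_power2)
      then have rT: "T \<le> r" using T by (intro power2_le_imp_le[of T r]) (auto simp: r_def)
      have r1: "1 \<le> r" using rT T by linarith
      have z: "(x0, p) \<noteq> (0, 0)" using r1 by (auto simp: r_def cmod_def)
      have bd: "norm (eterm zpow_family P x0 p w jk) \<le> (C / r) * wt jk" for jk
      proof -
        obtain j k where jk: "jk = (j, k)" by (cases jk)
        show ?thesis
        proof (cases "0 \<le> j")
          case True
          then show ?thesis using Z C(1) r1 w0[of jk] by (simp add: jk eterm_def cact_simps)
        next
          case False
          have "r powi j = inverse r ^ nat (- j)" using False by (simp add: power_int_def)
          also have "\<dots> \<le> inverse r ^ 1" using False r1 by (intro power_decreasing) (auto simp: inverse_le_1_iff)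
          finally have rj: "r powi j \<le> 1 / r" by (simp add: inverse_eq_divide)
          have "norm (eterm zpow_family P x0 p w jk) = r powi j * norm (P k j w)"
            by (simp add: jk eterm_def norm_cact[OF w] zpow_family_def norm_mult norm_power norm_power_int r_def)
          also have "\<dots> \<le> (1 / r) * (C * (1/2) ^ nat \<bar>j\<bar> / (real k + 1)\<^sup>2)"
            using rj C(2)[OF w] r1 by (intro mult_mono) auto
          finally show ?thesis by (simp add: wt_def jk)
        qed
      qed
      have "norm (\<Sum>n. eterm zpow_family P x0 p w (enum_jk n)) \<le> (\<Sum>n. (C / r) * wt (enum_jk n))"
        by (rule norm_suminf_le[OF bd]) (rule summable_mult[OF summable_wt])
      also have "\<dots> = (C / r) * S" unfolding S_def by (rule suminf_mult[OF summable_wt])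
      also have "\<dots> \<le> C * S / T"
        using C(1) S rT T by (simp add: frac_le)
      also have "\<dots> < \<epsilon>"
      proof -
        have "\<epsilon> * T = C * S + \<epsilon>" using e by (simp add: T_def distrib_left)
        then have "C * S < \<epsilon> * T" using e by simp
        then show ?thesis using T by (simp add: pos_divide_less_eq)
      qed
      finally show ?thesis using val[OF z w] by simp
    qed
    then show ?thesis by (intro exI[of _ "T\<^sup>2"]) auto
  qed
  ultimately show "in_Sinf f" unfolding in_Sinf_def using expands_in_S[OF f] by auto
qed

definition expansion_sum :: "(nat \<Rightarrow> int \<Rightarrow> real ^ 'n::{finite,linorder} \<Rightarrow> 'n clif) \<Rightarrow> real \<times> real \<times> (real, 'n) vec \<Rightarrow> 'n clif" where
  "expansion_sum P = (\<lambda>(x0, p, w). \<Sum>n. eterm zpow_family P x0 p w (enum_jk n))"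

lemma expands_expansion_sum:
  "(\<And>k j. monogenic_hom k (P k j)) \<Longrightarrow> rapid_family 0 P \<Longrightarrow> expands (expansion_sum P) P"
  by (simp add: expands_def expansion_sum_def)

lemma I2_eq: "I2 g (x0, p, w) = cact w (inverse (Complex x0 p)) (g (x0 / (x0\<^sup>2 + p\<^sup>2), - p / (x0\<^sup>2 + p\<^sup>2), w))"
  unfolding inverse_Complex I2_def cact_def
  by (simp add: cl_mult.scaleR_left cl_mult.diff_left scaleR_diff_right)

text \<open>Inversion turns z^j into z^(-j) and the prefactor contributes z^(-1), so the index
  becomes -1 - j; this involution exchanges nonnegative and negative indices.\<close>

lemma expands_I2:
  fixes f g :: "real \<times> real \<times> (real ^ 'n::{finite,linorder}) \<Rightarrow> 'n clif"
  assumes g: "expands g P" and f: "\<And>z. z \<in> sdom punct \<Longrightarrow> f z = I2 g z"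
  shows "expands f (\<lambda>k j. P k (- 1 - j))"
  unfolding expands_def
proof (intro conjI allI impI)
  have P: "rapid_family 0 P" "\<And>k j. monogenic_hom k (P k j)" using g by (auto simp: expands_def)
  show "monogenic_hom k (P k (- 1 - j))" for k j by (rule P(2))
  show P': "rapid_family 0 (\<lambda>k j. P k (- 1 - j))" by (rule rapid_family_reindex[OF P(1)]) auto
  fix x0 p :: real and w :: "(real, 'n) vec" assume z: "(x0, p) \<noteq> (0, 0)" and w: "norm w = 1"
  let ?\<sigma> = "\<lambda>(j::int, k::nat). (- 1 - j, k)" and ?P' = "\<lambda>k j. P k (- 1 - j)"
  let ?x = "x0 / (x0\<^sup>2 + p\<^sup>2)" and ?p = "- p / (x0\<^sup>2 + p\<^sup>2)"
  have z': "Complex x0 p \<noteq> 0" using z by (auto simp: complex_eq_iff)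
  have b: "bij ?\<sigma>" by (rule o_bij[of ?\<sigma>]) (auto simp: fun_eq_iff)
  have e: "cact w (inverse (Complex x0 p)) (eterm zpow_family P ?x ?p w jk) = eterm zpow_family ?P' x0 p w (?\<sigma> jk)" for jk
  proof -
    obtain j k where jk: "jk = (j, k)" by (cases jk)
    have "inverse (Complex x0 p) * (Complex x0 p powi (- j) * \<i> ^ k) = Complex x0 p powi (- 1 - j) * \<i> ^ k"
      using z' by (simp add: power_int_diff power_int_minus field_simps)
    then show ?thesis
      unfolding jk prod.case eterm_inversion[OF z] cact_mult[OF w, symmetric]
      unfolding eterm_def zpow_family_def prod.case by (simp only: diff_diff_eq2 add_diff_cancel_right' add.commute[of "- 1"])
  qed
  have "f (x0, p, w) = I2 g (x0, p, w)" using z w by (intro f) (auto simp: sdom_def)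
  also have "\<dots> = cact w (inverse (Complex x0 p)) (\<Sum>n. eterm zpow_family P ?x ?p w (enum_jk n))"
  proof -
    have "g (?x, ?p, w) = (\<Sum>n. eterm zpow_family P ?x ?p w (enum_jk n))"
      using g inversion_nonzero[OF z] w unfolding expands_def by blast
    then show ?thesis by (simp only: I2_eq)
  qed
  also have "\<dots> = (\<Sum>n. cact w (inverse (Complex x0 p)) (eterm zpow_family P ?x ?p w (enum_jk n)))"
  proof (rule bounded_linear.suminf[OF bounded_linear_cact])
    have "Complex ?x ?p \<in> - {0}" using inversion_nonzero[OF z] by (auto simp: complex_eq_iff)
    then show "summable (\<lambda>n. eterm zpow_family P ?x ?p w (enum_jk n))"
      by (rule summable_eterm(1)[OF holo_zpow_family P(1) _ w])
  qed
  also have "\<dots> = (\<Sum>n. eterm zpow_family ?P' x0 p w (enum_jk n))"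
    unfolding e by (rule suminf_enum_reindex[OF eterm_sums[OF P' z w] b])
  finally show "f (x0, p, w) = (\<Sum>n. eterm zpow_family ?P' x0 p w (enum_jk n))" .
qed

lemma in_S_iff_expands: "in_S f \<longleftrightarrow> (\<exists>P. expands f P)"
proof
  assume "in_S f"
  then show "\<exists>P. expands f P" unfolding expands_def by (rule in_S_expansion)
qed (elim exE, rule expands_in_S)

text \<open>Masking either half of the index set keeps decay and monogenicity, so both halves are
  expansions in their own right.\<close>

lemma expands_split:
  fixes f :: "real \<times> real \<times> (real ^ 'n::{finite,linorder}) \<Rightarrow> 'n clif"
  assumes f: "expands f P"
  shows "\<exists>g h. in_S0 g \<and> in_Sinf h \<and> (\<forall>z\<in>sdom punct. f z = g z + h z)"
proof -
  let ?P0 = "\<lambda>k j. if 0 \<le> j then P k j else (\<lambda>x. 0)" and ?P1 = "\<lambda>k j. if j < 0 then P k j else (\<lambda>x. 0)"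
  have P: "rapid_family 0 P" "\<And>k j. monogenic_hom k (P k j)" using f by (auto simp: expands_def)
  have r: "rapid_family 0 ?P0" "rapid_family 0 ?P1" by (rule rapid_family_mask[OF P(1)])+
  have e0: "expands (expansion_sum ?P0) ?P0" and e1: "expands (expansion_sum ?P1) ?P1"
    by (rule expands_expansion_sum[OF monogenic_hom_mask[OF P(2)] r(1)],
        rule expands_expansion_sum[OF monogenic_hom_mask[OF P(2)] r(2)])
  have *: "f (x0, p, w) = expansion_sum ?P0 (x0, p, w) + expansion_sum ?P1 (x0, p, w)"
    if z: "(x0, p) \<noteq> (0, 0)" and w: "norm w = 1" for x0 p w
  proof -
    have z': "Complex x0 p \<in> - {0}" using z by (auto simp: complex_eq_iff)
    have "eterm zpow_family P x0 p w jk = eterm zpow_family ?P0 x0 p w jk + eterm zpow_family ?P1 x0 p w jk" for jk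
      by (cases jk) (simp add: eterm_def cact_simps)
    then have "(\<Sum>n. eterm zpow_family P x0 p w (enum_jk n))
        = (\<Sum>n. eterm zpow_family ?P0 x0 p w (enum_jk n)) + (\<Sum>n. eterm zpow_family ?P1 x0 p w (enum_jk n))"
      using suminf_add[OF summable_eterm(1)[OF holo_zpow_family r(1) z' w] summable_eterm(1)[OF holo_zpow_family r(2) z' w]]
      by simp
    then show ?thesis using f z w unfolding expands_def expansion_sum_def by simp
  qed
  have "in_S0 (expansion_sum ?P0)" by (subst expands_S0_iff[OF e0]) auto
  moreover have "in_Sinf (expansion_sum ?P1)" by (subst expands_Sinf_iff[OF e1]) auto
  moreover have "f z = expansion_sum ?P0 z + expansion_sum ?P1 z" if z: "z \<in> sdom punct" for z
  proof -
    obtain x0 p w where zw: "z = (x0, p, w)" by (cases z)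
    have "(x0, p) \<noteq> (0, 0)" "norm w = 1" using z by (simp_all add: zw sdom_def)
    then show ?thesis unfolding zw by (rule *)
  qed
  ultimately show ?thesis by (intro exI[of _ "expansion_sum ?P0"] exI[of _ "expansion_sum ?P1"] conjI ballI)
qed

lemma S0_Sinf_trivial:
  assumes g: "in_S0 g" "in_Sinf g" and z: "z \<in> sdom punct"
  shows "g z = 0"
proof -
  obtain P where P: "expands g P" using g(1) in_S_iff_expands[of g] unfolding in_S0_def by blast
  have "P k j = (\<lambda>_. 0)" for k j
    using g expands_S0_iff[OF P] expands_Sinf_iff[OF P] by (cases "j < 0") auto
  then have "eterm zpow_family P x0 p w jk = 0" for x0 p w jk
    by (cases jk) (simp add: eterm_def cact_simps)
  then show ?thesis using P z unfolding expands_def by (auto simp: sdom_def)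
qed

text \<open>Since the reindexing by -1 - j is its own inverse, a preimage of \<open>f\<close> is
  obtained by summing the reindexed expansion.\<close>

lemma Sinf_iff_I2:
  fixes f :: "real \<times> real \<times> (real ^ 'n::{finite,linorder}) \<Rightarrow> 'n clif"
  shows "in_Sinf f \<longleftrightarrow> (\<exists>g. in_S0 g \<and> (\<forall>z\<in>sdom punct. f z = I2 g z))"
proof
  assume f: "in_Sinf f"
  obtain P where P: "expands f P" using f in_S_iff_expands[of f] unfolding in_Sinf_def by blast
  have Z: "P k j = (\<lambda>_. 0)" if "0 \<le> j" for k j using f expands_Sinf_iff[OF P] that by auto
  have P': "rapid_family 0 P" "\<And>k j. monogenic_hom k (P k j)" using P by (auto simp: expands_def)
  define Q where "Q k j = P k (- 1 - j)" for k j
  have rQ: "rapid_family 0 Q" unfolding Q_def[abs_def] by (rule rapid_family_reindex[OF P'(1)]) auto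
  have Q: "expands (expansion_sum Q) Q"
    by (rule expands_expansion_sum[OF _ rQ]) (simp add: Q_def P'(2))
  have "in_S0 (expansion_sum Q)" by (subst expands_S0_iff[OF Q]) (simp add: Q_def Z)
  moreover have "expands (I2 (expansion_sum Q)) (\<lambda>k j. Q k (- 1 - j))" by (rule expands_I2[OF Q refl])
  then have "expands (I2 (expansion_sum Q)) P" by (simp add: Q_def)
  then have "f z = I2 (expansion_sum Q) z" if "z \<in> sdom punct" for z
    using P that unfolding expands_def by (auto simp: sdom_def)
  ultimately show "\<exists>g. in_S0 g \<and> (\<forall>z\<in>sdom punct. f z = I2 g z)" by blast
next
  assume "\<exists>g. in_S0 g \<and> (\<forall>z\<in>sdom punct. f z = I2 g z)"
  then obtain g where g: "in_S0 g" "\<And>z. z \<in> sdom punct \<Longrightarrow> f z = I2 g z" by blast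
  obtain P where P: "expands g P" using g(1) in_S_iff_expands[of g] unfolding in_S0_def by blast
  have "P k j = (\<lambda>_. 0)" if "j < 0" for k j using g(1) expands_S0_iff[OF P] that by auto
  then show "in_Sinf f" using expands_Sinf_iff[OF expands_I2[OF P g(2)]] by simp
qed

text \<open>The direct sum is rendered as existence of a decomposition together with triviality of
  the intersection. Equalities of functions are asserted on \<open>sdom punct\<close>, since the
  functions are total with arbitrary values elsewhere, whereas uniqueness of the polynomials holds
  on the whole space by homogeneity.\<close>

theorem theorem3p5:
  fixes N :: "((real ^ ('n::{finite,linorder})) \<Rightarrow> 'n clif) \<Rightarrow> real"
  assumes "N = sup_norm_S \<or> N = L2_norm_S"
  shows "(\<forall>f. in_S f \<longleftrightarrow> (\<exists>P. is_expansion N f P))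
    \<and> (\<forall>f P Q. is_expansion N f P \<and> is_expansion N f Q \<longrightarrow> P = Q)
    \<and> (\<forall>f P. is_expansion N f P \<longrightarrow> (in_S0 f \<longleftrightarrow> (\<forall>k j. j < 0 \<longrightarrow> P k j = (\<lambda>_. 0))))
    \<and> (\<forall>f P. is_expansion N f P \<longrightarrow> (in_Sinf f \<longleftrightarrow> (\<forall>k j. 0 \<le> j \<longrightarrow> P k j = (\<lambda>_. 0))))
    \<and> (\<forall>f :: real \<times> real \<times> (real, 'n) vec \<Rightarrow> 'n clif. in_S f \<longrightarrow> (\<exists>g h. in_S0 g \<and> in_Sinf h \<and>
           (\<forall>z\<in>sdom punct. f z = g z + h z)))
    \<and> (\<forall>g :: real \<times> real \<times> (real, 'n) vec \<Rightarrow> 'n clif. in_S0 g \<and> in_Sinf g \<longrightarrow> (\<forall>z\<in>sdom punct. g z = 0))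
    \<and> (\<forall>f :: real \<times> real \<times> (real, 'n) vec \<Rightarrow> 'n clif. in_Sinf f \<longleftrightarrow> (\<exists>g. in_S0 g \<and> (\<forall>z\<in>sdom punct. f z = I2 g z)))"
  unfolding is_expansion_iff_expands[OF assms]
proof (intro conjI allI impI ballI; (elim conjE)?)
  fix f g :: "real \<times> real \<times> (real, 'n) vec \<Rightarrow> 'n clif" and P Q z
  show "in_S f \<longleftrightarrow> (\<exists>P. expands f P)" by (rule in_S_iff_expands)
  show "P = Q" if "expands f P" "expands f Q" using that by (rule expands_unique)
  show "in_S0 f \<longleftrightarrow> (\<forall>k j. j < 0 \<longrightarrow> P k j = (\<lambda>_. 0))" if "expands f P"
    using that by (rule expands_S0_iff)
  show "in_Sinf f \<longleftrightarrow> (\<forall>k j. 0 \<le> j \<longrightarrow> P k j = (\<lambda>_. 0))" if "expands f P"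
    using that by (rule expands_Sinf_iff)
  show "\<exists>g h. in_S0 g \<and> in_Sinf h \<and> (\<forall>z\<in>sdom punct. f z = g z + h z)" if "in_S f"
    using that unfolding in_S_iff_expands by (elim exE) (rule expands_split)
  show "g z = 0" if "in_S0 g" "in_Sinf g" "z \<in> sdom punct" using that by (rule S0_Sinf_trivial)
  show "in_Sinf f \<longleftrightarrow> (\<exists>g. in_S0 g \<and> (\<forall>z\<in>sdom punct. f z = I2 g z))" by (rule Sinf_iff_I2)
qed

end
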